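(* Let $\nabla$ be a torsion-free connection on a smooth manifold $M$. The decomposition of the vector space of Killing vector fields for the Patterson-Walker metric $g_\nabla$ on $T^*M$, $$\{\alpha^{\mathrm v}\mid\alpha\in\mathrm{Kill}^1(M,\nabla)\}\oplus\{X^c\mid X\in\mathrm{aff}(M,\nabla)\}\oplus\{\pi^h\mid\pi\in\mathfrak{X}^2(M,\nabla)\},$$ is a grading of the Lie algebra of Killing vector fields for $g_\nabla$ concentrated in degrees $-1,0,1$ (the three summands, in this order, having degrees $-1$, $0$, $1$). In particular, for $\alpha,\beta\in\mathrm{Kill}^1(M,\nabla)$, $X,Y\in\mathrm{aff}(M,\nabla)$ and $\pi,\rho\in\mathfrak{X}^2(M,\nabla)$, we have $$[\alpha^{\mathrm v},\beta^{\mathrm v}]=0,\qquad[X^c,\alpha^{\mathrm v}]=(L_X\alpha)^{\mathrm v},\qquad[\alpha^{\mathrm v},\pi^h]=\pi(\alpha)^c,$$ $$[X^c,Y^c]=[X,Y]^c,\qquad[X^c,\pi^h]=(L_X\pi)^h,\qquad[\pi^h,\rho^h]=0.$$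
   Context: $M$ is a smooth manifold of positive dimension; a connection on $M$ is an affine connection on $TM$, extended to tensor fields. Let $\mathrm{pr}:T^*M\to M$ be the projection. Lifts. For $Y\in\mathfrak{X}(M)$, $Y^v\in C^\infty(T^*M)$ is $Y^v(\zeta)=\zeta(Y_{\mathrm{pr}(\zeta)})$; a vector field on $T^*M$ is determined by its action on all functions $Y^v$. For $\alpha\in\Omega^1(M)$, the vertical lift $\alpha^{\mathrm v}\in\mathfrak{X}(T^*M)$ is determined by $\alpha^{\mathrm v}Y^v=\mathrm{pr}^*(\alpha(Y))$. For $X\in\mathfrak{X}(M)$, the horizontal lift $X^{\mathrm h}$ (for the dual connection on $T^*M$) is determined by $X^{\mathrm h}Y^v=(\nabla_XY)^v$, and the complete lift $X^c$ by $X^cY^v=[X,Y]^v$. For a bivector field $\pi\in\mathfrak{X}^2(M)=\Gamma(\Lambda^2TM)$, $\pi(\alpha)=\pi(\alpha,\cdot)\in\mathfrak{X}(M)$, with $(X\wedge Y)(\alpha)=\alpha(X)Y-\alpha(Y)X$. The horizontal lift $\pi^h\in\mathfrak{X}(T^*M)$ of a bivector field is determined by $(f\pi)^h=(\mathrm{pr}^*f)\pi^h$, additivity, and $(X\wedge Y)^h=X^vY^{\mathrm h}-Y^vX^{\mathrm h}$; in natural coordinates $\{x^i\}\cup\{p_j\}$ on $T^*M$, if $\pi=\frac12\pi^{ij}\partial_{x^i}\wedge\partial_{x^j}$ then $\pi^h=p_i(\mathrm{pr}^*\pi^{ij})\partial_{x^j}^{\mathrm h}$. The Patterson-Walker metric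 $g_\nabla$ is the split-signature metric on $T^*M$ determined by $g_\nabla(X^{\mathrm h}+\alpha^{\mathrm v},Y^{\mathrm h}+\beta^{\mathrm v})=\mathrm{pr}^*(\alpha(Y)+\beta(X))$. $\mathrm{Kill}^1(M,\nabla)$ is the space of $\alpha\in\Omega^1(M)$ with $(\nabla_X\alpha)(Y)+(\nabla_Y\alpha)(X)=0$ for all $X,Y\in\mathfrak{X}(M)$. $\mathrm{aff}(M,\nabla)$ is the Lie algebra of affine vector fields: those whose flow consists of local diffeomorphisms preserving $\nabla$, equivalently $[X,\nabla_YZ]-\nabla_Y[X,Z]=\nabla_{[X,Y]}Z$ for all $Y,Z\in\mathfrak{X}(M)$. $\mathfrak{X}^2(M,\nabla)=\{\pi\in\mathfrak{X}^2(M)\mid\nabla\pi=0,\ R^\pi_\nabla=0\}$, where $R^\pi_\nabla\in\Gamma(\mathrm{Sym}^2T^*M\otimes\mathrm{Sym}^2TM)$ is $R^\pi_\nabla(Y,Z)=\mathrm{sym}\big(R_\nabla(Y,\pi(\,\cdot\,))Z+R_\nabla(Z,\pi(\,\cdot\,))Y\big)$; here $R_\nabla(X,Y)Z=\nabla_X\nabla_YZ-\nabla_Y\nabla_XZ-\nabla_{[X,Y]}Z$, $R_\nabla(Y,\pi(\,\cdot\,))Z$ is the $(2,0)$-tensor field associated with the map $\eta\mapsto R_\nabla(Y,\pi(\eta))Z$ from $1$-forms to vector fields, and $\mathrm{sym}$ is symmetrization. $L_X$ is the usual Lie derivative. A grading means that the bracket of elements of degrees $i$ and $j$ has degree $i+j$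 (and is zero if $i+j\notin\{-1,0,1\}$). *)

theory Defs
  imports "HOL-Analysis.Analysis" "HOL-Library.Function_Algebras"
begin

text \<open>
  Conventions.  A smooth manifold is given by an atlas on a set; its topology is the one in which
  a set is open iff all its chart images are open.  Scalar functions, vector fields and tensor
  fields are total functions which vanish outside their proper domain, so that the pointwise
  operations of \<open>Function_Algebras\<close> are the intended ones and equality is the intended equality.
  Tangent vectors are derivations on smooth functions, vector fields are smooth sections of the
  tangent spaces, and tensor fields are \<open>C\<^sup>\<infinity>(M)\<close>-multilinear maps with values in
  \<open>C\<^sup>\<infinity>(M)\<close> (O'Neill's conventions).
\<close>


section \<open>Smooth manifolds\<close>

primrec Ck_on :: "nat \<Rightarrow> 'e set \<Rightarrow> ('e::euclidean_space \<Rightarrow> 'f::real_normed_vector) \<Rightarrow> bool" where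
  "Ck_on 0 S f \<longleftrightarrow> continuous_on S f"
| "Ck_on (Suc k) S f \<longleftrightarrow> (\<forall>x\<in>S. f differentiable (at x)) \<and>
      (\<forall>v. Ck_on k S (\<lambda>x. frechet_derivative f (at x) v))"

text \<open>Only used for open \<open>S\<close>.\<close>
definition smooth_on :: "'e set \<Rightarrow> ('e::euclidean_space \<Rightarrow> 'f::real_normed_vector) \<Rightarrow> bool" where
  "smooth_on S f \<longleftrightarrow> (\<forall>k. Ck_on k S f)"

type_synonym ('a, 'e) chart = "'a set \<times> ('a \<Rightarrow> 'e)"

definition mcarrier :: "('a, 'e) chart set \<Rightarrow> 'a set" where
  "mcarrier A = \<Union> (fst ` A)"

definition atlas :: "('a, 'e::euclidean_space) chart set \<Rightarrow> bool" where
  "atlas A \<longleftrightarrow>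
     (\<forall>(U, \<phi>)\<in>A. inj_on \<phi> U \<and> open (\<phi> ` U)) \<and>
     (\<forall>(U, \<phi>)\<in>A. \<forall>(V, \<psi>)\<in>A.
        open (\<phi> ` (U \<inter> V)) \<and> smooth_on (\<phi> ` (U \<inter> V)) (\<psi> \<circ> inv_into U \<phi>))"

definition atlas_topology :: "('a, 'e::euclidean_space) chart set \<Rightarrow> 'a topology" where
  "atlas_topology A =
     topology (\<lambda>W. W \<subseteq> mcarrier A \<and> (\<forall>(U, \<phi>)\<in>A. open (\<phi> ` (W \<inter> U))))"

lemma openin_atlas_topology:
  assumes "atlas A"
  shows "openin (atlas_topology A) W \<longleftrightarrow>
           W \<subseteq> mcarrier A \<and> (\<forall>(U, \<phi>)\<in>A. open (\<phi> ` (W \<inter> U)))"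
proof -
  let ?P = "\<lambda>W. W \<subseteq> mcarrier A \<and> (\<forall>(U, \<phi>)\<in>A. open (\<phi> ` (W \<inter> U)))"
  have "istopology ?P"
    unfolding istopology_def
  proof (intro conjI allI impI)
    fix S T assume S: "?P S" and T: "?P T"
    have "open (\<phi> ` (S \<inter> T \<inter> U))" if "(U, \<phi>) \<in> A" for U \<phi>
    proof -
      have "inj_on \<phi> U" using assms that by (auto simp: atlas_def)
      then have "\<phi> ` (S \<inter> T \<inter> U) = \<phi> ` (S \<inter> U) \<inter> \<phi> ` (T \<inter> U)"
        by (auto simp: inj_on_def)
      moreover have "open (\<phi> ` (S \<inter> U))" "open (\<phi> ` (T \<inter> U))" using S T that by auto
      ultimately show ?thesis by auto
    qed
    then show "S \<inter> T \<subseteq> mcarrier A" "\<forall>(U, \<phi>)\<in>A. open (\<phi> ` (S \<inter> T \<inter> U))"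
      using S by auto
  next
    fix K assume K: "\<forall>S\<in>K. ?P S"
    have "open (\<phi> ` (\<Union> K \<inter> U))" if "(U, \<phi>) \<in> A" for U \<phi>
    proof -
      have "\<phi> ` (\<Union> K \<inter> U) = (\<Union>S\<in>K. \<phi> ` (S \<inter> U))" by auto
      moreover have "open (\<Union>S\<in>K. \<phi> ` (S \<inter> U))" using K that by (intro open_UN) auto
      ultimately show ?thesis by simp
    qed
    then show "\<Union> K \<subseteq> mcarrier A" "\<forall>(U, \<phi>)\<in>A. open (\<phi> ` (\<Union> K \<inter> U))"
      using K by auto
  qed
  then show ?thesis by (simp add: atlas_topology_def)
qed

text \<open>The dimension is \<open>DIM('e)\<close>, which is positive for every type of class \<open>euclidean_space\<close>.\<close>
definition smooth_manifold :: "('a, 'e::euclidean_space) chart set \<Rightarrow> bool" where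
  "smooth_manifold A \<longleftrightarrow>
     atlas A \<and> Hausdorff_space (atlas_topology A) \<and> second_countable (atlas_topology A)"

definition smooth_funs :: "('a, 'e::euclidean_space) chart set \<Rightarrow> ('a \<Rightarrow> real) set" where
  "smooth_funs A = {f. (\<forall>p. p \<notin> mcarrier A \<longrightarrow> f p = 0) \<and>
                       (\<forall>(U, \<phi>)\<in>A. smooth_on (\<phi> ` U) (f \<circ> inv_into U \<phi>))}"


section \<open>Tangent vectors and vector fields\<close>

type_synonym 'a tvec = "('a \<Rightarrow> real) \<Rightarrow> real"
type_synonym 'a vfield = "'a \<Rightarrow> 'a tvec"

definition tangent_space :: "('a, 'e::euclidean_space) chart set \<Rightarrow> 'a \<Rightarrow> 'a tvec set" where
  "tangent_space A p = {v.
     (\<forall>f. f \<notin> smooth_funs A \<longrightarrow> v f = 0) \<and>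
     (\<forall>f\<in>smooth_funs A. \<forall>g\<in>smooth_funs A.
        v (f + g) = v f + v g \<and> v (f * g) = f p * v g + g p * v f) \<and>
     (\<forall>c. \<forall>f\<in>smooth_funs A. v (\<lambda>x. c * f x) = c * v f)}"

definition vf_app :: "'a vfield \<Rightarrow> ('a \<Rightarrow> real) \<Rightarrow> ('a \<Rightarrow> real)" where
  "vf_app X f = (\<lambda>p. X p f)"

definition vfields :: "('a, 'e::euclidean_space) chart set \<Rightarrow> 'a vfield set" where
  "vfields A = {X. (\<forall>p\<in>mcarrier A. X p \<in> tangent_space A p) \<and>
                   (\<forall>p. p \<notin> mcarrier A \<longrightarrow> X p = 0) \<and>
                   (\<forall>f\<in>smooth_funs A. vf_app X f \<in> smooth_funs A)}"

definition vf_mult :: "('a \<Rightarrow> real) \<Rightarrow> 'a vfield \<Rightarrow> 'a vfield" where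
  "vf_mult f X = (\<lambda>p h. f p * X p h)"

definition vf_scale :: "real \<Rightarrow> 'a vfield \<Rightarrow> 'a vfield" where
  "vf_scale c X = (\<lambda>p h. c * X p h)"

definition vf_bracket :: "'a vfield \<Rightarrow> 'a vfield \<Rightarrow> 'a vfield" where
  "vf_bracket X Y = (\<lambda>p f. X p (vf_app Y f) - Y p (vf_app X f))"


section \<open>Differential forms and bivector fields\<close>

type_synonym 'a form1 = "'a vfield \<Rightarrow> ('a \<Rightarrow> real)"
type_synonym 'a bivec = "'a form1 \<Rightarrow> 'a form1 \<Rightarrow> ('a \<Rightarrow> real)"

definition forms1 :: "('a, 'e::euclidean_space) chart set \<Rightarrow> 'a form1 set" where
  "forms1 A = {\<alpha>.
     (\<forall>X. X \<notin> vfields A \<longrightarrow> \<alpha> X = 0) \<and>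
     (\<forall>X\<in>vfields A. \<alpha> X \<in> smooth_funs A) \<and>
     (\<forall>X\<in>vfields A. \<forall>Y\<in>vfields A. \<alpha> (X + Y) = \<alpha> X + \<alpha> Y) \<and>
     (\<forall>f\<in>smooth_funs A. \<forall>X\<in>vfields A. \<alpha> (vf_mult f X) = f * \<alpha> X)}"

definition form_mult :: "('a \<Rightarrow> real) \<Rightarrow> 'a form1 \<Rightarrow> 'a form1" where
  "form_mult f \<alpha> = (\<lambda>X. f * \<alpha> X)"

definition differential :: "('a, 'e::euclidean_space) chart set \<Rightarrow> ('a \<Rightarrow> real) \<Rightarrow> 'a form1" where
  "differential A f = (\<lambda>X. if X \<in> vfields A then vf_app X f else 0)"

definition bivecs :: "('a, 'e::euclidean_space) chart set \<Rightarrow> 'a bivec set" where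
  "bivecs A = {\<pi>.
     (\<forall>\<alpha> \<beta>. \<alpha> \<notin> forms1 A \<or> \<beta> \<notin> forms1 A \<longrightarrow> \<pi> \<alpha> \<beta> = 0) \<and>
     (\<forall>\<alpha>\<in>forms1 A. \<forall>\<beta>\<in>forms1 A. \<pi> \<alpha> \<beta> \<in> smooth_funs A \<and> \<pi> \<alpha> \<beta> = - \<pi> \<beta> \<alpha>) \<and>
     (\<forall>\<alpha>\<in>forms1 A. \<forall>\<beta>\<in>forms1 A. \<forall>\<gamma>\<in>forms1 A. \<pi> (\<alpha> + \<beta>) \<gamma> = \<pi> \<alpha> \<gamma> + \<pi> \<beta> \<gamma>) \<and>
     (\<forall>f\<in>smooth_funs A. \<forall>\<alpha>\<in>forms1 A. \<forall>\<beta>\<in>forms1 A. \<pi> (form_mult f \<alpha>) \<beta> = f * \<pi> \<alpha> \<beta>)}"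

definition bivec_mult :: "('a \<Rightarrow> real) \<Rightarrow> 'a bivec \<Rightarrow> 'a bivec" where
  "bivec_mult f \<pi> = (\<lambda>\<alpha> \<beta>. f * \<pi> \<alpha> \<beta>)"

definition wedge :: "('a, 'e::euclidean_space) chart set \<Rightarrow> 'a vfield \<Rightarrow> 'a vfield \<Rightarrow> 'a bivec" where
  "wedge A X Y = (\<lambda>\<alpha> \<beta>. if \<alpha> \<in> forms1 A \<and> \<beta> \<in> forms1 A then \<alpha> X * \<beta> Y - \<alpha> Y * \<beta> X else 0)"

text \<open>The vector field \<open>\<pi>(\<alpha>) = \<pi>(\<alpha>, \<cdot>)\<close>, whose action on \<open>f\<close> is its pairing with \<open>df\<close>.\<close>
definition contract :: "('a, 'e::euclidean_space) chart set \<Rightarrow> 'a bivec \<Rightarrow> 'a form1 \<Rightarrow> 'a vfield" where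
  "contract A \<pi> \<alpha> = (\<lambda>p f. if f \<in> smooth_funs A then \<pi> \<alpha> (differential A f) p else 0)"

definition lie_form :: "('a, 'e::euclidean_space) chart set \<Rightarrow> 'a vfield \<Rightarrow> 'a form1 \<Rightarrow> 'a form1" where
  "lie_form A X \<alpha> =
     (\<lambda>Y. if Y \<in> vfields A then vf_app X (\<alpha> Y) - \<alpha> (vf_bracket X Y) else 0)"

definition lie_bivec :: "('a, 'e::euclidean_space) chart set \<Rightarrow> 'a vfield \<Rightarrow> 'a bivec \<Rightarrow> 'a bivec" where
  "lie_bivec A X \<pi> = (\<lambda>\<alpha> \<beta>. if \<alpha> \<in> forms1 A \<and> \<beta> \<in> forms1 A
     then vf_app X (\<pi> \<alpha> \<beta>) - \<pi> (lie_form A X \<alpha>) \<beta> - \<pi> \<alpha> (lie_form A X \<beta>) else 0)"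


section \<open>Connections\<close>

definition connection ::
    "('a, 'e::euclidean_space) chart set \<Rightarrow> ('a vfield \<Rightarrow> 'a vfield \<Rightarrow> 'a vfield) \<Rightarrow> bool" where
  "connection A D \<longleftrightarrow>
     (\<forall>X\<in>vfields A. \<forall>Y\<in>vfields A. D X Y \<in> vfields A) \<and>
     (\<forall>X\<in>vfields A. \<forall>Y\<in>vfields A. \<forall>Z\<in>vfields A.
        D (X + Y) Z = D X Z + D Y Z \<and> D X (Y + Z) = D X Y + D X Z) \<and>
     (\<forall>f\<in>smooth_funs A. \<forall>X\<in>vfields A. \<forall>Y\<in>vfields A.
        D (vf_mult f X) Y = vf_mult f (D X Y) \<and>
        D X (vf_mult f Y) = vf_mult f (D X Y) + vf_mult (vf_app X f) Y) \<and>
     (\<forall>c. \<forall>X\<in>vfields A. \<forall>Y\<in>vfields A. D X (vf_scale c Y) = vf_scale c (D X Y))"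

definition torsion_free ::
    "('a, 'e::euclidean_space) chart set \<Rightarrow> ('a vfield \<Rightarrow> 'a vfield \<Rightarrow> 'a vfield) \<Rightarrow> bool" where
  "torsion_free A D \<longleftrightarrow>
     (\<forall>X\<in>vfields A. \<forall>Y\<in>vfields A. D X Y - D Y X = vf_bracket X Y)"

definition nabla_form ::
    "('a, 'e::euclidean_space) chart set \<Rightarrow> ('a vfield \<Rightarrow> 'a vfield \<Rightarrow> 'a vfield) \<Rightarrow>
     'a vfield \<Rightarrow> 'a form1 \<Rightarrow> 'a form1" where
  "nabla_form A D X \<alpha> = (\<lambda>Y. if Y \<in> vfields A then vf_app X (\<alpha> Y) - \<alpha> (D X Y) else 0)"

definition nabla_bivec ::
    "('a, 'e::euclidean_space) chart set \<Rightarrow> ('a vfield \<Rightarrow> 'a vfield \<Rightarrow> 'a vfield) \<Rightarrow>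
     'a vfield \<Rightarrow> 'a bivec \<Rightarrow> 'a bivec" where
  "nabla_bivec A D X \<pi> = (\<lambda>\<alpha> \<beta>. if \<alpha> \<in> forms1 A \<and> \<beta> \<in> forms1 A
     then vf_app X (\<pi> \<alpha> \<beta>) - \<pi> (nabla_form A D X \<alpha>) \<beta> - \<pi> \<alpha> (nabla_form A D X \<beta>) else 0)"

definition curvature ::
    "('a vfield \<Rightarrow> 'a vfield \<Rightarrow> 'a vfield) \<Rightarrow> 'a vfield \<Rightarrow> 'a vfield \<Rightarrow> 'a vfield \<Rightarrow> 'a vfield" where
  "curvature D X Y Z = D X (D Y Z) - D Y (D X Z) - D (vf_bracket X Y) Z"

definition symmetrization :: "('a form1 \<Rightarrow> 'a form1 \<Rightarrow> ('a \<Rightarrow> real)) \<Rightarrow> 'a form1 \<Rightarrow> 'a form1 \<Rightarrow> ('a \<Rightarrow> real)" where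
  "symmetrization T = (\<lambda>\<eta> \<theta> p. (T \<eta> \<theta> p + T \<theta> \<eta> p) / 2)"

text \<open>The symmetrized \<open>(2,0)\<close>-tensor field
  \<open>sym (R(Y, \<pi>(\<cdot>))Z + R(Z, \<pi>(\<cdot>))Y)\<close>; the unsymmetrized one takes \<open>(\<eta>, \<theta>)\<close> to the pairing of \<open>\<theta>\<close>
  with the value of the vector-valued map at \<open>\<eta>\<close>.\<close>
definition R_bivec ::
    "('a, 'e::euclidean_space) chart set \<Rightarrow> ('a vfield \<Rightarrow> 'a vfield \<Rightarrow> 'a vfield) \<Rightarrow> 'a bivec \<Rightarrow>
     'a vfield \<Rightarrow> 'a vfield \<Rightarrow> 'a form1 \<Rightarrow> 'a form1 \<Rightarrow> ('a \<Rightarrow> real)" where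
  "R_bivec A D \<pi> Y Z = symmetrization
     (\<lambda>\<eta> \<theta>. \<theta> (curvature D Y (contract A \<pi> \<eta>) Z + curvature D Z (contract A \<pi> \<eta>) Y))"

definition Kill1 ::
    "('a, 'e::euclidean_space) chart set \<Rightarrow> ('a vfield \<Rightarrow> 'a vfield \<Rightarrow> 'a vfield) \<Rightarrow> 'a form1 set" where
  "Kill1 A D = {\<alpha>\<in>forms1 A. \<forall>X\<in>vfields A. \<forall>Y\<in>vfields A.
                  nabla_form A D X \<alpha> Y + nabla_form A D Y \<alpha> X = 0}"

definition aff ::
    "('a, 'e::euclidean_space) chart set \<Rightarrow> ('a vfield \<Rightarrow> 'a vfield \<Rightarrow> 'a vfield) \<Rightarrow> 'a vfield set" where
  "aff A D = {X\<in>vfields A. \<forall>Y\<in>vfields A. \<forall>Z\<in>vfields A.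
                vf_bracket X (D Y Z) - D Y (vf_bracket X Z) = D (vf_bracket X Y) Z}"

definition parallel_bivecs ::
    "('a, 'e::euclidean_space) chart set \<Rightarrow> ('a vfield \<Rightarrow> 'a vfield \<Rightarrow> 'a vfield) \<Rightarrow> 'a bivec set" where
  "parallel_bivecs A D = {\<pi>\<in>bivecs A.
     (\<forall>X\<in>vfields A. nabla_bivec A D X \<pi> = 0) \<and>
     (\<forall>Y\<in>vfields A. \<forall>Z\<in>vfields A. \<forall>\<eta>\<in>forms1 A. \<forall>\<theta>\<in>forms1 A. R_bivec A D \<pi> Y Z \<eta> \<theta> = 0)}"


section \<open>The cotangent bundle\<close>

type_synonym 'a covec = "'a \<times> ('a tvec \<Rightarrow> real)"

definition cotangent_space :: "('a, 'e::euclidean_space) chart set \<Rightarrow> 'a \<Rightarrow> ('a tvec \<Rightarrow> real) set" where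
  "cotangent_space A p = {\<zeta>.
     (\<forall>v. v \<notin> tangent_space A p \<longrightarrow> \<zeta> v = 0) \<and>
     (\<forall>v\<in>tangent_space A p. \<forall>w\<in>tangent_space A p. \<zeta> (v + w) = \<zeta> v + \<zeta> w) \<and>
     (\<forall>c. \<forall>v\<in>tangent_space A p. \<zeta> (\<lambda>f. c * v f) = c * \<zeta> v)}"

text \<open>The tangent vector at \<open>p\<close> with coordinate representation \<open>b\<close> in the chart \<open>(U, \<phi>)\<close>.\<close>
definition coord_vec ::
    "('a, 'e::euclidean_space) chart set \<Rightarrow> ('a, 'e) chart \<Rightarrow> 'a \<Rightarrow> 'e \<Rightarrow> 'a tvec" where
  "coord_vec A c p b = (case c of (U, \<phi>) \<Rightarrow>
     (\<lambda>f. if f \<in> smooth_funs A then frechet_derivative (f \<circ> inv_into U \<phi>) (at (\<phi> p)) b else 0))"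

text \<open>The natural coordinates \<open>(x\<^sup>i, p\<^sub>j)\<close>, where \<open>p\<^sub>j(\<zeta>) = \<zeta>(\<partial>\<^sub>j)\<close>.\<close>
definition cotangent_chart ::
    "('a, 'e::euclidean_space) chart set \<Rightarrow> ('a, 'e) chart \<Rightarrow> ('a covec, 'e \<times> 'e) chart" where
  "cotangent_chart A c =
     ({(p, \<zeta>). p \<in> fst c \<and> \<zeta> \<in> cotangent_space A p},
      (\<lambda>(p, \<zeta>). (snd c p, \<Sum>b\<in>Basis. \<zeta> (coord_vec A c p b) *\<^sub>R b)))"

definition cotangent_bundle ::
    "('a, 'e::euclidean_space) chart set \<Rightarrow> ('a covec, 'e \<times> 'e) chart set" where
  "cotangent_bundle A = cotangent_chart A ` A"

definition pr_pull :: "('a, 'e::euclidean_space) chart set \<Rightarrow> ('a \<Rightarrow> real) \<Rightarrow> ('a covec \<Rightarrow> real)" where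
  "pr_pull A f = (\<lambda>\<xi>. if \<xi> \<in> mcarrier (cotangent_bundle A) then f (fst \<xi>) else 0)"


section \<open>Lifts to the cotangent bundle\<close>

text \<open>The function \<open>Y\<^sup>v\<close> on the cotangent bundle.\<close>
definition fun_lift :: "('a, 'e::euclidean_space) chart set \<Rightarrow> 'a vfield \<Rightarrow> ('a covec \<Rightarrow> real)" where
  "fun_lift A Y = (\<lambda>\<xi>. if \<xi> \<in> mcarrier (cotangent_bundle A) then snd \<xi> (Y (fst \<xi>)) else 0)"

text \<open>A vector field on the cotangent bundle is determined by its action on the functions \<open>Y\<^sup>v\<close>.\<close>
definition vert_lift ::
    "('a, 'e::euclidean_space) chart set \<Rightarrow> 'a form1 \<Rightarrow> 'a covec vfield" where
  "vert_lift A \<alpha> = (THE W. W \<in> vfields (cotangent_bundle A) \<and>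
     (\<forall>Y\<in>vfields A. vf_app W (fun_lift A Y) = pr_pull A (\<alpha> Y)))"

definition hor_lift ::
    "('a, 'e::euclidean_space) chart set \<Rightarrow> ('a vfield \<Rightarrow> 'a vfield \<Rightarrow> 'a vfield) \<Rightarrow>
     'a vfield \<Rightarrow> 'a covec vfield" where
  "hor_lift A D X = (THE W. W \<in> vfields (cotangent_bundle A) \<and>
     (\<forall>Y\<in>vfields A. vf_app W (fun_lift A Y) = fun_lift A (D X Y)))"

definition complete_lift ::
    "('a, 'e::euclidean_space) chart set \<Rightarrow> 'a vfield \<Rightarrow> 'a covec vfield" where
  "complete_lift A X = (THE W. W \<in> vfields (cotangent_bundle A) \<and>
     (\<forall>Y\<in>vfields A. vf_app W (fun_lift A Y) = fun_lift A (vf_bracket X Y)))"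

text \<open>The first condition only fixes the value of the map off its proper domain.\<close>
definition bivec_lift ::
    "('a, 'e::euclidean_space) chart set \<Rightarrow> ('a vfield \<Rightarrow> 'a vfield \<Rightarrow> 'a vfield) \<Rightarrow>
     'a bivec \<Rightarrow> 'a covec vfield" where
  "bivec_lift A D = (THE H.
     (\<forall>\<pi>. \<pi> \<notin> bivecs A \<longrightarrow> H \<pi> = 0) \<and>
     (\<forall>\<pi>\<in>bivecs A. H \<pi> \<in> vfields (cotangent_bundle A)) \<and>
     (\<forall>\<pi>\<in>bivecs A. \<forall>\<rho>\<in>bivecs A. H (\<pi> + \<rho>) = H \<pi> + H \<rho>) \<and>
     (\<forall>f\<in>smooth_funs A. \<forall>\<pi>\<in>bivecs A. H (bivec_mult f \<pi>) = vf_mult (pr_pull A f) (H \<pi>)) \<and>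
     (\<forall>X\<in>vfields A. \<forall>Y\<in>vfields A. H (wedge A X Y) =
        vf_mult (fun_lift A X) (hor_lift A D Y) - vf_mult (fun_lift A Y) (hor_lift A D X)))"


section \<open>Metrics and Killing vector fields\<close>

type_synonym 'a tensor2 = "'a vfield \<Rightarrow> 'a vfield \<Rightarrow> ('a \<Rightarrow> real)"

definition sym_tensors2 :: "('a, 'e::euclidean_space) chart set \<Rightarrow> 'a tensor2 set" where
  "sym_tensors2 A = {g.
     (\<forall>V W. V \<notin> vfields A \<or> W \<notin> vfields A \<longrightarrow> g V W = 0) \<and>
     (\<forall>V\<in>vfields A. \<forall>W\<in>vfields A. g V W \<in> smooth_funs A \<and> g V W = g W V) \<and>
     (\<forall>U\<in>vfields A. \<forall>V\<in>vfields A. \<forall>W\<in>vfields A. g (U + V) W = g U W + g V W) \<and>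
     (\<forall>f\<in>smooth_funs A. \<forall>V\<in>vfields A. \<forall>W\<in>vfields A. g (vf_mult f V) W = f * g V W)}"

text \<open>At every point there is an orthonormal basis with equally many positive and negative vectors
  (given as values of vector fields); in particular \<open>g\<close> is nondegenerate.\<close>
definition split_signature :: "('a, 'e::euclidean_space) chart set \<Rightarrow> 'a tensor2 \<Rightarrow> bool" where
  "split_signature A g \<longleftrightarrow> even (DIM('e)) \<and>
     (\<forall>p\<in>mcarrier A. \<exists>V :: nat \<Rightarrow> 'a vfield.
        (\<forall>i<DIM('e). V i \<in> vfields A) \<and>
        (\<forall>i<DIM('e). \<forall>j<DIM('e). g (V i) (V j) p =
           (if i \<noteq> j then 0 else if 2 * i < DIM('e) then 1 else -1)))"

definition pw_metric ::
    "('a, 'e::euclidean_space) chart set \<Rightarrow> ('a vfield \<Rightarrow> 'a vfield \<Rightarrow> 'a vfield) \<Rightarrow>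
     'a covec tensor2" where
  "pw_metric A D = (THE g.
     g \<in> sym_tensors2 (cotangent_bundle A) \<and> split_signature (cotangent_bundle A) g \<and>
     (\<forall>X\<in>vfields A. \<forall>Y\<in>vfields A. \<forall>\<alpha>\<in>forms1 A. \<forall>\<beta>\<in>forms1 A.
        g (hor_lift A D X + vert_lift A \<alpha>) (hor_lift A D Y + vert_lift A \<beta>) =
          pr_pull A (\<alpha> Y + \<beta> X)))"

text \<open>Vanishing of the Lie derivative of \<open>g\<close>.\<close>
definition killing_fields :: "('a, 'e::euclidean_space) chart set \<Rightarrow> 'a tensor2 \<Rightarrow> 'a vfield set" where
  "killing_fields A g = {K\<in>vfields A. \<forall>V\<in>vfields A. \<forall>W\<in>vfields A.
     vf_app K (g V W) - g (vf_bracket K V) W - g V (vf_bracket K W) = 0}"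


section \<open>Graded Lie algebras\<close>

definition lie_algebra_on ::
    "(real \<Rightarrow> 'v::ab_group_add \<Rightarrow> 'v) \<Rightarrow> ('v \<Rightarrow> 'v \<Rightarrow> 'v) \<Rightarrow> 'v set \<Rightarrow> bool" where
  "lie_algebra_on smul br L \<longleftrightarrow>
     vector_space smul \<and> module.subspace smul L \<and>
     (\<forall>x\<in>L. \<forall>y\<in>L. br x y \<in> L) \<and>
     (\<forall>x\<in>L. \<forall>y\<in>L. \<forall>z\<in>L.
        br (x + y) z = br x z + br y z \<and> br x (y + z) = br x y + br x z) \<and>
     (\<forall>c. \<forall>x\<in>L. \<forall>y\<in>L. br (smul c x) y = smul c (br x y) \<and> br x (smul c y) = smul c (br x y)) \<and>
     (\<forall>x\<in>L. br x x = 0) \<and>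
     (\<forall>x\<in>L. \<forall>y\<in>L. \<forall>z\<in>L. br x (br y z) + br y (br z x) + br z (br x y) = 0)"

text \<open>\<open>L\<close> is the internal direct sum of the subspaces \<open>V i\<close>, and the bracket is additive on degrees.\<close>
definition lie_grading ::
    "(real \<Rightarrow> 'v::ab_group_add \<Rightarrow> 'v) \<Rightarrow> ('v \<Rightarrow> 'v \<Rightarrow> 'v) \<Rightarrow> 'v set \<Rightarrow> (int \<Rightarrow> 'v set) \<Rightarrow> bool" where
  "lie_grading smul br L V \<longleftrightarrow>
     lie_algebra_on smul br L \<and>
     (\<forall>i. module.subspace smul (V i) \<and> V i \<subseteq> L) \<and>
     (\<forall>x\<in>L. \<exists>!d. (\<forall>i. d i \<in> V i) \<and> finite {i. d i \<noteq> 0} \<and> x = (\<Sum>i | d i \<noteq> 0. d i)) \<and>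
     (\<forall>i j. \<forall>x\<in>V i. \<forall>y\<in>V j. br x y \<in> V (i + j))"

end

theory Submission
  imports Defs
begin

text \<open>
  Let \<open>\<epsilon>\<close> be the Euler vector field of the fibres of the cotangent bundle and \<open>g\<close> the
  Patterson-Walker metric. Since \<open>L\<^sub>\<epsilon> g = g\<close>, bracketing with \<open>\<epsilon>\<close> is a derivation of the Lie algebra of
  Killing vector fields. Vertical lifts of forms, complete lifts of vector fields and horizontal lifts
  of bivector fields are eigenvectors of this derivation for the eigenvalues \<open>-1, 0, 1\<close>. So the theorem
  says that the derivation is diagonalizable on the Killing fields, with no other eigenvalues and with
  the three families of lifts as eigenspaces. The Leibniz rule then makes degrees additive
  (\<open>lie_grading_derivation\<close>).

  Diagonalizability is the equation \<open>(ad \<epsilon>)\<^sup>3 = ad \<epsilon>\<close> (\<open>eul_bracket_cube\<close>), which expresses that a Killing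
  field \<open>K\<close> is polynomial along the fibres. Consider its moment functions \<open>m\<^sub>\<beta> = g(\<beta>\<^sup>v, K)\<close>. The Killing
  equation on two vertical lifts makes \<open>\<alpha>\<^sup>v m\<^sub>\<beta>\<close> antisymmetric in \<open>\<alpha>\<close> and \<open>\<beta>\<close>, and vertical lifts commute;
  hence \<open>\<alpha>\<^sup>v \<beta>\<^sup>v m\<^sub>\<gamma>\<close> is symmetric in the first two and antisymmetric in the last two forms and
  vanishes (\<open>vl_vl_mo\<close>). The Killing equation on a complete and a vertical lift expresses the second
  derivative of \<open>K Y\<^sup>v\<close> in the direction \<open>\<eta>\<^sup>v\<close> by a first derivative of a moment function
  (\<open>vl_vl_action\<close>), so its third derivative vanishes. Along the section \<open>\<eta>\<close>, on the other hand, \<open>\<epsilon>\<close>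
  coincides with \<open>\<eta>\<^sup>v\<close>, and this turns the third derivative into \<open>\<epsilon>(\<epsilon> - 1)(\<epsilon> - 2)\<close> (\<open>eul_cube\<close>). As
  \<open>ad \<epsilon>\<close> acts on \<open>K Y\<^sup>v\<close> as \<open>\<epsilon> - 1\<close>, the cubic equation follows.

  An eigenvector \<open>K\<close> is recovered from its tensor by homogeneity, because a function of degree zero
  along the fibres is constant on them (\<open>eul_zero_imp_basic\<close>): the form is \<open>Y \<mapsto> K Y\<^sup>v\<close>, the vector field
  is \<open>f \<mapsto> K(f \<circ> pr)\<close>, and the bivector field is \<open>(\<alpha>, \<beta>) \<mapsto> \<alpha>\<^sup>v m\<^sub>\<beta>\<close>. Conversely, complete and vertical lifts
  span the tangent spaces of the bundle, and the components of \<open>L\<^sub>K g\<close> on them show which lifts are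
  Killing (\<open>vl_KF_iff\<close>, \<open>cl_KF_iff\<close>, \<open>bl_KF_iff\<close>): for a vertical lift the symmetrized covariant
  derivative of the form is left over, for a complete lift the Lie derivative of the connection, and
  for a bivector field its covariant derivative and the curvature term.

  Two devices carry the computations. A vector field on the bundle is the same as a compatible action on
  the functions \<open>f \<circ> pr\<close> and \<open>Y\<^sup>v\<close> (\<open>vector_field_from_action\<close>), and it is determined by the action on
  the functions \<open>Y\<^sup>v\<close> alone (\<open>TVec_eqI\<close>). Functions on the bundle are compared after pulling them back
  by all one-forms \<open>\<eta>\<close>, regarded as sections (\<open>ev_eqI\<close>); this replaces calculations in coordinates by
  tensor calculus on the base.
\<close>

section \<open>Calculus of smooth functions on open subsets of Euclidean spaces\<close>

lemma Ck_on_SucD: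
  assumes "Ck_on (Suc k) S f"
  shows "x \<in> S \<Longrightarrow> (f has_derivative frechet_derivative f (at x)) (at x)"
    and "Ck_on k S (\<lambda>x. frechet_derivative f (at x) v)"
  using assms by (auto simp: frechet_derivative_works)

lemma Ck_on_cong:
  assumes "open S" "\<And>x. x \<in> S \<Longrightarrow> f x = g x" "Ck_on k S f"
  shows "Ck_on k S g"
  using assms(2,3)
proof (induction k arbitrary: f g)
  case 0
  then show ?case by (metis Ck_on.simps(1) continuous_on_cong)
next
  case (Suc k)
  have d: "(g has_derivative frechet_derivative f (at x)) (at x)" if "x \<in> S" for x
    using has_derivative_transform_within_open[OF Ck_on_SucD(1)[OF Suc.prems(2) that] assms(1) that]
      Suc.prems(1) by blast
  have "frechet_derivative f (at x) = frechet_derivative g (at x)" if "x \<in> S" for x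
    using d[OF that] by (rule frechet_derivative_at)
  then have "Ck_on k S (\<lambda>x. frechet_derivative g (at x) v)" for v
    by (intro Suc.IH[OF _ Ck_on_SucD(2)[OF Suc.prems(2), of v]]) simp
  then show ?case using d by (auto simp: differentiable_def)
qed

lemma Ck_on_SucI:
  assumes "open S" "\<And>x. x \<in> S \<Longrightarrow> (f has_derivative f' x) (at x)"
    and "\<And>v. Ck_on k S (\<lambda>x. f' x v)"
  shows "Ck_on (Suc k) S f"
proof -
  have e: "f' x = frechet_derivative f (at x)" if "x \<in> S" for x
    using assms(2)[OF that] by (rule frechet_derivative_at)
  have "Ck_on k S (\<lambda>x. frechet_derivative f (at x) v)" for v
    by (rule Ck_on_cong[OF assms(1) _ assms(3)[of v]]) (simp add: e)
  then show ?thesis using assms(2) by (auto simp: differentiable_def)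
qed

lemma Ck_on_subset: "Ck_on k S f \<Longrightarrow> T \<subseteq> S \<Longrightarrow> Ck_on k T f"
  by (induction k arbitrary: f) (auto intro: continuous_on_subset)

lemma Ck_on_Suc_imp: "Ck_on (Suc k) S f \<Longrightarrow> Ck_on k S f"
proof (induction k arbitrary: f)
  case 0
  then show ?case
    by (auto intro!: continuous_at_imp_continuous_on differentiable_imp_continuous_within)
next
  case (Suc k)
  then show ?case using Ck_on.simps(2) by blast
qed

lemma Ck_on_local:
  assumes "\<And>x. x \<in> S \<Longrightarrow> \<exists>N. open N \<and> x \<in> N \<and> Ck_on k N f"
  shows "Ck_on k S f"
  using assms
proof (induction k arbitrary: f)
  case 0
  then show ?case
    by (auto intro!: continuous_at_imp_continuous_on)
      (metis continuous_on_eq_continuous_at)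
next
  case (Suc k)
  have "\<exists>N. open N \<and> x \<in> N \<and> Ck_on k N (\<lambda>x. frechet_derivative f (at x) v)" if "x \<in> S" for x v
    using Suc.prems[OF that] Ck_on.simps(2) by blast
  then have "Ck_on k S (\<lambda>x. frechet_derivative f (at x) v)" for v
    by (rule Suc.IH)
  moreover have "f differentiable (at x)" if "x \<in> S" for x
    using Suc.prems[OF that] Ck_on.simps(2) by blast
  ultimately show ?case by simp
qed

lemma Ck_on_const: "open S \<Longrightarrow> Ck_on k S (\<lambda>x. c)"
proof (induction k arbitrary: c)
  case (Suc k)
  show ?case by (rule Ck_on_SucI[where f'="\<lambda>x v. 0", OF Suc.prems]) (auto intro: Suc.IH Suc.prems)
qed auto

lemma Ck_on_bounded_linear:
  assumes "bounded_linear L" "open S" "Ck_on k S f"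
  shows "Ck_on k S (\<lambda>x. L (f x))"
  using assms(3)
proof (induction k arbitrary: f)
  case 0
  then show ?case
    using bounded_linear.continuous_on[OF assms(1)] by auto
next
  case (Suc k)
  show ?case
    using bounded_linear.has_derivative[OF assms(1) Ck_on_SucD(1)[OF Suc.prems]]
    by (rule Ck_on_SucI[OF assms(2)]) (auto intro: Suc.IH[OF Ck_on_SucD(2)[OF Suc.prems]])
qed

lemma Ck_on_ident: "open S \<Longrightarrow> Ck_on k S (\<lambda>x. x)"
  by (cases k) (auto intro!: Ck_on_SucI[where f'="\<lambda>x v. v"] Ck_on_const)

lemma Ck_on_add:
  assumes "open S" "Ck_on k S f" "Ck_on k S g"
  shows "Ck_on k S (\<lambda>x. f x + g x)"
  using assms(2,3)
proof (induction k arbitrary: f g)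
  case (Suc k)
  show ?case
    using has_derivative_add[OF Ck_on_SucD(1)[OF Suc.prems(1)] Ck_on_SucD(1)[OF Suc.prems(2)]]
    by (rule Ck_on_SucI[OF assms(1)])
       (auto intro: Suc.IH[OF Ck_on_SucD(2)[OF Suc.prems(1)] Ck_on_SucD(2)[OF Suc.prems(2)]])
qed (simp add: continuous_on_add)

lemma (in bounded_bilinear) Ck_on_prod:
  assumes "open S" "Ck_on k S f" "Ck_on k S g"
  shows "Ck_on k S (\<lambda>x. prod (f x) (g x))"
  using assms(2,3)
proof (induction k arbitrary: f g)
  case 0
  then show ?case by (auto intro: continuous_on)
next
  case (Suc k)
  have "Ck_on k S (\<lambda>x. prod (f x) (frechet_derivative g (at x) v) + prod (frechet_derivative f (at x) v) (g x))" for v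
    by (intro Ck_on_add[OF assms(1)] Suc.IH Ck_on_SucD(2)[OF Suc.prems(1)] Ck_on_SucD(2)[OF Suc.prems(2)]
        Ck_on_Suc_imp[OF Suc.prems(1)] Ck_on_Suc_imp[OF Suc.prems(2)])
  then show ?case
    by (intro Ck_on_SucI[OF assms(1)
        FDERIV[OF Ck_on_SucD(1)[OF Suc.prems(1)] Ck_on_SucD(1)[OF Suc.prems(2)]]])
qed

lemma Ck_on_sum:
  assumes "open S" "\<And>i. i \<in> I \<Longrightarrow> Ck_on k S (f i)"
  shows "Ck_on k S (\<lambda>x. \<Sum>i\<in>I. f i x)"
  using assms(2)
  by (induction I rule: infinite_finite_induct) (auto intro: Ck_on_const Ck_on_add assms(1))

lemma linear_basis_expansion:
  fixes L :: "'e::euclidean_space \<Rightarrow> 'f::real_vector"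
  assumes "linear L"
  shows "L w = (\<Sum>b\<in>Basis. (w \<bullet> b) *\<^sub>R L b)"
proof -
  have "L w = L (\<Sum>b\<in>Basis. (w \<bullet> b) *\<^sub>R b)" by (simp add: euclidean_representation)
  also have "\<dots> = (\<Sum>b\<in>Basis. L ((w \<bullet> b) *\<^sub>R b))" by (rule linear_sum[OF assms])
  finally show ?thesis by (simp add: linear_scale[OF assms])
qed

text \<open>The derivative of a composition is a finite sum of products of lower order data, because the
  chain rule is linear in the inner derivative and a Euclidean space has a finite basis.\<close>
lemma Ck_on_compose:
  fixes f :: "'e::euclidean_space \<Rightarrow> 'f::euclidean_space"
  assumes "open S" "open T" "Ck_on k S f" "Ck_on k T g" "f ` S \<subseteq> T"
  shows "Ck_on k S (\<lambda>x. g (f x))"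
  using assms(3,4)
proof (induction k arbitrary: g)
  case 0
  then show ?case using assms(5) by (auto intro: continuous_on_compose2)
next
  case (Suc k)
  let ?f' = "\<lambda>x. frechet_derivative f (at x)" and ?g' = "\<lambda>y. frechet_derivative g (at y)"
  have Ck: "Ck_on k S f" by (rule Ck_on_Suc_imp[OF Suc.prems(1)])
  have d: "((\<lambda>x. g (f x)) has_derivative (\<lambda>v. \<Sum>b\<in>Basis. (?f' x v \<bullet> b) *\<^sub>R ?g' (f x) b)) (at x)"
    if "x \<in> S" for x
  proof -
    have g: "(g has_derivative ?g' (f x)) (at (f x))"
      using Ck_on_SucD(1)[OF Suc.prems(2)] assms(5) that by auto
    have lin: "linear (?g' (f x))" using g has_derivative_linear by blast
    have "(\<lambda>v. \<Sum>b\<in>Basis. (?f' x v \<bullet> b) *\<^sub>R ?g' (f x) b) = (\<lambda>v. ?g' (f x) (?f' x v))"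
      by (intro ext linear_basis_expansion[OF lin, symmetric])
    then show ?thesis
      using has_derivative_compose[OF Ck_on_SucD(1)[OF Suc.prems(1) that] g] by simp
  qed
  have "Ck_on k S (\<lambda>x. \<Sum>b\<in>Basis. (?f' x v \<bullet> b) *\<^sub>R ?g' (f x) b)" for v
  proof (rule Ck_on_sum[OF assms(1)])
    fix b
    show "Ck_on k S (\<lambda>x. (?f' x v \<bullet> b) *\<^sub>R ?g' (f x) b)"
      by (rule bounded_bilinear.Ck_on_prod[OF bounded_bilinear_scaleR assms(1)
        Ck_on_bounded_linear[OF bounded_linear_inner_left assms(1) Ck_on_SucD(2)[OF Suc.prems(1)]]
        Suc.IH[OF Ck Ck_on_SucD(2)[OF Suc.prems(2)]]])
  qed
  then show ?case by (intro Ck_on_SucI[OF assms(1) d])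
qed

lemma Ck_on_inverse: "Ck_on k (- {0::real}) inverse"
proof (induction k)
  case 0
  show ?case using continuous_on_inverse[OF continuous_on_id, of "- {0::real}"] by auto
next
  case (Suc k)
  have o: "open (- {0::real})" by (intro open_Compl closed_singleton)
  note p = bounded_bilinear.Ck_on_prod[OF bounded_bilinear_mult o]
  have "Ck_on k (- {0}) (\<lambda>x::real. - (inverse x * v * inverse x))" for v
    using Ck_on_bounded_linear[OF bounded_linear_minus[OF bounded_linear_ident] o
        p[OF p[OF Suc Ck_on_const[OF o, of k v]] Suc]] .
  then show ?case
    by (rule Ck_on_SucI[OF o, rotated]) (rule has_derivative_inverse', simp)
qed

lemma smooth_on_cong: "open S \<Longrightarrow> (\<And>x. x \<in> S \<Longrightarrow> f x = g x) \<Longrightarrow> smooth_on S f \<Longrightarrow> smooth_on S g"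
  unfolding smooth_on_def using Ck_on_cong by blast

lemma smooth_on_subset: "smooth_on S f \<Longrightarrow> T \<subseteq> S \<Longrightarrow> smooth_on T f"
  unfolding smooth_on_def using Ck_on_subset by blast

lemma smooth_on_local:
  assumes "\<And>x. x \<in> S \<Longrightarrow> \<exists>N. open N \<and> x \<in> N \<and> smooth_on N f"
  shows "smooth_on S f"
  using assms Ck_on_local unfolding smooth_on_def by metis

lemma smooth_on_const: "open S \<Longrightarrow> smooth_on S (\<lambda>x. c)"
  unfolding smooth_on_def using Ck_on_const by blast

lemma smooth_on_ident: "open S \<Longrightarrow> smooth_on S (\<lambda>x. x)"
  unfolding smooth_on_def using Ck_on_ident by blast

lemma smooth_on_bounded_linear:
  "bounded_linear L \<Longrightarrow> open S \<Longrightarrow> smooth_on S f \<Longrightarrow> smooth_on S (\<lambda>x. L (f x))"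
  unfolding smooth_on_def using Ck_on_bounded_linear by blast

lemma smooth_on_linear: "bounded_linear L \<Longrightarrow> open S \<Longrightarrow> smooth_on S L"
  using smooth_on_bounded_linear[OF _ _ smooth_on_ident] by blast

lemma smooth_on_add: "open S \<Longrightarrow> smooth_on S f \<Longrightarrow> smooth_on S g \<Longrightarrow> smooth_on S (\<lambda>x. f x + g x)"
  unfolding smooth_on_def using Ck_on_add by blast

lemma smooth_on_minus: "open S \<Longrightarrow> smooth_on S f \<Longrightarrow> smooth_on S (\<lambda>x. - f x)"
  by (rule smooth_on_bounded_linear[OF bounded_linear_minus[OF bounded_linear_ident]])

lemma smooth_on_diff: "open S \<Longrightarrow> smooth_on S f \<Longrightarrow> smooth_on S g \<Longrightarrow> smooth_on S (\<lambda>x. f x - g x)"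
  using smooth_on_add[OF _ _ smooth_on_minus, of S f g] by simp

lemma smooth_on_sum:
  "open S \<Longrightarrow> (\<And>i. i \<in> I \<Longrightarrow> smooth_on S (f i)) \<Longrightarrow> smooth_on S (\<lambda>x. \<Sum>i\<in>I. f i x)"
  unfolding smooth_on_def using Ck_on_sum[where f=f and I=I] by blast

lemma smooth_on_scaleR:
  "open S \<Longrightarrow> smooth_on S f \<Longrightarrow> smooth_on S g \<Longrightarrow> smooth_on S (\<lambda>x. f x *\<^sub>R g x)"
  unfolding smooth_on_def using bounded_bilinear.Ck_on_prod[OF bounded_bilinear_scaleR] by blast

lemma smooth_on_mult:
  fixes f g :: "'e::euclidean_space \<Rightarrow> real"
  shows "open S \<Longrightarrow> smooth_on S f \<Longrightarrow> smooth_on S g \<Longrightarrow> smooth_on S (\<lambda>x. f x * g x)"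
  using smooth_on_scaleR[of S f g] by simp

lemma smooth_on_inner: "open S \<Longrightarrow> smooth_on S f \<Longrightarrow> smooth_on S g \<Longrightarrow> smooth_on S (\<lambda>x. f x \<bullet> g x)"
  unfolding smooth_on_def using bounded_bilinear.Ck_on_prod[OF bounded_bilinear_inner] by blast

lemma smooth_on_compose:
  fixes f :: "'e::euclidean_space \<Rightarrow> 'f::euclidean_space"
  shows "open S \<Longrightarrow> open T \<Longrightarrow> smooth_on S f \<Longrightarrow> smooth_on T g \<Longrightarrow> f ` S \<subseteq> T \<Longrightarrow> smooth_on S (\<lambda>x. g (f x))"
  unfolding smooth_on_def using Ck_on_compose by blast

lemma smooth_on_inverse:
  fixes f :: "'e::euclidean_space \<Rightarrow> real"
  assumes "open S" "smooth_on S f" "\<And>x. x \<in> S \<Longrightarrow> f x \<noteq> 0"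
  shows "smooth_on S (\<lambda>x. inverse (f x))"
  by (rule smooth_on_compose[OF assms(1) _ assms(2), where T="- {0}"])
     (use assms Ck_on_inverse in \<open>auto simp: smooth_on_def\<close>)

lemma smooth_on_Pair:
  fixes f :: "'e::euclidean_space \<Rightarrow> 'f::euclidean_space" and g :: "'e \<Rightarrow> 'g::euclidean_space"
  assumes "open S" "smooth_on S f" "smooth_on S g"
  shows "smooth_on S (\<lambda>x. (f x, g x))"
proof -
  have "smooth_on S (\<lambda>x. (f x, 0) + (0, g x))"
    using assms by (intro smooth_on_add
      smooth_on_bounded_linear[of "\<lambda>y. (y, 0)"] smooth_on_bounded_linear[of "\<lambda>y. (0, y)"]
      bounded_linear_Pair bounded_linear_ident bounded_linear_zero) 
  then show ?thesis by simp
qed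

lemma smooth_on_differentiable: "smooth_on S f \<Longrightarrow> x \<in> S \<Longrightarrow> f differentiable (at x)"
  unfolding smooth_on_def by (metis Ck_on.simps(2))

lemma smooth_on_has_derivative:
  "smooth_on S f \<Longrightarrow> x \<in> S \<Longrightarrow> (f has_derivative frechet_derivative f (at x)) (at x)"
  using smooth_on_differentiable frechet_derivative_works by blast

lemma smooth_on_derivative: "smooth_on S f \<Longrightarrow> smooth_on S (\<lambda>x. frechet_derivative f (at x) v)"
  unfolding smooth_on_def by (metis Ck_on.simps(2))

lemma smooth_on_continuous: "smooth_on S f \<Longrightarrow> continuous_on S f"
  unfolding smooth_on_def by (metis Ck_on.simps(1))

text \<open>All derivatives of \<open>t \<mapsto> exp (- 1 / t)\<close>, continued by zero, are linear combinations of the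
  following functions, which is why the family is treated as a whole.\<close>
definition flat :: "nat \<Rightarrow> real \<Rightarrow> real" where
  "flat n t = (if t > 0 then exp (- (1 / t)) / t ^ n else 0)"

text \<open>A single term of the exponential series of \<open>1 / h\<close> beats the power; the exponent 2 makes the
  difference quotient at \<open>0\<close> tend to \<open>0\<close>.\<close>
lemma flat_le: "\<bar>flat n h\<bar> \<le> fact (n + 2) * h\<^sup>2"
proof (cases "h > 0")
  case True
  define c where "c = fact (n + 2) * h ^ (n + 2)"
  have c: "c > 0" using True by (simp add: c_def del: fact_Suc power_Suc)
  have "(1 / h) ^ (n + 2) / fact (n + 2) \<le> exp (1 / h)"
  proof -
    have s: "summable (\<lambda>k. (1 / h) ^ k /\<^sub>R fact k)" by (rule summable_exp_generic)
    have "(\<Sum>k\<in>{n+2}. (1 / h) ^ k /\<^sub>R fact k) \<le> (\<Sum>k. (1 / h) ^ k /\<^sub>R fact k)"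
      by (rule sum_le_suminf[OF s]) (use True in auto)
    then show ?thesis by (simp add: exp_def divide_inverse mult.commute)
  qed
  then have "1 / c \<le> exp (1 / h)"
    by (simp only: c_def power_divide power_one divide_divide_eq_left mult.commute)
  then have "1 \<le> exp (1 / h) * c" using c by (simp only: pos_divide_le_eq)
  then have "1 \<le> exp (1 / h) * (fact (n + 2) * h ^ (n + 2))" by (simp only: c_def)
  then have "exp (- (1 / h)) \<le> fact (n + 2) * h ^ (n + 2)"
    by (simp only: exp_minus inverse_eq_divide pos_divide_le_eq exp_gt_zero mult_ac)
  then have "exp (- (1 / h)) \<le> (fact (n + 2) * h\<^sup>2) * h ^ n"
    by (simp add: power_add mult_ac power2_eq_square)
  then have "exp (- (1 / h)) / h ^ n \<le> fact (n + 2) * h\<^sup>2"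
    using True by (simp only: pos_divide_le_eq zero_less_power)
  then show ?thesis using True by (simp add: flat_def)
qed (simp add: flat_def)

lemma flat_deriv: "(flat n has_real_derivative flat (n + 2) t - n * flat (n + 1) t) (at t)"
proof -
  consider "t > 0" | "t < 0" | "t = 0" by linarith
  then show ?thesis
  proof cases
    case 1
    have "((\<lambda>t. exp (- (1 / t)) / t ^ n) has_real_derivative
        (exp (- (1/t)) * (1 / t\<^sup>2) * t ^ n - exp (- (1/t)) * (n * t ^ (n - 1))) / (t ^ n * t ^ n)) (at t)"
      using 1 by (auto intro!: derivative_eq_intros simp: power2_eq_square divide_simps)
    also have "(exp (- (1/t)) * (1 / t\<^sup>2) * t ^ n - exp (- (1/t)) * (n * t ^ (n - 1))) / (t ^ n * t ^ n)
       = flat (n + 2) t - n * flat (n + 1) t"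
      using 1 by (cases n) (auto simp: flat_def field_simps power_add power2_eq_square)
    finally show ?thesis
      by (rule has_field_derivative_transform_within_open[where S="{0<..}"]) (use 1 in \<open>auto simp: flat_def\<close>)
  next
    case 2
    have "((\<lambda>t::real. 0::real) has_real_derivative 0) (at t)" by simp
    then have "(flat n has_real_derivative 0) (at t)"
      by (rule has_field_derivative_transform_within_open[where S="{..<0}"]) (use 2 in \<open>auto simp: flat_def\<close>)
    then show ?thesis using 2 by (simp add: flat_def)
  next
    case 3
    have "((\<lambda>h. flat n h / h) \<longlongrightarrow> 0) (at 0)"
    proof (rule Lim_null_comparison)
      show "\<forall>\<^sub>F h in at 0. norm (flat n h / h) \<le> fact (n + 2) * \<bar>h\<bar>"
        unfolding eventually_at
      proof (intro exI[of _ 1] conjI ballI impI)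
        fix h :: real assume "h \<noteq> 0 \<and> dist h 0 < 1"
        then have "h \<noteq> 0" by simp
        have "\<bar>flat n h\<bar> \<le> fact (n + 2) * \<bar>h\<bar> * \<bar>h\<bar>"
          using flat_le[of n h] by (simp add: power2_eq_square mult.assoc)
        then show "norm (flat n h / h) \<le> fact (n + 2) * \<bar>h\<bar>"
          using \<open>h \<noteq> 0\<close> by (simp add: divide_le_eq)
      qed simp
      show "((\<lambda>h::real. fact (n + 2) * \<bar>h\<bar>) \<longlongrightarrow> 0) (at 0)"
        by (auto intro!: tendsto_eq_intros)
    qed
    then show ?thesis using 3 by (simp add: DERIV_def flat_def)
  qed
qed

lemma smooth_on_flat: "smooth_on UNIV (flat n)"
proof -
  have "Ck_on k UNIV (flat n)" for k n
  proof (induction k arbitrary: n)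
    case 0
    show ?case using DERIV_isCont[OF flat_deriv] by (simp add: continuous_at_imp_continuous_on)
  next
    case (Suc k)
    have "Ck_on k UNIV (\<lambda>t. (flat (n + 2) t + (- real n) * flat (n + 1) t) * v)" for v
      by (intro bounded_bilinear.Ck_on_prod[OF bounded_bilinear_mult] Ck_on_add Ck_on_const Suc) auto
    then show ?case
      using flat_deriv[of n, THEN has_field_derivative_imp_has_derivative]
      by (intro Ck_on_SucI) (auto simp: algebra_simps)
  qed
  then show ?thesis by (simp add: smooth_on_def)
qed

text \<open>The function is \<open>u / (u + w)\<close>, where \<open>u\<close> vanishes outside the large ball and \<open>w\<close> inside the small
  one, and they never vanish together.\<close>
lemma plateau_exists:
  fixes a :: "'e::euclidean_space"
  assumes "0 < r1" "r1 < r2"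
  obtains h :: "'e \<Rightarrow> real" where "smooth_on UNIV h"
    "\<And>x. dist x a \<le> r1 \<Longrightarrow> h x = 1" "\<And>x. dist x a \<ge> r2 \<Longrightarrow> h x = 0"
proof -
  define N where "N = (\<lambda>x::'e. (x - a) \<bullet> (x - a))"
  define u where "u = (\<lambda>x. flat 0 (r2\<^sup>2 - N x))"
  define w where "w = (\<lambda>x. flat 0 (N x - r1\<^sup>2))"
  have N: "N x = (dist x a)\<^sup>2" for x by (simp add: N_def dist_norm dot_square_norm)
  have sN: "smooth_on UNIV N" unfolding N_def
    by (intro smooth_on_inner smooth_on_diff smooth_on_ident smooth_on_const) auto
  have su: "smooth_on UNIV u" unfolding u_def
    by (intro smooth_on_compose[OF _ _ _ smooth_on_flat] smooth_on_diff sN smooth_on_const) auto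
  have sw: "smooth_on UNIV w" unfolding w_def
    by (intro smooth_on_compose[OF _ _ _ smooth_on_flat] smooth_on_diff sN smooth_on_const) auto
  have r: "r1\<^sup>2 < r2\<^sup>2" using assms by (simp add: power_strict_mono)
  have pos: "u x + w x \<noteq> 0" for x
  proof -
    have "r2\<^sup>2 - N x > 0 \<or> N x - r1\<^sup>2 > 0" using r by linarith
    then show ?thesis by (auto simp: u_def w_def flat_def add_pos_nonneg add_nonneg_pos 
        intro!: less_imp_neq[THEN not_sym] split: if_splits)
  qed
  show ?thesis
  proof (rule that[of "\<lambda>x. u x * inverse (u x + w x)"])
    show "smooth_on UNIV (\<lambda>x. u x * inverse (u x + w x))"
      by (intro smooth_on_mult smooth_on_inverse smooth_on_add su sw pos) auto
    show "u x * inverse (u x + w x) = 1" if "dist x a \<le> r1" for x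
    proof -
      have "N x \<le> r1\<^sup>2" using that N by (simp add: power_mono)
      then have "w x = 0" by (simp add: w_def flat_def)
      then show ?thesis using pos[of x] by simp
    qed
    show "u x * inverse (u x + w x) = 0" if "dist x a \<ge> r2" for x
    proof -
      have "N x \<ge> r2\<^sup>2" using that N assms by (simp add: power_mono)
      then show ?thesis by (simp add: u_def flat_def)
    qed
  qed
qed

text \<open>Differentiating under the integral sign raises the power of \<open>t\<close> by one, hence the general
  exponent.\<close>
lemma Ck_on_radial_integral:
  fixes h :: "'e::euclidean_space \<Rightarrow> real"
  assumes "smooth_on (ball a r) h"
  shows "Ck_on k (ball a r) (\<lambda>x. integral (cbox 0 1) (\<lambda>t. t ^ m * h (a + t *\<^sub>R (x - a))))"
  using assms
proof (induction k arbitrary: h m)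
  case (0 h m)
  have *: "a + t *\<^sub>R (x - a) \<in> ball a r" if "x \<in> ball a r" "t \<in> cbox 0 1" for x t
  proof -
    have "\<bar>t\<bar> * norm (x - a) \<le> 1 * norm (x - a)" using that by (intro mult_right_mono) auto
    then show ?thesis using that by (simp add: dist_norm norm_minus_commute)
  qed
  have "continuous_on (ball a r \<times> cbox 0 1) (\<lambda>(x, t::real). t ^ m * h (a + t *\<^sub>R (x - a)))"
    unfolding split_beta using *
    by (intro continuous_intros continuous_on_compose2[OF smooth_on_continuous[OF 0]]) auto
  from integral_continuous_on_param[OF this] show ?case by simp
next
  case (Suc k h m)
  have *: "a + t *\<^sub>R (x - a) \<in> ball a r" if "x \<in> ball a r" "t \<in> cbox 0 1" for x t
  proof -
    have "\<bar>t\<bar> * norm (x - a) \<le> 1 * norm (x - a)" using that by (intro mult_right_mono) auto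
    then show ?thesis using that by (simp add: dist_norm norm_minus_commute)
  qed
  let ?h' = "\<lambda>y. frechet_derivative h (at y)"
  define fx where "fx = (\<lambda>x t. t ^ (m + 1) *\<^sub>R Blinfun (?h' (a + t *\<^sub>R (x - a))))"
  have bl: "bounded_linear (?h' y)" if "y \<in> ball a r" for y
    using smooth_on_has_derivative[OF Suc.prems that] has_derivative_bounded_linear by blast
  have fx: "blinfun_apply (fx x t) v = t ^ (m + 1) * ?h' (a + t *\<^sub>R (x - a)) v"
    if "x \<in> ball a r" "t \<in> cbox 0 1" for x t v
    using bl[OF *[OF that]] by (simp add: fx_def blinfun.scaleR_left bounded_linear_Blinfun_apply)
  have cont: "continuous_on (ball a r \<times> cbox 0 1) (\<lambda>(x, t::real). t ^ j * g (a + t *\<^sub>R (x - a)))"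
    if "smooth_on (ball a r) g" for g :: "'e \<Rightarrow> real" and j
    unfolding split_beta using *
    by (intro continuous_intros continuous_on_compose2[OF smooth_on_continuous[OF that]]) auto
  have intble: "(\<lambda>t. t ^ j * g (a + t *\<^sub>R (x - a))) integrable_on cbox 0 1"
    if "smooth_on (ball a r) g" "x \<in> ball a r" for g :: "'e \<Rightarrow> real" and x j
  proof (rule integrable_continuous)
    show "continuous_on (cbox 0 1) (\<lambda>t. t ^ j * g (a + t *\<^sub>R (x - a)))"
      using *[OF that(2)]
      by (intro continuous_intros continuous_on_compose2[OF smooth_on_continuous[OF that(1)]]) auto
  qed
  have cont_fx: "continuous_on (ball a r \<times> cbox 0 1) (\<lambda>(x, t). fx x t)"
  proof (rule continuous_on_blinfun_componentwise)
    fix i :: 'e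
    have "continuous_on (ball a r \<times> cbox 0 1) (\<lambda>(x, t::real). t ^ (m + 1) * ?h' (a + t *\<^sub>R (x - a)) i)"
      by (rule cont[OF smooth_on_derivative[OF Suc.prems]])
    then show "continuous_on (ball a r \<times> cbox 0 1) (\<lambda>y. blinfun_apply (case y of (x, t) \<Rightarrow> fx x t) i)"
      by (rule continuous_on_eq) (auto simp: fx)
  qed
  have der: "((\<lambda>x. t ^ m * h (a + t *\<^sub>R (x - a))) has_derivative blinfun_apply (fx x t)) (at x within ball a r)"
    if "x \<in> ball a r" "t \<in> cbox 0 1" for x t
  proof -
    have lin: "linear (?h' (a + t *\<^sub>R (x - a)))" using bl[OF *[OF that]] by (simp add: bounded_linear.linear)
    have "((\<lambda>x. a + t *\<^sub>R (x - a)) has_derivative (\<lambda>v. t *\<^sub>R v)) (at x)"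
      by (auto intro!: derivative_eq_intros)
    from has_derivative_compose[OF this smooth_on_has_derivative[OF Suc.prems *[OF that]]]
    have "((\<lambda>x. t ^ m * h (a + t *\<^sub>R (x - a))) has_derivative (\<lambda>v. t ^ m * ?h' (a + t *\<^sub>R (x - a)) (t *\<^sub>R v))) (at x)"
      by (rule has_derivative_mult_right)
    also have "(\<lambda>v. t ^ m * ?h' (a + t *\<^sub>R (x - a)) (t *\<^sub>R v)) = blinfun_apply (fx x t)"
      using lin by (auto simp: fx[OF that] linear_scale mult_ac)
    finally show ?thesis by (rule has_derivative_at_withinI)
  qed
  have D: "((\<lambda>x. integral (cbox 0 1) (\<lambda>t. t ^ m * h (a + t *\<^sub>R (x - a)))) has_derivative
      (\<lambda>v. integral (cbox 0 1) (\<lambda>t. t ^ (m + 1) * ?h' (a + t *\<^sub>R (x - a)) v))) (at x)"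
    if x: "x \<in> ball a r" for x
  proof -
    have "((\<lambda>x. integral (cbox 0 1) (\<lambda>t. t ^ m * h (a + t *\<^sub>R (x - a)))) has_derivative
       blinfun_apply (integral (cbox 0 1) (fx x))) (at x within ball a r)"
      by (rule leibniz_rule[OF der intble[OF Suc.prems] cont_fx x]) auto
    moreover have "fx x integrable_on cbox 0 1"
    proof (rule integrable_continuous)
      show "continuous_on (cbox 0 1) (fx x)"
      proof -
        have "continuous_on (cbox 0 1) (\<lambda>t::real. (x, t))" by (intro continuous_intros)
        moreover have "(\<lambda>t::real. (x, t)) ` cbox 0 1 \<subseteq> ball a r \<times> cbox 0 1" using x by auto
        ultimately show ?thesis using continuous_on_compose2[OF cont_fx] by fastforce
      qed
    qed
    then have "blinfun_apply (integral (cbox 0 1) (fx x)) =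
       (\<lambda>v. integral (cbox 0 1) (\<lambda>t. t ^ (m + 1) * ?h' (a + t *\<^sub>R (x - a)) v))"
      using fx[OF x] by (auto simp: blinfun_apply_integral intro!: integral_cong ext)
    ultimately show ?thesis using x by (simp add: at_within_open[OF x])
  qed
  show ?case
    by (rule Ck_on_SucI[OF open_ball D Suc.IH[OF smooth_on_derivative[OF Suc.prems]]])
qed

text \<open>The difference \<open>f x - f a\<close> is the integral of the derivative of \<open>f\<close> along the segment from \<open>a\<close> to
  \<open>x\<close>; the coefficients are the integrals of the partial derivatives.\<close>
lemma hadamard:
  fixes f :: "'e::euclidean_space \<Rightarrow> real"
  assumes "smooth_on (ball a r) f"
  obtains g where "\<And>b. smooth_on (ball a r) (g b)"
    "\<And>x. x \<in> ball a r \<Longrightarrow> f x = f a + (\<Sum>b\<in>Basis. ((x - a) \<bullet> b) * g b x)"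
    "\<And>b. g b a = frechet_derivative f (at a) b"
proof -
  let ?f' = "\<lambda>y. frechet_derivative f (at y)"
  define g where "g = (\<lambda>b x. integral (cbox 0 1) (\<lambda>t::real. ?f' (a + t *\<^sub>R (x - a)) b))"
  have s: "smooth_on (ball a r) (g b)" for b
    using Ck_on_radial_integral[OF smooth_on_derivative[OF assms], of _ 0 b]
    by (simp add: g_def smooth_on_def)
  have eq: "f x = f a + (\<Sum>b\<in>Basis. ((x - a) \<bullet> b) * g b x)" if x: "x \<in> ball a r" for x
  proof -
    have mem: "a + t *\<^sub>R (x - a) \<in> ball a r" if "t \<in> cbox 0 1" for t
    proof -
      have "\<bar>t\<bar> * norm (x - a) \<le> 1 * norm (x - a)" using that by (intro mult_right_mono) auto
      then show ?thesis using that x by (simp add: dist_norm norm_minus_commute)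
    qed
    have d: "((\<lambda>t. f (a + t *\<^sub>R (x - a))) has_vector_derivative
        (\<Sum>b\<in>Basis. ((x - a) \<bullet> b) * ?f' (a + t *\<^sub>R (x - a)) b)) (at t within {0..1})" if "t \<in> {0..1}" for t
    proof -
      have t: "t \<in> cbox 0 1" using that by simp
      have D: "(f has_derivative ?f' (a + t *\<^sub>R (x - a))) (at (a + t *\<^sub>R (x - a)))"
        by (rule smooth_on_has_derivative[OF assms mem[OF t]])
      have lin: "linear (?f' (a + t *\<^sub>R (x - a)))" using D has_derivative_linear by blast
      have e: "?f' (a + t *\<^sub>R (x - a)) w = (\<Sum>b\<in>Basis. (w \<bullet> b) * ?f' (a + t *\<^sub>R (x - a)) b)" for w
        unfolding real_scaleR_def[symmetric] by (rule linear_basis_expansion[OF lin])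
      have "((\<lambda>t. a + t *\<^sub>R (x - a)) has_derivative (\<lambda>s. s *\<^sub>R (x - a))) (at t)"
        by (auto intro!: derivative_eq_intros)
      from has_derivative_compose[OF this D]
      have "((\<lambda>t. f (a + t *\<^sub>R (x - a))) has_derivative (\<lambda>s. s * ?f' (a + t *\<^sub>R (x - a)) (x - a))) (at t)"
        using lin by (simp add: linear_scale)
      then show ?thesis using e[of "x - a"]
        by (auto simp: has_vector_derivative_def intro: has_derivative_at_withinI)
    qed
    have "((\<lambda>t. \<Sum>b\<in>Basis. ((x - a) \<bullet> b) * ?f' (a + t *\<^sub>R (x - a)) b) has_integral f x - f a) {0..1}"
      using fundamental_theorem_of_calculus[OF _ d] by simp
    then have "f x - f a = integral {0..1} (\<lambda>t. \<Sum>b\<in>Basis. ((x - a) \<bullet> b) * ?f' (a + t *\<^sub>R (x - a)) b)"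
      by (simp add: integral_unique)
    also have "\<dots> = (\<Sum>b\<in>Basis. integral {0..1} (\<lambda>t. ((x - a) \<bullet> b) * ?f' (a + t *\<^sub>R (x - a)) b))"
    proof (rule integral_sum)
      fix b :: 'e
      have "continuous_on {0..1} (\<lambda>t. ((x - a) \<bullet> b) * ?f' (a + t *\<^sub>R (x - a)) b)"
        using mem
        by (intro continuous_intros continuous_on_compose2[OF smooth_on_continuous[OF smooth_on_derivative[OF assms]]])
           auto
      then show "(\<lambda>t. ((x - a) \<bullet> b) * ?f' (a + t *\<^sub>R (x - a)) b) integrable_on {0..1}"
        by (rule integrable_continuous_real)
    qed simp
    also have "\<dots> = (\<Sum>b\<in>Basis. ((x - a) \<bullet> b) * g b x)"
      by (simp add: g_def)
    finally show ?thesis by simp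
  qed
  have "g b a = ?f' a b" for b by (simp add: g_def)
  then show ?thesis using that s eq by blast
qed

section \<open>Local structure of a manifold\<close>

lemma vf_app_add_left: "vf_app (X + Y) f = vf_app X f + vf_app Y f"
  and vf_app_diff_left: "vf_app (X - Y) f = vf_app X f - vf_app Y f"
  and vf_app_minus_left: "vf_app (- X) f = - vf_app X f"
  and vf_app_zero_left: "vf_app 0 f = 0"
  and vf_app_mult_left: "vf_app (vf_mult h X) f = h * vf_app X f"
  and vf_app_scale_left: "vf_app (vf_scale c X) f = (\<lambda>p. c * vf_app X f p)"
  and vf_app_bracket: "vf_app (vf_bracket X Y) f = vf_app X (vf_app Y f) - vf_app Y (vf_app X f)"
  by (auto simp: vf_app_def vf_mult_def vf_scale_def vf_bracket_def)

lemmas vf_app_left = vf_app_add_left vf_app_diff_left vf_app_minus_left vf_app_zero_left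
  vf_app_mult_left vf_app_scale_left vf_app_bracket

lemma sum_fun_apply: "(\<Sum>i\<in>I. f i) x = (\<Sum>i\<in>I. f i x)"
  by (induction I rule: infinite_finite_induct) simp_all

lemma vf_bracket_antisym: "vf_bracket X Y = - vf_bracket Y X"
  by (simp add: vf_bracket_def fun_eq_iff)

lemma vf_bracket_self: "vf_bracket X X = 0"
  by (simp add: vf_bracket_def fun_eq_iff)

lemma additive_sum:
  fixes H :: "'b::comm_monoid_add \<Rightarrow> 'c::comm_monoid_add"
  assumes zero: "S 0" and plus: "\<And>x y. S x \<Longrightarrow> S y \<Longrightarrow> S (x + y)"
    and H0: "H 0 = 0" and H: "\<And>x y. S x \<Longrightarrow> S y \<Longrightarrow> H (x + y) = H x + H y"
    and w: "\<And>i. i \<in> I \<Longrightarrow> S (w i)"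
  shows "H (sum w I) = (\<Sum>i\<in>I. H (w i))"
proof -
  have "S (sum w I) \<and> H (sum w I) = (\<Sum>i\<in>I. H (w i))"
    using w
  proof (induction I rule: infinite_finite_induct)
    case (insert i I)
    then show ?case using H[of "w i" "sum w I"] plus[of "w i" "sum w I"] by simp
  qed (simp_all add: zero H0)
  then show ?thesis ..
qed

locale manifold =
  fixes A :: "('a, 'e::euclidean_space) chart set"
  assumes atlas: "atlas A" and hausdorff: "Hausdorff_space (atlas_topology A)"
begin

abbreviation "Car \<equiv> mcarrier A"
abbreviation "Cinf \<equiv> smooth_funs A"
abbreviation "Tan \<equiv> tangent_space A"
abbreviation "Vec \<equiv> vfields A"
abbreviation "Om \<equiv> forms1 A"

lemma chart_inj: "(U, \<phi>) \<in> A \<Longrightarrow> inj_on \<phi> U"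
  and chart_open: "(U, \<phi>) \<in> A \<Longrightarrow> open (\<phi> ` U)"
  and chart_sub: "(U, \<phi>) \<in> A \<Longrightarrow> U \<subseteq> Car"
  using atlas by (auto simp: atlas_def mcarrier_def)

lemma chart_inter_open: "(U, \<phi>) \<in> A \<Longrightarrow> (V, \<psi>) \<in> A \<Longrightarrow> open (\<phi> ` (U \<inter> V))"
  and chart_transition: "(U, \<phi>) \<in> A \<Longrightarrow> (V, \<psi>) \<in> A \<Longrightarrow> smooth_on (\<phi> ` (U \<inter> V)) (\<psi> \<circ> inv_into U \<phi>)"
  using atlas by (fastforce simp: atlas_def)+

lemma Car_chart: "p \<in> Car \<Longrightarrow> \<exists>U \<phi>. (U, \<phi>) \<in> A \<and> p \<in> U"
  by (force simp: mcarrier_def)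

lemma chart_inv: "(U, \<phi>) \<in> A \<Longrightarrow> q \<in> U \<Longrightarrow> inv_into U \<phi> (\<phi> q) = q"
  using chart_inj by (simp add: inv_into_f_f)

lemma chart_inv_mem: "x \<in> \<phi> ` U \<Longrightarrow> inv_into U \<phi> x \<in> U"
  by (rule inv_into_into)

lemma chart_inv_Car: "(U, \<phi>) \<in> A \<Longrightarrow> x \<in> \<phi> ` U \<Longrightarrow> inv_into U \<phi> x \<in> Car"
  using chart_sub[of U \<phi>] chart_inv_mem[of x \<phi> U] by auto

subsection \<open>The algebra of smooth functions\<close>

lemma Cinf_off: "f \<in> Cinf \<Longrightarrow> p \<notin> Car \<Longrightarrow> f p = 0"
  by (simp add: smooth_funs_def)

lemma Cinf_chart: "f \<in> Cinf \<Longrightarrow> (U, \<phi>) \<in> A \<Longrightarrow> smooth_on (\<phi> ` U) (f \<circ> inv_into U \<phi>)"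
  by (auto simp: smooth_funs_def)

lemma CinfI:
  assumes "\<And>p. p \<notin> Car \<Longrightarrow> f p = 0"
    and "\<And>U \<phi>. (U, \<phi>) \<in> A \<Longrightarrow> smooth_on (\<phi> ` U) (\<lambda>x. f (inv_into U \<phi> x))"
  shows "f \<in> Cinf"
  using assms by (auto simp: smooth_funs_def comp_def)

lemma Cinf_chart': "f \<in> Cinf \<Longrightarrow> (U, \<phi>) \<in> A \<Longrightarrow> smooth_on (\<phi> ` U) (\<lambda>x. f (inv_into U \<phi> x))"
  using Cinf_chart by (simp add: comp_def)

lemma Cinf_zero [simp]: "0 \<in> Cinf"
  by (rule CinfI) (auto intro: smooth_on_const chart_open)

lemma Cinf_add [simp]: "f \<in> Cinf \<Longrightarrow> g \<in> Cinf \<Longrightarrow> f + g \<in> Cinf"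
  by (rule CinfI) (auto intro: smooth_on_add chart_open Cinf_chart' simp: Cinf_off)

lemma Cinf_mult [simp]: "f \<in> Cinf \<Longrightarrow> g \<in> Cinf \<Longrightarrow> f * g \<in> Cinf"
  by (rule CinfI) (auto intro: smooth_on_mult chart_open Cinf_chart' simp: Cinf_off)

lemma Cinf_minus [simp]: "f \<in> Cinf \<Longrightarrow> - f \<in> Cinf"
  by (rule CinfI) (auto intro: smooth_on_minus chart_open Cinf_chart' simp: Cinf_off)

lemma Cinf_diff [simp]: "f \<in> Cinf \<Longrightarrow> g \<in> Cinf \<Longrightarrow> f - g \<in> Cinf"
  by (rule CinfI) (auto intro: smooth_on_diff chart_open Cinf_chart' simp: Cinf_off)

lemma Cinf_scale [simp]: "f \<in> Cinf \<Longrightarrow> (\<lambda>p. c * f p) \<in> Cinf"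
  by (rule CinfI)
    (simp_all add: Cinf_off smooth_on_bounded_linear[OF bounded_linear_mult_right] chart_open Cinf_chart')

lemma Cinf_sum: "(\<And>i. i \<in> I \<Longrightarrow> f i \<in> Cinf) \<Longrightarrow> (\<Sum>i\<in>I. f i) \<in> Cinf"
  by (induction I rule: infinite_finite_induct) simp_all

text \<open>Smooth functions vanish off the manifold by convention, so constants are cut off there.\<close>
definition konst :: "real \<Rightarrow> 'a \<Rightarrow> real" where
  "konst c = (\<lambda>p. if p \<in> Car then c else 0)"

lemma Cinf_konst [simp]: "konst c \<in> Cinf"
proof (rule CinfI)
  fix U \<phi> assume c: "(U, \<phi>) \<in> A"
  have "smooth_on (\<phi> ` U) (\<lambda>x. c)" for c :: real using chart_open[OF c] by (rule smooth_on_const)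
  then show "smooth_on (\<phi> ` U) (\<lambda>x. konst c (inv_into U \<phi> x))"
    by (rule smooth_on_cong[OF chart_open[OF c], rotated]) (simp add: konst_def chart_inv_Car[OF c])
qed (simp add: konst_def)

text \<open>Smoothness is local: inverting a function that does not vanish at the point localizes.\<close>
lemma Cinf_local:
  assumes off: "\<And>p. p \<notin> Car \<Longrightarrow> F p = 0"
    and loc: "\<And>p. p \<in> Car \<Longrightarrow> \<exists>\<mu>\<in>Cinf. \<mu> p \<noteq> 0 \<and> \<mu> * F \<in> Cinf"
  shows "F \<in> Cinf"
proof (rule CinfI[OF off])
  fix U \<phi> assume c: "(U, \<phi>) \<in> A"
  let ?i = "inv_into U \<phi>"
  show "smooth_on (\<phi> ` U) (\<lambda>x. F (?i x))"
  proof (rule smooth_on_local)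
    fix x assume x: "x \<in> \<phi> ` U"
    then have "?i x \<in> Car" by (rule chart_inv_Car[OF c])
    then obtain \<mu> where \<mu>: "\<mu> \<in> Cinf" "\<mu> (?i x) \<noteq> 0" "\<mu> * F \<in> Cinf" using loc by blast
    define N where "N = \<phi> ` U \<inter> (\<lambda>x. \<mu> (?i x)) -` (- {0})"
    have N: "open N" "x \<in> N"
      unfolding N_def using x \<mu>(2)
      by (auto intro!: continuous_open_preimage smooth_on_continuous Cinf_chart' \<mu> c chart_open[OF c])
    have s: "smooth_on N (\<lambda>x. \<mu> (?i x))" "smooth_on N (\<lambda>x. (\<mu> * F) (?i x))"
      using smooth_on_subset[OF Cinf_chart'[OF \<mu>(1) c], of N]
        smooth_on_subset[OF Cinf_chart'[OF \<mu>(3) c], of N] by (auto simp: N_def)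
    have "smooth_on N (\<lambda>x. inverse (\<mu> (?i x)) * (\<mu> * F) (?i x))"
      by (intro smooth_on_mult smooth_on_inverse s N) (auto simp: N_def)
    then have "smooth_on N (\<lambda>x. F (?i x))"
      by (rule smooth_on_cong[OF N(1), rotated]) (auto simp: N_def)
    then show "\<exists>N. open N \<and> x \<in> N \<and> smooth_on N (\<lambda>x. F (?i x))" using N by blast
  qed
qed

lemma topspace_atlas: "topspace (atlas_topology A) = Car"
proof -
  have "openin (atlas_topology A) Car"
    using openin_atlas_topology[OF atlas, of Car] chart_open chart_sub
    by (auto simp: Int_absorb1)
  then show ?thesis
    using openin_subset openin_atlas_topology[OF atlas] openin_topspace by (metis subset_antisym)
qed

text \<open>Charts have continuous inverses, and compact subsets of a Hausdorff space are closed.\<close>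
lemma closedin_chart_compact:
  assumes c: "(U, \<phi>) \<in> A" and K: "compact K" "K \<subseteq> \<phi> ` U"
  shows "closedin (atlas_topology A) (inv_into U \<phi> ` K)"
proof (rule compactin_imp_closedin[OF hausdorff], rule image_compactin)
  show "compactin (top_of_set (\<phi> ` U)) K"
    using K by (simp add: compactin_subtopology compactin_euclidean_iff)
  show "continuous_map (top_of_set (\<phi> ` U)) (atlas_topology A) (inv_into U \<phi>)"
    unfolding continuous_map_def
  proof (intro conjI allI impI)
    show "inv_into U \<phi> \<in> topspace (top_of_set (\<phi> ` U)) \<rightarrow> topspace (atlas_topology A)"
      using chart_inv_Car[OF c] by (simp add: topspace_atlas)
    fix W assume "openin (atlas_topology A) W"
    then have "open (\<phi> ` (W \<inter> U))" using c openin_atlas_topology[OF atlas] by auto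
    moreover have "{x \<in> topspace (top_of_set (\<phi> ` U)). inv_into U \<phi> x \<in> W} = \<phi> ` (W \<inter> U)"
      using chart_inv[OF c] by force
    ultimately show "openin (top_of_set (\<phi> ` U)) {x \<in> topspace (top_of_set (\<phi> ` U)). inv_into U \<phi> x \<in> W}"
      using chart_open[OF c] by (metis image_mono inf.cobounded2 openin_open_eq)
  qed
qed

text \<open>A compactly supported smooth function of the coordinates extends by zero; this is where the
  Hausdorff property enters, through the closedness of the support.\<close>
lemma Cinf_cutoff:
  assumes c: "(U, \<phi>) \<in> A" and K: "compact K" "K \<subseteq> Q" "Q \<subseteq> \<phi> ` U" and Q: "open Q"
    and h: "smooth_on Q h" "\<And>x. x \<notin> K \<Longrightarrow> h x = 0"
  shows "(\<lambda>q. if q \<in> U then h (\<phi> q) else 0) \<in> Cinf" (is "?F \<in> _")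
proof (rule CinfI)
  show "?F p = 0" if "p \<notin> Car" for p using that chart_sub[OF c] by auto
next
  fix V \<psi> assume d: "(V, \<psi>) \<in> A"
  let ?i = "inv_into V \<psi>"
  have oK: "open (- K)" using K compact_imp_closed by blast
  have hU: "smooth_on (\<phi> ` U) h"
  proof (rule smooth_on_local)
    fix x
    have "smooth_on (- K) h"
      by (rule smooth_on_cong[OF oK _ smooth_on_const[OF oK, of 0]]) (use h in auto)
    then show "\<exists>N. open N \<and> x \<in> N \<and> smooth_on N h" using K Q oK h by (cases "x \<in> K") blast+
  qed
  have cl: "closedin (atlas_topology A) (inv_into U \<phi> ` K)"
    using closedin_chart_compact[OF c] K by blast
  then have op: "openin (atlas_topology A) (Car - inv_into U \<phi> ` K)"
    by (metis closedin_def topspace_atlas)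
  show "smooth_on (\<psi> ` V) (\<lambda>x. ?F (?i x))"
  proof (rule smooth_on_local)
    fix y assume "y \<in> \<psi> ` V"
    then obtain q where q: "q \<in> V" "y = \<psi> q" by blast
    show "\<exists>N. open N \<and> y \<in> N \<and> smooth_on N (\<lambda>x. ?F (?i x))"
    proof (cases "q \<in> U")
      case True
      let ?N = "\<psi> ` (V \<inter> U)"
      have N: "open ?N" using chart_inter_open[OF d c] .
      have "smooth_on ?N (\<lambda>x. h ((\<phi> \<circ> ?i) x))"
        by (rule smooth_on_compose[OF N chart_open[OF c] chart_transition[OF d c] hU])
          (auto simp: chart_inv[OF d])
      then have "smooth_on ?N (\<lambda>x. ?F (?i x))"
        by (rule smooth_on_cong[OF N, rotated]) (auto simp: chart_inv[OF d])
      then show ?thesis using N q True by blast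
    next
      case False
      let ?N = "\<psi> ` ((Car - inv_into U \<phi> ` K) \<inter> V)"
      have N: "open ?N" using op d openin_atlas_topology[OF atlas] by blast
      have "inv_into U \<phi> x \<in> U" if "x \<in> K" for x using that K by (intro chart_inv_mem) auto
      then have "q \<notin> inv_into U \<phi> ` K" using False by auto
      then have y: "y \<in> ?N" using q chart_sub[OF d] by blast
      have "?F (?i x) = 0" if "x \<in> ?N" for x
      proof -
        from that obtain q' where q': "x = \<psi> q'" "q' \<in> V" "q' \<notin> inv_into U \<phi> ` K" by blast
        have "\<phi> q' \<notin> K" if "q' \<in> U" using that q'(3) chart_inv[OF c that] by (metis image_eqI)
        then show ?thesis using h(2) q' chart_inv[OF d] by auto
      qed
      then have "smooth_on ?N (\<lambda>x. ?F (?i x))"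
        by (intro smooth_on_cong[OF N _ smooth_on_const[OF N, of 0]]) auto
      then show ?thesis using N y by blast
    qed
  qed
qed

subsection \<open>Tangent vectors\<close>

lemma tan_off: "v \<in> Tan p \<Longrightarrow> f \<notin> Cinf \<Longrightarrow> v f = 0"
  and tan_add: "v \<in> Tan p \<Longrightarrow> f \<in> Cinf \<Longrightarrow> g \<in> Cinf \<Longrightarrow> v (f + g) = v f + v g"
  and tan_mult: "v \<in> Tan p \<Longrightarrow> f \<in> Cinf \<Longrightarrow> g \<in> Cinf \<Longrightarrow> v (f * g) = f p * v g + g p * v f"
  and tan_scale: "v \<in> Tan p \<Longrightarrow> f \<in> Cinf \<Longrightarrow> v (\<lambda>x. c * f x) = c * v f"
  by (auto simp: tangent_space_def)

lemma tan_zero: "v \<in> Tan p \<Longrightarrow> v 0 = 0"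
  using tan_add[of v p 0 0] by simp

lemma tan_minus: "v \<in> Tan p \<Longrightarrow> f \<in> Cinf \<Longrightarrow> v (- f) = - v f"
  using tan_add[of v p f "- f"] tan_zero[of v p] by simp

lemma tan_diff: "v \<in> Tan p \<Longrightarrow> f \<in> Cinf \<Longrightarrow> g \<in> Cinf \<Longrightarrow> v (f - g) = v f - v g"
  using tan_add[of v p f "- g"] tan_minus by simp

lemma tan_sum: "v \<in> Tan p \<Longrightarrow> (\<And>i. i \<in> I \<Longrightarrow> f i \<in> Cinf) \<Longrightarrow> v (\<Sum>i\<in>I. f i) = (\<Sum>i\<in>I. v (f i))"
  by (induction I rule: infinite_finite_induct) (simp_all add: tan_zero tan_add Cinf_sum)

lemma tan_konst: "v \<in> Tan p \<Longrightarrow> p \<in> Car \<Longrightarrow> v (konst c) = 0"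
proof -
  assume v: "v \<in> Tan p" and p: "p \<in> Car"
  have "konst 1 * konst 1 = konst 1" "konst 1 p = 1" using p by (auto simp: konst_def)
  then have "v (konst 1) = 0" using tan_mult[OF v Cinf_konst Cinf_konst, of 1 1] by simp
  moreover have "konst c = (\<lambda>x. c * konst 1 x)" by (auto simp: konst_def)
  ultimately show ?thesis using tan_scale[OF v, of "konst 1" c] by simp
qed

lemma tan_eqI:
  assumes "v \<in> Tan p" "w \<in> Tan p" "\<And>f. f \<in> Cinf \<Longrightarrow> v f = w f"
  shows "v = w"
proof
  fix f show "v f = w f" using assms(3) tan_off[OF assms(1)] tan_off[OF assms(2)] by (cases "f \<in> Cinf") simp_all
qed

lemma Tan_zero: "0 \<in> Tan p"
  and Tan_add: "v \<in> Tan p \<Longrightarrow> w \<in> Tan p \<Longrightarrow> v + w \<in> Tan p"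
  and Tan_scale: "v \<in> Tan p \<Longrightarrow> (\<lambda>f. c * v f) \<in> Tan p"
  by (auto simp: tangent_space_def algebra_simps)

lemma Tan_lincomb: "(\<And>i. i \<in> I \<Longrightarrow> v i \<in> Tan p) \<Longrightarrow> (\<lambda>f. \<Sum>i\<in>I. c i * v i f) \<in> Tan p"
proof (induction I rule: infinite_finite_induct)
  case (insert x F)
  have "(\<lambda>f. \<Sum>i\<in>insert x F. c i * v i f) = (\<lambda>f. c x * v x f) + (\<lambda>f. \<Sum>i\<in>F. c i * v i f)"
    using insert.hyps by (auto simp: fun_eq_iff)
  then show ?case using Tan_add[OF Tan_scale[of "v x"] insert.IH] insert.prems by simp
qed (use Tan_zero in \<open>auto simp: zero_fun_def\<close>)

lemma coord_has_derivative:
  assumes "(U, \<phi>) \<in> A" "p \<in> U" "f \<in> Cinf"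
  shows "((\<lambda>x. f (inv_into U \<phi> x)) has_derivative (\<lambda>b. coord_vec A (U, \<phi>) p b f)) (at (\<phi> p))"
  using smooth_on_has_derivative[OF Cinf_chart'[OF assms(3,1)], of "\<phi> p"] assms
  by (simp add: coord_vec_def comp_def)

lemma coord_vec_eqI:
  assumes "(U, \<phi>) \<in> A" "p \<in> U" "f \<in> Cinf"
    and "((\<lambda>x. f (inv_into U \<phi> x)) has_derivative L) (at (\<phi> p))"
  shows "coord_vec A (U, \<phi>) p b f = L b"
  using has_derivative_unique[OF coord_has_derivative[OF assms(1-3)] assms(4)] by metis

lemma coord_vec_Tan:
  assumes c: "(U, \<phi>) \<in> A" and p: "p \<in> U"
  shows "coord_vec A (U, \<phi>) p b \<in> Tan p"
proof -
  note d = coord_has_derivative[OF c p] and e = coord_vec_eqI[OF c p]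
  have "coord_vec A (U, \<phi>) p b (f + g) = coord_vec A (U, \<phi>) p b f + coord_vec A (U, \<phi>) p b g"
    if "f \<in> Cinf" "g \<in> Cinf" for f g
    using has_derivative_add[OF d[OF that(1)] d[OF that(2)]] by (intro e[OF Cinf_add[OF that]]) simp
  moreover have "coord_vec A (U, \<phi>) p b (f * g) = f p * coord_vec A (U, \<phi>) p b g + g p * coord_vec A (U, \<phi>) p b f"
    if "f \<in> Cinf" "g \<in> Cinf" for f g
    using has_derivative_mult[OF d[OF that(1)] d[OF that(2)]]
    by (intro e[OF Cinf_mult[OF that]]) (simp add: chart_inv[OF c p] mult.commute)
  moreover have "coord_vec A (U, \<phi>) p b (\<lambda>x. k * f x) = k * coord_vec A (U, \<phi>) p b f"
    if "f \<in> Cinf" for f k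
    using has_derivative_mult_right[OF d[OF that]] by (intro e[OF Cinf_scale[OF that]]) simp
  ultimately show ?thesis by (auto simp: tangent_space_def coord_vec_def)
qed

lemma coord_vec_coordinate:
  assumes c: "(U, \<phi>) \<in> A" and p: "p \<in> U" and Q: "open Q" "\<phi> p \<in> Q"
    and y: "y \<in> Cinf" "\<And>q. q \<in> U \<Longrightarrow> \<phi> q \<in> Q \<Longrightarrow> y q = \<phi> q \<bullet> b'"
  shows "coord_vec A (U, \<phi>) p b y = b \<bullet> b'"
proof -
  have o: "open (Q \<inter> \<phi> ` U)" "\<phi> p \<in> Q \<inter> \<phi> ` U" using Q chart_open[OF c] p by auto
  have "((\<lambda>x. x \<bullet> b') has_derivative (\<lambda>v. v \<bullet> b')) (at (\<phi> p))"
    by (auto intro!: derivative_eq_intros)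
  then have "((\<lambda>x. y (inv_into U \<phi> x)) has_derivative (\<lambda>v. v \<bullet> b')) (at (\<phi> p))"
  proof (rule has_derivative_transform_within_open[OF _ o])
    fix x assume "x \<in> Q \<inter> \<phi> ` U"
    then obtain q where "q \<in> U" "x = \<phi> q" "x \<in> Q" by blast
    then show "x \<bullet> b' = y (inv_into U \<phi> x)" using y(2) chart_inv[OF c] by simp
  qed
  then show ?thesis by (rule coord_vec_eqI[OF c p y(1)])
qed

text \<open>A derivation is determined by its values on coordinate functions: by Hadamard's lemma, a smooth
  function is, up to a cutoff, a constant plus products of functions vanishing at the point.\<close>
lemma tangent_expand:
  assumes c: "(U, \<phi>) \<in> A" and p: "p \<in> U" and v: "v \<in> Tan p"
    and Q: "open Q" "\<phi> p \<in> Q"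
    and y: "\<And>b. b \<in> Basis \<Longrightarrow> y b \<in> Cinf"
      "\<And>b q. b \<in> Basis \<Longrightarrow> q \<in> U \<Longrightarrow> \<phi> q \<in> Q \<Longrightarrow> y b q = \<phi> q \<bullet> b"
    and f: "f \<in> Cinf"
  shows "v f = (\<Sum>b\<in>Basis. v (y b) * coord_vec A (U, \<phi>) p b f)"
proof -
  let ?a = "\<phi> p" and ?i = "inv_into U \<phi>"
  have "open (Q \<inter> \<phi> ` U)" "?a \<in> Q \<inter> \<phi> ` U" using Q chart_open[OF c] p by auto
  then obtain r where r: "r > 0" "ball ?a r \<subseteq> Q \<inter> \<phi> ` U" using open_contains_ball by blast
  obtain h :: "'e \<Rightarrow> real" where h: "smooth_on UNIV h"
      "\<And>x. dist x ?a \<le> r/3 \<Longrightarrow> h x = 1" "\<And>x. dist x ?a \<ge> r/2 \<Longrightarrow> h x = 0"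
    using plateau_exists[of "r/3" "r/2" ?a] r by auto
  have "smooth_on (ball ?a r) (\<lambda>x. f (?i x))"
    using smooth_on_subset[OF Cinf_chart'[OF f c]] r by blast
  then obtain g where g: "\<And>b. smooth_on (ball ?a r) (g b)"
    "\<And>x. x \<in> ball ?a r \<Longrightarrow> f (?i x) = f (?i ?a) + (\<Sum>b\<in>Basis. ((x - ?a) \<bullet> b) * g b x)"
    "\<And>b. g b ?a = frechet_derivative (\<lambda>x. f (?i x)) (at ?a) b"
    using hadamard by blast
  define \<mu> where "\<mu> = (\<lambda>q. if q \<in> U then h (\<phi> q) else 0)"
  define G where "G b = (\<lambda>q. if q \<in> U then h (\<phi> q) * g b (\<phi> q) else 0)" for b
  have sub: "cball ?a (r/2) \<subseteq> ball ?a r" "ball ?a r \<subseteq> \<phi> ` U" using r by auto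
  have h0: "h x = 0" if "x \<notin> cball ?a (r/2)" for x using that h(3)[of x] by (simp add: dist_commute)
  have hs: "smooth_on (ball ?a r) h" using smooth_on_subset[OF h(1)] by blast
  have \<mu>: "\<mu> \<in> Cinf" unfolding \<mu>_def
    by (rule Cinf_cutoff[OF c compact_cball sub open_ball hs h0])
  have G: "G b \<in> Cinf" for b unfolding G_def
    by (rule Cinf_cutoff[OF c compact_cball sub open_ball, where h="\<lambda>x. h x * g b x"])
      (auto simp: smooth_on_mult hs g h0)
  have \<mu>p: "\<mu> p = 1" and Gp: "G b p = coord_vec A (U, \<phi>) p b f" for b
    using p h(2)[of ?a] r g(3) f by (simp_all add: \<mu>_def G_def coord_vec_def comp_def)
  let ?z = "\<lambda>b. \<mu> * y b - (\<lambda>q. (?a \<bullet> b) * \<mu> q)"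
  have z: "?z b \<in> Cinf" if "b \<in> Basis" for b using \<mu> y(1)[OF that] by simp
  have zp: "?z b p = 0" "v (?z b) = v (y b)" if "b \<in> Basis" for b
    using \<mu>p y(2)[OF that p Q(2)] \<mu> y(1)[OF that]
    by (simp_all add: tan_diff[OF v] tan_mult[OF v] tan_scale[OF v])
  \<comment> \<open>Hadamard's formula, multiplied by two cutoffs to make both factors of each summand global\<close>
  have eq: "(\<mu> * \<mu>) * f = (\<lambda>q. f p * (\<mu> * \<mu>) q) + (\<Sum>b\<in>Basis. ?z b * G b)"
  proof
    fix q
    show "((\<mu> * \<mu>) * f) q = ((\<lambda>q. f p * (\<mu> * \<mu>) q) + (\<Sum>b\<in>Basis. ?z b * G b)) q"
    proof (cases "q \<in> U \<and> \<phi> q \<in> ball ?a r")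
      case True
      then have "f q = f p + (\<Sum>b\<in>Basis. ((\<phi> q - ?a) \<bullet> b) * g b (\<phi> q))"
        using g(2)[of "\<phi> q"] chart_inv[OF c] p by simp
      moreover have "y b q = \<phi> q \<bullet> b" if "b \<in> Basis" for b using True r y(2)[OF that] by auto
      moreover have "(\<Sum>b\<in>Basis. ?z b q * G b q) =
          h (\<phi> q) * h (\<phi> q) * (\<Sum>b\<in>Basis. ((\<phi> q - ?a) \<bullet> b) * g b (\<phi> q))"
        unfolding sum_distrib_left using True calculation(2)
        by (intro sum.cong[OF refl]) (simp add: G_def \<mu>_def algebra_simps inner_diff_left)
      ultimately show ?thesis using True
        by (simp only: sum_fun_apply plus_fun_apply times_fun_apply \<mu>_def if_True) (simp add: algebra_simps)
    next
      case False
      then have "q \<in> U \<Longrightarrow> h (\<phi> q) = 0" using sub h0 by blast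
      then have "\<mu> q = 0" "\<And>b. G b q = 0" by (simp_all add: \<mu>_def G_def)
      then show ?thesis by (simp add: sum_fun_apply)
    qed
  qed
  have "v ((\<mu> * \<mu>) * f) = v f + f p * v (\<mu> * \<mu>)"
    using \<mu> f \<mu>p by (simp add: tan_mult[OF v])
  moreover have "v ((\<lambda>q. f p * (\<mu> * \<mu>) q) + (\<Sum>b\<in>Basis. ?z b * G b)) =
      f p * v (\<mu> * \<mu>) + (\<Sum>b\<in>Basis. v (y b) * coord_vec A (U, \<phi>) p b f)"
  proof -
    have "v (\<Sum>b\<in>Basis. ?z b * G b) = (\<Sum>b\<in>Basis. v (?z b * G b))"
      by (rule tan_sum[OF v]) (use z G in simp)
    also have "\<dots> = (\<Sum>b\<in>Basis. v (y b) * coord_vec A (U, \<phi>) p b f)"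
      by (rule sum.cong[OF refl]) (simp only: tan_mult[OF v z G] zp Gp, simp add: mult.commute)
    finally have s: "v (\<Sum>b\<in>Basis. ?z b * G b) = (\<Sum>b\<in>Basis. v (y b) * coord_vec A (U, \<phi>) p b f)" .
    have m: "(\<Sum>b\<in>Basis. ?z b * G b) \<in> Cinf" by (rule Cinf_sum) (use z G in simp)
    have m2: "(\<mu> * \<mu>) \<in> Cinf" using \<mu> by simp
    show ?thesis by (simp only: tan_add[OF v Cinf_scale[OF m2] m] s tan_scale[OF v m2])
  qed
  ultimately show ?thesis by (simp add: eq)
qed

text \<open>Global functions and vector fields that are dual bases of the cotangent and tangent spaces
  where \<open>\<mu>\<close> does not vanish.\<close>
definition frame :: "('a \<Rightarrow> real) \<Rightarrow> ('e \<Rightarrow> 'a \<Rightarrow> real) \<Rightarrow> ('e \<Rightarrow> 'a vfield) \<Rightarrow> bool" where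
  "frame \<mu> y G \<longleftrightarrow> \<mu> \<in> Cinf \<and> (\<forall>b\<in>Basis. y b \<in> Cinf \<and> G b \<in> Vec) \<and>
     (\<forall>q. \<mu> q \<noteq> 0 \<longrightarrow>
       (\<forall>b\<in>Basis. \<forall>b'\<in>Basis. G b q (y b') = (if b = b' then 1 else 0)) \<and>
       (\<forall>v\<in>Tan q. v = (\<lambda>f. \<Sum>b\<in>Basis. v (y b) * G b q f)))"

lemma VecI:
  assumes "\<And>p. p \<in> Car \<Longrightarrow> V p \<in> Tan p" "\<And>p. p \<notin> Car \<Longrightarrow> V p = 0"
    "\<And>f. f \<in> Cinf \<Longrightarrow> vf_app V f \<in> Cinf"
  shows "V \<in> Vec"
  using assms by (auto simp: vfields_def)

text \<open>Two nested plateaus: multiplication by \<open>h1\<close> makes the coordinates and the coordinate fields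
  global, and \<open>\<mu>\<close> comes from \<open>h0\<close>, whose support lies where \<open>h1\<close> is \<open>1\<close>.\<close>
lemma coordinate_frame:
  assumes c: "(U, \<phi>) \<in> A" and p: "p \<in> U" and Q: "open Q" "\<phi> p \<in> Q"
  obtains \<mu> y G where "frame \<mu> y G" "\<mu> p = 1"
    "\<And>q. \<mu> q \<noteq> 0 \<Longrightarrow> q \<in> U \<and> \<phi> q \<in> Q"
    "\<And>q b. \<mu> q \<noteq> 0 \<Longrightarrow> b \<in> Basis \<Longrightarrow> y b q = \<phi> q \<bullet> b"
    "\<And>q b. \<mu> q \<noteq> 0 \<Longrightarrow> b \<in> Basis \<Longrightarrow> G b q = coord_vec A (U, \<phi>) q b"
proof -
  let ?a = "\<phi> p" and ?i = "inv_into U \<phi>"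
  have "open (Q \<inter> \<phi> ` U)" "?a \<in> Q \<inter> \<phi> ` U" using Q chart_open[OF c] p by auto
  then obtain r where r: "r > 0" "ball ?a r \<subseteq> Q \<inter> \<phi> ` U" using open_contains_ball by blast
  obtain h1 :: "'e \<Rightarrow> real" where h1: "smooth_on UNIV h1"
      "\<And>x. dist x ?a \<le> r/3 \<Longrightarrow> h1 x = 1" "\<And>x. dist x ?a \<ge> r/2 \<Longrightarrow> h1 x = 0"
    using plateau_exists[of "r/3" "r/2" ?a] r by auto
  obtain h0 :: "'e \<Rightarrow> real" where h0: "smooth_on UNIV h0"
      "\<And>x. dist x ?a \<le> r/9 \<Longrightarrow> h0 x = 1" "\<And>x. dist x ?a \<ge> r/6 \<Longrightarrow> h0 x = 0"
    using plateau_exists[of "r/9" "r/6" ?a] r by auto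
  have sub: "cball ?a (r/2) \<subseteq> ball ?a r" "ball ?a r \<subseteq> \<phi> ` U" using r by auto
  have z1: "h1 x = 0" if "x \<notin> cball ?a (r/2)" for x using that h1(3)[of x] by (simp add: dist_commute)
  have z0: "h0 x = 0" if "x \<notin> cball ?a (r/2)" for x
    using that h0(3)[of x] r by (simp add: dist_commute)
  have s1: "smooth_on (ball ?a r) h1" using smooth_on_subset[OF h1(1)] by blast
  have s0: "smooth_on (ball ?a r) h0" using smooth_on_subset[OF h0(1)] by blast
  define \<mu> where "\<mu> = (\<lambda>q. if q \<in> U then h0 (\<phi> q) else 0)"
  define y where "y b = (\<lambda>q. if q \<in> U then h1 (\<phi> q) * (\<phi> q \<bullet> b) else 0)" for b
  define G where "G b = (\<lambda>q. if q \<in> U then (\<lambda>f. h1 (\<phi> q) * coord_vec A (U, \<phi>) q b f) else 0)" for b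
  have \<mu>: "\<mu> \<in> Cinf" unfolding \<mu>_def
    by (rule Cinf_cutoff[OF c compact_cball sub open_ball s0 z0])
  have y: "y b \<in> Cinf" for b unfolding y_def
    by (rule Cinf_cutoff[OF c compact_cball sub open_ball, where h="\<lambda>x. h1 x * (x \<bullet> b)"])
      (auto simp: smooth_on_mult smooth_on_inner smooth_on_ident smooth_on_const s1 z1)
  have G: "G b \<in> Vec" for b
  proof (rule VecI)
    show "G b p \<in> Tan p" if "p \<in> Car" for p
      using Tan_zero Tan_scale[OF coord_vec_Tan[OF c]] by (simp add: G_def)
    show "G b p = 0" if "p \<notin> Car" for p using that chart_sub[OF c] by (auto simp: G_def)
    fix f assume f: "f \<in> Cinf"
    have "smooth_on (ball ?a r) (\<lambda>x. frechet_derivative (\<lambda>x. f (?i x)) (at x) b)"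
      using smooth_on_subset[OF smooth_on_derivative[OF Cinf_chart'[OF f c]]] sub by blast
    then have "(\<lambda>q. if q \<in> U then h1 (\<phi> q) * frechet_derivative (\<lambda>x. f (?i x)) (at (\<phi> q)) b else 0) \<in> Cinf"
      by (intro Cinf_cutoff[OF c compact_cball sub open_ball,
          where h="\<lambda>x. h1 x * frechet_derivative (\<lambda>x. f (?i x)) (at x) b"] smooth_on_mult s1)
        (auto simp: z1)
    also have "(\<lambda>q. if q \<in> U then h1 (\<phi> q) * frechet_derivative (\<lambda>x. f (?i x)) (at (\<phi> q)) b else 0) = vf_app (G b) f"
      using f by (auto simp: vf_app_def G_def coord_vec_def comp_def)
    finally show "vf_app (G b) f \<in> Cinf" .
  qed
  have in0: "q \<in> U" "dist (\<phi> q) ?a < r/6" if "\<mu> q \<noteq> 0" for q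
    using that h0(3)[of "\<phi> q"] by (auto simp: \<mu>_def split: if_splits) (meson not_le)
  have yq: "y b q = \<phi> q \<bullet> b" if "q \<in> U" "\<phi> q \<in> ball ?a (r/3)" for b q
    using that h1(2)[of "\<phi> q"] by (simp add: y_def dist_commute)
  have nr: "\<phi> q \<in> ball ?a (r/3)" if "\<mu> q \<noteq> 0" for q using in0(2)[OF that] r by (simp add: dist_commute)
  have Gq: "G b q = coord_vec A (U, \<phi>) q b" if "\<mu> q \<noteq> 0" for b q
    using h1(2)[of "\<phi> q"] in0[OF that] r by (simp add: G_def)
  have Gy: "G b q (y b') = (if b = b' then 1 else 0)" if q: "\<mu> q \<noteq> 0" and b: "b \<in> Basis" "b' \<in> Basis" for q b b'
  proof -
    have "coord_vec A (U, \<phi>) q b (y b') = b \<bullet> b'"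
      by (rule coord_vec_coordinate[OF c in0(1)[OF q] open_ball nr[OF q] y yq])
    then show ?thesis using Gq[OF q] inner_Basis[OF b] by simp
  qed
  have ex: "v = (\<lambda>f. \<Sum>b\<in>Basis. v (y b) * G b q f)" if q: "\<mu> q \<noteq> 0" and v: "v \<in> Tan q" for q v
  proof (rule tan_eqI[OF v])
    show "(\<lambda>f. \<Sum>b\<in>Basis. v (y b) * G b q f) \<in> Tan q"
      using coord_vec_Tan[OF c in0(1)[OF q]] by (intro Tan_lincomb) (simp add: Gq[OF q])
    show "v f = (\<Sum>b\<in>Basis. v (y b) * G b q f)" if "f \<in> Cinf" for f
      unfolding Gq[OF q]
      by (rule tangent_expand[OF c in0(1)[OF q] v open_ball nr[OF q] y yq that])
  qed
  show ?thesis
  proof (rule that[of \<mu> y G])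
    show "frame \<mu> y G" unfolding frame_def using \<mu> y G Gy ex by simp
    show "\<mu> p = 1" using p h0(2)[of ?a] r by (simp add: \<mu>_def)
    show "q \<in> U \<and> \<phi> q \<in> Q" if "\<mu> q \<noteq> 0" for q
    proof -
      have "\<phi> q \<in> ball ?a r" using nr[OF that] r by simp
      then show ?thesis using in0[OF that] r by blast
    qed
    show "y b q = \<phi> q \<bullet> b" if "\<mu> q \<noteq> 0" for q b by (rule yq[OF in0(1)[OF that] nr[OF that]])
    show "G b q = coord_vec A (U, \<phi>) q b" if "\<mu> q \<noteq> 0" for q b by (rule Gq[OF that])
  qed
qed

lemma frame_exists:
  assumes "p \<in> Car"
  obtains \<mu> y G where "frame \<mu> y G" "\<mu> p = 1"
proof -
  obtain U \<phi> where c: "(U, \<phi>) \<in> A" "p \<in> U" using Car_chart[OF assms] by blast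
  show ?thesis by (rule coordinate_frame[OF c open_UNIV UNIV_I]) (rule that)
qed

lemma frame_Cinf: "frame \<mu> y G \<Longrightarrow> \<mu> \<in> Cinf" "frame \<mu> y G \<Longrightarrow> b \<in> Basis \<Longrightarrow> y b \<in> Cinf"
    "frame \<mu> y G \<Longrightarrow> b \<in> Basis \<Longrightarrow> G b \<in> Vec"
  and frame_expand: "frame \<mu> y G \<Longrightarrow> \<mu> q \<noteq> 0 \<Longrightarrow> v \<in> Tan q \<Longrightarrow> v f = (\<Sum>b\<in>Basis. v (y b) * G b q f)"
  and frame_dual: "frame \<mu> y G \<Longrightarrow> \<mu> q \<noteq> 0 \<Longrightarrow> b \<in> Basis \<Longrightarrow> b' \<in> Basis \<Longrightarrow>
    G b q (y b') = (if b = b' then 1 else 0)"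
  unfolding frame_def by metis+

subsection \<open>Vector fields\<close>

lemma Vec_Tan: "V \<in> Vec \<Longrightarrow> p \<in> Car \<Longrightarrow> V p \<in> Tan p"
  and Vec_off: "V \<in> Vec \<Longrightarrow> p \<notin> Car \<Longrightarrow> V p = 0"
  and Vec_app [simp]: "V \<in> Vec \<Longrightarrow> f \<in> Cinf \<Longrightarrow> vf_app V f \<in> Cinf"
  by (auto simp: vfields_def)

lemma vf_app_eqI:
  assumes "V \<in> Vec" "\<And>p. p \<in> Car \<Longrightarrow> V p \<in> Tan p \<Longrightarrow> V p f = g p" "\<And>p. p \<notin> Car \<Longrightarrow> g p = 0"
  shows "vf_app V f = g"
proof
  fix p
  show "vf_app V f p = g p"
    using assms(2)[OF _ Vec_Tan[OF assms(1)], of p] assms(3)[of p] Vec_off[OF assms(1), of p]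
    by (cases "p \<in> Car") (simp_all add: vf_app_def)
qed

lemma
  assumes V: "V \<in> Vec"
  shows vf_app_add: "f \<in> Cinf \<Longrightarrow> g \<in> Cinf \<Longrightarrow> vf_app V (f + g) = vf_app V f + vf_app V g"
    and vf_app_diff: "f \<in> Cinf \<Longrightarrow> g \<in> Cinf \<Longrightarrow> vf_app V (f - g) = vf_app V f - vf_app V g"
    and vf_app_minus: "f \<in> Cinf \<Longrightarrow> vf_app V (- f) = - vf_app V f"
    and vf_app_mult: "f \<in> Cinf \<Longrightarrow> g \<in> Cinf \<Longrightarrow> vf_app V (f * g) = f * vf_app V g + g * vf_app V f"
    and vf_app_scale: "f \<in> Cinf \<Longrightarrow> vf_app V (\<lambda>x. c * f x) = (\<lambda>x. c * vf_app V f x)"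
    and vf_app_zero: "vf_app V 0 = 0"
    and vf_app_konst: "vf_app V (konst c) = 0"
  by (rule vf_app_eqI[OF V]; simp add: tan_add[where v="V p" for p] tan_diff[where v="V p" for p]
      tan_minus[where v="V p" for p] tan_mult[where v="V p" for p] tan_scale[where v="V p" for p]
      tan_zero[where v="V p" for p] tan_konst[where v="V p" for p] vf_app_def Vec_off[OF V])+

lemmas vf_app_right = vf_app_add vf_app_diff vf_app_minus vf_app_mult vf_app_zero

lemma vf_app_nonsmooth: "V \<in> Vec \<Longrightarrow> f \<notin> Cinf \<Longrightarrow> vf_app V f = 0"
  by (rule vf_app_eqI) (simp_all add: tan_off)

lemma vf_eqI:
  assumes "V \<in> Vec" "W \<in> Vec" "\<And>f. f \<in> Cinf \<Longrightarrow> vf_app V f = vf_app W f"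
  shows "V = W"
proof (intro ext)
  fix p f
  show "V p f = W p f"
    using assms(3)[of f] vf_app_nonsmooth[OF assms(1), of f] vf_app_nonsmooth[OF assms(2), of f]
    by (cases "f \<in> Cinf") (simp_all add: vf_app_def fun_eq_iff)
qed

lemma Vec_zero [simp]: "0 \<in> Vec"
  by (rule VecI) (simp_all add: Tan_zero vf_app_left)

lemma Vec_add [simp]: "V \<in> Vec \<Longrightarrow> W \<in> Vec \<Longrightarrow> V + W \<in> Vec"
  by (rule VecI) (simp_all add: Tan_add Vec_Tan vf_app_left, simp add: Vec_off[of V] Vec_off[of W] fun_eq_iff)

lemma Vec_mult [simp]: "h \<in> Cinf \<Longrightarrow> V \<in> Vec \<Longrightarrow> vf_mult h V \<in> Vec"
  by (rule VecI) (simp_all add: vf_app_left, simp_all add: vf_mult_def Tan_scale Vec_Tan Vec_off[of V] fun_eq_iff)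

lemma vf_scale_eq: "V \<in> Vec \<Longrightarrow> vf_scale c V = vf_mult (konst c) V"
  by (simp add: vf_scale_def vf_mult_def konst_def fun_eq_iff Vec_off[of V])

lemma Vec_scale [simp]: "V \<in> Vec \<Longrightarrow> vf_scale c V \<in> Vec"
  by (simp add: vf_scale_eq)

lemma Vec_minus [simp]: "V \<in> Vec \<Longrightarrow> - V \<in> Vec"
proof -
  assume "V \<in> Vec"
  moreover have "- V = vf_scale (- 1) V" by (simp add: vf_scale_def fun_eq_iff)
  ultimately show ?thesis using Vec_scale by metis
qed

lemma Vec_diff [simp]: "V \<in> Vec \<Longrightarrow> W \<in> Vec \<Longrightarrow> V - W \<in> Vec"
  using Vec_add[OF _ Vec_minus, of V W] by simp

lemma Vec_sum: "(\<And>i. i \<in> I \<Longrightarrow> V i \<in> Vec) \<Longrightarrow> (\<Sum>i\<in>I. V i) \<in> Vec"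
  by (induction I rule: infinite_finite_induct) simp_all

lemma Vec_bracket [simp]:
  assumes V: "V \<in> Vec" and W: "W \<in> Vec"
  shows "vf_bracket V W \<in> Vec"
proof (rule VecI)
  fix p assume p: "p \<in> Car"
  have *: "vf_bracket V W p f = vf_app (vf_bracket V W) f p" for f by (simp add: vf_app_def)
  have "vf_bracket V W p f = 0" if "f \<notin> Cinf" for f
    using that vf_app_nonsmooth[OF V] vf_app_nonsmooth[OF W] by (simp add: * vf_app_left vf_app_zero V W)
  moreover have "vf_app (vf_bracket V W) (f * g) = f * vf_app (vf_bracket V W) g + g * vf_app (vf_bracket V W) f"
    if "f \<in> Cinf" "g \<in> Cinf" for f g
    using that V W by (simp add: vf_app_left vf_app_right algebra_simps)
  moreover have "vf_app (vf_bracket V W) (f + g) = vf_app (vf_bracket V W) f + vf_app (vf_bracket V W) g"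
    if "f \<in> Cinf" "g \<in> Cinf" for f g
    using that V W by (simp add: vf_app_left vf_app_right algebra_simps)
  moreover have "vf_app (vf_bracket V W) (\<lambda>x. c * f x) = (\<lambda>x. c * vf_app (vf_bracket V W) f x)"
    if "f \<in> Cinf" for f c
    using that V W by (simp add: vf_app_left vf_app_scale fun_eq_iff algebra_simps)
  ultimately show "vf_bracket V W p \<in> Tan p"
    unfolding tangent_space_def * by simp
next
  show "vf_bracket V W p = 0" if "p \<notin> Car" for p
    using that by (simp add: vf_bracket_def Vec_off[OF V] Vec_off[OF W] fun_eq_iff)
  show "vf_app (vf_bracket V W) f \<in> Cinf" if "f \<in> Cinf" for f
    using that V W by (simp add: vf_app_left)
qed

lemma vf_bracket_add_left: "V \<in> Vec \<Longrightarrow> W \<in> Vec \<Longrightarrow> Z \<in> Vec \<Longrightarrow>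
    vf_bracket (V + W) Z = vf_bracket V Z + vf_bracket W Z"
  and vf_bracket_add_right: "V \<in> Vec \<Longrightarrow> W \<in> Vec \<Longrightarrow> Z \<in> Vec \<Longrightarrow>
    vf_bracket Z (V + W) = vf_bracket Z V + vf_bracket Z W"
  and vf_bracket_diff_right: "V \<in> Vec \<Longrightarrow> W \<in> Vec \<Longrightarrow> Z \<in> Vec \<Longrightarrow>
    vf_bracket Z (V - W) = vf_bracket Z V - vf_bracket Z W"
  and vf_bracket_mult_right: "V \<in> Vec \<Longrightarrow> W \<in> Vec \<Longrightarrow> h \<in> Cinf \<Longrightarrow>
    vf_bracket V (vf_mult h W) = vf_mult h (vf_bracket V W) + vf_mult (vf_app V h) W"
  and vf_bracket_mult_left: "V \<in> Vec \<Longrightarrow> W \<in> Vec \<Longrightarrow> h \<in> Cinf \<Longrightarrow>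
    vf_bracket (vf_mult h V) W = vf_mult h (vf_bracket V W) - vf_mult (vf_app W h) V"
  by (rule vf_eqI; simp add: vf_app_left vf_app_right algebra_simps)+

lemma vf_bracket_scale: 
  assumes "V \<in> Vec" "W \<in> Vec"
  shows "vf_bracket (vf_scale c V) W = vf_scale c (vf_bracket V W)"
    and "vf_bracket V (vf_scale c W) = vf_scale c (vf_bracket V W)"
proof -
  have z: "vf_mult 0 Z = 0" for Z :: "'a vfield" by (simp add: vf_mult_def fun_eq_iff)
  show "vf_bracket (vf_scale c V) W = vf_scale c (vf_bracket V W)"
    and "vf_bracket V (vf_scale c W) = vf_scale c (vf_bracket V W)"
    using assms by (simp_all add: vf_scale_eq vf_bracket_mult_left vf_bracket_mult_right vf_app_konst z)
qed

lemma vf_jacobi: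
  "V \<in> Vec \<Longrightarrow> W \<in> Vec \<Longrightarrow> Z \<in> Vec \<Longrightarrow>
    vf_bracket V (vf_bracket W Z) + vf_bracket W (vf_bracket Z V) + vf_bracket Z (vf_bracket V W) = 0"
  by (rule vf_eqI; simp add: vf_app_left vf_app_right algebra_simps)

lemma vf_bracket_bracket:
  "V \<in> Vec \<Longrightarrow> W \<in> Vec \<Longrightarrow> Z \<in> Vec \<Longrightarrow>
    vf_bracket V (vf_bracket W Z) = vf_bracket (vf_bracket V W) Z + vf_bracket W (vf_bracket V Z)"
  by (rule vf_eqI; simp add: vf_app_left vf_app_right algebra_simps)

lemma vector_extension:
  assumes p: "p \<in> Car" and v: "v \<in> Tan p"
  obtains V where "V \<in> Vec" "V p = v"
proof -
  obtain \<mu> y G where fr: "frame \<mu> y G" "\<mu> p = 1" using frame_exists[OF p] .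
  let ?V = "\<Sum>b\<in>Basis. vf_scale (v (y b)) (G b)"
  have "?V \<in> Vec" by (rule Vec_sum) (use frame_Cinf[OF fr(1)] in simp)
  moreover have "?V p = v"
  proof
    fix f
    have "?V p f = (\<Sum>b\<in>Basis. v (y b) * G b p f)" by (simp only: sum_fun_apply vf_scale_def)
    also have "\<dots> = v f" by (rule frame_expand[OF fr(1) _ v, symmetric]) (simp add: fr(2))
    finally show "?V p f = v f" .
  qed
  ultimately show ?thesis using that by blast
qed

lemma frame_Vec:
  assumes "frame \<mu> y G" "V \<in> Vec"
  shows "vf_mult \<mu> V = (\<Sum>b\<in>Basis. vf_mult (\<mu> * vf_app V (y b)) (G b))"
proof (intro ext)
  fix q f
  show "vf_mult \<mu> V q f = (\<Sum>b\<in>Basis. vf_mult (\<mu> * vf_app V (y b)) (G b)) q f"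
  proof (cases "\<mu> q = 0")
    case False
    then have "q \<in> Car" using Cinf_off frame_Cinf(1)[OF assms(1)] by blast
    then show ?thesis
      using frame_expand[OF assms(1) False Vec_Tan[OF assms(2)], of f]
      by (simp add: vf_mult_def vf_app_def sum_fun_apply sum_distrib_left mult.assoc)
  qed (simp add: vf_mult_def sum_fun_apply)
qed

lemma vector_functional:
  fixes L :: "'a vfield \<Rightarrow> real"
  assumes fr: "frame \<mu> y G"
    and add: "\<And>V W. V \<in> Vec \<Longrightarrow> W \<in> Vec \<Longrightarrow> L (V + W) = L V + L W"
    and mult: "\<And>h V. h \<in> Cinf \<Longrightarrow> V \<in> Vec \<Longrightarrow> L (vf_mult h V) = h p * L V"
    and V: "V \<in> Vec"
  shows "\<mu> p * L V = (\<Sum>b\<in>Basis. \<mu> p * vf_app V (y b) p * L (G b))"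
proof -
  note fC = frame_Cinf[OF fr]
  have L0: "L 0 = 0" using add[OF Vec_zero Vec_zero] by (simp only: add_0)
  have sum: "L (\<Sum>b\<in>I. W b) = (\<Sum>b\<in>I. L (W b))" if "\<And>b. b \<in> I \<Longrightarrow> W b \<in> Vec" for I :: "'e set" and W
    by (rule additive_sum[where S="\<lambda>V. V \<in> Vec" and H=L, OF Vec_zero Vec_add L0 add that])
  have c: "\<mu> * vf_app V (y b) \<in> Cinf" if "b \<in> Basis" for b using V fC that by simp
  have "\<mu> p * L V = L (vf_mult \<mu> V)" by (rule mult[OF fC(1) V, symmetric])
  also have "\<dots> = (\<Sum>b\<in>Basis. L (vf_mult (\<mu> * vf_app V (y b)) (G b)))"
    unfolding frame_Vec[OF fr V] by (rule sum) (intro Vec_mult c fC(3))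
  also have "\<dots> = (\<Sum>b\<in>Basis. \<mu> p * vf_app V (y b) p * L (G b))"
    by (rule sum.cong[OF refl], subst mult[OF c fC(3)]) simp_all
  finally show ?thesis .
qed

text \<open>Both sides are the same combination of the values on a frame.\<close>
lemma tensorial:
  fixes L :: "'a vfield \<Rightarrow> real"
  assumes p: "p \<in> Car"
    and add: "\<And>V W. V \<in> Vec \<Longrightarrow> W \<in> Vec \<Longrightarrow> L (V + W) = L V + L W"
    and mult: "\<And>h V. h \<in> Cinf \<Longrightarrow> V \<in> Vec \<Longrightarrow> L (vf_mult h V) = h p * L V"
    and V: "V \<in> Vec" "W \<in> Vec" "V p = W p"
  shows "L V = L W"
proof -
  obtain \<mu> y G where fr: "frame \<mu> y G" "\<mu> p = 1" using frame_exists[OF p] .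
  have "L V = (\<Sum>b\<in>Basis. vf_app V (y b) p * L (G b))" if "V \<in> Vec" for V
    using vector_functional[OF fr(1) add mult that] fr(2) by simp
  then show ?thesis using V by (simp add: vf_app_def)
qed

subsection \<open>Differential forms\<close>

lemma
  assumes "\<alpha> \<in> Om"
  shows Om_off: "X \<notin> Vec \<Longrightarrow> \<alpha> X = 0"
    and Om_app: "X \<in> Vec \<Longrightarrow> \<alpha> X \<in> Cinf"
    and Om_add: "X \<in> Vec \<Longrightarrow> Y \<in> Vec \<Longrightarrow> \<alpha> (X + Y) = \<alpha> X + \<alpha> Y"
    and Om_mult: "f \<in> Cinf \<Longrightarrow> X \<in> Vec \<Longrightarrow> \<alpha> (vf_mult f X) = f * \<alpha> X"
  using assms unfolding forms1_def mem_Collect_eq by blast+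

lemma Om_zero_app: "\<alpha> \<in> Om \<Longrightarrow> \<alpha> 0 = 0"
  using Om_add[of \<alpha> 0 0] by (simp add: fun_eq_iff)

lemma Om_minus: "\<alpha> \<in> Om \<Longrightarrow> X \<in> Vec \<Longrightarrow> \<alpha> (- X) = - \<alpha> X"
  using Om_add[of \<alpha> X "- X"] Om_zero_app[of \<alpha>] by (simp add: fun_eq_iff eq_neg_iff_add_eq_0 add.commute)

lemma Om_diff: "\<alpha> \<in> Om \<Longrightarrow> X \<in> Vec \<Longrightarrow> Y \<in> Vec \<Longrightarrow> \<alpha> (X - Y) = \<alpha> X - \<alpha> Y"
  using Om_add[of \<alpha> X "- Y"] Om_minus[of \<alpha> Y] by (simp add: fun_eq_iff)

lemmas Om_lin = Om_add Om_diff Om_minus Om_mult Om_zero_app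

lemma OmI:
  assumes "\<And>X. X \<notin> Vec \<Longrightarrow> \<alpha> X = 0" "\<And>X. X \<in> Vec \<Longrightarrow> \<alpha> X \<in> Cinf"
    "\<And>X Y. X \<in> Vec \<Longrightarrow> Y \<in> Vec \<Longrightarrow> \<alpha> (X + Y) = \<alpha> X + \<alpha> Y"
    "\<And>f X. f \<in> Cinf \<Longrightarrow> X \<in> Vec \<Longrightarrow> \<alpha> (vf_mult f X) = f * \<alpha> X"
  shows "\<alpha> \<in> Om"
  using assms by (auto simp: forms1_def)

lemma Om_plus [simp]: "\<alpha> \<in> Om \<Longrightarrow> \<beta> \<in> Om \<Longrightarrow> \<alpha> + \<beta> \<in> Om"
  by (rule OmI) (simp_all add: Om_off[of \<alpha>] Om_off[of \<beta>] Om_lin[of \<alpha>] Om_lin[of \<beta>] Om_app fun_eq_iff algebra_simps)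

lemma Om_zero [simp]: "0 \<in> Om"
  by (rule OmI) (simp_all add: fun_eq_iff)

lemma Om_form_mult [simp]: "f \<in> Cinf \<Longrightarrow> \<alpha> \<in> Om \<Longrightarrow> form_mult f \<alpha> \<in> Om"
  by (rule OmI) (simp_all add: form_mult_def Om_off[of \<alpha>] Om_lin[of \<alpha>] Om_app[of \<alpha>] fun_eq_iff algebra_simps)

lemma differential_app: "X \<in> Vec \<Longrightarrow> differential A f X = vf_app X f"
  by (simp add: differential_def)

lemma Om_differential [simp]: "f \<in> Cinf \<Longrightarrow> differential A f \<in> Om"
  by (rule OmI) (simp_all add: differential_def vf_app_left)

lemma form_eqI:
  assumes "\<alpha> \<in> Om" "\<beta> \<in> Om" "\<And>X. X \<in> Vec \<Longrightarrow> \<alpha> X = \<beta> X"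
  shows "\<alpha> = \<beta>"
proof
  fix X
  show "\<alpha> X = \<beta> X"
    by (cases "X \<in> Vec") (simp_all only: assms(3) Om_off[OF assms(1)] Om_off[OF assms(2)] not_False_eq_True)
qed

lemma form_pointwise: "\<alpha> \<in> Om \<Longrightarrow> X \<in> Vec \<Longrightarrow> Y \<in> Vec \<Longrightarrow> p \<in> Car \<Longrightarrow> X p = Y p \<Longrightarrow> \<alpha> X p = \<alpha> Y p"
  by (rule tensorial[where L="\<lambda>X. \<alpha> X p"]) (simp_all add: Om_add Om_mult[of \<alpha>])

lemma
  assumes "\<zeta> \<in> cotangent_space A p"
  shows cotan_off: "v \<notin> Tan p \<Longrightarrow> \<zeta> v = 0"
    and cotan_add: "v \<in> Tan p \<Longrightarrow> w \<in> Tan p \<Longrightarrow> \<zeta> (v + w) = \<zeta> v + \<zeta> w"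
    and cotan_scale: "v \<in> Tan p \<Longrightarrow> \<zeta> (\<lambda>f. c * v f) = c * \<zeta> v"
  using assms unfolding cotangent_space_def mem_Collect_eq by blast+

lemma cotan_zero: "\<zeta> \<in> cotangent_space A p \<Longrightarrow> \<zeta> 0 = 0"
  using cotan_add[of \<zeta> p 0 0] Tan_zero[of p] by simp

lemma cotan_lincomb:
  assumes \<zeta>: "\<zeta> \<in> cotangent_space A p" and v: "\<And>i. i \<in> I \<Longrightarrow> v i \<in> Tan p"
  shows "\<zeta> (\<lambda>f. \<Sum>i\<in>I. c i * v i f) = (\<Sum>i\<in>I. c i * \<zeta> (v i))"
  using v
proof (induction I rule: infinite_finite_induct)
  case (insert x F)
  have e: "(\<lambda>f. \<Sum>i\<in>insert x F. c i * v i f) = (\<lambda>f. c x * v x f) + (\<lambda>f. \<Sum>i\<in>F. c i * v i f)"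
    using insert.hyps by (simp add: fun_eq_iff)
  have "(\<lambda>f. \<Sum>i\<in>F. c i * v i f) \<in> Tan p" using insert.prems by (intro Tan_lincomb) auto
  moreover have "(\<lambda>f. c x * v x f) \<in> Tan p" "\<zeta> (\<lambda>f. c x * v x f) = c x * \<zeta> (v x)"
    using cotan_scale[OF \<zeta>] Tan_scale insert.prems by simp_all
  moreover have "\<zeta> (\<lambda>f. \<Sum>i\<in>F. c i * v i f) = (\<Sum>i\<in>F. c i * \<zeta> (v i))"
    using insert by auto
  ultimately show ?case unfolding e using cotan_add[OF \<zeta>] insert.hyps by simp
qed (use cotan_zero[OF \<zeta>] in \<open>simp_all add: zero_fun_def\<close>)

lemma covector_extension:
  assumes p: "p \<in> Car" and \<zeta>: "\<zeta> \<in> cotangent_space A p"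
  obtains \<eta> where "\<eta> \<in> Om" "\<And>X. X \<in> Vec \<Longrightarrow> \<eta> X p = \<zeta> (X p)"
proof -
  obtain \<mu> y G where fr: "frame \<mu> y G" "\<mu> p = 1" using frame_exists[OF p] .
  let ?\<eta> = "\<lambda>X. if X \<in> Vec then \<Sum>b\<in>Basis. (\<lambda>q. \<zeta> (G b p) * vf_app X (y b) q) else 0"
  have \<eta>: "?\<eta> \<in> Om"
    by (rule OmI)
      (auto intro!: Cinf_sum Cinf_scale Vec_app frame_Cinf[OF fr(1)]
        simp: vf_app_left fun_eq_iff sum_fun_apply algebra_simps sum.distrib sum_distrib_left)
  have "?\<eta> X p = \<zeta> (X p)" if X: "X \<in> Vec" for X
  proof -
    have G: "G b p \<in> Tan p" if "b \<in> Basis" for b using Vec_Tan[OF frame_Cinf(3)[OF fr(1) that] p] .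
    have "X p = (\<lambda>f. \<Sum>b\<in>Basis. X p (y b) * G b p f)"
      by (rule ext, rule frame_expand[OF fr(1) _ Vec_Tan[OF X p]]) (simp add: fr(2))
    then have "\<zeta> (X p) = \<zeta> (\<lambda>f. \<Sum>b\<in>Basis. X p (y b) * G b p f)" by (rule arg_cong)
    also have "\<dots> = (\<Sum>b\<in>Basis. X p (y b) * \<zeta> (G b p))" by (rule cotan_lincomb[OF \<zeta> G])
    finally have "\<zeta> (X p) = (\<Sum>b\<in>Basis. X p (y b) * \<zeta> (G b p))" .
    then show ?thesis using X by (simp add: sum_fun_apply vf_app_def mult.commute)
  qed
  then show ?thesis using \<eta> that by blast
qed

end

section \<open>The cotangent bundle as a manifold\<close>

lemma openin_chart_preimage:
  assumes A: "atlas A" and c: "(U, \<phi>) \<in> A" and Q: "open Q"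
  shows "openin (atlas_topology A) {q \<in> U. \<phi> q \<in> Q}"
proof -
  have "open (\<psi> ` ({q \<in> U. \<phi> q \<in> Q} \<inter> V))" if d: "(V, \<psi>) \<in> A" for V \<psi>
  proof -
    have inj: "inj_on \<psi> V" and o: "open (\<psi> ` (V \<inter> U))"
      and s: "smooth_on (\<psi> ` (V \<inter> U)) (\<phi> \<circ> inv_into V \<psi>)"
      using A c d by (fastforce simp: atlas_def)+
    have "\<psi> ` ({q \<in> U. \<phi> q \<in> Q} \<inter> V) = \<psi> ` (V \<inter> U) \<inter> (\<phi> \<circ> inv_into V \<psi>) -` Q"
      using inv_into_f_f[OF inj] by force
    then show ?thesis using continuous_open_preimage[OF smooth_on_continuous[OF s] o Q] by simp
  qed
  moreover have "{q \<in> U. \<phi> q \<in> Q} \<subseteq> mcarrier A" using c by (force simp: mcarrier_def)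
  ultimately show ?thesis by (auto simp: openin_atlas_topology[OF A])
qed

context manifold
begin

abbreviation "TCar \<equiv> mcarrier (cotangent_bundle A)"
abbreviation "Cot \<equiv> cotangent_space A"

lemma TCar_iff: "(p, \<zeta>) \<in> TCar \<longleftrightarrow> p \<in> Car \<and> \<zeta> \<in> Cot p"
  by (auto simp: mcarrier_def cotangent_bundle_def cotangent_chart_def)

lemma TCar_fst: "\<xi> \<in> TCar \<Longrightarrow> fst \<xi> \<in> Car" and TCar_snd: "\<xi> \<in> TCar \<Longrightarrow> snd \<xi> \<in> Cot (fst \<xi>)"
  using TCar_iff[of "fst \<xi>" "snd \<xi>"] by simp_all

text \<open>The value of a form at a point; by tensoriality any vector field with the given value serves.\<close>
definition covec :: "'a form1 \<Rightarrow> 'a \<Rightarrow> ('a tvec \<Rightarrow> real)" where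
  "covec \<eta> p = (\<lambda>v. if v \<in> Tan p then \<eta> (SOME V. V \<in> Vec \<and> V p = v) p else 0)"

lemma covec_app:
  assumes "\<eta> \<in> Om" "p \<in> Car" "V \<in> Vec"
  shows "covec \<eta> p (V p) = \<eta> V p"
proof -
  let ?W = "SOME W. W \<in> Vec \<and> W p = V p"
  have "?W \<in> Vec \<and> ?W p = V p" by (rule someI[of _ V]) (simp add: assms)
  then have "\<eta> ?W p = \<eta> V p" using form_pointwise[OF assms(1) _ assms(3,2)] by blast
  then show ?thesis using Vec_Tan[OF assms(3,2)] by (simp add: covec_def)
qed

lemma covec_Cot:
  assumes \<eta>: "\<eta> \<in> Om" and p: "p \<in> Car"
  shows "covec \<eta> p \<in> Cot p"
proof -
  have "covec \<eta> p (v + w) = covec \<eta> p v + covec \<eta> p w" if vw: "v \<in> Tan p" "w \<in> Tan p" for v w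
  proof -
    obtain V where V: "V \<in> Vec" "V p = v" by (rule vector_extension[OF p vw(1)])
    obtain W where W: "W \<in> Vec" "W p = w" by (rule vector_extension[OF p vw(2)])
    have "v + w = (V + W) p" using V W by simp
    then show ?thesis
      using covec_app[OF \<eta> p Vec_add[OF V(1) W(1)]] covec_app[OF \<eta> p V(1)] covec_app[OF \<eta> p W(1)]
        Om_add[OF \<eta> V(1) W(1)] V W by simp
  qed
  moreover have "covec \<eta> p (\<lambda>f. c * v f) = c * covec \<eta> p v" if v: "v \<in> Tan p" for v c
  proof -
    obtain V where V: "V \<in> Vec" "V p = v" by (rule vector_extension[OF p v])
    have "(\<lambda>f. c * v f) = vf_scale c V p" using V by (simp add: vf_scale_def)
    then show ?thesis
      using covec_app[OF \<eta> p Vec_scale[OF V(1)], of c] covec_app[OF \<eta> p V(1)]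
        Om_mult[OF \<eta> Cinf_konst V(1), of c] V p by (simp add: vf_scale_eq konst_def)
  qed
  ultimately show ?thesis by (simp add: cotangent_space_def covec_def)
qed

lemma cotan_eqI:
  assumes p: "p \<in> Car" and "\<zeta> \<in> Cot p" "\<theta> \<in> Cot p"
    and eq: "\<And>V. V \<in> Vec \<Longrightarrow> \<zeta> (V p) = \<theta> (V p)"
  shows "\<zeta> = \<theta>"
proof
  fix v
  show "\<zeta> v = \<theta> v"
  proof (cases "v \<in> Tan p")
    case True
    then obtain V where "V \<in> Vec" "V p = v" by (rule vector_extension[OF p])
    then show ?thesis using eq by blast
  qed (simp add: cotan_off[OF assms(2)] cotan_off[OF assms(3)])
qed

lemma covec_exists:
  assumes "p \<in> Car" "\<zeta> \<in> Cot p"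
  obtains \<eta> where "\<eta> \<in> Om" "covec \<eta> p = \<zeta>"
proof -
  obtain \<eta> where \<eta>: "\<eta> \<in> Om" "\<And>X. X \<in> Vec \<Longrightarrow> \<eta> X p = \<zeta> (X p)"
    by (rule covector_extension[OF assms]) blast
  have "covec \<eta> p = \<zeta>"
    by (rule cotan_eqI[OF assms(1) covec_Cot[OF \<eta>(1) assms(1)] assms(2)])
      (simp add: covec_app[OF \<eta>(1) assms(1)] \<eta>(2))
  then show ?thesis using that \<eta> by blast
qed

lemma frame_cotan:
  assumes fr: "frame \<mu> y G" and q: "\<mu> q \<noteq> 0" and \<zeta>: "\<zeta> \<in> Cot q" and V: "V \<in> Vec"
  shows "\<zeta> (V q) = (\<Sum>b\<in>Basis. vf_app V (y b) q * \<zeta> (G b q))"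
proof -
  have qC: "q \<in> Car" using q Cinf_off[OF frame_Cinf(1)[OF fr]] by blast
  have "V q = (\<lambda>f. \<Sum>b\<in>Basis. V q (y b) * G b q f)"
    by (rule ext, rule frame_expand[OF fr q Vec_Tan[OF V qC]])
  then have "\<zeta> (V q) = \<zeta> (\<lambda>f. \<Sum>b\<in>Basis. V q (y b) * G b q f)" by (rule arg_cong)
  also have "\<dots> = (\<Sum>b\<in>Basis. V q (y b) * \<zeta> (G b q))"
    by (rule cotan_lincomb[OF \<zeta>]) (rule Vec_Tan[OF frame_Cinf(3)[OF fr] qC])
  finally show ?thesis by (simp add: vf_app_def)
qed

lemma Om_sum: "(\<And>i. i \<in> I \<Longrightarrow> \<alpha> i \<in> Om) \<Longrightarrow> (\<Sum>i\<in>I. \<alpha> i) \<in> Om"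
  by (induction I rule: infinite_finite_induct) simp_all

text \<open>The domain and the coordinate map of the natural chart over \<open>(U, \<phi>)\<close>.\<close>
definition tdom :: "'a set \<Rightarrow> 'a covec set" where
  "tdom U = {(p, \<zeta>). p \<in> U \<and> \<zeta> \<in> Cot p}"

definition tmap :: "'a set \<Rightarrow> ('a \<Rightarrow> 'e) \<Rightarrow> 'a covec \<Rightarrow> 'e \<times> 'e" where
  "tmap U \<phi> = (\<lambda>(p, \<zeta>). (\<phi> p, \<Sum>b\<in>Basis. \<zeta> (coord_vec A (U, \<phi>) p b) *\<^sub>R b))"

lemma cotangent_chart_eq: "cotangent_chart A (U, \<phi>) = (tdom U, tmap U \<phi>)"
  by (simp add: cotangent_chart_def tdom_def tmap_def)

lemma bundle_chart: "(U, \<phi>) \<in> A \<Longrightarrow> (tdom U, tmap U \<phi>) \<in> cotangent_bundle A"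
  unfolding cotangent_bundle_def cotangent_chart_eq[symmetric] by (rule imageI)

lemma bundle_chartE:
  assumes "c \<in> cotangent_bundle A"
  obtains U \<phi> where "(U, \<phi>) \<in> A" "c = (tdom U, tmap U \<phi>)"
  using assms by (auto simp: cotangent_bundle_def cotangent_chart_eq)

lemma tmap_fst: "fst (tmap U \<phi> \<xi>) = \<phi> (fst \<xi>)"
  by (simp add: tmap_def split_beta)

lemma tmap_snd: "b \<in> Basis \<Longrightarrow> snd (tmap U \<phi> \<xi>) \<bullet> b = snd \<xi> (coord_vec A (U, \<phi>) (fst \<xi>) b)"
  by (simp add: tmap_def split_beta inner_sum_left inner_Basis if_distrib cong: if_cong)

lemma tmap_inj:
  assumes c: "(U, \<phi>) \<in> A"
  shows "inj_on (tmap U \<phi>) (tdom U)"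
proof (rule inj_onI)
  fix \<xi> \<xi>' assume \<xi>: "\<xi> \<in> tdom U" "\<xi>' \<in> tdom U" and eq: "tmap U \<phi> \<xi> = tmap U \<phi> \<xi>'"
  obtain p \<zeta> q \<theta> where e: "\<xi> = (p, \<zeta>)" "\<xi>' = (q, \<theta>)" by fastforce
  have p: "p \<in> U" "q \<in> U" "\<zeta> \<in> Cot p" "\<theta> \<in> Cot q" using \<xi> by (auto simp: tdom_def e)
  have "\<phi> p = \<phi> q" using eq tmap_fst[of U \<phi> \<xi>] tmap_fst[of U \<phi> \<xi>'] by (simp add: e)
  then have pq: "p = q" using chart_inj[OF c] p by (simp add: inj_on_def)
  have co: "\<zeta> (coord_vec A (U, \<phi>) p b) = \<theta> (coord_vec A (U, \<phi>) p b)" if "b \<in> Basis" for b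
    using tmap_snd[OF that, of U \<phi> \<xi>] tmap_snd[OF that, of U \<phi> \<xi>'] eq by (simp add: e pq)
  obtain \<mu> y G where fr: "frame \<mu> y G" "\<mu> p = 1"
    and G: "\<And>q b. \<mu> q \<noteq> 0 \<Longrightarrow> b \<in> Basis \<Longrightarrow> G b q = coord_vec A (U, \<phi>) q b"
    by (rule coordinate_frame[OF c p(1) open_UNIV UNIV_I]) blast
  have pC: "p \<in> Car" using p chart_sub[OF c] by blast
  have th: "\<theta> \<in> Cot p" using p pq by simp
  have "\<zeta> = \<theta>"
    by (rule cotan_eqI[OF pC p(3) th])
      (simp add: frame_cotan[OF fr(1) _ p(3)] frame_cotan[OF fr(1) _ th] fr(2) G co)
  then show "\<xi> = \<xi>'" by (simp add: e pq)
qed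

lemma tmap_image:
  assumes c: "(U, \<phi>) \<in> A" and W: "W \<subseteq> U"
  shows "tmap U \<phi> ` tdom W = \<phi> ` W \<times> UNIV"
proof
  show "tmap U \<phi> ` tdom W \<subseteq> \<phi> ` W \<times> UNIV"
    by (auto simp: tdom_def tmap_def)
  show "\<phi> ` W \<times> UNIV \<subseteq> tmap U \<phi> ` tdom W"
  proof
    fix z assume "z \<in> \<phi> ` W \<times> (UNIV :: 'e set)"
    then obtain p u where z: "z = (\<phi> p, u)" "p \<in> W" by auto
    then have p: "p \<in> U" "p \<in> Car" using W chart_sub[OF c] by auto
    obtain \<mu> y G where fr: "frame \<mu> y G" "\<mu> p = 1"
      and G: "\<And>q b. \<mu> q \<noteq> 0 \<Longrightarrow> b \<in> Basis \<Longrightarrow> G b q = coord_vec A (U, \<phi>) q b"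
      by (rule coordinate_frame[OF c p(1) open_UNIV UNIV_I]) blast
    define \<eta> where "\<eta> = (\<Sum>b\<in>Basis. form_mult (konst (u \<bullet> b)) (differential A (y b)))"
    have \<eta>: "\<eta> \<in> Om" unfolding \<eta>_def
      by (rule Om_sum) (intro Om_form_mult Om_differential Cinf_konst frame_Cinf(2)[OF fr(1)])
    have "\<eta> (G b) p = u \<bullet> b" if b: "b \<in> Basis" for b
    proof -
      have "\<eta> (G b) p = (\<Sum>b'\<in>Basis. (u \<bullet> b') * G b p (y b'))"
        unfolding \<eta>_def sum_fun_apply form_mult_def
        using frame_Cinf(3)[OF fr(1) b] p by (simp add: konst_def differential_app vf_app_def)
      also have "\<dots> = (\<Sum>b'\<in>Basis. (u \<bullet> b') * (if b = b' then 1 else 0))"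
        by (rule sum.cong[OF refl], subst frame_dual[OF fr(1) _ b]) (simp_all add: fr(2))
      also have "\<dots> = u \<bullet> b" using b by (simp add: if_distrib cong: if_cong)
      finally show ?thesis .
    qed
    then have "covec \<eta> p (coord_vec A (U, \<phi>) p b) = u \<bullet> b" if "b \<in> Basis" for b
      using covec_app[OF \<eta> p(2) frame_Cinf(3)[OF fr(1) that]] G[of p b] fr(2) that by simp
    then have "tmap U \<phi> (p, covec \<eta> p) = z"
      by (simp add: tmap_def z euclidean_representation)
    moreover have "(p, covec \<eta> p) \<in> tdom W" using z covec_Cot[OF \<eta> p(2)] by (simp add: tdom_def)
    ultimately show "z \<in> tmap U \<phi> ` tdom W" by blast
  qed
qed

lemma tinv:
  assumes c: "(U, \<phi>) \<in> A" and z: "z \<in> \<phi> ` U \<times> UNIV"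
  shows "inv_into (tdom U) (tmap U \<phi>) z \<in> tdom U"
    and "tmap U \<phi> (inv_into (tdom U) (tmap U \<phi>) z) = z"
    and "fst (inv_into (tdom U) (tmap U \<phi>) z) = inv_into U \<phi> (fst z)"
proof -
  let ?\<xi> = "inv_into (tdom U) (tmap U \<phi>) z"
  have zi: "z \<in> tmap U \<phi> ` tdom U" using z tmap_image[OF c order_refl] by simp
  show 1: "?\<xi> \<in> tdom U" by (rule inv_into_into[OF zi])
  show 2: "tmap U \<phi> ?\<xi> = z" by (rule f_inv_into_f[OF zi])
  have "\<phi> (fst ?\<xi>) = fst z" using tmap_fst[of U \<phi> ?\<xi>] 2 by simp
  moreover have "fst ?\<xi> \<in> U" using 1 by (auto simp: tdom_def)
  ultimately show "fst ?\<xi> = inv_into U \<phi> (fst z)" using chart_inv[OF c] by metis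
qed

lemma tinv_map: "(U, \<phi>) \<in> A \<Longrightarrow> \<xi> \<in> tdom U \<Longrightarrow> inv_into (tdom U) (tmap U \<phi>) (tmap U \<phi> \<xi>) = \<xi>"
  using tmap_inj by (simp add: inv_into_f_f)

lemma tdom_TCar: "(U, \<phi>) \<in> A \<Longrightarrow> \<xi> \<in> tdom U \<Longrightarrow> \<xi> \<in> TCar"
  using chart_sub[of U \<phi>] by (auto simp: tdom_def TCar_iff)

lemma tdom_snd: "\<xi> \<in> tdom U \<Longrightarrow> snd \<xi> \<in> Cot (fst \<xi>)"
  by (auto simp: tdom_def)

lemma open_nonzero:
  assumes "(U, \<phi>) \<in> A" "f \<in> Cinf"
  shows "open (\<phi> ` U \<inter> (\<lambda>x. f (inv_into U \<phi> x)) -` (- {0}))"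
  by (intro continuous_open_preimage smooth_on_continuous Cinf_chart' chart_open open_Compl closed_singleton assms)

lemma smooth_base:
  assumes c: "(U, \<phi>) \<in> A" and f: "f \<in> Cinf"
  shows "smooth_on (\<phi> ` U \<times> (UNIV :: 'e set)) (\<lambda>z. f (inv_into U \<phi> (fst z)))"
  by (rule smooth_on_compose[OF _ chart_open[OF c] smooth_on_linear[OF bounded_linear_fst] Cinf_chart'[OF f c]])
    (auto intro: open_Times chart_open[OF c])

text \<open>In natural coordinates the function is linear along the fibres, with the components of \<open>Y\<close> as
  coefficients.\<close>
lemma smooth_fun_lift:
  assumes c: "(U, \<phi>) \<in> A" and Y: "Y \<in> Vec"
  shows "smooth_on (\<phi> ` U \<times> UNIV) (\<lambda>z. fun_lift A Y (inv_into (tdom U) (tmap U \<phi>) z))"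
proof (rule smooth_on_local)
  fix z0 assume "z0 \<in> \<phi> ` U \<times> (UNIV :: 'e set)"
  then obtain p u0 where z0: "z0 = (\<phi> p, u0)" and p: "p \<in> U" by auto
  obtain \<mu> y G where fr: "frame \<mu> y G" "\<mu> p = 1"
    and G: "\<And>q b. \<mu> q \<noteq> 0 \<Longrightarrow> b \<in> Basis \<Longrightarrow> G b q = coord_vec A (U, \<phi>) q b"
    by (rule coordinate_frame[OF c p open_UNIV UNIV_I]) blast
  define N where "N = \<phi> ` U \<inter> (\<lambda>x. \<mu> (inv_into U \<phi> x)) -` (- {0})"
  have N: "open N" "\<phi> p \<in> N" "N \<subseteq> \<phi> ` U"
    unfolding N_def using open_nonzero[OF c frame_Cinf(1)[OF fr(1)]] p chart_inv[OF c p] fr(2) by auto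
  have oN: "open (N \<times> (UNIV :: 'e set))" using N by (simp add: open_Times)
  have "smooth_on (N \<times> UNIV) (\<lambda>z. \<Sum>b\<in>Basis. vf_app Y (y b) (inv_into U \<phi> (fst z)) * (snd z \<bullet> b))"
  proof (intro smooth_on_sum[OF oN] smooth_on_mult[OF oN])
    fix b :: 'e assume b: "b \<in> Basis"
    show "smooth_on (N \<times> (UNIV :: 'e set)) (\<lambda>z. vf_app Y (y b) (inv_into U \<phi> (fst z)))"
      by (rule smooth_on_subset[OF smooth_base[OF c Vec_app[OF Y frame_Cinf(2)[OF fr(1) b]]]]) (use N in auto)
    show "smooth_on (N \<times> UNIV) (\<lambda>z. snd z \<bullet> b)"
      by (rule smooth_on_linear[OF bounded_linear_compose[OF bounded_linear_inner_left bounded_linear_snd] oN])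
  qed
  then have "smooth_on (N \<times> UNIV) (\<lambda>z. fun_lift A Y (inv_into (tdom U) (tmap U \<phi>) z))"
  proof (rule smooth_on_cong[OF oN, rotated])
    fix z assume z: "z \<in> N \<times> (UNIV :: 'e set)"
    then have zU: "z \<in> \<phi> ` U \<times> UNIV" using N by auto
    let ?\<xi> = "inv_into (tdom U) (tmap U \<phi>) z"
    note t = tinv[OF c zU]
    have q: "\<mu> (fst ?\<xi>) \<noteq> 0" using z t(3) by (auto simp: N_def)
    have "snd z \<bullet> b = snd ?\<xi> (G b (fst ?\<xi>))" if "b \<in> Basis" for b
      using tmap_snd[OF that, of U \<phi> ?\<xi>] t(2) G[OF q that] by simp
    then show "(\<Sum>b\<in>Basis. vf_app Y (y b) (inv_into U \<phi> (fst z)) * (snd z \<bullet> b)) = fun_lift A Y ?\<xi>"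
      using frame_cotan[OF fr(1) q tdom_snd[OF t(1)] Y] tdom_TCar[OF c t(1)] t(3)
      by (simp add: fun_lift_def)
  qed
  then show "\<exists>N. open N \<and> z0 \<in> N \<and> smooth_on N (\<lambda>z. fun_lift A Y (inv_into (tdom U) (tmap U \<phi>) z))"
    using oN N z0 by blast
qed

lemma tdom_inter: "tdom U \<inter> tdom V = tdom (U \<inter> V)"
  by (auto simp: tdom_def)

text \<open>A change of natural coordinates is smooth in the fibre direction because, locally, it evaluates
  covectors on vector fields extending the coordinate fields of the other chart.\<close>
lemma smooth_transition:
  assumes c: "(U, \<phi>) \<in> A" and d: "(V, \<psi>) \<in> A"
  shows "smooth_on (tmap U \<phi> ` (tdom U \<inter> tdom V)) (tmap V \<psi> \<circ> inv_into (tdom U) (tmap U \<phi>))"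
proof -
  let ?i = "inv_into (tdom U) (tmap U \<phi>)"
  let ?S = "\<phi> ` (U \<inter> V) \<times> (UNIV :: 'e set)"
  have S: "tmap U \<phi> ` (tdom U \<inter> tdom V) = ?S" unfolding tdom_inter by (rule tmap_image[OF c]) simp
  have oS: "open ?S" using chart_inter_open[OF c d] by (simp add: open_Times)
  have s1: "smooth_on ?S (\<lambda>z. (\<psi> \<circ> inv_into U \<phi>) (fst z))"
    by (rule smooth_on_compose[OF oS chart_inter_open[OF c d] smooth_on_linear[OF bounded_linear_fst oS]
        chart_transition[OF c d]]) auto
  have s2: "smooth_on ?S (\<lambda>z. snd (?i z) (coord_vec A (V, \<psi>) (fst (?i z)) b))" if b: "b \<in> Basis" for b
  proof (rule smooth_on_local)
    fix z0 assume "z0 \<in> ?S"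
    then obtain p u0 where z0: "z0 = (\<phi> p, u0)" and p: "p \<in> U" "p \<in> V" by auto
    obtain \<mu> y G where fr: "frame \<mu> y G" "\<mu> p = 1"
      and G: "\<And>q b. \<mu> q \<noteq> 0 \<Longrightarrow> b \<in> Basis \<Longrightarrow> G b q = coord_vec A (V, \<psi>) q b"
      by (rule coordinate_frame[OF d p(2) open_UNIV UNIV_I]) blast
    define N where "N = \<phi> ` U \<inter> (\<lambda>x. \<mu> (inv_into U \<phi> x)) -` (- {0})"
    have N: "open N" "\<phi> p \<in> N" "N \<subseteq> \<phi> ` U"
      unfolding N_def using open_nonzero[OF c frame_Cinf(1)[OF fr(1)]] p chart_inv[OF c p(1)] fr(2) by auto
    have oN: "open (N \<times> (UNIV :: 'e set))" using N by (simp add: open_Times)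
    have "smooth_on (N \<times> UNIV) (\<lambda>z. fun_lift A (G b) (?i z))"
      by (rule smooth_on_subset[OF smooth_fun_lift[OF c frame_Cinf(3)[OF fr(1) b]]]) (use N in auto)
    then have "smooth_on (N \<times> UNIV) (\<lambda>z. snd (?i z) (coord_vec A (V, \<psi>) (fst (?i z)) b))"
    proof (rule smooth_on_cong[OF oN, rotated])
      fix z assume z: "z \<in> N \<times> (UNIV :: 'e set)"
      then have zU: "z \<in> \<phi> ` U \<times> UNIV" using N by auto
      note t = tinv[OF c zU]
      have q: "\<mu> (fst (?i z)) \<noteq> 0" using z t(3) by (auto simp: N_def)
      show "fun_lift A (G b) (?i z) = snd (?i z) (coord_vec A (V, \<psi>) (fst (?i z)) b)"
        using G[OF q b] tdom_TCar[OF c t(1)] by (simp add: fun_lift_def)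
    qed
    then show "\<exists>N. open N \<and> z0 \<in> N \<and> smooth_on N (\<lambda>z. snd (?i z) (coord_vec A (V, \<psi>) (fst (?i z)) b))"
      using oN N z0 by blast
  qed
  have "smooth_on ?S (\<lambda>z. ((\<psi> \<circ> inv_into U \<phi>) (fst z),
      \<Sum>b\<in>Basis. snd (?i z) (coord_vec A (V, \<psi>) (fst (?i z)) b) *\<^sub>R b))"
    by (intro smooth_on_Pair[OF oS s1] smooth_on_sum[OF oS] smooth_on_scaleR[OF oS s2] smooth_on_const[OF oS])
  then have "smooth_on ?S (tmap V \<psi> \<circ> ?i)"
  proof (rule smooth_on_cong[OF oS, rotated])
    fix z assume "z \<in> ?S"
    then have "z \<in> \<phi> ` U \<times> UNIV" by auto
    from tinv(3)[OF c this] show "((\<psi> \<circ> inv_into U \<phi>) (fst z),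
      \<Sum>b\<in>Basis. snd (?i z) (coord_vec A (V, \<psi>) (fst (?i z)) b) *\<^sub>R b) = (tmap V \<psi> \<circ> ?i) z"
      by (simp add: tmap_def split_beta)
  qed
  then show ?thesis by (simp add: S)
qed

lemma atlas_cotangent: "atlas (cotangent_bundle A)"
  unfolding atlas_def
proof (intro conjI ballI)
  fix x assume "x \<in> cotangent_bundle A"
  then obtain U \<phi> where c: "(U, \<phi>) \<in> A" and x: "x = (tdom U, tmap U \<phi>)" by (rule bundle_chartE)
  show "case x of (U, \<phi>) \<Rightarrow> inj_on \<phi> U \<and> open (\<phi> ` U)"
    using tmap_inj[OF c] tmap_image[OF c order_refl] chart_open[OF c] by (simp add: x open_Times)
  show "case x of (U, \<phi>) \<Rightarrow> \<forall>(V, \<psi>)\<in>cotangent_bundle A.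
      open (\<phi> ` (U \<inter> V)) \<and> smooth_on (\<phi> ` (U \<inter> V)) (\<psi> \<circ> inv_into U \<phi>)"
  proof (simp only: x prod.case, rule ballI)
    fix w assume "w \<in> cotangent_bundle A"
    then obtain V \<psi> where d: "(V, \<psi>) \<in> A" and w: "w = (tdom V, tmap V \<psi>)" by (rule bundle_chartE)
    have "open (tmap U \<phi> ` (tdom U \<inter> tdom V))"
      unfolding tdom_inter using tmap_image[OF c, of "U \<inter> V"] chart_inter_open[OF c d] by (simp add: open_Times)
    then show "case w of (V, \<psi>) \<Rightarrow> open (tmap U \<phi> ` (tdom U \<inter> V)) \<and>
        smooth_on (tmap U \<phi> ` (tdom U \<inter> V)) (\<psi> \<circ> inv_into (tdom U) (tmap U \<phi>))"
      using smooth_transition[OF c d] by (simp add: w)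
  qed
qed

text \<open>Points over different base points are separated by preimages of open sets of the base, and points
  of one fibre lie in a common natural chart.\<close>
lemma hausdorff_cotangent: "Hausdorff_space (atlas_topology (cotangent_bundle A))"
  unfolding Hausdorff_space_def
proof (intro allI impI)
  let ?X = "atlas_topology (cotangent_bundle A)"
  fix \<xi> \<xi>' assume "\<xi> \<in> topspace ?X \<and> \<xi>' \<in> topspace ?X \<and> \<xi> \<noteq> \<xi>'"
  moreover have "topspace ?X \<subseteq> TCar"
    using openin_atlas_topology[OF atlas_cotangent] openin_topspace by blast
  ultimately have \<xi>: "\<xi> \<in> TCar" "\<xi>' \<in> TCar" "\<xi> \<noteq> \<xi>'" by auto
  show "\<exists>U V. openin ?X U \<and> openin ?X V \<and> \<xi> \<in> U \<and> \<xi>' \<in> V \<and> disjnt U V"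
  proof (cases "fst \<xi> = fst \<xi>'")
    case False
    have op: "openin ?X (tdom W)" if W: "openin (atlas_topology A) W" for W
    proof -
      have "open (tmap U \<phi> ` (tdom W \<inter> tdom U))" if c: "(U, \<phi>) \<in> A" for U \<phi>
      proof -
        have "open (\<phi> ` (W \<inter> U))" using W c openin_atlas_topology[OF atlas] by blast
        then show ?thesis unfolding tdom_inter using tmap_image[OF c, of "W \<inter> U"] by (simp add: open_Times)
      qed
      moreover have "tdom W \<subseteq> TCar"
        using W openin_atlas_topology[OF atlas] by (auto simp: tdom_def TCar_iff)
      ultimately show ?thesis
        unfolding openin_atlas_topology[OF atlas_cotangent] by (auto elim!: bundle_chartE)
    qed
    obtain W W' where W: "openin (atlas_topology A) W" "openin (atlas_topology A) W'"
        "fst \<xi> \<in> W" "fst \<xi>' \<in> W'" "disjnt W W'"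
      using hausdorff False TCar_fst[OF \<xi>(1)] TCar_fst[OF \<xi>(2)]
      unfolding Hausdorff_space_def topspace_atlas by blast
    moreover have "\<xi> \<in> tdom W" "\<xi>' \<in> tdom W'" "disjnt (tdom W) (tdom W')"
      using W TCar_snd[OF \<xi>(1)] TCar_snd[OF \<xi>(2)] by (auto simp: tdom_def disjnt_def split_beta)
    ultimately show ?thesis using op by blast
  next
    case True
    obtain U \<phi> where c: "(U, \<phi>) \<in> A" "fst \<xi> \<in> U" using Car_chart[OF TCar_fst[OF \<xi>(1)]] by blast
    have t: "\<xi> \<in> tdom U" "\<xi>' \<in> tdom U"
      using c True TCar_snd[OF \<xi>(1)] TCar_snd[OF \<xi>(2)] by (auto simp: tdom_def split_beta)
    then have "tmap U \<phi> \<xi> \<noteq> tmap U \<phi> \<xi>'" using tmap_inj[OF c(1)] \<xi>(3) by (simp add: inj_on_eq_iff)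
    then obtain Q Q' where Q: "open Q" "open Q'" "tmap U \<phi> \<xi> \<in> Q" "tmap U \<phi> \<xi>' \<in> Q'" "Q \<inter> Q' = {}"
      unfolding separation_t2 by blast
    let ?W = "\<lambda>Q. {q \<in> tdom U. tmap U \<phi> q \<in> Q}"
    have "openin ?X (?W Q)" "openin ?X (?W Q')"
      using openin_chart_preimage[OF atlas_cotangent bundle_chart[OF c(1)]] Q by blast+
    moreover have "\<xi> \<in> ?W Q" "\<xi>' \<in> ?W Q'" "disjnt (?W Q) (?W Q')"
      using t Q by (auto simp: disjnt_def)
    ultimately show ?thesis by blast
  qed
qed

end

locale cotangent = manifold A for A :: "('a, 'e::euclidean_space) chart set"

sublocale cotangent \<subseteq> T: manifold "cotangent_bundle A"
  by unfold_locales (rule atlas_cotangent hausdorff_cotangent)+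

section \<open>Vector fields on the cotangent bundle\<close>

context cotangent
begin

abbreviation "TB \<equiv> cotangent_bundle A"

lemma TCinfI:
  assumes "\<And>\<xi>. \<xi> \<notin> TCar \<Longrightarrow> F \<xi> = 0"
    and "\<And>U \<phi>. (U, \<phi>) \<in> A \<Longrightarrow> smooth_on (\<phi> ` U \<times> UNIV) (\<lambda>z. F (inv_into (tdom U) (tmap U \<phi>) z))"
  shows "F \<in> T.Cinf"
  using assms(1)
  by (rule T.CinfI) (auto elim!: bundle_chartE simp: tmap_image assms(2))

lemma TCinf_chart:
  assumes "F \<in> T.Cinf" "(U, \<phi>) \<in> A"
  shows "smooth_on (\<phi> ` U \<times> UNIV) (\<lambda>z. F (inv_into (tdom U) (tmap U \<phi>) z))"
  using T.Cinf_chart'[OF assms(1) bundle_chart[OF assms(2)]] by (simp add: tmap_image[OF assms(2)])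

lemma pr_pull_Cinf [simp]:
  assumes f: "f \<in> Cinf"
  shows "pr_pull A f \<in> T.Cinf"
proof (rule TCinfI)
  fix U \<phi> assume c: "(U, \<phi>) \<in> A"
  have o: "open (\<phi> ` U \<times> (UNIV :: 'e set))" using chart_open[OF c] by (simp add: open_Times)
  show "smooth_on (\<phi> ` U \<times> UNIV) (\<lambda>z. pr_pull A f (inv_into (tdom U) (tmap U \<phi>) z))"
    by (rule smooth_on_cong[OF o _ smooth_base[OF c f]])
      (use tinv[OF c] tdom_TCar[OF c] in \<open>simp add: pr_pull_def\<close>)
qed (simp add: pr_pull_def)

lemma fun_lift_Cinf [simp]: "Y \<in> Vec \<Longrightarrow> fun_lift A Y \<in> T.Cinf"
  by (rule TCinfI) (simp_all add: fun_lift_def[of A Y] smooth_fun_lift[unfolded fun_lift_def])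

lemma pr_pull_add: "pr_pull A (f + g) = pr_pull A f + pr_pull A g"
  and pr_pull_diff: "pr_pull A (f - g) = pr_pull A f - pr_pull A g"
  and pr_pull_minus: "pr_pull A (- f) = - pr_pull A f"
  and pr_pull_mult: "pr_pull A (f * g) = pr_pull A f * pr_pull A g"
  and pr_pull_scale: "pr_pull A (\<lambda>x. c * f x) = (\<lambda>x. c * pr_pull A f x)"
  and pr_pull_zero: "pr_pull A 0 = 0"
  by (auto simp: pr_pull_def fun_eq_iff)

lemmas pr_pull_ring = pr_pull_add pr_pull_diff pr_pull_minus pr_pull_mult pr_pull_zero

lemma fun_lift_at: "(p, \<zeta>) \<in> TCar \<Longrightarrow> fun_lift A Y (p, \<zeta>) = \<zeta> (Y p)"
  by (simp add: fun_lift_def)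

lemma pr_pull_at: "(p, \<zeta>) \<in> TCar \<Longrightarrow> pr_pull A f (p, \<zeta>) = f p"
  by (simp add: pr_pull_def)

lemma fun_lift_eqI:
  assumes "\<And>p \<zeta>. p \<in> Car \<Longrightarrow> \<zeta> \<in> Cot p \<Longrightarrow> \<zeta> (Y p) = F (p, \<zeta>)" "\<And>\<xi>. \<xi> \<notin> TCar \<Longrightarrow> F \<xi> = 0"
  shows "fun_lift A Y = F"
proof
  fix \<xi> show "fun_lift A Y \<xi> = F \<xi>"
    using assms(1)[of "fst \<xi>" "snd \<xi>"] assms(2)[of \<xi>] TCar_fst[of \<xi>] TCar_snd[of \<xi>]
    by (auto simp: fun_lift_def)
qed

lemma fun_lift_off: "\<xi> \<notin> TCar \<Longrightarrow> fun_lift A Y \<xi> = 0"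
  and pr_pull_off: "\<xi> \<notin> TCar \<Longrightarrow> pr_pull A f \<xi> = 0"
  by (simp_all add: fun_lift_def pr_pull_def)

lemma fun_lift_add:
  assumes "Y \<in> Vec" "Z \<in> Vec"
  shows "fun_lift A (Y + Z) = fun_lift A Y + fun_lift A Z"
proof (rule fun_lift_eqI)
  fix p \<zeta> assume p: "p \<in> Car" and \<zeta>: "\<zeta> \<in> Cot p"
  then show "\<zeta> ((Y + Z) p) = (fun_lift A Y + fun_lift A Z) (p, \<zeta>)"
    using cotan_add[OF \<zeta> Vec_Tan[OF assms(1) p] Vec_Tan[OF assms(2) p]] by (simp add: fun_lift_at TCar_iff)
qed (simp add: fun_lift_off)

lemma fun_lift_mult:
  assumes "Y \<in> Vec"
  shows "fun_lift A (vf_mult f Y) = pr_pull A f * fun_lift A Y"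
proof (rule fun_lift_eqI)
  fix p \<zeta> assume p: "p \<in> Car" and \<zeta>: "\<zeta> \<in> Cot p"
  then show "\<zeta> (vf_mult f Y p) = (pr_pull A f * fun_lift A Y) (p, \<zeta>)"
    using cotan_scale[OF \<zeta> Vec_Tan[OF assms(1) p]] by (simp add: vf_mult_def fun_lift_at pr_pull_at TCar_iff)
qed (simp add: fun_lift_off)

lemma fun_lift_zero: "fun_lift A 0 = 0"
proof (rule fun_lift_eqI)
  fix p \<zeta> assume "\<zeta> \<in> Cot p"
  then show "\<zeta> (0 p) = 0 (p, \<zeta>)" using cotan_zero by simp
qed simp

lemma fun_lift_minus: "Y \<in> Vec \<Longrightarrow> fun_lift A (- Y) = - fun_lift A Y"
  using fun_lift_add[of Y "- Y"] fun_lift_zero by (simp add: fun_eq_iff add_eq_0_iff2)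

lemma fun_lift_diff: "Y \<in> Vec \<Longrightarrow> Z \<in> Vec \<Longrightarrow> fun_lift A (Y - Z) = fun_lift A Y - fun_lift A Z"
  using fun_lift_add[of Y "- Z"] by (simp add: fun_lift_minus)

lemmas fun_lift_lin = fun_lift_add fun_lift_diff fun_lift_minus fun_lift_mult fun_lift_zero

subsection \<open>A tangent vector is determined by its action on lifted functions\<close>

text \<open>The natural coordinates near a point as global functions. A basis vector of the product space is
  \<open>(b, 0)\<close>, for a base coordinate, or \<open>(0, b)\<close>, for a fibre coordinate.\<close>
definition tcoord :: "('e \<Rightarrow> 'a \<Rightarrow> real) \<Rightarrow> ('e \<Rightarrow> 'a vfield) \<Rightarrow> 'e \<times> 'e \<Rightarrow> 'a covec \<Rightarrow> real" where
  "tcoord y G B = (if snd B = 0 then pr_pull A (y (fst B)) else fun_lift A (G (snd B)))"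

lemma Basis_prod_cases:
  assumes "B \<in> (Basis :: ('e \<times> 'e) set)"
  obtains b where "b \<in> Basis" "B = (b, 0)" | b where "b \<in> Basis" "B = (0, b)" "b \<noteq> 0"
  using assms by (auto simp: Basis_prod_def)

lemma tcoord_Cinf: "frame \<mu> y G \<Longrightarrow> B \<in> Basis \<Longrightarrow> tcoord y G B \<in> T.Cinf"
  using frame_Cinf(2)[of \<mu> y G] frame_Cinf(3)[of \<mu> y G]
  by (elim Basis_prod_cases) (simp_all add: tcoord_def)

text \<open>The setting shared by the next arguments: a coordinate frame at the base point of \<open>\<xi>\<close>.\<close>
lemma bundle_coordinates:
  assumes \<xi>: "\<xi> \<in> TCar"
  obtains U \<phi> \<mu> y G N where "(U, \<phi>) \<in> A" "frame \<mu> y G" "\<mu> (fst \<xi>) = 1" "open N"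
    "\<xi> \<in> tdom U" "tmap U \<phi> \<xi> \<in> N"
    "\<And>\<xi>. \<xi> \<in> tdom U \<Longrightarrow> tmap U \<phi> \<xi> \<in> N \<Longrightarrow> \<mu> (fst \<xi>) \<noteq> 0"
    "\<And>\<xi> B. B \<in> Basis \<Longrightarrow> \<xi> \<in> tdom U \<Longrightarrow> tmap U \<phi> \<xi> \<in> N \<Longrightarrow> tcoord y G B \<xi> = tmap U \<phi> \<xi> \<bullet> B"
proof -
  let ?p = "fst \<xi>"
  obtain U \<phi> where c: "(U, \<phi>) \<in> A" "?p \<in> U" using Car_chart[OF TCar_fst[OF \<xi>]] by blast
  obtain \<mu> y G where fr: "frame \<mu> y G" "\<mu> ?p = 1"
    and y: "\<And>q b. \<mu> q \<noteq> 0 \<Longrightarrow> b \<in> Basis \<Longrightarrow> y b q = \<phi> q \<bullet> b"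
    and G: "\<And>q b. \<mu> q \<noteq> 0 \<Longrightarrow> b \<in> Basis \<Longrightarrow> G b q = coord_vec A (U, \<phi>) q b"
    by (rule coordinate_frame[OF c open_UNIV UNIV_I]) blast
  define N where "N = (\<phi> ` U \<inter> (\<lambda>x. \<mu> (inv_into U \<phi> x)) -` (- {0})) \<times> (UNIV :: 'e set)"
  show ?thesis
  proof (rule that[OF c(1) fr, of N])
    show "open N" unfolding N_def
      using open_nonzero[OF c(1) frame_Cinf(1)[OF fr(1)]] by (simp add: open_Times)
    show t: "\<xi> \<in> tdom U" using c TCar_snd[OF \<xi>] by (simp add: tdom_def split_beta)
    show "tmap U \<phi> \<xi> \<in> N"
      using c fr(2) chart_inv[OF c] by (simp add: N_def tmap_def split_beta)
    show nz: "\<mu> (fst \<xi>) \<noteq> 0" if "\<xi> \<in> tdom U" "tmap U \<phi> \<xi> \<in> N" for \<xi>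
      using that chart_inv[OF c(1)] by (auto simp: N_def tmap_def tdom_def split_beta)
    show "tcoord y G B \<xi> = tmap U \<phi> \<xi> \<bullet> B"
      if B: "B \<in> Basis" and \<xi>: "\<xi> \<in> tdom U" "tmap U \<phi> \<xi> \<in> N" for \<xi> B
      using B
    proof (cases rule: Basis_prod_cases)
      case (1 b)
      have "tmap U \<phi> \<xi> \<bullet> B = fst (tmap U \<phi> \<xi>) \<bullet> b" by (simp add: 1 inner_prod_def)
      then show ?thesis
        using y[OF nz[OF \<xi>] 1(1)] tmap_fst[of U \<phi> \<xi>] tdom_TCar[OF c(1) \<xi>(1)] 1
        by (simp add: tcoord_def pr_pull_def)
    next
      case (2 b)
      have "tmap U \<phi> \<xi> \<bullet> B = snd (tmap U \<phi> \<xi>) \<bullet> b" by (simp add: 2 inner_prod_def)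
      then show ?thesis
        using G[OF nz[OF \<xi>] 2(1)] tmap_snd[OF 2(1), of U \<phi> \<xi>] tdom_TCar[OF c(1) \<xi>(1)] 2
        by (simp add: tcoord_def fun_lift_def)
    qed
  qed
qed

text \<open>Each natural coordinate is, near the point, a function of one of the two kinds.\<close>
lemma tangent_bundle_eqI:
  assumes \<xi>: "\<xi> \<in> TCar" and w: "w \<in> T.Tan \<xi>" "w' \<in> T.Tan \<xi>"
    and f: "\<And>f. f \<in> Cinf \<Longrightarrow> w (pr_pull A f) = w' (pr_pull A f)"
    and Y: "\<And>Y. Y \<in> Vec \<Longrightarrow> w (fun_lift A Y) = w' (fun_lift A Y)"
  shows "w = w'"
proof (rule T.tan_eqI[OF w])
  fix F assume F: "F \<in> T.Cinf"
  obtain U \<phi> \<mu> y G N where c: "(U, \<phi>) \<in> A" and fr: "frame \<mu> y G" and N: "open N"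
    and t: "\<xi> \<in> tdom U" "tmap U \<phi> \<xi> \<in> N"
    and co: "\<And>\<xi> B. B \<in> Basis \<Longrightarrow> \<xi> \<in> tdom U \<Longrightarrow> tmap U \<phi> \<xi> \<in> N \<Longrightarrow> tcoord y G B \<xi> = tmap U \<phi> \<xi> \<bullet> B"
    by (rule bundle_coordinates[OF \<xi>]) blast
  note ex = T.tangent_expand[OF bundle_chart[OF c] t(1) _ N t(2) tcoord_Cinf[OF fr] co F]
  have "w (tcoord y G B) = w' (tcoord y G B)" if "B \<in> Basis" for B
    using that by (rule Basis_prod_cases) (auto simp: tcoord_def intro: f Y frame_Cinf[OF fr])
  then show "w F = w' F" using ex[OF w(1)] ex[OF w(2)] by simp
qed

text \<open>The compatible data \<open>P\<close> on functions and \<open>L\<close> on vector fields are those that a vector field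
  on the bundle induces; they prescribe its coordinates, hence a vector field.\<close>
lemma vector_field_from_action:
  fixes P :: "('a \<Rightarrow> real) \<Rightarrow> 'a covec \<Rightarrow> real" and L :: "'a vfield \<Rightarrow> 'a covec \<Rightarrow> real"
  assumes P: "\<And>f. f \<in> Cinf \<Longrightarrow> P f \<in> T.Cinf"
    and Padd: "\<And>f g. f \<in> Cinf \<Longrightarrow> g \<in> Cinf \<Longrightarrow> P (f + g) = P f + P g"
    and Pmult: "\<And>f g. f \<in> Cinf \<Longrightarrow> g \<in> Cinf \<Longrightarrow> P (f * g) = pr_pull A f * P g + pr_pull A g * P f"
    and Pscale: "\<And>f c. f \<in> Cinf \<Longrightarrow> P (\<lambda>x. c * f x) = (\<lambda>x. c * P f x)"
    and L: "\<And>Y. Y \<in> Vec \<Longrightarrow> L Y \<in> T.Cinf"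
    and Ladd: "\<And>Y Z. Y \<in> Vec \<Longrightarrow> Z \<in> Vec \<Longrightarrow> L (Y + Z) = L Y + L Z"
    and Lmult: "\<And>f Y. f \<in> Cinf \<Longrightarrow> Y \<in> Vec \<Longrightarrow> L (vf_mult f Y) = P f * fun_lift A Y + pr_pull A f * L Y"
  obtains W where "W \<in> T.Vec" "\<And>f. f \<in> Cinf \<Longrightarrow> vf_app W (pr_pull A f) = P f"
    "\<And>Y. Y \<in> Vec \<Longrightarrow> vf_app W (fun_lift A Y) = L Y"
proof -
  define good where "good \<xi> w \<longleftrightarrow> w \<in> T.Tan \<xi> \<and> (\<forall>f\<in>Cinf. w (pr_pull A f) = P f \<xi>) \<and>
    (\<forall>Y\<in>Vec. w (fun_lift A Y) = L Y \<xi>)" for \<xi> w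
  define co where "co y G B = (if snd B = 0 then P (y (fst B)) else L (G (snd B)))"
    for y :: "'e \<Rightarrow> 'a \<Rightarrow> real" and G and B :: "'e \<times> 'e"
  have coC: "co y G B \<in> T.Cinf" if "frame \<mu> y G" "B \<in> Basis" for \<mu> y G B
    using that(2) by (rule Basis_prod_cases) (auto simp: co_def intro!: P L frame_Cinf[OF that(1)])
  have local: "good \<xi> (\<lambda>F. \<Sum>B\<in>Basis. co y G B \<xi> * coord_vec TB (tdom U, tmap U \<phi>) \<xi> B F)"
    if c: "(U, \<phi>) \<in> A" and fr: "frame \<mu> y G" and N: "open N" and t: "\<xi> \<in> tdom U" "tmap U \<phi> \<xi> \<in> N"
      and nz: "\<And>\<xi>. \<xi> \<in> tdom U \<Longrightarrow> tmap U \<phi> \<xi> \<in> N \<Longrightarrow> \<mu> (fst \<xi>) \<noteq> 0"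
      and tc: "\<And>\<xi> B. B \<in> Basis \<Longrightarrow> \<xi> \<in> tdom U \<Longrightarrow> tmap U \<phi> \<xi> \<in> N \<Longrightarrow> tcoord y G B \<xi> = tmap U \<phi> \<xi> \<bullet> B"
    for U \<phi> \<mu> y G N \<xi>
  proof -
    let ?p = "fst \<xi>" and ?w = "\<lambda>F. \<Sum>B\<in>Basis. co y G B \<xi> * coord_vec TB (tdom U, tmap U \<phi>) \<xi> B F"
    have \<xi>C: "\<xi> \<in> TCar" by (rule tdom_TCar[OF c t(1)])
    then have pC: "?p \<in> Car" by (rule TCar_fst)
    have \<xi>e: "(?p, snd \<xi>) \<in> TCar" using \<xi>C by simp
    have w: "?w \<in> T.Tan \<xi>"
      by (rule T.Tan_lincomb) (rule T.coord_vec_Tan[OF bundle_chart[OF c] t(1)])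
    have wt: "?w (tcoord y G B') = co y G B' \<xi>" if B': "B' \<in> Basis" for B'
    proof -
      have "?w (tcoord y G B') = (\<Sum>B\<in>Basis. co y G B \<xi> * (B \<bullet> B'))"
        by (rule sum.cong[OF refl], subst T.coord_vec_coordinate[OF bundle_chart[OF c] t(1) N t(2)
          tcoord_Cinf[OF fr B'] tc[OF B']]) simp_all
      also have "\<dots> = (\<Sum>B\<in>Basis. if B = B' then co y G B \<xi> else 0)"
        by (rule sum.cong[OF refl]) (simp add: inner_Basis B')
      finally show ?thesis using B' by simp
    qed
    have wy: "?w (pr_pull A (y b)) = P (y b) \<xi>" if "b \<in> Basis" for b
      using wt[of "(b, 0)"] that by (simp add: tcoord_def co_def Basis_prod_def)
    have wG: "?w (fun_lift A (G b)) = L (G b) \<xi>" if b: "b \<in> Basis" for b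
      using wt[of "(0, b)"] b nonzero_Basis[OF b] by (simp add: tcoord_def co_def Basis_prod_def)
    \<comment> \<open>both sides are derivations at the base point that agree on the coordinates\<close>
    have wP: "?w (pr_pull A f) = P f \<xi>" if f: "f \<in> Cinf" for f
    proof -
      let ?v = "\<lambda>f. if f \<in> Cinf then ?w (pr_pull A f) else 0" and ?v' = "\<lambda>f. if f \<in> Cinf then P f \<xi> else 0"
      have v: "?v \<in> Tan ?p"
        using T.tan_add[OF w] T.tan_mult[OF w] T.tan_scale[OF w] pr_pull_at[OF \<xi>e]
        unfolding tangent_space_def mem_Collect_eq by (simp add: pr_pull_ring pr_pull_scale)
      have v': "?v' \<in> Tan ?p"
        using pr_pull_at[OF \<xi>e] unfolding tangent_space_def mem_Collect_eq
        by (simp add: Padd Pmult Pscale)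
      have "?v (y b) = ?v' (y b)" if "b \<in> Basis" for b
        using wy[OF that] frame_Cinf(2)[OF fr that] by simp
      then have "?v f = ?v' f"
        using frame_expand[OF fr nz[OF t] v, of f] frame_expand[OF fr nz[OF t] v', of f]
        by (simp only: cong: sum.cong)
      then show ?thesis using f by simp
    qed
    \<comment> \<open>the difference is linear over functions, by wP, and vanishes on the frame\<close>
    have wL: "?w (fun_lift A Y) = L Y \<xi>" if Y: "Y \<in> Vec" for Y
    proof -
      let ?D = "\<lambda>Y. ?w (fun_lift A Y) - L Y \<xi>"
      have add: "?D (Y + Z) = ?D Y + ?D Z" if "Y \<in> Vec" "Z \<in> Vec" for Y Z
        using that T.tan_add[OF w, of "fun_lift A Y" "fun_lift A Z"] by (simp add: fun_lift_add Ladd)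
      have mult: "?D (vf_mult f Y) = f ?p * ?D Y" if "f \<in> Cinf" "Y \<in> Vec" for f Y
        using that T.tan_mult[OF w, of "pr_pull A f" "fun_lift A Y"] pr_pull_at[OF \<xi>e, of f] wP[OF that(1)]
        by (simp add: fun_lift_mult Lmult algebra_simps)
      have "\<mu> ?p * ?D Y = (\<Sum>b\<in>Basis. \<mu> ?p * vf_app Y (y b) ?p * ?D (G b))"
        by (rule vector_functional[where L="?D", OF fr add mult Y])
      also have "\<dots> = 0" by (rule sum.neutral, rule ballI) (simp only: wG diff_self mult_zero_right)
      finally have "?D Y = 0" using nz[OF t] by simp
      then show ?thesis by (simp only: right_minus_eq)
    qed
    show ?thesis unfolding good_def using w wP wL by blast
  qed
  have uniq: "w = w'" if "\<xi> \<in> TCar" "good \<xi> w" "good \<xi> w'" for \<xi> w w'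
    using that unfolding good_def by (intro tangent_bundle_eqI[OF that(1)]) auto
  define W where "W \<xi> = (if \<xi> \<in> TCar then (THE w. good \<xi> w) else 0)" for \<xi>
  have Wg: "W \<xi> = w" if "\<xi> \<in> TCar" "good \<xi> w" for \<xi> w
    using that uniq[OF that(1)] by (auto simp: W_def intro!: the_equality)
  have ex: "good \<xi> (W \<xi>)" if \<xi>: "\<xi> \<in> TCar" for \<xi>
  proof -
    obtain U \<phi> \<mu> y G N where c: "(U, \<phi>) \<in> A" and fr: "frame \<mu> y G" and N: "open N"
      and t: "\<xi> \<in> tdom U" "tmap U \<phi> \<xi> \<in> N"
      and nz: "\<And>\<xi>. \<xi> \<in> tdom U \<Longrightarrow> tmap U \<phi> \<xi> \<in> N \<Longrightarrow> \<mu> (fst \<xi>) \<noteq> 0"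
      and co: "\<And>\<xi> B. B \<in> Basis \<Longrightarrow> \<xi> \<in> tdom U \<Longrightarrow> tmap U \<phi> \<xi> \<in> N \<Longrightarrow> tcoord y G B \<xi> = tmap U \<phi> \<xi> \<bullet> B"
      by (rule bundle_coordinates[OF \<xi>]) blast
    note g = local[OF c fr N t nz co]
    show ?thesis using Wg[OF \<xi> g] g by (simp only:)
  qed
  have WV: "W \<in> T.Vec"
  proof (rule T.VecI)
    show "W \<xi> \<in> T.Tan \<xi>" if "\<xi> \<in> TCar" for \<xi> using ex[OF that] by (simp add: good_def)
    show "W \<xi> = 0" if "\<xi> \<notin> TCar" for \<xi> using that by (simp add: W_def)
    fix F assume F: "F \<in> T.Cinf"
    show "vf_app W F \<in> T.Cinf"
    proof (rule T.Cinf_local)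
      show "vf_app W F \<xi> = 0" if "\<xi> \<notin> TCar" for \<xi> using that by (simp add: vf_app_def W_def)
      fix \<xi> assume \<xi>: "\<xi> \<in> TCar"
      obtain U \<phi> \<mu> y G N where c: "(U, \<phi>) \<in> A" and fr: "frame \<mu> y G" and N: "open N"
        and t: "\<xi> \<in> tdom U" "tmap U \<phi> \<xi> \<in> N"
        and nz: "\<And>\<xi>. \<xi> \<in> tdom U \<Longrightarrow> tmap U \<phi> \<xi> \<in> N \<Longrightarrow> \<mu> (fst \<xi>) \<noteq> 0"
        and co: "\<And>\<xi> B. B \<in> Basis \<Longrightarrow> \<xi> \<in> tdom U \<Longrightarrow> tmap U \<phi> \<xi> \<in> N \<Longrightarrow> tcoord y G B \<xi> = tmap U \<phi> \<xi> \<bullet> B"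
        by (rule bundle_coordinates[OF \<xi>]) blast
      obtain \<theta> z H where fT: "T.frame \<theta> z H" "\<theta> \<xi> = 1"
        and supp: "\<And>\<xi>. \<theta> \<xi> \<noteq> 0 \<Longrightarrow> \<xi> \<in> tdom U \<and> tmap U \<phi> \<xi> \<in> N"
        and H: "\<And>\<xi> B. \<theta> \<xi> \<noteq> 0 \<Longrightarrow> B \<in> Basis \<Longrightarrow> H B \<xi> = coord_vec TB (tdom U, tmap U \<phi>) \<xi> B"
        by (rule T.coordinate_frame[OF bundle_chart[OF c] t(1) N t(2)]) blast
      let ?S = "\<Sum>B\<in>Basis. \<theta> * (co y G B * vf_app (H B) F)"
      have "?S \<in> T.Cinf"
        by (rule T.Cinf_sum)
          (use T.frame_Cinf[OF fT(1)] coC[OF fr] F in \<open>auto intro!: T.Cinf_mult T.Vec_app\<close>)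
      moreover have "?S = \<theta> * vf_app W F"
      proof
        fix \<xi>'
        show "?S \<xi>' = (\<theta> * vf_app W F) \<xi>'"
        proof (cases "\<theta> \<xi>' = 0")
          case False
          then have t': "\<xi>' \<in> tdom U" "tmap U \<phi> \<xi>' \<in> N" using supp by auto
          have "W \<xi>' F = (\<Sum>B\<in>Basis. co y G B \<xi>' * coord_vec TB (tdom U, tmap U \<phi>) \<xi>' B F)"
            using Wg[OF tdom_TCar[OF c t'(1)] local[OF c fr N t' nz co]] by (simp only:)
          then show ?thesis
            using H[OF False] by (simp add: sum_fun_apply vf_app_def sum_distrib_left)
        qed (simp add: sum_fun_apply)
      qed
      ultimately show "\<exists>\<mu>\<in>T.Cinf. \<mu> \<xi> \<noteq> 0 \<and> \<mu> * vf_app W F \<in> T.Cinf"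
        using T.frame_Cinf(1)[OF fT(1)] fT(2) by (metis zero_neq_one)
    qed
  qed
  show ?thesis
  proof (rule that[OF WV])
    show "vf_app W (pr_pull A f) = P f" if "f \<in> Cinf" for f
    proof (rule T.vf_app_eqI[OF WV])
      show "P f \<xi> = 0" if "\<xi> \<notin> TCar" for \<xi> using T.Cinf_off[OF P[OF \<open>f \<in> Cinf\<close>] that] .
    qed (use ex that in \<open>auto simp: good_def\<close>)
    show "vf_app W (fun_lift A Y) = L Y" if "Y \<in> Vec" for Y
    proof (rule T.vf_app_eqI[OF WV])
      show "L Y \<xi> = 0" if "\<xi> \<notin> TCar" for \<xi> using T.Cinf_off[OF L[OF \<open>Y \<in> Vec\<close>] that] .
    qed (use ex that in \<open>auto simp: good_def\<close>)
  qed
qed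

subsection \<open>Fibre lines and sections\<close>

definition line :: "'a \<Rightarrow> ('a tvec \<Rightarrow> real) \<Rightarrow> ('a tvec \<Rightarrow> real) \<Rightarrow> real \<Rightarrow> 'a covec" where
  "line p \<zeta> \<theta> s = (p, \<lambda>v. \<zeta> v + s * \<theta> v)"

lemma Cot_lin: "\<zeta> \<in> Cot p \<Longrightarrow> \<theta> \<in> Cot p \<Longrightarrow> (\<lambda>v. \<zeta> v + s * \<theta> v) \<in> Cot p"
  by (simp add: cotangent_space_def algebra_simps)

lemma line_TCar: "p \<in> Car \<Longrightarrow> \<zeta> \<in> Cot p \<Longrightarrow> \<theta> \<in> Cot p \<Longrightarrow> line p \<zeta> \<theta> s \<in> TCar"
  by (simp add: line_def TCar_iff Cot_lin)

lemma line_differentiable: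
  assumes p: "p \<in> Car" and \<zeta>: "\<zeta> \<in> Cot p" and \<theta>: "\<theta> \<in> Cot p" and F: "F \<in> T.Cinf"
  shows "(\<lambda>s. F (line p \<zeta> \<theta> s)) differentiable (at s)"
proof -
  obtain U \<phi> where c: "(U, \<phi>) \<in> A" "p \<in> U" using Car_chart[OF p] by blast
  let ?u = "\<Sum>b\<in>Basis. \<zeta> (coord_vec A (U, \<phi>) p b) *\<^sub>R b" and ?w = "\<Sum>b\<in>Basis. \<theta> (coord_vec A (U, \<phi>) p b) *\<^sub>R b"
  let ?i = "inv_into (tdom U) (tmap U \<phi>)"
  have t: "line p \<zeta> \<theta> s \<in> tdom U" for s using c Cot_lin[OF \<zeta> \<theta>] by (simp add: line_def tdom_def)
  have m: "tmap U \<phi> (line p \<zeta> \<theta> s) = (\<phi> p, ?u + s *\<^sub>R ?w)" for s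
    by (simp add: tmap_def line_def scaleR_add_left sum.distrib scaleR_sum_right)
  have e: "F (line p \<zeta> \<theta> s) = F (?i (\<phi> p, ?u + s *\<^sub>R ?w))" for s
    using tinv_map[OF c(1) t, of s] by (simp only: m)
  have d: "((\<lambda>s. (\<phi> p, ?u + s *\<^sub>R ?w)) has_derivative (\<lambda>h. (0, h *\<^sub>R ?w))) (at s)"
    by (auto intro!: derivative_eq_intros)
  have "(\<lambda>z. F (?i z)) differentiable (at (\<phi> p, ?u + s *\<^sub>R ?w))"
    by (rule smooth_on_differentiable[OF TCinf_chart[OF F c(1)]]) (use c in auto)
  then obtain D where "((\<lambda>z. F (?i z)) has_derivative D) (at (\<phi> p, ?u + s *\<^sub>R ?w))"
    by (auto simp: differentiable_def)
  from has_derivative_compose[OF d this] show ?thesis unfolding e differentiable_def by blast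
qed

lemma line_deriv:
  assumes "p \<in> Car" "\<zeta> \<in> Cot p" "\<theta> \<in> Cot p" "F \<in> T.Cinf"
  shows "((\<lambda>s. F (line p \<zeta> \<theta> s)) has_real_derivative deriv (\<lambda>s. F (line p \<zeta> \<theta> s)) s) (at s)"
  using line_differentiable[OF assms] by (simp add: DERIV_deriv_iff_real_differentiable)

lemma line_tangent:
  assumes p: "p \<in> Car" and \<zeta>: "\<zeta> \<in> Cot p" and \<theta>: "\<theta> \<in> Cot p"
  shows "(\<lambda>F. if F \<in> T.Cinf then deriv (\<lambda>s. F (line p \<zeta> \<theta> s)) t else 0) \<in> T.Tan (line p \<zeta> \<theta> t)"
proof -
  note d = line_deriv[OF p \<zeta> \<theta>]
  have "deriv (\<lambda>s. (F + G) (line p \<zeta> \<theta> s)) t = deriv (\<lambda>s. F (line p \<zeta> \<theta> s)) t + deriv (\<lambda>s. G (line p \<zeta> \<theta> s)) t"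
    if "F \<in> T.Cinf" "G \<in> T.Cinf" for F G
    using DERIV_imp_deriv[OF DERIV_add[OF d[OF that(1)] d[OF that(2)]]] by simp
  moreover have "deriv (\<lambda>s. (F * G) (line p \<zeta> \<theta> s)) t =
      F (line p \<zeta> \<theta> t) * deriv (\<lambda>s. G (line p \<zeta> \<theta> s)) t + G (line p \<zeta> \<theta> t) * deriv (\<lambda>s. F (line p \<zeta> \<theta> s)) t"
    if "F \<in> T.Cinf" "G \<in> T.Cinf" for F G
    using DERIV_imp_deriv[OF DERIV_mult[OF d[OF that(1)] d[OF that(2)]]] by (simp add: mult.commute)
  moreover have "deriv (\<lambda>s. c * F (line p \<zeta> \<theta> s)) t = c * deriv (\<lambda>s. F (line p \<zeta> \<theta> s)) t"
    if "F \<in> T.Cinf" for F c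
    using DERIV_imp_deriv[OF DERIV_cmult[OF d[OF that]]] by simp
  ultimately show ?thesis by (simp add: tangent_space_def)
qed

text \<open>Any vector field acting as the vertical lift of \<open>\<theta>\<close> differentiates along the fibre line.\<close>
lemma line_derivative_vertical:
  assumes p: "p \<in> Car" and \<zeta>: "\<zeta> \<in> Cot p" and \<theta>: "\<theta> \<in> Cot p" and F: "F \<in> T.Cinf"
    and W: "W \<in> T.Vec" "\<And>f. f \<in> Cinf \<Longrightarrow> vf_app W (pr_pull A f) (line p \<zeta> \<theta> t) = 0"
      "\<And>Y. Y \<in> Vec \<Longrightarrow> vf_app W (fun_lift A Y) (line p \<zeta> \<theta> t) = \<theta> (Y p)"
  shows "((\<lambda>s. F (line p \<zeta> \<theta> s)) has_real_derivative vf_app W F (line p \<zeta> \<theta> t)) (at t)"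
proof -
  let ?w = "\<lambda>F. if F \<in> T.Cinf then deriv (\<lambda>s. F (line p \<zeta> \<theta> s)) t else 0"
  note l = line_TCar[OF p \<zeta> \<theta>]
  have "?w = W (line p \<zeta> \<theta> t)"
  proof (rule tangent_bundle_eqI[OF l line_tangent[OF p \<zeta> \<theta>] T.Vec_Tan[OF W(1) l]])
    show "?w (pr_pull A f) = W (line p \<zeta> \<theta> t) (pr_pull A f)" if "f \<in> Cinf" for f
      using W(2)[OF that] l that by (simp add: vf_app_def pr_pull_def) (simp add: line_def)
    show "?w (fun_lift A Y) = W (line p \<zeta> \<theta> t) (fun_lift A Y)" if Y: "Y \<in> Vec" for Y
    proof -
      have "((\<lambda>s. \<zeta> (Y p) + s * \<theta> (Y p)) has_real_derivative \<theta> (Y p)) (at t)"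
        by (auto intro!: derivative_eq_intros)
      moreover have "fun_lift A Y (line p \<zeta> \<theta> s) = \<zeta> (Y p) + s * \<theta> (Y p)" for s
        using l[of s] by (simp add: fun_lift_def line_def)
      ultimately have "deriv (\<lambda>s. fun_lift A Y (line p \<zeta> \<theta> s)) t = \<theta> (Y p)"
        by (simp add: DERIV_imp_deriv)
      then show ?thesis using W(3)[OF Y] Y by (simp add: vf_app_def)
    qed
  qed
  then have "vf_app W F (line p \<zeta> \<theta> t) = ?w F"
    unfolding vf_app_def by (rule fun_cong[OF sym])
  then show ?thesis using line_deriv[OF p \<zeta> \<theta> F, of t] F by simp
qed

text \<open>Applying \<open>W\<close> to \<open>(fY)\<^sup>v = (f \<circ> pr) Y\<^sup>v\<close> gives \<open>W(f \<circ> pr) Y\<^sup>v = 0\<close>. So \<open>W(f \<circ> pr)\<close> vanishes off the zero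
  section, which is nowhere dense because the dimension is positive, and hence everywhere.\<close>
lemma vertical_unique:
  assumes W: "W \<in> T.Vec" and z: "\<And>Y. Y \<in> Vec \<Longrightarrow> vf_app W (fun_lift A Y) = 0"
  shows "W = 0"
proof -
  have f0: "vf_app W (pr_pull A f) = 0" if f: "f \<in> Cinf" for f
  proof
    fix \<xi>
    let ?F = "vf_app W (pr_pull A f)"
    have FC: "?F \<in> T.Cinf" using W f by simp
    have prod: "?F * fun_lift A Y = 0" if Y: "Y \<in> Vec" for Y
      using z[OF Vec_mult[OF f Y]] z[OF Y] T.vf_app_mult[OF W pr_pull_Cinf[OF f] fun_lift_Cinf[OF Y]]
      by (simp add: fun_lift_mult[OF Y] mult.commute)
    have nonzero: "?F (p, \<zeta>) = 0" if "(p, \<zeta>) \<in> TCar" "Y \<in> Vec" "\<zeta> (Y p) \<noteq> 0" for p \<zeta> Y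
      using fun_cong[OF prod[OF that(2)], of "(p, \<zeta>)"] fun_lift_at[OF that(1), of Y] that(3) by simp
    have "?F \<xi> = 0" if \<xi>: "\<xi> \<in> TCar"
    proof (cases "\<exists>Y\<in>Vec. snd \<xi> (Y (fst \<xi>)) \<noteq> 0")
      case True
      then show ?thesis using nonzero[of "fst \<xi>" "snd \<xi>"] \<xi> by auto
    next
      case False
      \<comment> \<open>approach the zero covector along the line spanned by a coordinate differential\<close>
      let ?p = "fst \<xi>" and ?\<zeta> = "snd \<xi>"
      have p: "?p \<in> Car" and \<zeta>: "?\<zeta> \<in> Cot ?p" using TCar_fst[OF \<xi>] TCar_snd[OF \<xi>] .
      obtain \<mu> y G where fr: "frame \<mu> y G" "\<mu> ?p = 1" by (rule frame_exists[OF p])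
      obtain b :: 'e where b: "b \<in> Basis" using nonempty_Basis by blast
      let ?\<theta> = "covec (differential A (y b)) ?p"
      have \<theta>: "?\<theta> \<in> Cot ?p" by (rule covec_Cot[OF Om_differential[OF frame_Cinf(2)[OF fr(1) b]] p])
      have \<theta>G: "?\<theta> (G b ?p) = 1"
        using covec_app[OF Om_differential[OF frame_Cinf(2)[OF fr(1) b]] p frame_Cinf(3)[OF fr(1) b]]
          frame_dual[OF fr(1) _ b b, of ?p] fr(2)
        by (simp add: differential_app[OF frame_Cinf(3)[OF fr(1) b]] vf_app_def)
      have nz: "?F (line ?p ?\<zeta> ?\<theta> s) = 0" if "s \<noteq> 0" for s
        unfolding line_def using False \<theta>G that frame_Cinf(3)[OF fr(1) b] line_TCar[OF p \<zeta> \<theta>, of s]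
        by (intro nonzero[of _ _ "G b"]) (auto simp: line_def)
      have "isCont (\<lambda>s. ?F (line ?p ?\<zeta> ?\<theta> s)) 0"
        by (rule DERIV_isCont[OF line_deriv[OF p \<zeta> \<theta> FC]])
      then have "((\<lambda>s. ?F (line ?p ?\<zeta> ?\<theta> s)) \<longlongrightarrow> ?F (line ?p ?\<zeta> ?\<theta> 0)) (at 0)"
        by (simp add: isCont_def)
      moreover have "((\<lambda>s. ?F (line ?p ?\<zeta> ?\<theta> s)) \<longlongrightarrow> 0) (at 0)"
        by (rule tendsto_eventually) (auto simp: eventually_at_filter nz)
      ultimately have "?F (line ?p ?\<zeta> ?\<theta> 0) = 0" by (rule tendsto_unique[OF at_neq_bot])
      then show ?thesis by (simp add: line_def)
    qed
    then show "?F \<xi> = 0 \<xi>" using T.Cinf_off[OF FC] by (cases "\<xi> \<in> TCar") simp_all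
  qed
  show ?thesis
  proof
    fix \<xi>
    show "W \<xi> = 0 \<xi>"
    proof (cases "\<xi> \<in> TCar")
      case True
      have "W \<xi> = 0"
      proof (rule tangent_bundle_eqI[OF True T.Vec_Tan[OF W True] T.Tan_zero])
        show "W \<xi> (pr_pull A f) = 0 (pr_pull A f)" if "f \<in> Cinf" for f
          using fun_cong[OF f0[OF that], of \<xi>] by (simp add: vf_app_def)
        show "W \<xi> (fun_lift A Y) = 0 (fun_lift A Y)" if "Y \<in> Vec" for Y
          using fun_cong[OF z[OF that], of \<xi>] by (simp add: vf_app_def)
      qed
      then show ?thesis by simp
    qed (simp add: T.Vec_off[OF W])
  qed
qed

lemma TVec_eqI:
  assumes "V \<in> T.Vec" "W \<in> T.Vec" "\<And>Y. Y \<in> Vec \<Longrightarrow> vf_app V (fun_lift A Y) = vf_app W (fun_lift A Y)"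
  shows "V = W"
proof -
  have "V - W = 0"
    by (rule vertical_unique) (use assms in \<open>simp_all add: vf_app_left\<close>)
  then show ?thesis by (simp only: right_minus_eq)
qed

text \<open>Pullback of a function on the bundle by a section, that is, by a differential form.\<close>
definition ev :: "'a form1 \<Rightarrow> ('a covec \<Rightarrow> real) \<Rightarrow> 'a \<Rightarrow> real" where
  "ev \<eta> F = (\<lambda>p. if p \<in> Car then F (p, covec \<eta> p) else 0)"

lemma sec_TCar: "\<eta> \<in> Om \<Longrightarrow> p \<in> Car \<Longrightarrow> (p, covec \<eta> p) \<in> TCar"
  by (simp add: TCar_iff covec_Cot)

lemma ev_at: "p \<in> Car \<Longrightarrow> ev \<eta> F p = F (p, covec \<eta> p)"
  by (simp add: ev_def)

lemma ev_add: "ev \<eta> (F + G) = ev \<eta> F + ev \<eta> G"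
  and ev_diff: "ev \<eta> (F - G) = ev \<eta> F - ev \<eta> G"
  and ev_minus: "ev \<eta> (- F) = - ev \<eta> F"
  and ev_mult: "ev \<eta> (F * G) = ev \<eta> F * ev \<eta> G"
  and ev_zero: "ev \<eta> 0 = 0"
  by (auto simp: ev_def fun_eq_iff)

lemmas ev_ring = ev_add ev_diff ev_minus ev_mult ev_zero

lemma ev_scale: "ev \<eta> (\<lambda>\<xi>. c * F \<xi>) = (\<lambda>p. c * ev \<eta> F p)"
  by (auto simp: ev_def fun_eq_iff)

lemma ev_pr_pull: "\<eta> \<in> Om \<Longrightarrow> f \<in> Cinf \<Longrightarrow> ev \<eta> (pr_pull A f) = f"
  using sec_TCar[of \<eta>] Cinf_off[of f] by (auto simp: ev_def pr_pull_def fun_eq_iff)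

lemma ev_fun_lift: "\<eta> \<in> Om \<Longrightarrow> Y \<in> Vec \<Longrightarrow> ev \<eta> (fun_lift A Y) = \<eta> Y"
  using sec_TCar[of \<eta>] Cinf_off[OF Om_app[of \<eta> Y]] covec_app[of \<eta> _ Y]
  by (auto simp: ev_def fun_lift_def fun_eq_iff)

text \<open>Every covector is the value of a one-form.\<close>
lemma ev_eqI:
  assumes "F \<in> T.Cinf" "G \<in> T.Cinf" "\<And>\<eta>. \<eta> \<in> Om \<Longrightarrow> ev \<eta> F = ev \<eta> G"
  shows "F = G"
proof
  fix \<xi>
  show "F \<xi> = G \<xi>"
  proof (cases "\<xi> \<in> TCar")
    case True
    obtain \<eta> where \<eta>: "\<eta> \<in> Om" "covec \<eta> (fst \<xi>) = snd \<xi>" by (rule covec_exists[OF TCar_fst[OF True] TCar_snd[OF True]])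
    then show ?thesis using fun_cong[OF assms(3)[OF \<eta>(1)], of "fst \<xi>"] TCar_fst[OF True] by (simp add: ev_at)
  qed (simp add: T.Cinf_off[OF assms(1)] T.Cinf_off[OF assms(2)])
qed

lemma ev_Cinf:
  assumes \<eta>: "\<eta> \<in> Om" and F: "F \<in> T.Cinf"
  shows "ev \<eta> F \<in> Cinf"
proof (rule CinfI)
  show "ev \<eta> F p = 0" if "p \<notin> Car" for p using that by (simp add: ev_def)
  fix U \<phi> assume c: "(U, \<phi>) \<in> A"
  let ?i = "inv_into (tdom U) (tmap U \<phi>)" and ?j = "inv_into U \<phi>"
  have o: "open (\<phi> ` U)" by (rule chart_open[OF c])
  let ?g = "\<lambda>b x. covec \<eta> (?j x) (coord_vec A (U, \<phi>) (?j x) b)"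
  have g: "smooth_on (\<phi> ` U) (?g b)" if b: "b \<in> Basis" for b
  proof (rule smooth_on_local)
    fix x assume "x \<in> \<phi> ` U"
    then obtain p where x: "x = \<phi> p" and p: "p \<in> U" by blast
    obtain \<mu> y G where fr: "frame \<mu> y G" "\<mu> p = 1"
      and G: "\<And>q b. \<mu> q \<noteq> 0 \<Longrightarrow> b \<in> Basis \<Longrightarrow> G b q = coord_vec A (U, \<phi>) q b"
      by (rule coordinate_frame[OF c p open_UNIV UNIV_I]) blast
    define N where "N = \<phi> ` U \<inter> (\<lambda>x. \<mu> (inv_into U \<phi> x)) -` (- {0})"
    have N: "open N" "\<phi> p \<in> N" "N \<subseteq> \<phi> ` U"
      unfolding N_def using open_nonzero[OF c frame_Cinf(1)[OF fr(1)]] p chart_inv[OF c p] fr(2) by auto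
    have "smooth_on N (\<lambda>x. \<eta> (G b) (?j x))"
      by (rule smooth_on_subset[OF Cinf_chart'[OF Om_app[OF \<eta> frame_Cinf(3)[OF fr(1) b]] c] N(3)])
    then have "smooth_on N (?g b)"
    proof (rule smooth_on_cong[OF N(1), rotated])
      fix x assume x: "x \<in> N"
      then have q: "\<mu> (?j x) \<noteq> 0" "?j x \<in> Car" using N chart_inv_Car[OF c] by (auto simp: N_def)
      show "\<eta> (G b) (?j x) = ?g b x"
        using covec_app[OF \<eta> q(2) frame_Cinf(3)[OF fr(1) b]] G[OF q(1) b] by simp
    qed
    then show "\<exists>N. open N \<and> x \<in> N \<and> smooth_on N (?g b)" using N x by blast
  qed
  have oT: "open (\<phi> ` U \<times> (UNIV :: 'e set))" using o by (simp add: open_Times)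
  have "smooth_on (\<phi> ` U) (\<lambda>x. F (?i (x, \<Sum>b\<in>Basis. ?g b x *\<^sub>R b)))"
    by (rule smooth_on_compose[OF o oT _ TCinf_chart[OF F c]])
      (auto intro!: smooth_on_Pair[OF o] smooth_on_ident[OF o] smooth_on_sum[OF o] smooth_on_scaleR[OF o]
        g smooth_on_const[OF o])
  then show "smooth_on (\<phi> ` U) (\<lambda>x. ev \<eta> F (?j x))"
  proof (rule smooth_on_cong[OF o, rotated])
    fix x assume x: "x \<in> \<phi> ` U"
    let ?\<xi> = "(?j x, covec \<eta> (?j x))"
    have "?\<xi> \<in> tdom U" using chart_inv_mem[OF x] chart_inv_Car[OF c x] covec_Cot[OF \<eta>] by (simp add: tdom_def)
    from tinv_map[OF c this] show "F (?i (x, \<Sum>b\<in>Basis. ?g b x *\<^sub>R b)) = ev \<eta> F (?j x)"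
      using x chart_inv_Car[OF c x] by (simp add: tmap_def ev_def f_inv_into_f)
  qed
qed

end

section \<open>Tensor calculus on the base\<close>

context manifold
begin

lemma form_mult_app: "form_mult f \<alpha> X = f * \<alpha> X"
  by (simp add: form_mult_def)

lemma form_sum_app: "\<alpha> \<in> Om \<Longrightarrow> (\<And>i. i \<in> I \<Longrightarrow> V i \<in> Vec) \<Longrightarrow> \<alpha> (\<Sum>i\<in>I. V i) = (\<Sum>i\<in>I. \<alpha> (V i))"
proof (induction I rule: infinite_finite_induct)
  case (insert i I)
  have "\<alpha> (V i + (\<Sum>i\<in>I. V i)) = \<alpha> (V i) + \<alpha> (\<Sum>i\<in>I. V i)"
    by (rule Om_add[OF insert.prems(1) _ Vec_sum]) (use insert.prems in auto)
  moreover have "\<alpha> (\<Sum>i\<in>I. V i) = (\<Sum>i\<in>I. \<alpha> (V i))" using insert by auto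
  ultimately show ?case by (simp only: sum.insert[OF insert.hyps])
qed (simp_all only: sum.infinite sum.empty not_False_eq_True Om_zero_app)

lemma frame_Om:
  assumes fr: "frame \<mu> y G" and \<beta>: "\<beta> \<in> Om"
  shows "form_mult \<mu> \<beta> = (\<Sum>b\<in>Basis. form_mult (\<mu> * \<beta> (G b)) (differential A (y b)))"
proof (rule form_eqI)
  note fC = frame_Cinf[OF fr]
  have bG: "\<beta> (G b) \<in> Cinf" if "b \<in> Basis" for b by (rule Om_app[OF \<beta> fC(3)[OF that]])
  show "form_mult \<mu> \<beta> \<in> Om" using fC \<beta> by simp
  show "(\<Sum>b\<in>Basis. form_mult (\<mu> * \<beta> (G b)) (differential A (y b))) \<in> Om"
    by (rule Om_sum) (use fC bG in simp)
  fix X assume X: "X \<in> Vec"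
  have "\<mu> * \<beta> X = \<beta> (vf_mult \<mu> X)" by (rule Om_mult[OF \<beta> fC(1) X, symmetric])
  also have "\<dots> = (\<Sum>b\<in>Basis. \<beta> (vf_mult (\<mu> * vf_app X (y b)) (G b)))"
    unfolding frame_Vec[OF fr X] by (rule form_sum_app[OF \<beta>]) (use fC X in simp)
  also have "\<dots> = (\<Sum>b\<in>Basis. (\<mu> * \<beta> (G b)) * vf_app X (y b))"
    by (rule sum.cong[OF refl]) (use fC X in \<open>simp add: Om_mult[OF \<beta>] mult_ac\<close>)
  finally show "form_mult \<mu> \<beta> X = (\<Sum>b\<in>Basis. form_mult (\<mu> * \<beta> (G b)) (differential A (y b))) X"
    by (simp only: sum_fun_apply form_mult_def differential_app[OF X])
qed

text \<open>In a frame every form is, up to the cutoff, a combination of coordinate differentials.\<close>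
lemma form_functional:
  fixes L :: "'a form1 \<Rightarrow> real"
  assumes fr: "frame \<mu> y G"
    and add: "\<And>\<alpha> \<beta>. \<alpha> \<in> Om \<Longrightarrow> \<beta> \<in> Om \<Longrightarrow> L (\<alpha> + \<beta>) = L \<alpha> + L \<beta>"
    and mult: "\<And>h \<alpha>. h \<in> Cinf \<Longrightarrow> \<alpha> \<in> Om \<Longrightarrow> L (form_mult h \<alpha>) = h p * L \<alpha>"
    and \<beta>: "\<beta> \<in> Om"
  shows "\<mu> p * L \<beta> = (\<Sum>b\<in>Basis. \<mu> p * \<beta> (G b) p * L (differential A (y b)))"
proof -
  note fC = frame_Cinf[OF fr]
  have L0: "L 0 = 0" using add[OF Om_zero Om_zero] by (simp only: add_0)
  have sum: "L (\<Sum>b\<in>I. \<alpha> b) = (\<Sum>b\<in>I. L (\<alpha> b))" if "\<And>b. b \<in> I \<Longrightarrow> \<alpha> b \<in> Om" for I :: "'e set" and \<alpha>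
    by (rule additive_sum[where S="\<lambda>\<alpha>. \<alpha> \<in> Om" and H=L, OF Om_zero Om_plus L0 add that])
  have bG: "\<mu> * \<beta> (G b) \<in> Cinf" if "b \<in> Basis" for b using Om_app[OF \<beta> fC(3)[OF that]] fC(1) by simp
  have "\<mu> p * L \<beta> = L (form_mult \<mu> \<beta>)" by (rule mult[OF fC(1) \<beta>, symmetric])
  also have "\<dots> = (\<Sum>b\<in>Basis. L (form_mult (\<mu> * \<beta> (G b)) (differential A (y b))))"
    unfolding frame_Om[OF fr \<beta>]
    by (rule sum) (intro Om_form_mult bG Om_differential fC(2))
  also have "\<dots> = (\<Sum>b\<in>Basis. \<mu> p * \<beta> (G b) p * L (differential A (y b)))"
    by (rule sum.cong[OF refl], subst mult[OF bG Om_differential[OF fC(2)]]) simp_all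
  finally show ?thesis .
qed

lemma form_tensorial:
  fixes L :: "'a form1 \<Rightarrow> real"
  assumes p: "p \<in> Car"
    and add: "\<And>\<alpha> \<beta>. \<alpha> \<in> Om \<Longrightarrow> \<beta> \<in> Om \<Longrightarrow> L (\<alpha> + \<beta>) = L \<alpha> + L \<beta>"
    and mult: "\<And>h \<alpha>. h \<in> Cinf \<Longrightarrow> \<alpha> \<in> Om \<Longrightarrow> L (form_mult h \<alpha>) = h p * L \<alpha>"
    and \<beta>: "\<beta> \<in> Om" "\<beta>' \<in> Om" "\<And>X. X \<in> Vec \<Longrightarrow> \<beta> X p = \<beta>' X p"
  shows "L \<beta> = L \<beta>'"
proof -
  obtain \<mu> y G where fr: "frame \<mu> y G" "\<mu> p = 1" by (rule frame_exists[OF p])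
  have "L \<beta> = (\<Sum>b\<in>Basis. \<beta> (G b) p * L (differential A (y b)))"
    using form_functional[OF fr(1) add mult \<beta>(1)] fr(2) by simp
  also have "\<dots> = (\<Sum>b\<in>Basis. \<beta>' (G b) p * L (differential A (y b)))"
    by (rule sum.cong[OF refl]) (simp add: \<beta>(3)[OF frame_Cinf(3)[OF fr(1)]])
  also have "\<dots> = L \<beta>'" using form_functional[OF fr(1) add mult \<beta>(2)] fr(2) by simp
  finally show ?thesis .
qed

lemma form_functional_zero:
  fixes L :: "'a form1 \<Rightarrow> real"
  assumes p: "p \<in> Car"
    and add: "\<And>\<alpha> \<beta>. \<alpha> \<in> Om \<Longrightarrow> \<beta> \<in> Om \<Longrightarrow> L (\<alpha> + \<beta>) = L \<alpha> + L \<beta>"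
    and mult: "\<And>h \<alpha>. h \<in> Cinf \<Longrightarrow> \<alpha> \<in> Om \<Longrightarrow> L (form_mult h \<alpha>) = h p * L \<alpha>"
    and d: "\<And>f. f \<in> Cinf \<Longrightarrow> L (differential A f) = 0" and \<beta>: "\<beta> \<in> Om"
  shows "L \<beta> = 0"
proof -
  obtain \<mu> y G where fr: "frame \<mu> y G" "\<mu> p = 1" by (rule frame_exists[OF p])
  have "L \<beta> = (\<Sum>b\<in>Basis. \<beta> (G b) p * L (differential A (y b)))"
    using form_functional[OF fr(1) add mult \<beta>] fr(2) by simp
  also have "\<dots> = 0" by (rule sum.neutral) (simp add: d frame_Cinf(2)[OF fr(1)])
  finally show ?thesis .
qed

lemma lie_form_app: "Y \<in> Vec \<Longrightarrow> lie_form A X \<alpha> Y = vf_app X (\<alpha> Y) - \<alpha> (vf_bracket X Y)"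
  by (simp add: lie_form_def)

lemma lie_form_Om [simp]:
  assumes X: "X \<in> Vec" and \<alpha>: "\<alpha> \<in> Om"
  shows "lie_form A X \<alpha> \<in> Om"
proof (rule OmI)
  note [simp] = Om_app[OF \<alpha>] X
  show "lie_form A X \<alpha> (Y + Z) = lie_form A X \<alpha> Y + lie_form A X \<alpha> Z" if "Y \<in> Vec" "Z \<in> Vec" for Y Z
    using that
    by (simp add: lie_form_app vf_bracket_add_right Om_lin[OF \<alpha>] vf_app_right[OF X] fun_eq_iff algebra_simps)
  show "lie_form A X \<alpha> (vf_mult f Y) = f * lie_form A X \<alpha> Y" if "Y \<in> Vec" "f \<in> Cinf" for Y f
    using that
    by (simp add: lie_form_app vf_bracket_mult_right Om_lin[OF \<alpha>] vf_app_right[OF X] fun_eq_iff algebra_simps)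
qed (use assms in \<open>simp_all add: lie_form_def Om_app[OF \<alpha>]\<close>)

lemma lie_form_mult:
  assumes X: "X \<in> Vec" and \<alpha>: "\<alpha> \<in> Om" and f: "f \<in> Cinf"
  shows "lie_form A X (form_mult f \<alpha>) = form_mult f (lie_form A X \<alpha>) + form_mult (vf_app X f) \<alpha>"
proof (rule form_eqI)
  fix Y assume "Y \<in> Vec"
  then show "lie_form A X (form_mult f \<alpha>) Y = (form_mult f (lie_form A X \<alpha>) + form_mult (vf_app X f) \<alpha>) Y"
    using X f Om_app[OF \<alpha>] by (simp add: lie_form_app form_mult_def vf_app_right[OF X] fun_eq_iff algebra_simps)
qed (use assms in simp_all)

lemma lie_form_add:
  assumes X: "X \<in> Vec" and \<alpha>: "\<alpha> \<in> Om" "\<beta> \<in> Om"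
  shows "lie_form A X (\<alpha> + \<beta>) = lie_form A X \<alpha> + lie_form A X \<beta>"
proof (rule form_eqI)
  fix Y assume "Y \<in> Vec"
  then show "lie_form A X (\<alpha> + \<beta>) Y = (lie_form A X \<alpha> + lie_form A X \<beta>) Y"
    using X Om_app[OF \<alpha>(1)] Om_app[OF \<alpha>(2)]
    by (simp add: lie_form_app vf_app_right[OF X] fun_eq_iff algebra_simps)
qed (use assms in simp_all)

subsection \<open>Bivector fields\<close>

lemma
  assumes "\<pi> \<in> bivecs A" and "\<alpha> \<in> Om" "\<beta> \<in> Om"
  shows bv_Cinf: "\<pi> \<alpha> \<beta> \<in> Cinf"
    and bv_antisym: "\<pi> \<alpha> \<beta> = - \<pi> \<beta> \<alpha>"
    and bv_add_left: "\<gamma> \<in> Om \<Longrightarrow> \<pi> (\<alpha> + \<gamma>) \<beta> = \<pi> \<alpha> \<beta> + \<pi> \<gamma> \<beta>"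
    and bv_mult_left: "f \<in> Cinf \<Longrightarrow> \<pi> (form_mult f \<alpha>) \<beta> = f * \<pi> \<alpha> \<beta>"
  using assms unfolding bivecs_def mem_Collect_eq by blast+

lemma bv_off: "\<pi> \<in> bivecs A \<Longrightarrow> \<alpha> \<notin> Om \<or> \<beta> \<notin> Om \<Longrightarrow> \<pi> \<alpha> \<beta> = 0"
  unfolding bivecs_def by blast

lemma bv_add_right:
  assumes \<pi>: "\<pi> \<in> bivecs A" and \<alpha>: "\<alpha> \<in> Om" "\<beta> \<in> Om" "\<gamma> \<in> Om"
  shows "\<pi> \<alpha> (\<beta> + \<gamma>) = \<pi> \<alpha> \<beta> + \<pi> \<alpha> \<gamma>"
proof -
  have "\<pi> \<alpha> (\<beta> + \<gamma>) = - \<pi> (\<beta> + \<gamma>) \<alpha>" by (rule bv_antisym[OF \<pi>]) (use \<alpha> in simp_all)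
  also have "\<dots> = - \<pi> \<beta> \<alpha> + - \<pi> \<gamma> \<alpha>" by (subst bv_add_left[OF \<pi> \<alpha>(2) \<alpha>(1) \<alpha>(3)]) simp
  also have "\<dots> = \<pi> \<alpha> \<beta> + \<pi> \<alpha> \<gamma>"
    by (simp only: bv_antisym[OF \<pi> \<alpha>(1,2), symmetric] bv_antisym[OF \<pi> \<alpha>(1,3), symmetric])
  finally show ?thesis .
qed

lemma bv_mult_right:
  assumes \<pi>: "\<pi> \<in> bivecs A" and \<alpha>: "\<alpha> \<in> Om" "\<beta> \<in> Om" and f: "f \<in> Cinf"
  shows "\<pi> \<alpha> (form_mult f \<beta>) = f * \<pi> \<alpha> \<beta>"
proof -
  have "\<pi> \<alpha> (form_mult f \<beta>) = - \<pi> (form_mult f \<beta>) \<alpha>" by (rule bv_antisym[OF \<pi>]) (use \<alpha> f in simp_all)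
  also have "\<dots> = f * (- \<pi> \<beta> \<alpha>)" by (subst bv_mult_left[OF \<pi> \<alpha>(2,1) f]) simp
  also have "\<dots> = f * \<pi> \<alpha> \<beta>" by (simp only: bv_antisym[OF \<pi> \<alpha>(1,2), symmetric])
  finally show ?thesis .
qed

lemma bivecsI:
  assumes "\<And>\<alpha> \<beta>. \<alpha> \<notin> Om \<or> \<beta> \<notin> Om \<Longrightarrow> \<pi> \<alpha> \<beta> = 0"
    "\<And>\<alpha> \<beta>. \<alpha> \<in> Om \<Longrightarrow> \<beta> \<in> Om \<Longrightarrow> \<pi> \<alpha> \<beta> \<in> Cinf"
    "\<And>\<alpha> \<beta>. \<alpha> \<in> Om \<Longrightarrow> \<beta> \<in> Om \<Longrightarrow> \<pi> \<alpha> \<beta> = - \<pi> \<beta> \<alpha>"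
    "\<And>\<alpha> \<beta> \<gamma>. \<alpha> \<in> Om \<Longrightarrow> \<beta> \<in> Om \<Longrightarrow> \<gamma> \<in> Om \<Longrightarrow> \<pi> (\<alpha> + \<beta>) \<gamma> = \<pi> \<alpha> \<gamma> + \<pi> \<beta> \<gamma>"
    "\<And>f \<alpha> \<beta>. f \<in> Cinf \<Longrightarrow> \<alpha> \<in> Om \<Longrightarrow> \<beta> \<in> Om \<Longrightarrow> \<pi> (form_mult f \<alpha>) \<beta> = f * \<pi> \<alpha> \<beta>"
  shows "\<pi> \<in> bivecs A"
  unfolding bivecs_def mem_Collect_eq using assms by blast

lemma konst_at: "p \<in> Car \<Longrightarrow> konst c p = c"
  by (simp add: konst_def)

lemma differential_add: "f \<in> Cinf \<Longrightarrow> g \<in> Cinf \<Longrightarrow>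
    differential A (f + g) = differential A f + differential A g"
  by (rule form_eqI) (simp_all add: differential_app vf_app_right)

lemma differential_mult: "f \<in> Cinf \<Longrightarrow> g \<in> Cinf \<Longrightarrow>
    differential A (f * g) = form_mult f (differential A g) + form_mult g (differential A f)"
  by (rule form_eqI) (simp, simp only: Om_plus Om_form_mult Om_differential,
      simp add: differential_app vf_app_right form_mult_def)

lemma differential_scale:
  assumes "f \<in> Cinf"
  shows "differential A (\<lambda>x. c * f x) = form_mult (konst c) (differential A f)"
proof (rule form_eqI)
  fix X assume "X \<in> Vec"
  then show "differential A (\<lambda>x. c * f x) X = form_mult (konst c) (differential A f) X"
    using Cinf_off[OF Vec_app[OF _ assms]] assms
    by (simp add: differential_app vf_app_scale form_mult_def konst_def fun_eq_iff)
qed (use assms in simp_all)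

lemma contract_Vec [simp]:
  assumes \<pi>: "\<pi> \<in> bivecs A" and \<alpha>: "\<alpha> \<in> Om"
  shows "contract A \<pi> \<alpha> \<in> Vec"
proof (rule VecI)
  note C = bv_Cinf[OF \<pi> \<alpha> Om_differential]
  show "contract A \<pi> \<alpha> p = 0" if "p \<notin> Car" for p
    using Cinf_off[OF C that] by (simp add: contract_def fun_eq_iff)
  show "vf_app (contract A \<pi> \<alpha>) f \<in> Cinf" if "f \<in> Cinf" for f
    using C[OF that] that by (simp add: vf_app_def contract_def)
  fix p assume p: "p \<in> Car"
  show "contract A \<pi> \<alpha> p \<in> Tan p"
    unfolding tangent_space_def mem_Collect_eq contract_def
    by (simp add: differential_add differential_mult differential_scale konst_at[OF p]
      bv_add_right[OF \<pi> \<alpha>] bv_mult_right[OF \<pi> \<alpha>])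
qed

lemma contract_differential: "f \<in> Cinf \<Longrightarrow> vf_app (contract A \<pi> \<alpha>) f = \<pi> \<alpha> (differential A f)"
  by (simp add: vf_app_def contract_def)

text \<open>Both sides are linear over functions in \<open>\<beta>\<close> and agree on differentials by definition.\<close>
lemma contract_app:
  assumes \<pi>: "\<pi> \<in> bivecs A" and \<alpha>: "\<alpha> \<in> Om" and \<beta>: "\<beta> \<in> Om"
  shows "\<beta> (contract A \<pi> \<alpha>) = \<pi> \<alpha> \<beta>"
proof
  fix p
  note V = contract_Vec[OF \<pi> \<alpha>]
  show "\<beta> (contract A \<pi> \<alpha>) p = \<pi> \<alpha> \<beta> p"
  proof (cases "p \<in> Car")
    case True
    let ?L = "\<lambda>\<beta>. \<beta> (contract A \<pi> \<alpha>) p - \<pi> \<alpha> \<beta> p"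
    have "?L \<beta> = 0"
    proof (rule form_functional_zero[OF True _ _ _ \<beta>])
      show "?L (\<beta> + \<gamma>) = ?L \<beta> + ?L \<gamma>" if "\<beta> \<in> Om" "\<gamma> \<in> Om" for \<beta> \<gamma>
        using bv_add_right[OF \<pi> \<alpha> that] by simp
      show "?L (form_mult h \<beta>) = h p * ?L \<beta>" if "h \<in> Cinf" "\<beta> \<in> Om" for h \<beta>
        using bv_mult_right[OF \<pi> \<alpha> that(2,1)] by (simp add: form_mult_def algebra_simps)
      show "?L (differential A f) = 0" if "f \<in> Cinf" for f
        using contract_differential[OF that, of \<pi> \<alpha>] by (simp add: differential_app[OF V])
    qed
    then show ?thesis by simp
  qed (simp add: Cinf_off[OF Om_app[OF \<beta> V]] Cinf_off[OF bv_Cinf[OF \<pi> \<alpha> \<beta>]])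
qed

lemma bv_pointwise:
  assumes \<pi>: "\<pi> \<in> bivecs A" and p: "p \<in> Car" and "\<alpha> \<in> Om" "\<alpha>' \<in> Om" "\<beta> \<in> Om" "\<beta>' \<in> Om"
    and "\<And>X. X \<in> Vec \<Longrightarrow> \<alpha> X p = \<alpha>' X p" "\<And>X. X \<in> Vec \<Longrightarrow> \<beta> X p = \<beta>' X p"
  shows "\<pi> \<alpha> \<beta> p = \<pi> \<alpha>' \<beta>' p"
proof -
  have "\<pi> \<alpha> \<beta> p = \<pi> \<alpha>' \<beta> p"
    by (rule form_tensorial[where L="\<lambda>\<alpha>. \<pi> \<alpha> \<beta> p", OF p])
      (use assms in \<open>simp_all add: bv_add_left[OF \<pi>] bv_mult_left[OF \<pi>]\<close>)
  also have "\<dots> = \<pi> \<alpha>' \<beta>' p"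
    by (rule form_tensorial[where L="\<lambda>\<beta>. \<pi> \<alpha>' \<beta> p", OF p])
      (use assms in \<open>simp_all add: bv_add_right[OF \<pi>] bv_mult_right[OF \<pi>]\<close>)
  finally show ?thesis .
qed

lemma bivec_add [simp]:
  assumes \<pi>: "\<pi> \<in> bivecs A" and \<rho>: "\<rho> \<in> bivecs A"
  shows "\<pi> + \<rho> \<in> bivecs A"
proof (rule bivecsI)
  show "(\<pi> + \<rho>) \<alpha> \<beta> = 0" if "\<alpha> \<notin> Om \<or> \<beta> \<notin> Om" for \<alpha> \<beta>
    by (simp only: plus_fun_apply bv_off[OF \<pi> that] bv_off[OF \<rho> that] add_0)
  show "(\<pi> + \<rho>) \<alpha> \<beta> \<in> Cinf" if "\<alpha> \<in> Om" "\<beta> \<in> Om" for \<alpha> \<beta>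
    by (simp only: plus_fun_apply Cinf_add bv_Cinf[OF \<pi> that] bv_Cinf[OF \<rho> that])
  show "(\<pi> + \<rho>) \<alpha> \<beta> = - (\<pi> + \<rho>) \<beta> \<alpha>" if "\<alpha> \<in> Om" "\<beta> \<in> Om" for \<alpha> \<beta>
    unfolding plus_fun_apply bv_antisym[OF \<pi> that] bv_antisym[OF \<rho> that] by (simp add: fun_eq_iff)
  show "(\<pi> + \<rho>) (\<alpha> + \<beta>) \<gamma> = (\<pi> + \<rho>) \<alpha> \<gamma> + (\<pi> + \<rho>) \<beta> \<gamma>"
    if "\<alpha> \<in> Om" "\<beta> \<in> Om" "\<gamma> \<in> Om" for \<alpha> \<beta> \<gamma>
    by (simp add: bv_add_left[OF \<pi> that(1,3,2)] bv_add_left[OF \<rho> that(1,3,2)])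
  show "(\<pi> + \<rho>) (form_mult f \<alpha>) \<beta> = f * (\<pi> + \<rho>) \<alpha> \<beta>"
    if "f \<in> Cinf" "\<alpha> \<in> Om" "\<beta> \<in> Om" for f \<alpha> \<beta>
    unfolding plus_fun_apply bv_mult_left[OF \<pi> that(2,3,1)] bv_mult_left[OF \<rho> that(2,3,1)]
    by (simp add: fun_eq_iff distrib_left)
qed

lemma bivec_mult_bivecs [simp]:
  assumes h: "h \<in> Cinf" and \<pi>: "\<pi> \<in> bivecs A"
  shows "bivec_mult h \<pi> \<in> bivecs A"
  unfolding bivec_mult_def
proof (rule bivecsI)
  show "h * \<pi> \<alpha> \<beta> = 0" if "\<alpha> \<notin> Om \<or> \<beta> \<notin> Om" for \<alpha> \<beta>
    by (simp only: bv_off[OF \<pi> that] mult_zero_right)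
  show "h * \<pi> \<alpha> \<beta> \<in> Cinf" if "\<alpha> \<in> Om" "\<beta> \<in> Om" for \<alpha> \<beta>
    by (rule Cinf_mult[OF h bv_Cinf[OF \<pi> that]])
  show "h * \<pi> \<alpha> \<beta> = - (h * \<pi> \<beta> \<alpha>)" if "\<alpha> \<in> Om" "\<beta> \<in> Om" for \<alpha> \<beta>
    unfolding bv_antisym[OF \<pi> that] by simp
  show "h * \<pi> (\<alpha> + \<beta>) \<gamma> = h * \<pi> \<alpha> \<gamma> + h * \<pi> \<beta> \<gamma>" if "\<alpha> \<in> Om" "\<beta> \<in> Om" "\<gamma> \<in> Om" for \<alpha> \<beta> \<gamma>
    unfolding bv_add_left[OF \<pi> that(1,3,2)] by (rule distrib_left)
  show "h * \<pi> (form_mult f \<alpha>) \<beta> = f * (h * \<pi> \<alpha> \<beta>)" if "f \<in> Cinf" "\<alpha> \<in> Om" "\<beta> \<in> Om" for f \<alpha> \<beta>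
    unfolding bv_mult_left[OF \<pi> that(2,3,1)] by (rule mult.left_commute)
qed

lemma bivec_zero [simp]: "0 \<in> bivecs A"
  by (rule bivecsI) (simp_all add: fun_eq_iff)

lemma wedge_app: "\<alpha> \<in> Om \<Longrightarrow> \<beta> \<in> Om \<Longrightarrow> wedge A X Y \<alpha> \<beta> = \<alpha> X * \<beta> Y - \<alpha> Y * \<beta> X"
  by (simp add: wedge_def)

lemma wedge_bivecs [simp]:
  assumes X: "X \<in> Vec" and Y: "Y \<in> Vec"
  shows "wedge A X Y \<in> bivecs A"
proof (rule bivecsI)
  show "wedge A X Y \<alpha> \<beta> = 0" if "\<alpha> \<notin> Om \<or> \<beta> \<notin> Om" for \<alpha> \<beta> using that by (auto simp: wedge_def)
  show "wedge A X Y \<alpha> \<beta> \<in> Cinf" if "\<alpha> \<in> Om" "\<beta> \<in> Om" for \<alpha> \<beta>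
    using Om_app[OF that(1)] Om_app[OF that(2)] X Y by (simp add: wedge_app that)
  show "wedge A X Y \<alpha> \<beta> = - wedge A X Y \<beta> \<alpha>" if "\<alpha> \<in> Om" "\<beta> \<in> Om" for \<alpha> \<beta>
    by (simp add: wedge_app that mult.commute)
  show "wedge A X Y (\<alpha> + \<beta>) \<gamma> = wedge A X Y \<alpha> \<gamma> + wedge A X Y \<beta> \<gamma>"
    if "\<alpha> \<in> Om" "\<beta> \<in> Om" "\<gamma> \<in> Om" for \<alpha> \<beta> \<gamma>
    by (simp add: wedge_app that algebra_simps)
  show "wedge A X Y (form_mult f \<alpha>) \<beta> = f * wedge A X Y \<alpha> \<beta>" if "f \<in> Cinf" "\<alpha> \<in> Om" "\<beta> \<in> Om" for f \<alpha> \<beta>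
    unfolding wedge_app[OF Om_form_mult[OF that(1,2)] that(3)] wedge_app[OF that(2,3)]
    by (simp add: form_mult_app algebra_simps)
qed

text \<open>Summation over all basis vectors counts every pair of them twice, hence the factor 2.\<close>
lemma frame_bivec:
  assumes fr: "frame \<mu> y G" and \<pi>: "\<pi> \<in> bivecs A"
  shows "bivec_mult (\<lambda>p. 2 * \<mu> p) \<pi> =
    (\<Sum>b\<in>Basis. wedge A (vf_mult \<mu> (G b)) (contract A \<pi> (differential A (y b))))"
proof (intro ext)
  fix \<alpha> \<beta> p
  note fC = frame_Cinf[OF fr]
  show "bivec_mult (\<lambda>p. 2 * \<mu> p) \<pi> \<alpha> \<beta> p =
    (\<Sum>b\<in>Basis. wedge A (vf_mult \<mu> (G b)) (contract A \<pi> (differential A (y b)))) \<alpha> \<beta> p"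
  proof (cases "\<alpha> \<in> Om \<and> \<beta> \<in> Om")
    case True
    then have \<alpha>: "\<alpha> \<in> Om" and \<beta>: "\<beta> \<in> Om" by auto
    have e: "\<mu> p * \<pi> \<alpha> \<beta> p = (\<Sum>b\<in>Basis. \<mu> p * \<alpha> (G b) p * \<pi> (differential A (y b)) \<beta> p)"
      if \<alpha>: "\<alpha> \<in> Om" and \<beta>: "\<beta> \<in> Om" for \<alpha> \<beta>
      by (rule form_functional[where L="\<lambda>\<alpha>. \<pi> \<alpha> \<beta> p", OF fr _ _ \<alpha>])
        (simp_all add: bv_add_left[OF \<pi> _ \<beta>] bv_mult_left[OF \<pi> _ \<beta>])
    have "(\<Sum>b\<in>Basis. wedge A (vf_mult \<mu> (G b)) (contract A \<pi> (differential A (y b)))) \<alpha> \<beta> p =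
      (\<Sum>b\<in>Basis. \<mu> p * \<alpha> (G b) p * \<pi> (differential A (y b)) \<beta> p - \<mu> p * \<beta> (G b) p * \<pi> (differential A (y b)) \<alpha> p)"
      unfolding sum_fun_apply
      by (rule sum.cong[OF refl])
        (simp add: wedge_app[OF \<alpha> \<beta>] Om_mult[OF \<alpha>] Om_mult[OF \<beta>] fC contract_app[OF \<pi> _ \<alpha>] contract_app[OF \<pi> _ \<beta>])
    also have "\<dots> = \<mu> p * \<pi> \<alpha> \<beta> p - \<mu> p * \<pi> \<beta> \<alpha> p"
      unfolding sum_subtractf e[OF \<alpha> \<beta>] e[OF \<beta> \<alpha>] ..
    also have "\<dots> = 2 * \<mu> p * \<pi> \<alpha> \<beta> p"
      using fun_cong[OF bv_antisym[OF \<pi> \<alpha> \<beta>], of p] by simp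
    finally show ?thesis by (simp add: bivec_mult_def)
  next
    case False
    then have f: "\<alpha> \<notin> Om \<or> \<beta> \<notin> Om" by blast
    show ?thesis using bv_off[OF \<pi> f] f by (auto simp: bivec_mult_def sum_fun_apply wedge_def)
  qed
qed

end

section \<open>A torsion-free connection\<close>

locale affine_manifold = cotangent A for A :: "('a, 'e::euclidean_space) chart set" +
  fixes D :: "'a vfield \<Rightarrow> 'a vfield \<Rightarrow> 'a vfield"
  assumes conn: "connection A D" and tf: "torsion_free A D"
begin

lemma D_Vec [simp]: "X \<in> Vec \<Longrightarrow> Y \<in> Vec \<Longrightarrow> D X Y \<in> Vec"
  and D_add_left: "X \<in> Vec \<Longrightarrow> Y \<in> Vec \<Longrightarrow> Z \<in> Vec \<Longrightarrow> D (X + Y) Z = D X Z + D Y Z"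
  and D_add_right: "X \<in> Vec \<Longrightarrow> Y \<in> Vec \<Longrightarrow> Z \<in> Vec \<Longrightarrow> D X (Y + Z) = D X Y + D X Z"
  and D_mult_left: "f \<in> Cinf \<Longrightarrow> X \<in> Vec \<Longrightarrow> Y \<in> Vec \<Longrightarrow> D (vf_mult f X) Y = vf_mult f (D X Y)"
  and D_mult_right: "f \<in> Cinf \<Longrightarrow> X \<in> Vec \<Longrightarrow> Y \<in> Vec \<Longrightarrow>
    D X (vf_mult f Y) = vf_mult f (D X Y) + vf_mult (vf_app X f) Y"
  using conn unfolding connection_def by blast+

lemma D_zero_left: "Y \<in> Vec \<Longrightarrow> D 0 Y = 0"
  using D_add_left[of 0 0 Y] by (simp add: fun_eq_iff)

lemma D_minus_left: "X \<in> Vec \<Longrightarrow> Y \<in> Vec \<Longrightarrow> D (- X) Y = - D X Y"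
  using D_add_left[of X "- X" Y] D_zero_left[of Y] by (simp add: fun_eq_iff add_eq_0_iff)

lemma D_diff_left: "X \<in> Vec \<Longrightarrow> Y \<in> Vec \<Longrightarrow> Z \<in> Vec \<Longrightarrow> D (X - Y) Z = D X Z - D Y Z"
  using D_add_left[of X "- Y" Z] D_minus_left[of Y Z] by (simp add: fun_eq_iff)

lemma D_zero_right: "X \<in> Vec \<Longrightarrow> D X 0 = 0"
  using D_add_right[of X 0 0] by (simp add: fun_eq_iff)

lemma D_minus_right: "X \<in> Vec \<Longrightarrow> Y \<in> Vec \<Longrightarrow> D X (- Y) = - D X Y"
  using D_add_right[of X Y "- Y"] D_zero_right[of X] by (simp add: fun_eq_iff add_eq_0_iff)

lemma D_diff_right: "X \<in> Vec \<Longrightarrow> Y \<in> Vec \<Longrightarrow> Z \<in> Vec \<Longrightarrow> D X (Y - Z) = D X Y - D X Z"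
  using D_add_right[of X Y "- Z"] D_minus_right[of X Z] by (simp add: fun_eq_iff)

lemma bracket_D: "X \<in> Vec \<Longrightarrow> Y \<in> Vec \<Longrightarrow> vf_bracket X Y = D X Y - D Y X"
  using tf by (simp add: torsion_free_def)

lemma D_pointwise: "X \<in> Vec \<Longrightarrow> X' \<in> Vec \<Longrightarrow> Y \<in> Vec \<Longrightarrow> p \<in> Car \<Longrightarrow> X p = X' p \<Longrightarrow> D X Y p f = D X' Y p f"
  by (rule tensorial[where L="\<lambda>X. D X Y p f"]) (simp_all add: D_add_left D_mult_left, simp add: vf_mult_def)

text \<open>The form \<open>\<eta> \<circ> \<nabla>Y\<close>.\<close>
definition dform :: "'a form1 \<Rightarrow> 'a vfield \<Rightarrow> 'a form1" where
  "dform \<eta> Y = (\<lambda>X. if X \<in> Vec then \<eta> (D X Y) else 0)"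

lemma dform_app: "X \<in> Vec \<Longrightarrow> dform \<eta> Y X = \<eta> (D X Y)"
  by (simp add: dform_def)

lemma dform_Om [simp]: "\<eta> \<in> Om \<Longrightarrow> Y \<in> Vec \<Longrightarrow> dform \<eta> Y \<in> Om"
  by (rule OmI) (simp_all add: dform_def D_add_left D_mult_left Om_lin[of \<eta>] Om_app[of \<eta>])

lemma dform_add_left: "\<eta> \<in> Om \<Longrightarrow> \<alpha> \<in> Om \<Longrightarrow> Y \<in> Vec \<Longrightarrow> dform (\<eta> + \<alpha>) Y = dform \<eta> Y + dform \<alpha> Y"
  and dform_mult_left: "f \<in> Cinf \<Longrightarrow> \<eta> \<in> Om \<Longrightarrow> Y \<in> Vec \<Longrightarrow> dform (form_mult f \<eta>) Y = form_mult f (dform \<eta> Y)"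
  and dform_add_right: "\<eta> \<in> Om \<Longrightarrow> Y \<in> Vec \<Longrightarrow> Z \<in> Vec \<Longrightarrow> dform \<eta> (Y + Z) = dform \<eta> Y + dform \<eta> Z"
  and dform_mult_right: "f \<in> Cinf \<Longrightarrow> \<eta> \<in> Om \<Longrightarrow> Y \<in> Vec \<Longrightarrow>
    dform \<eta> (vf_mult f Y) = form_mult f (dform \<eta> Y) + form_mult (\<eta> Y) (differential A f)"
  by (rule form_eqI; simp add: dform_app D_add_right D_mult_right Om_lin[of \<eta>] Om_app[of \<eta>]
      form_mult_app differential_app fun_eq_iff)+

lemma nabla_form_app: "Y \<in> Vec \<Longrightarrow> nabla_form A D X \<alpha> Y = vf_app X (\<alpha> Y) - \<alpha> (D X Y)"
  by (simp add: nabla_form_def)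

lemma nabla_form_Om [simp]:
  assumes X: "X \<in> Vec" and \<alpha>: "\<alpha> \<in> Om"
  shows "nabla_form A D X \<alpha> \<in> Om"
proof (rule OmI)
  note [simp] = Om_app[OF \<alpha>] X
  show "nabla_form A D X \<alpha> (Y + Z) = nabla_form A D X \<alpha> Y + nabla_form A D X \<alpha> Z" if "Y \<in> Vec" "Z \<in> Vec" for Y Z
    using that by (simp add: nabla_form_app D_add_right Om_lin[OF \<alpha>] vf_app_right[OF X] fun_eq_iff algebra_simps)
  show "nabla_form A D X \<alpha> (vf_mult f Y) = f * nabla_form A D X \<alpha> Y" if "Y \<in> Vec" "f \<in> Cinf" for Y f
    using that by (simp add: nabla_form_app D_mult_right Om_lin[OF \<alpha>] vf_app_right[OF X] fun_eq_iff algebra_simps)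
qed (use assms in \<open>simp_all add: nabla_form_def Om_app[OF \<alpha>]\<close>)

lemma lie_form_nabla:
  assumes X: "X \<in> Vec" and \<alpha>: "\<alpha> \<in> Om"
  shows "lie_form A X \<alpha> = nabla_form A D X \<alpha> + dform \<alpha> X"
  by (rule form_eqI)
    (use assms in \<open>simp_all add: lie_form_app nabla_form_app dform_app bracket_D Om_lin[OF \<alpha>]\<close>)

lemma lie_bivec_app: "\<alpha> \<in> Om \<Longrightarrow> \<beta> \<in> Om \<Longrightarrow>
    lie_bivec A X \<pi> \<alpha> \<beta> = vf_app X (\<pi> \<alpha> \<beta>) - \<pi> (lie_form A X \<alpha>) \<beta> - \<pi> \<alpha> (lie_form A X \<beta>)"
  by (simp add: lie_bivec_def)

lemma nabla_bivec_app: "\<alpha> \<in> Om \<Longrightarrow> \<beta> \<in> Om \<Longrightarrow>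
    nabla_bivec A D X \<pi> \<alpha> \<beta> = vf_app X (\<pi> \<alpha> \<beta>) - \<pi> (nabla_form A D X \<alpha>) \<beta> - \<pi> \<alpha> (nabla_form A D X \<beta>)"
  by (simp add: nabla_bivec_def)

lemma lie_bivec_nabla:
  assumes X: "X \<in> Vec" and \<pi>: "\<pi> \<in> bivecs A" and \<alpha>: "\<alpha> \<in> Om" and \<beta>: "\<beta> \<in> Om"
  shows "lie_bivec A X \<pi> \<alpha> \<beta> = nabla_bivec A D X \<pi> \<alpha> \<beta> - \<pi> (dform \<alpha> X) \<beta> - \<pi> \<alpha> (dform \<beta> X)"
  using assms
  by (simp add: lie_bivec_app nabla_bivec_app lie_form_nabla bv_add_left[OF \<pi>] bv_add_right[OF \<pi>])

lemma lie_bivec_bivecs [simp]: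
  assumes X: "X \<in> Vec" and \<pi>: "\<pi> \<in> bivecs A"
  shows "lie_bivec A X \<pi> \<in> bivecs A"
proof (rule bivecsI)
  note l = lie_form_Om[OF X]
  note C = bv_Cinf[OF \<pi>]
  show "lie_bivec A X \<pi> \<alpha> \<beta> = 0" if "\<alpha> \<notin> Om \<or> \<beta> \<notin> Om" for \<alpha> \<beta> using that by (auto simp: lie_bivec_def)
  show "lie_bivec A X \<pi> \<alpha> \<beta> \<in> Cinf" if "\<alpha> \<in> Om" "\<beta> \<in> Om" for \<alpha> \<beta>
    by (simp add: lie_bivec_app that X C l)
  show "lie_bivec A X \<pi> \<alpha> \<beta> = - lie_bivec A X \<pi> \<beta> \<alpha>" if \<alpha>: "\<alpha> \<in> Om" and \<beta>: "\<beta> \<in> Om" for \<alpha> \<beta>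
    unfolding lie_bivec_app[OF \<alpha> \<beta>] lie_bivec_app[OF \<beta> \<alpha>] bv_antisym[OF \<pi> l[OF \<alpha>] \<beta>]
      bv_antisym[OF \<pi> \<alpha> l[OF \<beta>]] bv_antisym[OF \<pi> \<alpha> \<beta>] vf_app_minus[OF X C[OF \<beta> \<alpha>]] by simp
  show "lie_bivec A X \<pi> (\<alpha> + \<beta>) \<gamma> = lie_bivec A X \<pi> \<alpha> \<gamma> + lie_bivec A X \<pi> \<beta> \<gamma>"
    if "\<alpha> \<in> Om" "\<beta> \<in> Om" "\<gamma> \<in> Om" for \<alpha> \<beta> \<gamma>
    using that X
    by (simp add: lie_bivec_app lie_form_add bv_add_left[OF \<pi>] vf_app_add[OF X] C algebra_simps)
  show "lie_bivec A X \<pi> (form_mult f \<alpha>) \<beta> = f * lie_bivec A X \<pi> \<alpha> \<beta>" if "f \<in> Cinf" "\<alpha> \<in> Om" "\<beta> \<in> Om" for f \<alpha> \<beta>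
    using that X
    by (simp add: lie_bivec_app lie_form_mult bv_add_left[OF \<pi>] bv_mult_left[OF \<pi>] vf_app_mult[OF X] C algebra_simps)
qed

end

section \<open>Lifts\<close>

context cotangent
begin

abbreviation "fl \<equiv> fun_lift A"
abbreviation "pp \<equiv> pr_pull A"
abbreviation "vl \<equiv> vert_lift A"
abbreviation "cl \<equiv> complete_lift A"

text \<open>The lifts are defined by their action on the functions \<open>Y\<^sup>v\<close>. Given a compatible action \<open>P\<close> on the
  functions pulled back from the base, the definite description denotes a vector field with both
  actions.\<close>
lemma lift_THE:
  fixes P :: "('a \<Rightarrow> real) \<Rightarrow> 'a covec \<Rightarrow> real" and L :: "'a vfield \<Rightarrow> 'a covec \<Rightarrow> real"
  assumes "\<And>f. f \<in> Cinf \<Longrightarrow> P f \<in> T.Cinf"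
    and "\<And>f g. f \<in> Cinf \<Longrightarrow> g \<in> Cinf \<Longrightarrow> P (f + g) = P f + P g"
    and "\<And>f g. f \<in> Cinf \<Longrightarrow> g \<in> Cinf \<Longrightarrow> P (f * g) = pp f * P g + pp g * P f"
    and "\<And>f c. f \<in> Cinf \<Longrightarrow> P (\<lambda>x. c * f x) = (\<lambda>x. c * P f x)"
    and "\<And>Y. Y \<in> Vec \<Longrightarrow> L Y \<in> T.Cinf"
    and "\<And>Y Z. Y \<in> Vec \<Longrightarrow> Z \<in> Vec \<Longrightarrow> L (Y + Z) = L Y + L Z"
    and "\<And>f Y. f \<in> Cinf \<Longrightarrow> Y \<in> Vec \<Longrightarrow> L (vf_mult f Y) = P f * fl Y + pp f * L Y"
  shows "(THE W. W \<in> T.Vec \<and> (\<forall>Y\<in>Vec. vf_app W (fl Y) = L Y)) \<in> T.Vec \<and>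
    (\<forall>f\<in>Cinf. vf_app (THE W. W \<in> T.Vec \<and> (\<forall>Y\<in>Vec. vf_app W (fl Y) = L Y)) (pp f) = P f) \<and>
    (\<forall>Y\<in>Vec. vf_app (THE W. W \<in> T.Vec \<and> (\<forall>Y\<in>Vec. vf_app W (fl Y) = L Y)) (fl Y) = L Y)"
proof -
  obtain W where W: "W \<in> T.Vec" "\<And>f. f \<in> Cinf \<Longrightarrow> vf_app W (pp f) = P f"
    "\<And>Y. Y \<in> Vec \<Longrightarrow> vf_app W (fl Y) = L Y"
    by (rule vector_field_from_action[OF assms]) blast+
  have "(THE W. W \<in> T.Vec \<and> (\<forall>Y\<in>Vec. vf_app W (fl Y) = L Y)) = W"
  proof (rule the_equality)
    show "V = W" if "V \<in> T.Vec \<and> (\<forall>Y\<in>Vec. vf_app V (fl Y) = L Y)" for V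
      by (rule TVec_eqI) (use that W in auto)
  qed (use W in auto)
  then show ?thesis using W by simp
qed

lemma
  assumes \<alpha>: "\<alpha> \<in> Om"
  shows vl_Vec [simp]: "vl \<alpha> \<in> T.Vec"
    and vl_pp [simp]: "f \<in> Cinf \<Longrightarrow> vf_app (vl \<alpha>) (pp f) = 0"
    and vl_fl [simp]: "Y \<in> Vec \<Longrightarrow> vf_app (vl \<alpha>) (fl Y) = pp (\<alpha> Y)"
proof -
  have "vl \<alpha> \<in> T.Vec \<and> (\<forall>f\<in>Cinf. vf_app (vl \<alpha>) (pp f) = 0) \<and> (\<forall>Y\<in>Vec. vf_app (vl \<alpha>) (fl Y) = pp (\<alpha> Y))"
    unfolding vert_lift_def
    by (rule lift_THE[where P="\<lambda>f. 0"]) (simp_all add: Om_lin[OF \<alpha>] Om_app[OF \<alpha>] pr_pull_ring fun_eq_iff)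
  then show "vl \<alpha> \<in> T.Vec" "f \<in> Cinf \<Longrightarrow> vf_app (vl \<alpha>) (pp f) = 0"
    "Y \<in> Vec \<Longrightarrow> vf_app (vl \<alpha>) (fl Y) = pp (\<alpha> Y)" by blast+
qed

lemma
  assumes X: "X \<in> Vec"
  shows cl_Vec [simp]: "cl X \<in> T.Vec"
    and cl_pp [simp]: "f \<in> Cinf \<Longrightarrow> vf_app (cl X) (pp f) = pp (vf_app X f)"
    and cl_fl [simp]: "Y \<in> Vec \<Longrightarrow> vf_app (cl X) (fl Y) = fl (vf_bracket X Y)"
proof -
  have "cl X \<in> T.Vec \<and> (\<forall>f\<in>Cinf. vf_app (cl X) (pp f) = pp (vf_app X f)) \<and>
      (\<forall>Y\<in>Vec. vf_app (cl X) (fl Y) = fl (vf_bracket X Y))"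
    unfolding complete_lift_def
    by (rule lift_THE[where P="\<lambda>f. pp (vf_app X f)"])
      (use X in \<open>simp_all add: vf_app_right[OF X] vf_app_scale[OF X] pr_pull_ring pr_pull_scale
        vf_bracket_add_right vf_bracket_mult_right fun_lift_lin add.commute\<close>)
  then show "cl X \<in> T.Vec" "f \<in> Cinf \<Longrightarrow> vf_app (cl X) (pp f) = pp (vf_app X f)"
    "Y \<in> Vec \<Longrightarrow> vf_app (cl X) (fl Y) = fl (vf_bracket X Y)" by blast+
qed

text \<open>The Euler vector field, which generates the dilations of the fibres.\<close>
definition eul :: "'a covec vfield" where
  "eul = (THE W. W \<in> T.Vec \<and> (\<forall>Y\<in>Vec. vf_app W (fl Y) = fl Y))"

lemma eul_Vec [simp]: "eul \<in> T.Vec"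
  and eul_pp [simp]: "f \<in> Cinf \<Longrightarrow> vf_app eul (pp f) = 0"
  and eul_fl [simp]: "Y \<in> Vec \<Longrightarrow> vf_app eul (fl Y) = fl Y"
proof -
  have "eul \<in> T.Vec \<and> (\<forall>f\<in>Cinf. vf_app eul (pp f) = 0) \<and> (\<forall>Y\<in>Vec. vf_app eul (fl Y) = fl Y)"
    unfolding eul_def
    by (rule lift_THE[where P="\<lambda>f. 0"]) (simp_all add: fun_lift_lin fun_eq_iff)
  then show "eul \<in> T.Vec" "f \<in> Cinf \<Longrightarrow> vf_app eul (pp f) = 0" "Y \<in> Vec \<Longrightarrow> vf_app eul (fl Y) = fl Y"
    by blast+
qed

subsection \<open>Algebra of lifts\<close>

lemma vl_vl: "\<alpha> \<in> Om \<Longrightarrow> \<beta> \<in> Om \<Longrightarrow> vf_bracket (vl \<alpha>) (vl \<beta>) = 0"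
  by (rule TVec_eqI) (simp_all add: vf_app_left Om_app[of \<alpha>] Om_app[of \<beta>])

lemma cl_vl:
  assumes "X \<in> Vec" "\<alpha> \<in> Om"
  shows "vf_bracket (cl X) (vl \<alpha>) = vl (lie_form A X \<alpha>)"
  by (rule TVec_eqI) (use assms in \<open>simp_all add: vf_app_left Om_app[OF assms(2)] lie_form_app pr_pull_ring\<close>)

lemma cl_cl:
  assumes "X \<in> Vec" "Y \<in> Vec"
  shows "vf_bracket (cl X) (cl Y) = cl (vf_bracket X Y)"
proof (rule TVec_eqI)
  fix Z assume Z: "Z \<in> Vec"
  have "vf_bracket X (vf_bracket Y Z) - vf_bracket Y (vf_bracket X Z) = vf_bracket (vf_bracket X Y) Z"
    using vf_bracket_bracket[OF assms Z] by simp
  then show "vf_app (vf_bracket (cl X) (cl Y)) (fl Z) = vf_app (cl (vf_bracket X Y)) (fl Z)"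
    using assms Z fun_lift_diff[of "vf_bracket X (vf_bracket Y Z)" "vf_bracket Y (vf_bracket X Z)"]
    by (simp add: vf_app_left)
qed (use assms in simp_all)

lemma eul_vl: "\<alpha> \<in> Om \<Longrightarrow> vf_bracket eul (vl \<alpha>) = - vl \<alpha>"
  by (rule TVec_eqI) (simp_all add: vf_app_left Om_app[of \<alpha>])

lemma eul_cl: "X \<in> Vec \<Longrightarrow> vf_bracket eul (cl X) = 0"
  by (rule TVec_eqI) (simp_all add: vf_app_left)

lemma vl_add: "\<alpha> \<in> Om \<Longrightarrow> \<beta> \<in> Om \<Longrightarrow> vl (\<alpha> + \<beta>) = vl \<alpha> + vl \<beta>"
  and vl_mult: "f \<in> Cinf \<Longrightarrow> \<alpha> \<in> Om \<Longrightarrow> vl (form_mult f \<alpha>) = vf_mult (pp f) (vl \<alpha>)"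
  and vl_zero: "vl 0 = 0"
  by (rule TVec_eqI; simp add: vf_app_left pr_pull_ring form_mult_app)+

subsection \<open>Pullbacks by sections\<close>

lemma section_vertical:
  assumes \<eta>: "\<eta> \<in> Om" and p: "p \<in> Car" and \<alpha>: "\<alpha> \<in> Om" and W: "W \<in> T.Vec"
    and f: "\<And>f. f \<in> Cinf \<Longrightarrow> vf_app W (pp f) = 0"
    and Y: "\<And>Y. Y \<in> Vec \<Longrightarrow> ev \<eta> (vf_app W (fl Y)) p = \<alpha> Y p"
  shows "W (p, covec \<eta> p) = vl \<alpha> (p, covec \<eta> p)"
proof -
  let ?\<xi> = "(p, covec \<eta> p)"
  note \<xi> = sec_TCar[OF \<eta> p]
  show ?thesis
  proof (rule tangent_bundle_eqI[OF \<xi> T.Vec_Tan[OF W \<xi>] T.Vec_Tan[OF vl_Vec[OF \<alpha>] \<xi>]])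
    show "W ?\<xi> (pp f) = vl \<alpha> ?\<xi> (pp f)" if "f \<in> Cinf" for f
      using fun_cong[OF f[OF that], of ?\<xi>] fun_cong[OF vl_pp[OF \<alpha> that], of ?\<xi>] by (simp add: vf_app_def)
    show "W ?\<xi> (fl Y) = vl \<alpha> ?\<xi> (fl Y)" if "Y \<in> Vec" for Y
      using Y[OF that] fun_cong[OF vl_fl[OF \<alpha> that], of ?\<xi>] pr_pull_at[OF \<xi>] ev_at[OF p]
      by (simp add: vf_app_def)
  qed
qed

lemma ev_eqI_point: "(\<And>p. p \<in> Car \<Longrightarrow> V (p, covec \<eta> p) = W (p, covec \<eta> p)) \<Longrightarrow> ev \<eta> (vf_app V F) = ev \<eta> (vf_app W F)"
  by (simp add: ev_def vf_app_def fun_eq_iff)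

text \<open>At a point of the bundle the Euler field is the point itself, regarded as a vertical vector.\<close>
lemma eul_section: "\<eta> \<in> Om \<Longrightarrow> p \<in> Car \<Longrightarrow> eul (p, covec \<eta> p) = vl \<eta> (p, covec \<eta> p)"
  by (rule section_vertical) (simp_all add: ev_fun_lift)

lemma ev_eul: "\<eta> \<in> Om \<Longrightarrow> ev \<eta> (vf_app eul F) = ev \<eta> (vf_app (vl \<eta>) F)"
  by (rule ev_eqI_point) (rule eul_section)

lemma covec_lin:
  assumes \<eta>: "\<eta> \<in> Om" and \<alpha>: "\<alpha> \<in> Om" and p: "p \<in> Car"
  shows "covec (\<eta> + form_mult (konst s) \<alpha>) p = (\<lambda>v. covec \<eta> p v + s * covec \<alpha> p v)"
proof (rule cotan_eqI[OF p covec_Cot[OF _ p] Cot_lin[OF covec_Cot[OF \<eta> p] covec_Cot[OF \<alpha> p]]])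
  show om: "\<eta> + form_mult (konst s) \<alpha> \<in> Om" using \<eta> \<alpha> by simp
  fix V assume V: "V \<in> Vec"
  show "covec (\<eta> + form_mult (konst s) \<alpha>) p (V p) = covec \<eta> p (V p) + s * covec \<alpha> p (V p)"
    unfolding covec_app[OF om p V] covec_app[OF \<eta> p V] covec_app[OF \<alpha> p V]
    by (simp add: form_mult_app konst_at[OF p])
qed

lemma covec_zero: "p \<in> Car \<Longrightarrow> covec 0 p = (\<lambda>v. 0)"
  by (simp add: covec_def fun_eq_iff)

lemma ev_line:
  assumes "\<eta> \<in> Om" "\<alpha> \<in> Om" "p \<in> Car"
  shows "F (line p (covec \<eta> p) (covec \<alpha> p) s) = ev (\<eta> + form_mult (konst s) \<alpha>) F p"
  using assms by (simp add: line_def ev_def covec_lin)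

text \<open>A vertical lift differentiates along a line of sections.\<close>
lemma ev_vl_derivative:
  assumes \<eta>: "\<eta> \<in> Om" and \<alpha>: "\<alpha> \<in> Om" and p: "p \<in> Car" and F: "F \<in> T.Cinf"
  shows "((\<lambda>s. ev (\<eta> + form_mult (konst s) \<alpha>) F p) has_real_derivative
    ev (\<eta> + form_mult (konst t) \<alpha>) (vf_app (vl \<alpha>) F) p) (at t)"
  unfolding ev_line[OF \<eta> \<alpha> p, symmetric]
proof (rule line_derivative_vertical[OF p covec_Cot[OF \<eta> p] covec_Cot[OF \<alpha> p] F vl_Vec[OF \<alpha>]])
  note l = line_TCar[OF p covec_Cot[OF \<eta> p] covec_Cot[OF \<alpha> p], of t]
  show "vf_app (vl \<alpha>) (pp f) (line p (covec \<eta> p) (covec \<alpha> p) t) = 0" if "f \<in> Cinf" for f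
    using that \<alpha> by simp
  show "vf_app (vl \<alpha>) (fl Y) (line p (covec \<eta> p) (covec \<alpha> p) t) = covec \<alpha> p (Y p)" if "Y \<in> Vec" for Y
    using that \<alpha> l by (simp add: covec_app[OF \<alpha> p that] pr_pull_def) (simp add: line_def)
qed

lemma ev_vl_eqI:
  assumes \<eta>: "\<eta> \<in> Om" and \<alpha>: "\<alpha> \<in> Om" and p: "p \<in> Car" and F: "F \<in> T.Cinf"
    and d: "((\<lambda>s. ev (\<eta> + form_mult (konst s) \<alpha>) F p) has_real_derivative l) (at 0)"
  shows "ev \<eta> (vf_app (vl \<alpha>) F) p = l"
proof -
  have z: "form_mult (konst 0) \<alpha> = 0" by (simp add: form_mult_def konst_def fun_eq_iff)
  show ?thesis using DERIV_unique[OF d ev_vl_derivative[OF \<eta> \<alpha> p F]] by (simp add: z)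
qed

text \<open>The flow of a complete lift moves a section by the Lie derivative.\<close>
lemma ev_cl:
  assumes \<eta>: "\<eta> \<in> Om" and X: "X \<in> Vec" and F: "F \<in> T.Cinf"
  shows "ev \<eta> (vf_app (cl X) F) = vf_app X (ev \<eta> F) - ev \<eta> (vf_app (vl (lie_form A X \<eta>)) F)"
proof
  fix p
  show "ev \<eta> (vf_app (cl X) F) p = (vf_app X (ev \<eta> F) - ev \<eta> (vf_app (vl (lie_form A X \<eta>)) F)) p"
  proof (cases "p \<in> Car")
    case p: True
    let ?\<xi> = "(p, covec \<eta> p)" and ?l = "lie_form A X \<eta>"
    note \<xi> = sec_TCar[OF \<eta> p] and \<lambda> = lie_form_Om[OF X \<eta>]
    let ?w = "\<lambda>F. if F \<in> T.Cinf then vf_app X (ev \<eta> F) p else 0"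
    have w: "?w \<in> T.Tan ?\<xi>"
      unfolding tangent_space_def mem_Collect_eq
      by (simp add: ev_add ev_mult ev_scale ev_Cinf[OF \<eta>] vf_app_right[OF X] vf_app_scale[OF X] ev_at[OF p])
    have "?w = (cl X + vl ?l) ?\<xi>"
    proof (rule tangent_bundle_eqI[OF \<xi> w T.Vec_Tan[OF T.Vec_add[OF cl_Vec[OF X] vl_Vec[OF \<lambda>]] \<xi>]])
      show "?w (pp f) = (cl X + vl ?l) ?\<xi> (pp f)" if "f \<in> Cinf" for f
        using fun_cong[OF cl_pp[OF X that], of ?\<xi>] fun_cong[OF vl_pp[OF \<lambda> that], of ?\<xi>] that
        by (simp add: vf_app_def[of "cl X"] vf_app_def[of "vl ?l"] ev_pr_pull[OF \<eta>] pr_pull_at[OF \<xi>])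
      show "?w (fl Y) = (cl X + vl ?l) ?\<xi> (fl Y)" if Y: "Y \<in> Vec" for Y
        using fun_cong[OF cl_fl[OF X Y], of ?\<xi>] fun_cong[OF vl_fl[OF \<lambda> Y], of ?\<xi>] Y X
          covec_app[OF \<eta> p Vec_bracket[OF X Y]]
        by (simp add: vf_app_def[of "cl X"] vf_app_def[of "vl ?l"] ev_fun_lift[OF \<eta>] fun_lift_at[OF \<xi>]
            pr_pull_at[OF \<xi>] lie_form_app)
    qed
    from fun_cong[OF this, of F] show ?thesis using F p by (simp add: ev_at vf_app_def[of "cl X"] vf_app_def[of "vl ?l"])
  next
    case False
    then show ?thesis using Cinf_off[OF Vec_app[OF X ev_Cinf[OF \<eta> F]]] by (simp add: ev_def)
  qed
qed

subsection \<open>Homogeneity along the fibres\<close>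

lemma vl_eul:
  assumes "\<alpha> \<in> Om" "F \<in> T.Cinf"
  shows "vf_app (vl \<alpha>) (vf_app eul F) = vf_app eul (vf_app (vl \<alpha>) F) + vf_app (vl \<alpha>) F"
  using arg_cong[OF eul_vl[OF assms(1)], of "\<lambda>V. vf_app V F"]
  by (simp add: vf_app_left algebra_simps)

text \<open>Along the section \<open>\<eta>\<close> the Euler field is \<open>\<eta>\<^sup>v\<close>, and \<open>[\<eta>\<^sup>v, \<epsilon>] = \<eta>\<^sup>v\<close>. Therefore \<open>\<epsilon>(\<epsilon> - 1)\<close> becomes the second
  derivative in the direction \<open>\<eta>\<^sup>v\<close> and, in the next lemma, \<open>(\<epsilon> - 2)\<epsilon>(\<epsilon> - 1)\<close> the third one.\<close>
lemma eul_square: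
  assumes \<eta>: "\<eta> \<in> Om" and F: "F \<in> T.Cinf"
  shows "ev \<eta> (vf_app eul (vf_app eul F) - vf_app eul F) = ev \<eta> (vf_app (vl \<eta>) (vf_app (vl \<eta>) F))"
  by (simp add: ev_ring ev_eul[OF \<eta>] vl_eul[OF assms])

lemma eul_cube:
  assumes \<eta>: "\<eta> \<in> Om" and F: "F \<in> T.Cinf"
  defines "G \<equiv> vf_app eul (vf_app eul F) - vf_app eul F"
  shows "ev \<eta> (vf_app eul G - G - G) = ev \<eta> (vf_app (vl \<eta>) (vf_app (vl \<eta>) (vf_app (vl \<eta>) F)))"
proof -
  let ?v = "vf_app (vl \<eta>)" and ?e = "vf_app eul"
  have C: "?v F \<in> T.Cinf" "?e F \<in> T.Cinf" "?v (?v F) \<in> T.Cinf" "?e (?e F) \<in> T.Cinf" "?e (?v F) \<in> T.Cinf"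
    using \<eta> F by simp_all
  have "?v G = ?e (?e (?v F)) + ?e (?v F)"
    unfolding G_def
    by (simp add: T.vf_app_diff[OF vl_Vec[OF \<eta>]] T.vf_app_add[OF eul_Vec] C vl_eul[OF \<eta>] F algebra_simps)
  also have "\<dots> = (?e (?e (?v F)) - ?e (?v F)) + ?e (?v F) + ?e (?v F)" by simp
  finally have "ev \<eta> (?e G) = ev \<eta> (?v (?v (?v F))) + ev \<eta> (?v (?v F)) + ev \<eta> (?v (?v F))"
    by (simp only: ev_eul[OF \<eta>] ev_add eul_square[OF \<eta> C(1)])
  moreover have "ev \<eta> G = ev \<eta> (?v (?v F))" unfolding G_def by (rule eul_square[OF \<eta> F])
  ultimately show ?thesis by (simp only: ev_diff) simp
qed

text \<open>A function of degree zero is constant on the open rays of the fibres and, by continuity, on the rays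
  together with their origin.\<close>
lemma eul_zero_imp_basic:
  assumes F: "F \<in> T.Cinf" and z: "vf_app eul F = 0"
  shows "F = pp (ev 0 F)"
proof
  fix \<xi>
  show "F \<xi> = pp (ev 0 F) \<xi>"
  proof (cases "\<xi> \<in> TCar")
    case True
    let ?p = "fst \<xi>"
    have p: "?p \<in> Car" by (rule TCar_fst[OF True])
    obtain \<eta> where \<eta>: "\<eta> \<in> Om" "covec \<eta> ?p = snd \<xi>" by (rule covec_exists[OF p TCar_snd[OF True]])
    let ?g = "\<lambda>s. ev (0 + form_mult (konst s) \<eta>) F ?p"
    have fm: "0 + form_mult (konst s) \<eta> \<in> Om" for s using \<eta> by simp
    note d = ev_vl_derivative[OF Om_zero \<eta>(1) p F]
    have "ev (0 + form_mult (konst t) \<eta>) (vf_app (vl \<eta>) F) ?p = 0" if "t \<noteq> 0" for t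
    proof -
      let ?\<theta> = "0 + form_mult (konst t) \<eta>"
      have "0 = ev ?\<theta> (vf_app (vl ?\<theta>) F) ?p" using ev_eul[OF fm, of t F] z by (simp add: ev_zero fun_eq_iff)
      also have "\<dots> = t * ev ?\<theta> (vf_app (vl \<eta>) F) ?p"
        using sec_TCar[OF fm p, of t] \<eta>(1)
        by (simp add: vl_mult vf_app_left ev_mult ev_pr_pull konst_at[OF p])
      finally show ?thesis using that by simp
    qed
    then have "(?g has_real_derivative 0) (at t)" if "0 < t" for t using d[of t] that by simp
    moreover have "isCont ?g t" for t by (rule DERIV_isCont[OF d])
    ultimately have "?g 1 = ?g 0"
      by (intro DERIV_isconst_end) (auto intro!: continuous_at_imp_continuous_on)
    moreover have "0 + form_mult (konst 0) \<eta> = 0" by (simp add: form_mult_def konst_def fun_eq_iff)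
    moreover have "covec (0 + form_mult (konst 1) \<eta>) ?p = snd \<xi>"
      using covec_lin[OF Om_zero \<eta>(1) p, of 1] covec_zero[OF p] \<eta>(2) by (simp add: fun_eq_iff)
    ultimately show ?thesis using p True by (simp add: ev_at pr_pull_def)
  qed (simp add: T.Cinf_off[OF F] pr_pull_off)
qed

lemma vertical_zero_imp_basic:
  assumes F: "F \<in> T.Cinf" and z: "\<And>\<alpha>. \<alpha> \<in> Om \<Longrightarrow> vf_app (vl \<alpha>) F = 0"
  shows "F = pp (ev 0 F)"
proof (rule eul_zero_imp_basic[OF F])
  show "vf_app eul F = 0"
    by (rule ev_eqI) (use F z in \<open>simp_all add: ev_eul\<close>)
qed

end

context affine_manifold
begin

abbreviation "hl \<equiv> hor_lift A D"
abbreviation "bl \<equiv> bivec_lift A D"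

lemma
  assumes X: "X \<in> Vec"
  shows hl_Vec [simp]: "hl X \<in> T.Vec"
    and hl_pp [simp]: "f \<in> Cinf \<Longrightarrow> vf_app (hl X) (pp f) = pp (vf_app X f)"
    and hl_fl [simp]: "Y \<in> Vec \<Longrightarrow> vf_app (hl X) (fl Y) = fl (D X Y)"
proof -
  have "hl X \<in> T.Vec \<and> (\<forall>f\<in>Cinf. vf_app (hl X) (pp f) = pp (vf_app X f)) \<and>
      (\<forall>Y\<in>Vec. vf_app (hl X) (fl Y) = fl (D X Y))"
    unfolding hor_lift_def
    by (rule lift_THE[where P="\<lambda>f. pp (vf_app X f)"])
      (use X in \<open>simp_all add: vf_app_right[OF X] vf_app_scale[OF X] pr_pull_ring pr_pull_scale
        D_add_right D_mult_right fun_lift_lin add.commute\<close>)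
  then show "hl X \<in> T.Vec" "f \<in> Cinf \<Longrightarrow> vf_app (hl X) (pp f) = pp (vf_app X f)"
    "Y \<in> Vec \<Longrightarrow> vf_app (hl X) (fl Y) = fl (D X Y)" by blast+
qed

text \<open>The vertical lift of the endomorphism field \<open>\<nabla>Y\<close>; it is the difference of \<open>Y\<^sup>h\<close> and \<open>Y\<^sup>c\<close>.\<close>
definition om :: "'a vfield \<Rightarrow> 'a covec vfield" where
  "om Y = (THE W. W \<in> T.Vec \<and> (\<forall>Z\<in>Vec. vf_app W (fl Z) = fl (D Z Y)))"

lemma
  assumes Y: "Y \<in> Vec"
  shows om_Vec [simp]: "om Y \<in> T.Vec"
    and om_pp [simp]: "f \<in> Cinf \<Longrightarrow> vf_app (om Y) (pp f) = 0"
    and om_fl [simp]: "Z \<in> Vec \<Longrightarrow> vf_app (om Y) (fl Z) = fl (D Z Y)"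
proof -
  have "om Y \<in> T.Vec \<and> (\<forall>f\<in>Cinf. vf_app (om Y) (pp f) = 0) \<and> (\<forall>Z\<in>Vec. vf_app (om Y) (fl Z) = fl (D Z Y))"
    unfolding om_def
    by (rule lift_THE[where P="\<lambda>f. 0"])
      (use Y in \<open>simp_all add: D_add_left D_mult_left fun_lift_lin fun_eq_iff\<close>)
  then show "om Y \<in> T.Vec" "f \<in> Cinf \<Longrightarrow> vf_app (om Y) (pp f) = 0"
    "Z \<in> Vec \<Longrightarrow> vf_app (om Y) (fl Z) = fl (D Z Y)" by blast+
qed

lemma cl_hl: "Y \<in> Vec \<Longrightarrow> cl Y = hl Y - om Y"
  by (rule TVec_eqI) (simp_all add: vf_app_left bracket_D fun_lift_lin)

lemma vl_om: "\<alpha> \<in> Om \<Longrightarrow> Y \<in> Vec \<Longrightarrow> vf_bracket (vl \<alpha>) (om Y) = vl (dform \<alpha> Y)"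
  by (rule TVec_eqI) (simp_all add: vf_app_left Om_app[of \<alpha>] dform_app)

lemma hl_add: "X \<in> Vec \<Longrightarrow> Y \<in> Vec \<Longrightarrow> hl (X + Y) = hl X + hl Y"
  and hl_zero: "hl 0 = 0"
  by (rule TVec_eqI; simp add: vf_app_left D_add_left D_zero_left fun_lift_lin)+

lemma om_section: "\<eta> \<in> Om \<Longrightarrow> p \<in> Car \<Longrightarrow> Y \<in> Vec \<Longrightarrow> om Y (p, covec \<eta> p) = vl (dform \<eta> Y) (p, covec \<eta> p)"
  by (rule section_vertical) (simp_all add: ev_fun_lift dform_app)

subsection \<open>The horizontal lift of a bivector field\<close>

text \<open>The quadratic function on the fibres whose pullback by \<open>\<eta>\<close> is \<open>\<pi>(\<eta>, \<eta> \<circ> \<nabla>Z)\<close>.\<close>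
definition qf :: "'a bivec \<Rightarrow> 'a vfield \<Rightarrow> 'a covec \<Rightarrow> real" where
  "qf \<pi> Z \<xi> = (if \<xi> \<in> TCar then
     (let \<eta> = SOME \<eta>. \<eta> \<in> Om \<and> covec \<eta> (fst \<xi>) = snd \<xi> in \<pi> \<eta> (dform \<eta> Z) (fst \<xi>)) else 0)"

lemma qf_section:
  assumes \<pi>: "\<pi> \<in> bivecs A" and Z: "Z \<in> Vec" and \<eta>: "\<eta> \<in> Om" and p: "p \<in> Car"
  shows "qf \<pi> Z (p, covec \<eta> p) = \<pi> \<eta> (dform \<eta> Z) p"
proof -
  let ?\<theta> = "SOME \<theta>. \<theta> \<in> Om \<and> covec \<theta> p = covec \<eta> p"
  have \<theta>: "?\<theta> \<in> Om \<and> covec ?\<theta> p = covec \<eta> p" by (rule someI[of _ \<eta>]) (simp add: \<eta>)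
  then have \<theta>1: "?\<theta> \<in> Om" by blast
  have eq: "?\<theta> X p = \<eta> X p" if "X \<in> Vec" for X
    using covec_app[OF \<theta>1 p that] covec_app[OF \<eta> p that] \<theta> by simp
  have "\<pi> ?\<theta> (dform ?\<theta> Z) p = \<pi> \<eta> (dform \<eta> Z) p"
    by (rule bv_pointwise[OF \<pi> p \<theta>1 \<eta> dform_Om[OF \<theta>1 Z] dform_Om[OF \<eta> Z]]) (simp_all add: eq dform_app Z)
  then show ?thesis using sec_TCar[OF \<eta> p] by (simp add: qf_def Let_def)
qed

lemma ev_qf: "\<pi> \<in> bivecs A \<Longrightarrow> Z \<in> Vec \<Longrightarrow> \<eta> \<in> Om \<Longrightarrow> ev \<eta> (qf \<pi> Z) = \<pi> \<eta> (dform \<eta> Z)"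
  using Cinf_off[OF bv_Cinf[of \<pi> \<eta> "dform \<eta> Z"]] by (auto simp: ev_def qf_section fun_eq_iff)

lemma qf_Cinf [simp]:
  assumes \<pi>: "\<pi> \<in> bivecs A" and Z: "Z \<in> Vec"
  shows "qf \<pi> Z \<in> T.Cinf"
proof (rule T.Cinf_local)
  show "qf \<pi> Z \<xi> = 0" if "\<xi> \<notin> TCar" for \<xi> using that by (simp add: qf_def)
  fix \<xi> assume \<xi>: "\<xi> \<in> TCar"
  obtain \<mu> y G where fr: "frame \<mu> y G" "\<mu> (fst \<xi>) = 1" by (rule frame_exists[OF TCar_fst[OF \<xi>]])
  note fC = frame_Cinf[OF fr(1)]
  let ?dy = "\<lambda>b. differential A (y b)"
  let ?V = "\<lambda>b. D (contract A \<pi> (?dy b)) Z"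
  let ?S = "\<Sum>b\<in>Basis. pp \<mu> * (fl (G b) * fl (?V b))"
  have V: "?V b \<in> Vec" if "b \<in> Basis" for b using that \<pi> Z fC by simp
  have S: "?S \<in> T.Cinf" by (rule T.Cinf_sum) (use fC V in simp)
  have "pp \<mu> * qf \<pi> Z = ?S"
  proof
    fix \<xi>
    show "(pp \<mu> * qf \<pi> Z) \<xi> = ?S \<xi>"
    proof (cases "\<xi> \<in> TCar")
      case True
      let ?p = "fst \<xi>"
      have p: "?p \<in> Car" by (rule TCar_fst[OF True])
      obtain \<eta> where \<eta>: "\<eta> \<in> Om" "covec \<eta> ?p = snd \<xi>" by (rule covec_exists[OF p TCar_snd[OF True]])
      have \<xi>e: "\<xi> = (?p, covec \<eta> ?p)" using \<eta> by simp
      have fle: "fl W \<xi> = \<eta> W ?p" if "W \<in> Vec" for W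
        using that True covec_app[OF \<eta>(1) p that] \<eta>(2) by (simp add: fun_lift_def)
      let ?\<theta> = "dform \<eta> Z"
      have \<theta>: "?\<theta> \<in> Om" using \<eta> Z by simp
      have "\<mu> ?p * \<pi> \<eta> ?\<theta> ?p = (\<Sum>b\<in>Basis. \<mu> ?p * \<eta> (G b) ?p * \<pi> (?dy b) ?\<theta> ?p)"
        by (rule form_functional[where L="\<lambda>\<alpha>. \<pi> \<alpha> ?\<theta> ?p", OF fr(1) _ _ \<eta>(1)])
          (simp_all add: bv_add_left[OF \<pi> _ \<theta>] bv_mult_left[OF \<pi> _ \<theta>])
      also have "\<dots> = (\<Sum>b\<in>Basis. pp \<mu> \<xi> * (fl (G b) \<xi> * fl (?V b) \<xi>))"
      proof (rule sum.cong[OF refl])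
        fix b :: 'e assume b: "b \<in> Basis"
        have "\<pi> (?dy b) ?\<theta> = \<eta> (?V b)"
          using contract_app[OF \<pi> Om_differential[OF fC(2)[OF b]] \<theta>] contract_Vec[OF \<pi> Om_differential[OF fC(2)[OF b]]]
          by (simp add: dform_app)
        then show "\<mu> ?p * \<eta> (G b) ?p * \<pi> (?dy b) ?\<theta> ?p = pp \<mu> \<xi> * (fl (G b) \<xi> * fl (?V b) \<xi>)"
          using True by (simp add: fle[OF fC(3)[OF b]] fle[OF V[OF b]] pr_pull_def)
      qed
      finally show ?thesis
        using qf_section[OF \<pi> Z \<eta>(1) p] True \<eta>(2) by (simp add: sum_fun_apply pr_pull_def)
    qed (simp add: sum_fun_apply pr_pull_off)
  qed
  then show "\<exists>\<mu>\<in>T.Cinf. \<mu> \<xi> \<noteq> 0 \<and> \<mu> * qf \<pi> Z \<in> T.Cinf"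
    using S fr(2) \<xi> by (intro bexI[of _ "pp \<mu>"]) (simp_all add: fC(1), simp add: pr_pull_def)
qed

text \<open>The horizontal lift, before it is known to satisfy the axioms that determine it.\<close>
definition bfield :: "'a bivec \<Rightarrow> 'a covec vfield" where
  "bfield \<pi> = (THE W. W \<in> T.Vec \<and> (\<forall>Z\<in>Vec. vf_app W (fl Z) = qf \<pi> Z))"

lemma
  assumes \<pi>: "\<pi> \<in> bivecs A"
  shows bfield_Vec: "bfield \<pi> \<in> T.Vec"
    and bfield_pp: "f \<in> Cinf \<Longrightarrow> vf_app (bfield \<pi>) (pp f) = - fl (contract A \<pi> (differential A f))"
    and bfield_fl: "Z \<in> Vec \<Longrightarrow> vf_app (bfield \<pi>) (fl Z) = qf \<pi> Z"
proof -
  let ?P = "\<lambda>f. - fl (contract A \<pi> (differential A f))"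
  have C: "contract A \<pi> (differential A f) \<in> Vec" if "f \<in> Cinf" for f using \<pi> that by simp
  have P: "?P f \<in> T.Cinf" if "f \<in> Cinf" for f using C[OF that] by simp
  have evP: "ev \<eta> (?P f) = \<pi> \<eta> (differential A f)" if "\<eta> \<in> Om" "f \<in> Cinf" for \<eta> f
    using ev_fun_lift[OF that(1) C[OF that(2)]] contract_app[OF \<pi> Om_differential[OF that(2)] that(1)]
      bv_antisym[OF \<pi> that(1) Om_differential[OF that(2)]] by (simp add: ev_minus)
  have "bfield \<pi> \<in> T.Vec \<and> (\<forall>f\<in>Cinf. vf_app (bfield \<pi>) (pp f) = ?P f) \<and>
      (\<forall>Z\<in>Vec. vf_app (bfield \<pi>) (fl Z) = qf \<pi> Z)"
    unfolding bfield_def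
  proof (rule lift_THE[where P="?P"])
    show "?P (f + g) = ?P f + ?P g" if f: "f \<in> Cinf" and g: "g \<in> Cinf" for f g
    proof (rule ev_eqI[OF P[OF Cinf_add[OF f g]] T.Cinf_add[OF P[OF f] P[OF g]]])
      fix \<eta> assume \<eta>: "\<eta> \<in> Om"
      show "ev \<eta> (?P (f + g)) = ev \<eta> (?P f + ?P g)"
        unfolding ev_add evP[OF \<eta> Cinf_add[OF f g]] evP[OF \<eta> f] evP[OF \<eta> g]
        unfolding differential_add[OF f g]
        by (rule bv_add_right[OF \<pi> \<eta> Om_differential[OF f] Om_differential[OF g]])
    qed
    show "?P (f * g) = pp f * ?P g + pp g * ?P f" if f: "f \<in> Cinf" and g: "g \<in> Cinf" for f g
    proof (rule ev_eqI[OF P[OF Cinf_mult[OF f g]]])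
      show "pp f * ?P g + pp g * ?P f \<in> T.Cinf"
        by (intro T.Cinf_add T.Cinf_mult P pr_pull_Cinf f g)
      fix \<eta> assume \<eta>: "\<eta> \<in> Om"
      note df = Om_differential[OF f] and dg = Om_differential[OF g]
      show "ev \<eta> (?P (f * g)) = ev \<eta> (pp f * ?P g + pp g * ?P f)"
        unfolding ev_add ev_mult ev_pr_pull[OF \<eta> f] ev_pr_pull[OF \<eta> g] evP[OF \<eta> Cinf_mult[OF f g]]
          evP[OF \<eta> f] evP[OF \<eta> g]
        unfolding differential_mult[OF f g]
          bv_add_right[OF \<pi> \<eta> Om_form_mult[OF f dg] Om_form_mult[OF g df]]
          bv_mult_right[OF \<pi> \<eta> dg f] bv_mult_right[OF \<pi> \<eta> df g] ..
    qed
    show "?P (\<lambda>x. c * f x) = (\<lambda>x. c * ?P f x)" if f: "f \<in> Cinf" for f c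
    proof (rule ev_eqI)
      fix \<eta> assume \<eta>: "\<eta> \<in> Om"
      have "konst c * \<pi> \<eta> (differential A f) = (\<lambda>p. c * \<pi> \<eta> (differential A f) p)"
        using Cinf_off[OF bv_Cinf[OF \<pi> \<eta> Om_differential[OF f]]] by (auto simp: konst_def fun_eq_iff)
      then show "ev \<eta> (?P (\<lambda>x. c * f x)) = ev \<eta> (\<lambda>x. c * ?P f x)"
        unfolding ev_scale evP[OF \<eta> f] evP[OF \<eta> Cinf_scale[OF f]]
        unfolding differential_scale[OF f]
          bv_mult_right[OF \<pi> \<eta> Om_differential[OF f] Cinf_konst] .
    qed (use P f in \<open>simp_all only: Cinf_scale T.Cinf_scale\<close>)
    show "qf \<pi> (Y + Z) = qf \<pi> Y + qf \<pi> Z" if "Y \<in> Vec" "Z \<in> Vec" for Y Z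
      by (rule ev_eqI) (use that \<pi> in \<open>simp_all add: ev_add ev_qf dform_add_right bv_add_right[OF \<pi>] fun_eq_iff\<close>)
    show "qf \<pi> (vf_mult f Y) = ?P f * fl Y + pp f * qf \<pi> Y" if f: "f \<in> Cinf" and Y: "Y \<in> Vec" for f Y
    proof (rule ev_eqI)
      fix \<eta> assume \<eta>: "\<eta> \<in> Om"
      show "ev \<eta> (qf \<pi> (vf_mult f Y)) = ev \<eta> (?P f * fl Y + pp f * qf \<pi> Y)"
        using f Y \<eta> Om_app[OF \<eta> Y]
        by (simp only: ev_add ev_mult evP ev_fun_lift ev_pr_pull ev_qf[OF \<pi>] Vec_mult dform_mult_right
            bv_add_right[OF \<pi>] bv_mult_right[OF \<pi>] dform_Om Om_form_mult Om_differential) (simp add: algebra_simps)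
    qed (use P[OF f] f Y \<pi> in \<open>simp_all only: T.Cinf_add T.Cinf_mult fun_lift_Cinf pr_pull_Cinf qf_Cinf Vec_mult\<close>)
  qed (use P \<pi> in simp_all)
  then show "bfield \<pi> \<in> T.Vec" "f \<in> Cinf \<Longrightarrow> vf_app (bfield \<pi>) (pp f) = ?P f"
    "Z \<in> Vec \<Longrightarrow> vf_app (bfield \<pi>) (fl Z) = qf \<pi> Z" by blast+
qed

text \<open>The axioms of the lift determine it: near a point every bivector field is, up to a cutoff, a
  sum of decomposable ones.\<close>
lemma bivec_lift_eq: "bivec_lift A D = (\<lambda>\<pi>. if \<pi> \<in> bivecs A then bfield \<pi> else 0)"
  unfolding bivec_lift_def
proof (rule the_equality)
  let ?H = "\<lambda>\<pi>. if \<pi> \<in> bivecs A then bfield \<pi> else 0"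
  let ?ax = "\<lambda>H. (\<forall>\<pi>. \<pi> \<notin> bivecs A \<longrightarrow> H \<pi> = 0) \<and>
     (\<forall>\<pi>\<in>bivecs A. H \<pi> \<in> vfields (cotangent_bundle A)) \<and>
     (\<forall>\<pi>\<in>bivecs A. \<forall>\<rho>\<in>bivecs A. H (\<pi> + \<rho>) = H \<pi> + H \<rho>) \<and>
     (\<forall>f\<in>smooth_funs A. \<forall>\<pi>\<in>bivecs A. H (bivec_mult f \<pi>) = vf_mult (pr_pull A f) (H \<pi>)) \<and>
     (\<forall>X\<in>vfields A. \<forall>Y\<in>vfields A. H (wedge A X Y) =
        vf_mult (fun_lift A X) (hor_lift A D Y) - vf_mult (fun_lift A Y) (hor_lift A D X))"
  have 1: "bfield (\<pi> + \<rho>) = bfield \<pi> + bfield \<rho>" if "\<pi> \<in> bivecs A" "\<rho> \<in> bivecs A" for \<pi> \<rho>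
  proof (rule TVec_eqI)
    fix Z assume Z: "Z \<in> Vec"
    have "qf (\<pi> + \<rho>) Z = qf \<pi> Z + qf \<rho> Z"
      by (rule ev_eqI) (use that Z in \<open>simp_all add: ev_add ev_qf fun_eq_iff\<close>)
    then show "vf_app (bfield (\<pi> + \<rho>)) (fl Z) = vf_app (bfield \<pi> + bfield \<rho>) (fl Z)"
      using that Z by (simp add: vf_app_left bfield_fl)
  qed (use that in \<open>simp_all add: bfield_Vec\<close>)
  have 2: "bfield (bivec_mult f \<pi>) = vf_mult (pp f) (bfield \<pi>)" if "f \<in> Cinf" "\<pi> \<in> bivecs A" for f \<pi>
  proof (rule TVec_eqI)
    fix Z assume Z: "Z \<in> Vec"
    have "qf (bivec_mult f \<pi>) Z = pp f * qf \<pi> Z"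
      by (rule ev_eqI) (use that Z in \<open>simp_all add: ev_mult ev_pr_pull ev_qf\<close>, simp add: bivec_mult_def fun_eq_iff)
    then show "vf_app (bfield (bivec_mult f \<pi>)) (fl Z) = vf_app (vf_mult (pp f) (bfield \<pi>)) (fl Z)"
      using that Z by (simp add: vf_app_left bfield_fl)
  qed (use that in \<open>simp_all add: bfield_Vec\<close>)
  have 3: "bfield (wedge A X Y) = vf_mult (fl X) (hl Y) - vf_mult (fl Y) (hl X)" if "X \<in> Vec" "Y \<in> Vec" for X Y
  proof (rule TVec_eqI)
    fix Z assume Z: "Z \<in> Vec"
    have "qf (wedge A X Y) Z = fl X * fl (D Y Z) - fl Y * fl (D X Z)"
      by (rule ev_eqI) (use that Z in \<open>simp_all add: ev_ring ev_fun_lift ev_qf wedge_app dform_app fun_eq_iff\<close>)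
    then show "vf_app (bfield (wedge A X Y)) (fl Z) = vf_app (vf_mult (fl X) (hl Y) - vf_mult (fl Y) (hl X)) (fl Z)"
      using that Z by (simp add: vf_app_left bfield_fl)
  qed (use that in \<open>simp_all add: bfield_Vec\<close>)
  show "?ax ?H" using 1 2 3 by (simp add: bfield_Vec)
  fix H assume H: "?ax H"
  have H0: "H \<pi> = 0" if "\<pi> \<notin> bivecs A" for \<pi> using H that by blast
  have HV: "H \<pi> \<in> T.Vec" if "\<pi> \<in> bivecs A" for \<pi> using H that by blast
  have Ha: "H (\<pi> + \<rho>) = H \<pi> + H \<rho>" if "\<pi> \<in> bivecs A" "\<rho> \<in> bivecs A" for \<pi> \<rho> using H that by blast
  have Hm: "H (bivec_mult f \<pi>) = vf_mult (pp f) (H \<pi>)" if "f \<in> Cinf" "\<pi> \<in> bivecs A" for f \<pi> using H that by blast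
  have Hw: "H (wedge A X Y) = bfield (wedge A X Y)" if "X \<in> Vec" "Y \<in> Vec" for X Y
    using H that unfolding 3[OF that] by blast
  have Hz: "H 0 = 0" using Ha[OF bivec_zero bivec_zero] by (simp only: add_0) (simp add: fun_eq_iff)
  have bz: "bfield 0 = 0" using 1[OF bivec_zero bivec_zero] by (simp only: add_0) (simp add: fun_eq_iff)
  have "H \<pi> = bfield \<pi>" if \<pi>: "\<pi> \<in> bivecs A" for \<pi>
  proof
    fix \<xi>
    show "H \<pi> \<xi> = bfield \<pi> \<xi>"
    proof (cases "\<xi> \<in> TCar")
      case True
      obtain \<mu> y G where fr: "frame \<mu> y G" "\<mu> (fst \<xi>) = 1" by (rule frame_exists[OF TCar_fst[OF True]])
      note fC = frame_Cinf[OF fr(1)]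
      let ?w = "\<lambda>b. wedge A (vf_mult \<mu> (G b)) (contract A \<pi> (differential A (y b)))"
      have w: "?w b \<in> bivecs A" "H (?w b) = bfield (?w b)" if "b \<in> Basis" for b
        using \<pi> fC that by (simp_all add: Hw)
      have "H (sum ?w Basis) = (\<Sum>b\<in>Basis. H (?w b))"
        by (rule additive_sum[where S="\<lambda>\<pi>. \<pi> \<in> bivecs A" and H=H, OF bivec_zero bivec_add Hz Ha w(1)])
      also have "\<dots> = (\<Sum>b\<in>Basis. bfield (?w b))" by (rule sum.cong[OF refl w(2)])
      also have "\<dots> = bfield (sum ?w Basis)"
        by (rule additive_sum[where S="\<lambda>\<pi>. \<pi> \<in> bivecs A" and H=bfield, OF bivec_zero bivec_add bz 1 w(1), symmetric])
      finally
      have "vf_mult (pp (\<lambda>p. 2 * \<mu> p)) (H \<pi>) = vf_mult (pp (\<lambda>p. 2 * \<mu> p)) (bfield \<pi>)"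
        unfolding frame_bivec[OF fr(1) \<pi>, symmetric] Hm[OF Cinf_scale[OF fC(1)] \<pi>] 2[OF Cinf_scale[OF fC(1)] \<pi>] .
      from fun_cong[OF this, of \<xi>] show ?thesis
        using True fr(2) by (simp add: vf_mult_def pr_pull_def fun_eq_iff)
    qed (simp add: T.Vec_off[OF HV[OF \<pi>]] T.Vec_off[OF bfield_Vec[OF \<pi>]])
  qed
  then show "H = ?H" using H0 by (simp add: fun_eq_iff)
qed

lemma
  assumes \<pi>: "\<pi> \<in> bivecs A"
  shows bl_Vec [simp]: "bl \<pi> \<in> T.Vec"
    and bl_pp: "f \<in> Cinf \<Longrightarrow> vf_app (bl \<pi>) (pp f) = - fl (contract A \<pi> (differential A f))"
    and bl_fl [simp]: "Z \<in> Vec \<Longrightarrow> vf_app (bl \<pi>) (fl Z) = qf \<pi> Z"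
  using bfield_Vec[OF \<pi>] bfield_pp[OF \<pi>] bfield_fl[OF \<pi>] \<pi> by (simp_all add: bivec_lift_eq)

lemma ev_vl_qf:
  assumes \<pi>: "\<pi> \<in> bivecs A" and Z: "Z \<in> Vec" and \<eta>: "\<eta> \<in> Om" and \<alpha>: "\<alpha> \<in> Om"
  shows "ev \<eta> (vf_app (vl \<alpha>) (qf \<pi> Z)) = \<pi> \<alpha> (dform \<eta> Z) + \<pi> \<eta> (dform \<alpha> Z)"
proof
  fix p
  note dO = dform_Om[OF \<eta> Z] dform_Om[OF \<alpha> Z]
  show "ev \<eta> (vf_app (vl \<alpha>) (qf \<pi> Z)) p = (\<pi> \<alpha> (dform \<eta> Z) + \<pi> \<eta> (dform \<alpha> Z)) p"
  proof (cases "p \<in> Car")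
    case p: True
    show ?thesis
    proof (rule ev_vl_eqI[OF \<eta> \<alpha> p qf_Cinf[OF \<pi> Z]])
      let ?\<theta> = "\<lambda>s. form_mult (konst s) \<alpha>"
      have "ev (\<eta> + ?\<theta> s) (qf \<pi> Z) p = \<pi> \<eta> (dform \<eta> Z) p +
          s * (\<pi> \<alpha> (dform \<eta> Z) + \<pi> \<eta> (dform \<alpha> Z)) p + s * s * \<pi> \<alpha> (dform \<alpha> Z) p" for s
      proof -
        have "ev (\<eta> + ?\<theta> s) (qf \<pi> Z) = \<pi> (\<eta> + ?\<theta> s) (dform \<eta> Z + form_mult (konst s) (dform \<alpha> Z))"
          using \<eta> \<alpha> Z by (simp add: ev_qf[OF \<pi>] dform_add_left dform_mult_left)
        also have "\<dots> = \<pi> \<eta> (dform \<eta> Z) + konst s * \<pi> \<alpha> (dform \<eta> Z) +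
            (konst s * \<pi> \<eta> (dform \<alpha> Z) + konst s * (konst s * \<pi> \<alpha> (dform \<alpha> Z)))"
          using \<eta> \<alpha> dO
          by (simp only: bv_add_right[OF \<pi>] bv_mult_right[OF \<pi>] bv_add_left[OF \<pi>] bv_mult_left[OF \<pi>]
              Om_plus Om_form_mult Cinf_konst distrib_left)
        finally show ?thesis by (simp add: konst_at[OF p] algebra_simps)
      qed
      then show "((\<lambda>s. ev (\<eta> + ?\<theta> s) (qf \<pi> Z) p) has_real_derivative
          (\<pi> \<alpha> (dform \<eta> Z) + \<pi> \<eta> (dform \<alpha> Z)) p) (at 0)"
        by (auto intro!: derivative_eq_intros)
    qed
  next
    case False
    then show ?thesis
      using Cinf_off[OF bv_Cinf[OF \<pi> \<alpha> dO(1)]] Cinf_off[OF bv_Cinf[OF \<pi> \<eta> dO(2)]] by (simp add: ev_def)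
  qed
qed

lemma bl_section:
  assumes \<pi>: "\<pi> \<in> bivecs A" and \<eta>: "\<eta> \<in> Om" and p: "p \<in> Car"
  shows "bl \<pi> (p, covec \<eta> p) = hl (contract A \<pi> \<eta>) (p, covec \<eta> p)"
proof -
  let ?\<xi> = "(p, covec \<eta> p)" and ?V = "contract A \<pi> \<eta>"
  note \<xi> = sec_TCar[OF \<eta> p] and V = contract_Vec[OF \<pi> \<eta>]
  show ?thesis
  proof (rule tangent_bundle_eqI[OF \<xi> T.Vec_Tan[OF bl_Vec[OF \<pi>] \<xi>] T.Vec_Tan[OF hl_Vec[OF V] \<xi>]])
    show "bl \<pi> ?\<xi> (pp f) = hl ?V ?\<xi> (pp f)" if f: "f \<in> Cinf" for f
    proof -
      note df = Om_differential[OF f]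
      have "bl \<pi> ?\<xi> (pp f) = - \<pi> (differential A f) \<eta> p"
        using fun_cong[OF bl_pp[OF \<pi> f], of ?\<xi>] fun_lift_at[OF \<xi>] covec_app[OF \<eta> p contract_Vec[OF \<pi> df]]
          fun_cong[OF contract_app[OF \<pi> df \<eta>], of p] by (simp add: vf_app_def)
      moreover have "hl ?V ?\<xi> (pp f) = \<pi> \<eta> (differential A f) p"
        using fun_cong[OF hl_pp[OF V f], of ?\<xi>] pr_pull_at[OF \<xi>] fun_cong[OF contract_differential[OF f, of \<pi> \<eta>], of p]
        by (simp add: vf_app_def)
      ultimately show ?thesis using fun_cong[OF bv_antisym[OF \<pi> \<eta> df], of p] by simp
    qed
    show "bl \<pi> ?\<xi> (fl Z) = hl ?V ?\<xi> (fl Z)" if Z: "Z \<in> Vec" for Z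
      using fun_cong[OF bl_fl[OF \<pi> Z], of ?\<xi>] fun_cong[OF hl_fl[OF V Z], of ?\<xi>] qf_section[OF \<pi> Z \<eta> p]
        fun_lift_at[OF \<xi>] covec_app[OF \<eta> p D_Vec[OF V Z]] fun_cong[OF contract_app[OF \<pi> \<eta> dform_Om[OF \<eta> Z]], of p]
        dform_app[OF V, of \<eta> Z]
      by (simp add: vf_app_def)
  qed
qed

end

section \<open>The Patterson-Walker metric\<close>

context affine_manifold
begin

lemma hv_pp:
  assumes \<xi>: "\<xi> \<in> TCar" and X: "X \<in> Vec" and \<alpha>: "\<alpha> \<in> Om" and V: "v = (hl X + vl \<alpha>) \<xi>"
  shows "f \<in> Cinf \<Longrightarrow> v (pp f) = vf_app X f (fst \<xi>)"
    and "Y \<in> Vec \<Longrightarrow> v (fl Y) = snd \<xi> (D X Y (fst \<xi>)) + \<alpha> Y (fst \<xi>)"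
proof -
  show "v (pp f) = vf_app X f (fst \<xi>)" if "f \<in> Cinf"
    using fun_cong[OF hl_pp[OF X that], of \<xi>] fun_cong[OF vl_pp[OF \<alpha> that], of \<xi>] \<xi> V
    by (simp add: vf_app_def pr_pull_def)
  show "v (fl Y) = snd \<xi> (D X Y (fst \<xi>)) + \<alpha> Y (fst \<xi>)" if "Y \<in> Vec"
    using fun_cong[OF hl_fl[OF X that], of \<xi>] fun_cong[OF vl_fl[OF \<alpha> that], of \<xi>] \<xi> V
    by (simp add: vf_app_def pr_pull_def fun_lift_def)
qed

lemma hv_unique:
  assumes \<xi>: "\<xi> \<in> TCar" and X: "X \<in> Vec" "X' \<in> Vec" and \<alpha>: "\<alpha> \<in> Om" "\<alpha>' \<in> Om"
    and eq: "(hl X + vl \<alpha>) \<xi> = (hl X' + vl \<alpha>') \<xi>"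
  shows "X (fst \<xi>) = X' (fst \<xi>)" "Y \<in> Vec \<Longrightarrow> \<alpha> Y (fst \<xi>) = \<alpha>' Y (fst \<xi>)"
proof -
  let ?p = "fst \<xi>"
  have p: "?p \<in> Car" by (rule TCar_fst[OF \<xi>])
  note 1 = hv_pp[OF \<xi> X(1) \<alpha>(1) refl] and 2 = hv_pp[OF \<xi> X(2) \<alpha>(2) refl]
  show Xp: "X ?p = X' ?p"
  proof (rule tan_eqI[OF Vec_Tan[OF X(1) p] Vec_Tan[OF X(2) p]])
    fix f assume f: "f \<in> Cinf"
    have "vf_app X f ?p = vf_app X' f ?p"
      unfolding 1(1)[OF f, symmetric] 2(1)[OF f, symmetric] eq ..
    then show "X ?p f = X' ?p f" by (simp only: vf_app_def)
  qed
  show "\<alpha> Y ?p = \<alpha>' Y ?p" if Y: "Y \<in> Vec"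
  proof -
    have "D X Y ?p = D X' Y ?p" by (rule ext, rule D_pointwise[OF X Y p Xp])
    moreover have "snd \<xi> (D X Y ?p) + \<alpha> Y ?p = snd \<xi> (D X' Y ?p) + \<alpha>' Y ?p"
      unfolding 1(2)[OF Y, symmetric] 2(2)[OF Y, symmetric] eq ..
    ultimately show ?thesis by simp
  qed
qed

text \<open>The horizontal part is read off from the action on functions pulled back from the base; what remains
  is vertical.\<close>
lemma hv_decompose:
  assumes \<xi>: "\<xi> \<in> TCar" and V: "V \<in> T.Vec"
  obtains X \<alpha> where "X \<in> Vec" "\<alpha> \<in> Om" "V \<xi> = (hl X + vl \<alpha>) \<xi>"
proof -
  let ?p = "fst \<xi>"
  have p: "?p \<in> Car" by (rule TCar_fst[OF \<xi>])
  have \<xi>e: "(?p, snd \<xi>) \<in> TCar" using \<xi> by simp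
  note VT = T.Vec_Tan[OF V \<xi>]
  have "(\<lambda>f. if f \<in> Cinf then V \<xi> (pp f) else 0) \<in> Tan ?p"
    using T.tan_add[OF VT] T.tan_mult[OF VT] T.tan_scale[OF VT] pr_pull_at[OF \<xi>e]
    unfolding tangent_space_def mem_Collect_eq by (simp add: pr_pull_ring pr_pull_scale)
  then obtain X where X: "X \<in> Vec" and Xp: "X ?p = (\<lambda>f. if f \<in> Cinf then V \<xi> (pp f) else 0)"
    by (rule vector_extension[OF p])
  let ?U = "V - hl X"
  have U: "?U \<in> T.Vec" using V X by simp
  note UT = T.Vec_Tan[OF U \<xi>]
  have U0: "?U \<xi> (pp f) = 0" if "f \<in> Cinf" for f
    using fun_cong[OF hl_pp[OF X that], of \<xi>] that \<xi> by (simp add: vf_app_def Xp pr_pull_def)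
  obtain \<mu> y G where fr: "frame \<mu> y G" "\<mu> ?p = 1" by (rule frame_exists[OF p])
  note fC = frame_Cinf[OF fr(1)]
  define \<alpha> where "\<alpha> = (\<Sum>b\<in>Basis. form_mult (konst (?U \<xi> (fl (G b)))) (differential A (y b)))"
  have \<alpha>: "\<alpha> \<in> Om" unfolding \<alpha>_def by (rule Om_sum) (use fC in simp)
  have U1: "?U \<xi> (fl Y) = \<alpha> Y ?p" if Y: "Y \<in> Vec" for Y
  proof -
    have "\<mu> ?p * ?U \<xi> (fl Y) = (\<Sum>b\<in>Basis. \<mu> ?p * vf_app Y (y b) ?p * ?U \<xi> (fl (G b)))"
    proof (rule vector_functional[where L="\<lambda>Y. ?U \<xi> (fl Y)", OF fr(1) _ _ Y])
      show "?U \<xi> (fl (Y + Z)) = ?U \<xi> (fl Y) + ?U \<xi> (fl Z)" if "Y \<in> Vec" "Z \<in> Vec" for Y Z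
        unfolding fun_lift_add[OF that] by (rule T.tan_add[OF UT]) (use that in simp_all)
      show "?U \<xi> (fl (vf_mult h Y)) = h ?p * ?U \<xi> (fl Y)" if "h \<in> Cinf" "Y \<in> Vec" for h Y
        unfolding fun_lift_mult[OF that(2)] T.tan_mult[OF UT pr_pull_Cinf[OF that(1)] fun_lift_Cinf[OF that(2)]]
          U0[OF that(1)] using pr_pull_at[OF \<xi>e, of h] by simp
    qed
    also have "\<dots> = \<alpha> Y ?p"
      unfolding \<alpha>_def sum_fun_apply form_mult_app
      by (rule sum.cong[OF refl]) (simp add: konst_at[OF p] differential_app[OF Y] fr(2))
    finally show ?thesis using fr(2) by simp
  qed
  have "?U \<xi> = vl \<alpha> \<xi>"
  proof (rule tangent_bundle_eqI[OF \<xi> UT T.Vec_Tan[OF vl_Vec[OF \<alpha>] \<xi>]])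
    show "?U \<xi> (pp f) = vl \<alpha> \<xi> (pp f)" if "f \<in> Cinf" for f
      using U0[OF that] fun_cong[OF vl_pp[OF \<alpha> that], of \<xi>] by (simp add: vf_app_def)
    show "?U \<xi> (fl Y) = vl \<alpha> \<xi> (fl Y)" if "Y \<in> Vec" for Y
      using U1[OF that] fun_cong[OF vl_fl[OF \<alpha> that], of \<xi>] \<xi> by (simp add: vf_app_def pr_pull_def)
  qed
  then have "V \<xi> = (hl X + vl \<alpha>) \<xi>" by (simp add: fun_eq_iff algebra_simps)
  then show ?thesis using that X \<alpha> by blast
qed

text \<open>The decomposition of a field into lifts is unique only at a point and only up to the values there,
  hence the definite description of the resulting number.\<close>
definition pwg :: "'a covec vfield \<Rightarrow> 'a covec vfield \<Rightarrow> 'a covec \<Rightarrow> real" where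
  "pwg V W \<xi> = (if V \<in> T.Vec \<and> W \<in> T.Vec \<and> \<xi> \<in> TCar then
     (THE c. \<exists>X\<in>Vec. \<exists>\<alpha>\<in>Om. \<exists>Y\<in>Vec. \<exists>\<beta>\<in>Om. V \<xi> = (hl X + vl \<alpha>) \<xi> \<and> W \<xi> = (hl Y + vl \<beta>) \<xi> \<and>
        c = \<alpha> Y (fst \<xi>) + \<beta> X (fst \<xi>)) else 0)"

lemma pwg_eq:
  assumes \<xi>: "\<xi> \<in> TCar" and V: "V \<in> T.Vec" "W \<in> T.Vec" and X: "X \<in> Vec" "\<alpha> \<in> Om" and Y: "Y \<in> Vec" "\<beta> \<in> Om"
    and eq: "V \<xi> = (hl X + vl \<alpha>) \<xi>" "W \<xi> = (hl Y + vl \<beta>) \<xi>"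
  shows "pwg V W \<xi> = \<alpha> Y (fst \<xi>) + \<beta> X (fst \<xi>)"
proof -
  let ?p = "fst \<xi>"
  have p: "?p \<in> Car" by (rule TCar_fst[OF \<xi>])
  have "(THE c. \<exists>X\<in>Vec. \<exists>\<alpha>\<in>Om. \<exists>Y\<in>Vec. \<exists>\<beta>\<in>Om. V \<xi> = (hl X + vl \<alpha>) \<xi> \<and> W \<xi> = (hl Y + vl \<beta>) \<xi> \<and>
        c = \<alpha> Y ?p + \<beta> X ?p) = \<alpha> Y ?p + \<beta> X ?p"
  proof (rule the_equality)
    fix c assume "\<exists>X\<in>Vec. \<exists>\<alpha>\<in>Om. \<exists>Y\<in>Vec. \<exists>\<beta>\<in>Om. V \<xi> = (hl X + vl \<alpha>) \<xi> \<and> W \<xi> = (hl Y + vl \<beta>) \<xi> \<and>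
        c = \<alpha> Y ?p + \<beta> X ?p"
    then obtain X' \<alpha>' Y' \<beta>' where X': "X' \<in> Vec" "\<alpha>' \<in> Om" and Y': "Y' \<in> Vec" "\<beta>' \<in> Om"
      and eq': "V \<xi> = (hl X' + vl \<alpha>') \<xi>" "W \<xi> = (hl Y' + vl \<beta>') \<xi>" and c: "c = \<alpha>' Y' ?p + \<beta>' X' ?p"
      by blast
    note u = hv_unique[OF \<xi> X'(1) X(1) X'(2) X(2) trans[OF eq'(1)[symmetric] eq(1)]]
      and w = hv_unique[OF \<xi> Y'(1) Y(1) Y'(2) Y(2) trans[OF eq'(2)[symmetric] eq(2)]]
    show "c = \<alpha> Y ?p + \<beta> X ?p"
      unfolding c u(2)[OF Y'(1)] w(2)[OF X'(1)]
      using form_pointwise[OF X(2) Y'(1) Y(1) p w(1)] form_pointwise[OF Y(2) X'(1) X(1) p u(1)] by simp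
  qed (use X Y eq in blast)
  then show ?thesis using \<xi> V by (simp add: pwg_def)
qed

lemma pwg_Cinf:
  assumes V: "V \<in> T.Vec" and W: "W \<in> T.Vec"
  shows "pwg V W \<in> T.Cinf"
proof (rule T.Cinf_local)
  show "pwg V W \<xi> = 0" if "\<xi> \<notin> TCar" for \<xi> using that by (simp add: pwg_def)
  fix \<xi>0 assume \<xi>0: "\<xi>0 \<in> TCar"
  obtain \<mu> y G where fr: "frame \<mu> y G" "\<mu> (fst \<xi>0) = 1" by (rule frame_exists[OF TCar_fst[OF \<xi>0]])
  note fC = frame_Cinf[OF fr(1)]
  \<comment> \<open>for V = hl X + vl \<alpha> at a point, K V b is the component \<alpha> (G b) there, as a global function\<close>
  define K where "K V b = vf_app V (fl (G b)) - (\<Sum>j\<in>Basis. vf_app V (pp (y j)) * fl (D (G j) (G b)))" for V b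
  have KC: "K V b \<in> T.Cinf" if "V \<in> T.Vec" "b \<in> Basis" for V b
    unfolding K_def by (intro T.Cinf_diff T.Cinf_sum T.Cinf_mult T.Vec_app fun_lift_Cinf pr_pull_Cinf D_Vec fC that)
  let ?S = "\<Sum>b\<in>Basis. vf_app V (pp (y b)) * K W b + vf_app W (pp (y b)) * K V b"
  have S: "?S \<in> T.Cinf"
    by (rule T.Cinf_sum) (intro T.Cinf_add T.Cinf_mult T.Vec_app pr_pull_Cinf KC fC V W)
  have "pp \<mu> * pwg V W = pp \<mu> * ?S"
  proof
    fix \<xi>
    show "(pp \<mu> * pwg V W) \<xi> = (pp \<mu> * ?S) \<xi>"
    proof (cases "\<xi> \<in> TCar \<and> \<mu> (fst \<xi>) \<noteq> 0")
      case True
      then have \<xi>: "\<xi> \<in> TCar" and nz: "\<mu> (fst \<xi>) \<noteq> 0" by auto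
      let ?p = "fst \<xi>"
      have p: "?p \<in> Car" by (rule TCar_fst[OF \<xi>])
      have cot: "snd \<xi> \<in> Cot ?p" by (rule TCar_snd[OF \<xi>])
      have vf: "L X = (\<Sum>b\<in>Basis. vf_app X (y b) ?p * L (G b))"
        if "\<And>V W. V \<in> Vec \<Longrightarrow> W \<in> Vec \<Longrightarrow> L (V + W) = L V + L W"
          "\<And>h V. h \<in> Cinf \<Longrightarrow> V \<in> Vec \<Longrightarrow> L (vf_mult h V) = h ?p * L V" "X \<in> Vec" for L X
      proof -
        have "\<mu> ?p * L X = \<mu> ?p * (\<Sum>b\<in>Basis. vf_app X (y b) ?p * L (G b))"
          unfolding sum_distrib_left mult.assoc[symmetric] by (rule vector_functional[OF fr(1) that])
        then show ?thesis using nz by simp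
      qed
      have K: "K V b \<xi> = \<alpha> (G b) ?p"
        if "V \<in> T.Vec" "X \<in> Vec" "\<alpha> \<in> Om" "V \<xi> = (hl X + vl \<alpha>) \<xi>" "b \<in> Basis" for V X \<alpha> b
      proof -
        note h = hv_pp[OF \<xi> that(2-4)] and Gb = fC(3)[OF that(5)]
        have "snd \<xi> (D X (G b) ?p) = (\<Sum>j\<in>Basis. vf_app X (y j) ?p * snd \<xi> (D (G j) (G b) ?p))"
        proof (rule vf[OF _ _ that(2)])
          show "snd \<xi> (D (V + W) (G b) ?p) = snd \<xi> (D V (G b) ?p) + snd \<xi> (D W (G b) ?p)"
            if "V \<in> Vec" "W \<in> Vec" for V W
            using cotan_add[OF cot Vec_Tan[OF D_Vec[OF that(1) Gb] p] Vec_Tan[OF D_Vec[OF that(2) Gb] p]]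
            by (simp add: D_add_left that Gb)
          show "snd \<xi> (D (vf_mult h V) (G b) ?p) = h ?p * snd \<xi> (D V (G b) ?p)" if "h \<in> Cinf" "V \<in> Vec" for h V
            using cotan_scale[OF cot Vec_Tan[OF D_Vec[OF that(2) Gb] p]]
            by (simp add: D_mult_left that Gb) (simp add: vf_mult_def)
        qed
        moreover have "(\<Sum>j\<in>Basis. vf_app V (pp (y j)) * fl (D (G j) (G b))) \<xi> =
            (\<Sum>j\<in>Basis. vf_app X (y j) ?p * snd \<xi> (D (G j) (G b) ?p))"
          unfolding sum_fun_apply
          by (rule sum.cong[OF refl]) (use \<xi> h(1)[OF fC(2)] in \<open>simp add: fun_lift_def vf_app_def[of V]\<close>)
        ultimately show ?thesis using h(2)[OF Gb] unfolding K_def by (simp add: vf_app_def[of V])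
      qed
      obtain X \<alpha> where X: "X \<in> Vec" "\<alpha> \<in> Om" and eX: "V \<xi> = (hl X + vl \<alpha>) \<xi>" by (rule hv_decompose[OF \<xi> V])
      obtain Y \<beta> where Y: "Y \<in> Vec" "\<beta> \<in> Om" and eY: "W \<xi> = (hl Y + vl \<beta>) \<xi>" by (rule hv_decompose[OF \<xi> W])
      have om: "\<alpha> Y ?p = (\<Sum>b\<in>Basis. vf_app Y (y b) ?p * \<alpha> (G b) ?p)" if "\<alpha> \<in> Om" "Y \<in> Vec" for \<alpha> Y
        by (rule vf[where L="\<lambda>Y. \<alpha> Y ?p"]) (simp_all add: Om_add[OF that(1)] Om_mult[OF that(1)] that(2))
      have "?S \<xi> = (\<Sum>b\<in>Basis. vf_app X (y b) ?p * \<beta> (G b) ?p + vf_app Y (y b) ?p * \<alpha> (G b) ?p)"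
        unfolding sum_fun_apply
        by (rule sum.cong[OF refl])
          (simp add: K[OF V X eX] K[OF W Y eY] vf_app_def[of V] vf_app_def[of W]
            hv_pp(1)[OF \<xi> X eX fC(2)] hv_pp(1)[OF \<xi> Y eY fC(2)])
      also have "\<dots> = \<beta> X ?p + \<alpha> Y ?p" unfolding sum.distrib om[OF Y(2) X(1)] om[OF X(2) Y(1)] ..
      also have "\<dots> = pwg V W \<xi>" using pwg_eq[where V=V and W=W and \<xi>=\<xi>, OF \<xi> V W X Y eX eY] by simp
      finally show ?thesis by simp
    qed (auto simp: pr_pull_def)
  qed
  moreover have "pp \<mu> \<xi>0 \<noteq> 0" using \<xi>0 fr(2) by (simp add: pr_pull_def)
  ultimately show "\<exists>\<mu>\<in>T.Cinf. \<mu> \<xi>0 \<noteq> 0 \<and> \<mu> * pwg V W \<in> T.Cinf"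
    using S fC(1) by (intro bexI[of _ "pp \<mu>"]) simp_all
qed

lemma pwg_sym_tensors: "pwg \<in> sym_tensors2 TB"
proof -
  have at: "F = G" if "\<And>\<xi>. \<xi> \<in> TCar \<Longrightarrow> F \<xi> = G \<xi>" "F \<in> T.Cinf" "G \<in> T.Cinf" for F G
  proof
    fix \<xi> show "F \<xi> = G \<xi>" using that(1) T.Cinf_off[OF that(2)] T.Cinf_off[OF that(3)] by (cases "\<xi> \<in> TCar") simp_all
  qed
  have sym: "pwg V W = pwg W V" if V: "V \<in> T.Vec" "W \<in> T.Vec" for V W
  proof (rule at[OF _ pwg_Cinf[OF V] pwg_Cinf[OF V(2,1)]])
    fix \<xi> assume \<xi>: "\<xi> \<in> TCar"
    obtain X \<alpha> where X: "X \<in> Vec" "\<alpha> \<in> Om" "V \<xi> = (hl X + vl \<alpha>) \<xi>" by (rule hv_decompose[OF \<xi> V(1)])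
    obtain Y \<beta> where Y: "Y \<in> Vec" "\<beta> \<in> Om" "W \<xi> = (hl Y + vl \<beta>) \<xi>" by (rule hv_decompose[OF \<xi> V(2)])
    show "pwg V W \<xi> = pwg W V \<xi>"
      using pwg_eq[where V=V and W=W and \<xi>=\<xi>, OF \<xi> V X(1,2) Y(1,2) X(3) Y(3)] pwg_eq[where V=W and W=V and \<xi>=\<xi>, OF \<xi> V(2,1) Y(1,2) X(1,2) Y(3) X(3)] by simp
  qed
  have add: "pwg (U + V) W = pwg U W + pwg V W" if V: "U \<in> T.Vec" "V \<in> T.Vec" "W \<in> T.Vec" for U V W
  proof (rule at)
    show "pwg (U + V) W \<in> T.Cinf" "pwg U W + pwg V W \<in> T.Cinf" using V by (simp_all add: pwg_Cinf)
    fix \<xi> assume \<xi>: "\<xi> \<in> TCar"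
    obtain Z \<gamma> where Z: "Z \<in> Vec" "\<gamma> \<in> Om" "U \<xi> = (hl Z + vl \<gamma>) \<xi>" by (rule hv_decompose[OF \<xi> V(1)])
    obtain X \<alpha> where X: "X \<in> Vec" "\<alpha> \<in> Om" "V \<xi> = (hl X + vl \<alpha>) \<xi>" by (rule hv_decompose[OF \<xi> V(2)])
    obtain Y \<beta> where Y: "Y \<in> Vec" "\<beta> \<in> Om" "W \<xi> = (hl Y + vl \<beta>) \<xi>" by (rule hv_decompose[OF \<xi> V(3)])
    have s: "(U + V) \<xi> = (hl (Z + X) + vl (\<gamma> + \<alpha>)) \<xi>"
      using Z X by (simp add: hl_add vl_add fun_eq_iff)
    show "pwg (U + V) W \<xi> = (pwg U W + pwg V W) \<xi>"
      using pwg_eq[where V="U + V" and W=W and \<xi>=\<xi>, OF \<xi> T.Vec_add[OF V(1,2)] V(3) Vec_add[OF Z(1) X(1)] Om_plus[OF Z(2) X(2)] Y(1,2) s Y(3)]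
        pwg_eq[where V=U and W=W and \<xi>=\<xi>, OF \<xi> V(1,3) Z(1,2) Y(1,2) Z(3) Y(3)] pwg_eq[where V=V and W=W and \<xi>=\<xi>, OF \<xi> V(2,3) X(1,2) Y(1,2) X(3) Y(3)]
        Om_add[OF Y(2) Z(1) X(1)] by simp
  qed
  have mult: "pwg (vf_mult F V) W = F * pwg V W" if F: "F \<in> T.Cinf" and V: "V \<in> T.Vec" "W \<in> T.Vec" for F V W
  proof (rule at)
    show "pwg (vf_mult F V) W \<in> T.Cinf" "F * pwg V W \<in> T.Cinf" using F V by (simp_all add: pwg_Cinf)
    fix \<xi> assume \<xi>: "\<xi> \<in> TCar"
    have p: "fst \<xi> \<in> Car" by (rule TCar_fst[OF \<xi>])
    obtain X \<alpha> where X: "X \<in> Vec" "\<alpha> \<in> Om" "V \<xi> = (hl X + vl \<alpha>) \<xi>" by (rule hv_decompose[OF \<xi> V(1)])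
    obtain Y \<beta> where Y: "Y \<in> Vec" "\<beta> \<in> Om" "W \<xi> = (hl Y + vl \<beta>) \<xi>" by (rule hv_decompose[OF \<xi> V(2)])
    let ?c = "konst (F \<xi>)"
    have h: "hl (vf_mult ?c X) = vf_mult (pp ?c) (hl X)"
      by (rule TVec_eqI) (use X in \<open>simp_all add: vf_app_left D_mult_left fun_lift_mult\<close>)
    have s: "vf_mult F V \<xi> = (hl (vf_mult ?c X) + vl (form_mult ?c \<alpha>)) \<xi>"
      using X \<xi> p by (simp add: h vl_mult) (simp add: vf_mult_def pr_pull_def konst_def fun_eq_iff algebra_simps)
    show "pwg (vf_mult F V) W \<xi> = (F * pwg V W) \<xi>"
      using pwg_eq[where V="vf_mult F V" and W=W and \<xi>=\<xi>, OF \<xi> T.Vec_mult[OF F V(1)] V(2) Vec_mult[OF Cinf_konst X(1)] Om_form_mult[OF Cinf_konst X(2)] Y(1,2) s Y(3)]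
        pwg_eq[where V=V and W=W and \<xi>=\<xi>, OF \<xi> V X(1,2) Y(1,2) X(3) Y(3)] Om_mult[OF Y(2) Cinf_konst X(1), of "F \<xi>"]
      by (simp add: form_mult_app konst_at[OF p] algebra_simps)
  qed
  show ?thesis
    unfolding sym_tensors2_def mem_Collect_eq
    using sym add mult pwg_Cinf by (auto simp: pwg_def fun_eq_iff)
qed

lemma pwg_lifts:
  assumes "X \<in> Vec" "Y \<in> Vec" "\<alpha> \<in> Om" "\<beta> \<in> Om"
  shows "pwg (hl X + vl \<alpha>) (hl Y + vl \<beta>) = pp (\<alpha> Y + \<beta> X)"
proof
  fix \<xi>
  have V: "hl X + vl \<alpha> \<in> T.Vec" "hl Y + vl \<beta> \<in> T.Vec" using assms by simp_all
  show "pwg (hl X + vl \<alpha>) (hl Y + vl \<beta>) \<xi> = pp (\<alpha> Y + \<beta> X) \<xi>"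
  proof (cases "\<xi> \<in> TCar")
    case False
    then show ?thesis by (simp only: pwg_def pr_pull_off simp_thms if_False)
  next
    case True
    then show ?thesis using pwg_eq[where V="hl X + vl \<alpha>" and W="hl Y + vl \<beta>" and \<xi>=\<xi>, OF _ V assms(1,3,2,4) refl refl]
      by (simp only: pr_pull_def plus_fun_apply if_True)
  qed
qed

text \<open>In a frame the fields \<open>G\<^sub>b\<^sup>h \<plusminus> (1/2) (dy\<^sub>b)\<^sup>v\<close> are orthogonal with squares \<open>\<plusminus>1\<close>, because a horizontal lift
  pairs with the vertical lift of a dual form to \<open>1\<close>.\<close>
lemma split_signatureI:
  assumes g: "\<And>X Y \<alpha> \<beta>. X \<in> Vec \<Longrightarrow> Y \<in> Vec \<Longrightarrow> \<alpha> \<in> Om \<Longrightarrow> \<beta> \<in> Om \<Longrightarrow>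
    g (hl X + vl \<alpha>) (hl Y + vl \<beta>) = pp (\<alpha> Y + \<beta> X)"
  shows "split_signature TB g"
  unfolding split_signature_def
proof (intro conjI ballI)
  let ?n = "DIM('e)"
  show "even DIM('e \<times> 'e)" by simp
  fix \<xi> assume \<xi>: "\<xi> \<in> TCar"
  let ?p = "fst \<xi>"
  have p: "?p \<in> Car" by (rule TCar_fst[OF \<xi>])
  obtain \<mu> y G where fr: "frame \<mu> y G" "\<mu> ?p = 1" by (rule frame_exists[OF p])
  note fC = frame_Cinf[OF fr(1)]
  obtain h :: "nat \<Rightarrow> 'e" where h: "bij_betw h {0..<?n} Basis"
    using ex_bij_betw_nat_finite[OF finite_Basis] by blast
  define b where "b i = h (if i < ?n then i else i - ?n)" for i
  define c :: "nat \<Rightarrow> real" where "c i = (if i < ?n then 1/2 else - 1/2)" for i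
  define V where "V i = hl (G (b i)) + vl (form_mult (konst (c i)) (differential A (y (b i))))" for i
  have b: "b i \<in> Basis" if "i < 2 * ?n" for i using h that by (auto simp: b_def bij_betw_def)
  have bij: "b i = b j \<longleftrightarrow> (if i < ?n then i else i - ?n) = (if j < ?n then j else j - ?n)"
    if "i < 2 * ?n" "j < 2 * ?n" for i j
    unfolding b_def by (rule inj_on_eq_iff[OF bij_betw_imp_inj_on[OF h]]) (use that in auto)
  have VT: "V i \<in> T.Vec" if "i < 2 * ?n" for i using b[OF that] fC by (simp add: V_def)
  have gV: "g (V i) (V j) \<xi> = (if b i = b j then c i + c j else 0)" if ij: "i < 2 * ?n" "j < 2 * ?n" for i j
  proof -
    have "g (V i) (V j) \<xi> = c i * G (b j) ?p (y (b i)) + c j * G (b i) ?p (y (b j))"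
      unfolding V_def using b[OF ij(1)] b[OF ij(2)] fC \<xi>
      by (subst g) (simp_all add: pr_pull_def form_mult_app konst_at[OF p] differential_app vf_app_def)
    also have "\<dots> = (if b i = b j then c i + c j else 0)"
      using frame_dual[OF fr(1) _ b[OF ij(1)] b[OF ij(2)], of ?p] frame_dual[OF fr(1) _ b[OF ij(2)] b[OF ij(1)], of ?p] fr(2)
      by auto
    finally show ?thesis .
  qed
  show "\<exists>V. (\<forall>i<DIM('e \<times> 'e). V i \<in> T.Vec) \<and> (\<forall>i<DIM('e \<times> 'e). \<forall>j<DIM('e \<times> 'e). g (V i) (V j) \<xi> =
           (if i \<noteq> j then 0 else if 2 * i < DIM('e \<times> 'e) then 1 else -1))"
  proof (intro exI[of _ V] conjI allI impI)
    fix i assume i: "i < DIM('e \<times> 'e)"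
    then have i2: "i < 2 * ?n" by simp
    show "V i \<in> T.Vec" by (rule VT[OF i2])
    fix j assume "j < DIM('e \<times> 'e)"
    then have j2: "j < 2 * ?n" by simp
    show "g (V i) (V j) \<xi> = (if i \<noteq> j then 0 else if 2 * i < DIM('e \<times> 'e) then 1 else -1)"
      unfolding gV[OF i2 j2] bij[OF i2 j2] using i2 j2
      by (cases "i < ?n"; cases "j < ?n"; auto simp: c_def)
  qed
qed

lemma pw_metric_eq: "pw_metric A D = pwg"
  unfolding pw_metric_def
proof (rule the_equality)
  show "pwg \<in> sym_tensors2 TB \<and> split_signature TB pwg \<and>
     (\<forall>X\<in>Vec. \<forall>Y\<in>Vec. \<forall>\<alpha>\<in>Om. \<forall>\<beta>\<in>Om. pwg (hl X + vl \<alpha>) (hl Y + vl \<beta>) = pp (\<alpha> Y + \<beta> X))"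
    by (intro conjI ballI pwg_sym_tensors split_signatureI pwg_lifts)
  fix g assume g: "g \<in> sym_tensors2 TB \<and> split_signature TB g \<and>
     (\<forall>X\<in>Vec. \<forall>Y\<in>Vec. \<forall>\<alpha>\<in>Om. \<forall>\<beta>\<in>Om. g (hl X + vl \<alpha>) (hl Y + vl \<beta>) = pp (\<alpha> Y + \<beta> X))"
  note gt = conjunct1[OF g] and gl = conjunct2[OF conjunct2[OF g], rule_format]
  have off: "\<And>V W. V \<notin> T.Vec \<or> W \<notin> T.Vec \<Longrightarrow> g V W = 0"
    and Cs: "\<And>V W. V \<in> T.Vec \<Longrightarrow> W \<in> T.Vec \<Longrightarrow> g V W \<in> T.Cinf \<and> g V W = g W V"
    and add: "\<And>U V W. U \<in> T.Vec \<Longrightarrow> V \<in> T.Vec \<Longrightarrow> W \<in> T.Vec \<Longrightarrow> g (U + V) W = g U W + g V W"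
    and mult: "\<And>F V W. F \<in> T.Cinf \<Longrightarrow> V \<in> T.Vec \<Longrightarrow> W \<in> T.Vec \<Longrightarrow> g (vf_mult F V) W = F * g V W"
    using gt unfolding sym_tensors2_def mem_Collect_eq by blast+
  show "g = pwg"
  proof (intro ext)
    fix V W \<xi>
    show "g V W \<xi> = pwg V W \<xi>"
    proof (cases "V \<in> T.Vec \<and> W \<in> T.Vec \<and> \<xi> \<in> TCar")
      case True
      then have V: "V \<in> T.Vec" and W: "W \<in> T.Vec" and \<xi>: "\<xi> \<in> TCar" by auto
      have pt: "g V W \<xi> = g V' W \<xi>" if "V \<in> T.Vec" "V' \<in> T.Vec" "W \<in> T.Vec" "V \<xi> = V' \<xi>" for V V' W
        by (rule T.tensorial[where L="\<lambda>V. g V W \<xi>", OF \<xi> _ _ that(1,2,4)]) (simp_all add: add mult that(3))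
      obtain X \<alpha> where X: "X \<in> Vec" "\<alpha> \<in> Om" "V \<xi> = (hl X + vl \<alpha>) \<xi>" by (rule hv_decompose[OF \<xi> V])
      obtain Y \<beta> where Y: "Y \<in> Vec" "\<beta> \<in> Om" "W \<xi> = (hl Y + vl \<beta>) \<xi>" by (rule hv_decompose[OF \<xi> W])
      have VX: "hl X + vl \<alpha> \<in> T.Vec" and WY: "hl Y + vl \<beta> \<in> T.Vec" using X Y by simp_all
      have "g V W \<xi> = g (hl X + vl \<alpha>) W \<xi>"
        by (rule pt[where V=V and V'="hl X + vl \<alpha>", OF V VX W X(3)])
      also have "\<dots> = g W (hl X + vl \<alpha>) \<xi>" by (rule fun_cong[OF conjunct2[OF Cs[OF VX W]]])
      also have "\<dots> = g (hl Y + vl \<beta>) (hl X + vl \<alpha>) \<xi>"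
        by (rule pt[where V=W and V'="hl Y + vl \<beta>", OF W WY VX Y(3)])
      also have "\<dots> = pp (\<beta> X + \<alpha> Y) \<xi>" unfolding gl[OF Y(1) X(1) Y(2) X(2)] ..
      also have "\<dots> = pwg V W \<xi>"
        using pwg_eq[where V=V and W=W and \<xi>=\<xi>, OF \<xi> V W X(1,2) Y(1,2) X(3) Y(3)] \<xi> by (simp add: pr_pull_def)
      finally show ?thesis .
    next
      case False
      then consider "V \<notin> T.Vec \<or> W \<notin> T.Vec" | "V \<in> T.Vec" "W \<in> T.Vec" "\<xi> \<notin> TCar" by blast
      then show ?thesis
      proof cases
        case 1
        then show ?thesis using off[OF 1] by (auto simp: pwg_def)
      next
        case 2
        then show ?thesis using T.Cinf_off[OF conjunct1[OF Cs[OF 2(1,2)]] 2(3)] by (simp add: pwg_def)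
      qed
    qed
  qed
qed

abbreviation "g \<equiv> pw_metric A D"

lemma
  assumes V: "V \<in> T.Vec" and W: "W \<in> T.Vec"
  shows g_Cinf [simp]: "g V W \<in> T.Cinf"
    and g_sym: "g V W = g W V"
    and g_add_left: "U \<in> T.Vec \<Longrightarrow> g (U + V) W = g U W + g V W"
    and g_mult_left: "F \<in> T.Cinf \<Longrightarrow> g (vf_mult F V) W = F * g V W"
  using pwg_sym_tensors V W unfolding sym_tensors2_def mem_Collect_eq pw_metric_eq by blast+

lemma g_lifts:
  "X \<in> Vec \<Longrightarrow> Y \<in> Vec \<Longrightarrow> \<alpha> \<in> Om \<Longrightarrow> \<beta> \<in> Om \<Longrightarrow> g (hl X + vl \<alpha>) (hl Y + vl \<beta>) = pp (\<alpha> Y + \<beta> X)"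
  unfolding pw_metric_eq by (rule pwg_lifts)

subsection \<open>The metric on lifts\<close>

lemma TCinf_eqI: "F \<in> T.Cinf \<Longrightarrow> G \<in> T.Cinf \<Longrightarrow> (\<And>\<xi>. \<xi> \<in> TCar \<Longrightarrow> F \<xi> = G \<xi>) \<Longrightarrow> F = G"
  using T.Cinf_off[of F] T.Cinf_off[of G] by (metis ext)

lemma g_add_right: "U \<in> T.Vec \<Longrightarrow> V \<in> T.Vec \<Longrightarrow> W \<in> T.Vec \<Longrightarrow> g W (U + V) = g W U + g W V"
  using g_add_left[of V W U] g_sym[of W] by simp

lemma g_zero_left: "W \<in> T.Vec \<Longrightarrow> g 0 W = 0"
  using g_add_left[of 0 W 0] by (simp add: fun_eq_iff)

lemma g_zero_right: "W \<in> T.Vec \<Longrightarrow> g W 0 = 0"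
  using g_zero_left[of W] g_sym[of W 0] by simp

lemma g_minus_left: "V \<in> T.Vec \<Longrightarrow> W \<in> T.Vec \<Longrightarrow> g (- V) W = - g V W"
  using g_add_left[of V W "- V"] g_zero_left[of W] by (simp add: fun_eq_iff add_eq_0_iff2)

lemma g_minus_right: "V \<in> T.Vec \<Longrightarrow> W \<in> T.Vec \<Longrightarrow> g W (- V) = - g W V"
  using g_minus_left[of V W] g_sym[of W V] g_sym[of W "- V"] by simp

lemma g_diff_left: "U \<in> T.Vec \<Longrightarrow> V \<in> T.Vec \<Longrightarrow> W \<in> T.Vec \<Longrightarrow> g (U - V) W = g U W - g V W"
  using g_add_left[of "- V" W U] by (simp add: g_minus_left)

lemma g_diff_right: "U \<in> T.Vec \<Longrightarrow> V \<in> T.Vec \<Longrightarrow> W \<in> T.Vec \<Longrightarrow> g W (U - V) = g W U - g W V"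
  using g_add_right[of U "- V" W] by (simp add: g_minus_right)

lemma g_pointwise:
  assumes \<xi>: "\<xi> \<in> TCar" and V: "V \<in> T.Vec" "V' \<in> T.Vec" and W: "W \<in> T.Vec" and eq: "V \<xi> = V' \<xi>"
  shows "g V W \<xi> = g V' W \<xi>"
  by (rule T.tensorial[where L="\<lambda>V. g V W \<xi>", OF \<xi> _ _ V eq]) (simp_all add: g_add_left g_mult_left W)

lemma ev_g_left:
  assumes \<eta>: "\<eta> \<in> Om" and V: "V \<in> T.Vec" "V' \<in> T.Vec" and W: "W \<in> T.Vec"
    and eq: "\<And>p. p \<in> Car \<Longrightarrow> V (p, covec \<eta> p) = V' (p, covec \<eta> p)"
  shows "ev \<eta> (g V W) = ev \<eta> (g V' W)"
proof
  fix p show "ev \<eta> (g V W) p = ev \<eta> (g V' W) p"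
  proof (cases "p \<in> Car")
    case True
    then show ?thesis
      using g_pointwise[where V=V and V'=V' and \<xi>="(p, covec \<eta> p)", OF sec_TCar[OF \<eta> True] V W eq[OF True]]
      by (simp only: ev_at)
  qed (simp add: ev_def)
qed

lemma g_vl_vl: "\<alpha> \<in> Om \<Longrightarrow> \<beta> \<in> Om \<Longrightarrow> g (vl \<alpha>) (vl \<beta>) = 0"
  using g_lifts[of 0 0 \<alpha> \<beta>] Om_zero_app[of \<alpha>] Om_zero_app[of \<beta>]
  by (simp only: hl_zero pr_pull_zero add_0 Vec_zero simp_thms)

lemma g_hl_vl: "X \<in> Vec \<Longrightarrow> \<beta> \<in> Om \<Longrightarrow> g (hl X) (vl \<beta>) = pp (\<beta> X)"
  using g_lifts[of X 0 0 \<beta>] by (simp add: hl_zero vl_zero)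

lemma g_hl_hl: "X \<in> Vec \<Longrightarrow> Y \<in> Vec \<Longrightarrow> g (hl X) (hl Y) = 0"
  using g_lifts[of X Y 0 0] by (simp add: vl_zero pr_pull_zero)

lemma ev_g_om:
  "\<eta> \<in> Om \<Longrightarrow> Y \<in> Vec \<Longrightarrow> W \<in> T.Vec \<Longrightarrow> ev \<eta> (g (om Y) W) = ev \<eta> (g (vl (dform \<eta> Y)) W)"
  by (rule ev_g_left) (simp_all add: om_section)

lemma g_om_vl: "Y \<in> Vec \<Longrightarrow> \<beta> \<in> Om \<Longrightarrow> g (om Y) (vl \<beta>) = 0"
  by (rule ev_eqI) (simp_all add: ev_g_om g_vl_vl)

lemma g_om_om: "Y \<in> Vec \<Longrightarrow> Z \<in> Vec \<Longrightarrow> g (om Y) (om Z) = 0"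
  by (rule ev_eqI) (simp_all add: ev_g_om g_sym[of "vl _" "om Z"] g_om_vl)

lemma g_om_hl:
  assumes Y: "Y \<in> Vec" and X: "X \<in> Vec"
  shows "g (om Y) (hl X) = fl (D X Y)"
proof (rule ev_eqI)
  fix \<eta> assume \<eta>: "\<eta> \<in> Om"
  show "ev \<eta> (g (om Y) (hl X)) = ev \<eta> (fl (D X Y))"
    using X Y \<eta> Om_app[OF \<eta> D_Vec[OF X Y]]
    by (simp add: ev_g_om g_sym[of "vl _" "hl X"] g_hl_vl ev_pr_pull ev_fun_lift dform_app)
qed (use X Y in simp_all)

lemma g_om_vertical:
  assumes "W \<in> T.Vec" "Y \<in> Vec" "\<And>\<beta>. \<beta> \<in> Om \<Longrightarrow> g (vl \<beta>) W = 0"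
  shows "g (om Y) W = 0"
  by (rule ev_eqI) (use assms in \<open>simp_all add: ev_g_om\<close>)

lemma g_cl_vl: "X \<in> Vec \<Longrightarrow> \<beta> \<in> Om \<Longrightarrow> g (cl X) (vl \<beta>) = pp (\<beta> X)"
  by (simp add: cl_hl g_diff_left g_hl_vl g_om_vl)

text \<open>Together with \<open>ev_g_om\<close> this reduces products with complete lifts to products with vertical lifts and
  the action on the functions \<open>Y\<^sup>v\<close>.\<close>
lemma g_cl:
  assumes Y: "Y \<in> Vec" and W: "W \<in> T.Vec"
  shows "g (cl Y) W = vf_app W (fl Y) - g (om Y) W - g (om Y) W"
proof (rule TCinf_eqI)
  show "g (cl Y) W \<in> T.Cinf" "vf_app W (fl Y) - g (om Y) W - g (om Y) W \<in> T.Cinf"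
    by (intro T.Cinf_diff g_Cinf T.Vec_app fun_lift_Cinf om_Vec cl_Vec Y W)+
  fix \<xi> assume \<xi>: "\<xi> \<in> TCar"
  obtain X \<alpha> where X: "X \<in> Vec" "\<alpha> \<in> Om" and eq: "W \<xi> = (hl X + vl \<alpha>) \<xi>" by (rule hv_decompose[OF \<xi> W])
  let ?W = "hl X + vl \<alpha>"
  have W': "?W \<in> T.Vec" using X by simp
  have pt: "g V W \<xi> = g V ?W \<xi>" if "V \<in> T.Vec" for V
    using g_pointwise[where V=W and V'="?W", OF \<xi> W W' that eq] g_sym[OF that W] g_sym[OF that W'] by simp
  have "g (om Y) ?W = fl (D X Y)" using X Y by (simp add: g_add_right g_om_hl g_om_vl)
  moreover have "g (cl Y) ?W = pp (\<alpha> Y) - fl (D X Y)"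
    using X Y by (simp add: g_add_right g_cl_vl) (simp add: cl_hl g_diff_left g_hl_hl g_om_hl)
  moreover have "vf_app W (fl Y) \<xi> = fl (D X Y) \<xi> + pp (\<alpha> Y) \<xi>"
    using hv_pp(2)[OF \<xi> X eq Y] \<xi> by (simp add: vf_app_def fun_lift_def pr_pull_def)
  ultimately show "g (cl Y) W \<xi> = (vf_app W (fl Y) - g (om Y) W - g (om Y) W) \<xi>"
    using pt[OF cl_Vec[OF Y]] pt[OF om_Vec[OF Y]] by simp
qed

lemma g_om_cl: "Y \<in> Vec \<Longrightarrow> Z \<in> Vec \<Longrightarrow> g (om Y) (cl Z) = fl (D Z Y)"
  by (simp add: cl_hl g_diff_right g_om_hl g_om_om)

lemma g_cl_cl: "Y \<in> Vec \<Longrightarrow> Z \<in> Vec \<Longrightarrow> g (cl Y) (cl Z) = - fl (D Y Z + D Z Y)"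
  by (simp add: g_cl g_om_cl bracket_D fun_lift_lin)

lemma g_df:
  assumes f: "f \<in> Cinf" and W: "W \<in> T.Vec"
  shows "g (vl (differential A f)) W = vf_app W (pp f)"
proof (rule TCinf_eqI)
  note df = Om_differential[OF f]
  show "g (vl (differential A f)) W \<in> T.Cinf" "vf_app W (pp f) \<in> T.Cinf" using f W by simp_all
  fix \<xi> assume \<xi>: "\<xi> \<in> TCar"
  obtain X \<alpha> where X: "X \<in> Vec" "\<alpha> \<in> Om" and eq: "W \<xi> = (hl X + vl \<alpha>) \<xi>" by (rule hv_decompose[OF \<xi> W])
  let ?W = "hl X + vl \<alpha>"
  have W': "?W \<in> T.Vec" using X by simp
  have "g (vl (differential A f)) W \<xi> = g W (vl (differential A f)) \<xi>" using g_sym[OF vl_Vec[OF df] W] by simp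
  also have "\<dots> = g ?W (vl (differential A f)) \<xi>"
    by (rule g_pointwise[where V=W and V'="?W", OF \<xi> W W' vl_Vec[OF df] eq])
  also have "g ?W (vl (differential A f)) = pp (vf_app X f)"
    using X df by (simp add: g_add_left g_hl_vl g_vl_vl differential_app)
  also have "\<dots> \<xi> = vf_app W (pp f) \<xi>"
    using hv_pp(1)[OF \<xi> X eq f] \<xi> by (simp add: vf_app_def pr_pull_def)
  finally show "g (vl (differential A f)) W \<xi> = vf_app W (pp f) \<xi>" .
qed

subsection \<open>The Lie derivative of the metric\<close>

text \<open>The Lie derivative \<open>L\<^sub>K g\<close>.\<close>
definition lieg :: "'a covec vfield \<Rightarrow> 'a covec vfield \<Rightarrow> 'a covec vfield \<Rightarrow> 'a covec \<Rightarrow> real" where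
  "lieg K V W = vf_app K (g V W) - g (vf_bracket K V) W - g V (vf_bracket K W)"

definition KF :: "'a covec vfield set" where
  "KF = {K \<in> T.Vec. \<forall>V\<in>T.Vec. \<forall>W\<in>T.Vec. lieg K V W = 0}"

lemma killing_fields_eq: "killing_fields TB g = KF"
  by (simp add: killing_fields_def KF_def lieg_def)

lemma lieg_Cinf [simp]: "K \<in> T.Vec \<Longrightarrow> V \<in> T.Vec \<Longrightarrow> W \<in> T.Vec \<Longrightarrow> lieg K V W \<in> T.Cinf"
  by (simp add: lieg_def)

lemma lieg_sym: "K \<in> T.Vec \<Longrightarrow> V \<in> T.Vec \<Longrightarrow> W \<in> T.Vec \<Longrightarrow> lieg K V W = lieg K W V"
  using g_sym[of V W] g_sym[of "vf_bracket K V" W] g_sym[of V "vf_bracket K W"] by (simp add: lieg_def)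

lemma lieg_add_left: "K \<in> T.Vec \<Longrightarrow> U \<in> T.Vec \<Longrightarrow> V \<in> T.Vec \<Longrightarrow> W \<in> T.Vec \<Longrightarrow>
    lieg K (U + V) W = lieg K U W + lieg K V W"
  by (simp add: lieg_def g_add_left T.vf_bracket_add_right T.vf_app_add)

lemma lieg_mult_left: "K \<in> T.Vec \<Longrightarrow> F \<in> T.Cinf \<Longrightarrow> V \<in> T.Vec \<Longrightarrow> W \<in> T.Vec \<Longrightarrow>
    lieg K (vf_mult F V) W = F * lieg K V W"
  by (simp add: lieg_def g_add_left g_mult_left T.vf_bracket_mult_right T.vf_app_mult algebra_simps)

lemma cv_decompose:
  assumes \<xi>: "\<xi> \<in> TCar" and V: "V \<in> T.Vec"
  obtains X \<alpha> where "X \<in> Vec" "\<alpha> \<in> Om" "V \<xi> = (cl X + vl \<alpha>) \<xi>"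
proof -
  obtain X \<alpha> where X: "X \<in> Vec" "\<alpha> \<in> Om" and eq: "V \<xi> = (hl X + vl \<alpha>) \<xi>" by (rule hv_decompose[OF \<xi> V])
  have p: "fst \<xi> \<in> Car" by (rule TCar_fst[OF \<xi>])
  obtain \<eta> where \<eta>: "\<eta> \<in> Om" "covec \<eta> (fst \<xi>) = snd \<xi>" by (rule covec_exists[OF p TCar_snd[OF \<xi>]])
  have "om X \<xi> = vl (dform \<eta> X) \<xi>" using om_section[OF \<eta>(1) p X(1)] \<eta>(2) by simp
  then have "V \<xi> = (cl X + vl (dform \<eta> X + \<alpha>)) \<xi>"
    using X \<eta> eq by (simp add: cl_hl vl_add fun_eq_iff)
  then show ?thesis using that[of X "dform \<eta> X + \<alpha>"] X \<eta> by simp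
qed

text \<open>Complete and vertical lifts span every tangent space of the bundle, so a symmetric tensor
  field that vanishes on them vanishes.\<close>
lemma tensor_zero:
  assumes sym: "\<And>V W. V \<in> T.Vec \<Longrightarrow> W \<in> T.Vec \<Longrightarrow> B V W = B W V"
    and add: "\<And>U V W. U \<in> T.Vec \<Longrightarrow> V \<in> T.Vec \<Longrightarrow> W \<in> T.Vec \<Longrightarrow> B (U + V) W = B U W + B V W"
    and mult: "\<And>F V W. F \<in> T.Cinf \<Longrightarrow> V \<in> T.Vec \<Longrightarrow> W \<in> T.Vec \<Longrightarrow> B (vf_mult F V) W = F * B V W"
    and C: "\<And>V W. V \<in> T.Vec \<Longrightarrow> W \<in> T.Vec \<Longrightarrow> B V W \<in> T.Cinf"
    and vv: "\<And>\<alpha> \<beta>. \<alpha> \<in> Om \<Longrightarrow> \<beta> \<in> Om \<Longrightarrow> B (vl \<alpha>) (vl \<beta>) = 0"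
    and cv: "\<And>X \<beta>. X \<in> Vec \<Longrightarrow> \<beta> \<in> Om \<Longrightarrow> B (cl X) (vl \<beta>) = 0"
    and cc: "\<And>X Y. X \<in> Vec \<Longrightarrow> Y \<in> Vec \<Longrightarrow> B (cl X) (cl Y) = 0"
    and V: "V \<in> T.Vec" and W: "W \<in> T.Vec"
  shows "B V W = 0"
proof (rule TCinf_eqI[OF C[OF V W] T.Cinf_zero])
  fix \<xi> assume \<xi>: "\<xi> \<in> TCar"
  have pt: "B V W \<xi> = B V' W \<xi>" if "V \<in> T.Vec" "V' \<in> T.Vec" "W \<in> T.Vec" "V \<xi> = V' \<xi>" for V V' W
    by (rule T.tensorial[where L="\<lambda>V. B V W \<xi>", OF \<xi> _ _ that(1,2,4)]) (simp_all add: add mult that(3))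
  obtain X \<alpha> where X: "X \<in> Vec" "\<alpha> \<in> Om" and eX: "V \<xi> = (cl X + vl \<alpha>) \<xi>" by (rule cv_decompose[OF \<xi> V])
  obtain Y \<beta> where Y: "Y \<in> Vec" "\<beta> \<in> Om" and eY: "W \<xi> = (cl Y + vl \<beta>) \<xi>" by (rule cv_decompose[OF \<xi> W])
  let ?V = "cl X + vl \<alpha>" and ?W = "cl Y + vl \<beta>"
  have V': "?V \<in> T.Vec" and W': "?W \<in> T.Vec" using X Y by simp_all
  have c: "cl X \<in> T.Vec" "cl Y \<in> T.Vec" "vl \<alpha> \<in> T.Vec" "vl \<beta> \<in> T.Vec" using X Y by simp_all
  have "B V W \<xi> = B ?V W \<xi>" by (rule pt[where V=V and V'="?V", OF V V' W eX])
  also have "\<dots> = B W ?V \<xi>" by (rule fun_cong[OF sym[OF V' W]])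
  also have "\<dots> = B ?W ?V \<xi>" by (rule pt[where V=W and V'="?W", OF W W' V' eY])
  also have "B ?W ?V = B (cl Y) ?V + B (vl \<beta>) ?V" by (rule add[OF c(2,4) V'])
  also have "\<dots> = B ?V (cl Y) + B ?V (vl \<beta>)" by (simp only: sym[OF c(2) V'] sym[OF c(4) V'])
  also have "\<dots> = 0"
    unfolding add[OF c(1,3,2)] add[OF c(1,3,4)] sym[OF c(3,2)]
    by (simp only: cc[OF X(1) Y(1)] cv[OF Y(1) X(2)] cv[OF X(1) Y(2)] vv[OF X(2) Y(2)] add_0)
  finally show "B V W \<xi> = 0 \<xi>" .
qed

lemma KFI:
  assumes K: "K \<in> T.Vec"
    and "\<And>\<alpha> \<beta>. \<alpha> \<in> Om \<Longrightarrow> \<beta> \<in> Om \<Longrightarrow> lieg K (vl \<alpha>) (vl \<beta>) = 0"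
    and "\<And>X \<beta>. X \<in> Vec \<Longrightarrow> \<beta> \<in> Om \<Longrightarrow> lieg K (cl X) (vl \<beta>) = 0"
    and "\<And>X Y. X \<in> Vec \<Longrightarrow> Y \<in> Vec \<Longrightarrow> lieg K (cl X) (cl Y) = 0"
  shows "K \<in> KF"
proof -
  have "lieg K V W = 0" if "V \<in> T.Vec" "W \<in> T.Vec" for V W
    by (rule tensor_zero[where B="lieg K", OF lieg_sym[OF K] lieg_add_left[OF K] lieg_mult_left[OF K]
        lieg_Cinf[OF K] assms(2-4) that])
  then show ?thesis using K by (simp add: KF_def)
qed

lemma lieg_vl_right:
  assumes K: "K \<in> T.Vec" and \<beta>: "\<beta> \<in> Om" and V: "V \<in> T.Vec"
    and v: "\<And>\<alpha>. \<alpha> \<in> Om \<Longrightarrow> lieg K (vl \<alpha>) (vl \<beta>) = 0"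
    and c: "\<And>X. X \<in> Vec \<Longrightarrow> lieg K (cl X) (vl \<beta>) = 0"
  shows "lieg K V (vl \<beta>) = 0"
proof (rule TCinf_eqI[OF lieg_Cinf[OF K V vl_Vec[OF \<beta>]] T.Cinf_zero])
  fix \<xi> assume \<xi>: "\<xi> \<in> TCar"
  obtain X \<alpha> where X: "X \<in> Vec" "\<alpha> \<in> Om" and eX: "V \<xi> = (cl X + vl \<alpha>) \<xi>" by (rule cv_decompose[OF \<xi> V])
  have V': "cl X + vl \<alpha> \<in> T.Vec" using X by simp
  have "lieg K V (vl \<beta>) \<xi> = lieg K (cl X + vl \<alpha>) (vl \<beta>) \<xi>"
    by (rule T.tensorial[where L="\<lambda>V. lieg K V (vl \<beta>) \<xi>", OF \<xi> _ _ V V' eX])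
      (simp_all add: lieg_add_left lieg_mult_left K \<beta>)
  also have "lieg K (cl X + vl \<alpha>) (vl \<beta>) = 0"
    using X \<beta> K by (simp add: lieg_add_left v c)
  finally show "lieg K V (vl \<beta>) \<xi> = 0 \<xi>" .
qed

text \<open>This and the next lemma hold for every form and every vector field, Killing or not; they are the
  reason why brackets with vertical and complete lifts act on moment functions by Lie derivatives.\<close>
lemma lieg_vl: "\<alpha> \<in> Om \<Longrightarrow> \<beta> \<in> Om \<Longrightarrow> V \<in> T.Vec \<Longrightarrow> lieg (vl \<alpha>) V (vl \<beta>) = 0"
proof (rule lieg_vl_right)
  assume \<alpha>: "\<alpha> \<in> Om" and \<beta>: "\<beta> \<in> Om"
  show "lieg (vl \<alpha>) (vl \<gamma>) (vl \<beta>) = 0" if "\<gamma> \<in> Om" for \<gamma>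
    using \<alpha> \<beta> that by (simp add: lieg_def g_vl_vl vl_vl g_zero_left g_zero_right T.vf_app_zero)
  show "lieg (vl \<alpha>) (cl X) (vl \<beta>) = 0" if X: "X \<in> Vec" for X
    using \<alpha> \<beta> X vf_bracket_antisym[of "vl \<alpha>" "cl X"] Om_app[OF \<beta> X]
    by (simp add: lieg_def g_vl_vl vl_vl g_zero_right g_cl_vl cl_vl g_minus_left)
qed simp_all

lemma lieg_cl: "Y \<in> Vec \<Longrightarrow> \<beta> \<in> Om \<Longrightarrow> V \<in> T.Vec \<Longrightarrow> lieg (cl Y) V (vl \<beta>) = 0"
proof (rule lieg_vl_right)
  assume Y: "Y \<in> Vec" and \<beta>: "\<beta> \<in> Om"
  show "lieg (cl Y) (vl \<gamma>) (vl \<beta>) = 0" if "\<gamma> \<in> Om" for \<gamma>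
    using Y \<beta> that by (simp add: lieg_def g_vl_vl cl_vl T.vf_app_zero)
  show "lieg (cl Y) (cl X) (vl \<beta>) = 0" if X: "X \<in> Vec" for X
    using Y \<beta> X Om_app[OF \<beta> X] by (simp add: lieg_def g_cl_vl cl_vl cl_cl lie_form_app pr_pull_ring)
qed simp_all

text \<open>The metric is homogeneous of degree one under dilations of the fibres.\<close>
lemma lieg_eul:
  assumes V: "V \<in> T.Vec" and W: "W \<in> T.Vec"
  shows "lieg eul V W = g V W"
proof -
  have "lieg eul V W - g V W = 0"
  proof (rule tensor_zero[where B="\<lambda>V W. lieg eul V W - g V W"])
    show "lieg eul V W - g V W = lieg eul W V - g W V" if "V \<in> T.Vec" "W \<in> T.Vec" for V W
      using lieg_sym[OF eul_Vec that] g_sym[OF that] by simp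
    show "lieg eul (U + V) W - g (U + V) W = lieg eul U W - g U W + (lieg eul V W - g V W)"
      if "U \<in> T.Vec" "V \<in> T.Vec" "W \<in> T.Vec" for U V W
      using that by (simp add: lieg_add_left g_add_left)
    show "lieg eul (vf_mult F V) W - g (vf_mult F V) W = F * (lieg eul V W - g V W)"
      if "F \<in> T.Cinf" "V \<in> T.Vec" "W \<in> T.Vec" for F V W
      using that by (simp add: lieg_mult_left g_mult_left algebra_simps)
    show "lieg eul (vl \<alpha>) (vl \<beta>) - g (vl \<alpha>) (vl \<beta>) = 0" if "\<alpha> \<in> Om" "\<beta> \<in> Om" for \<alpha> \<beta>
      using that by (simp add: lieg_def g_vl_vl eul_vl g_minus_left g_minus_right T.vf_app_zero)
    show "lieg eul (cl X) (vl \<beta>) - g (cl X) (vl \<beta>) = 0" if "X \<in> Vec" "\<beta> \<in> Om" for X \<beta>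
      using that Om_app[OF that(2,1)]
      by (simp add: lieg_def g_cl_vl eul_vl eul_cl g_minus_right g_zero_left)
    show "lieg eul (cl X) (cl Y) - g (cl X) (cl Y) = 0" if "X \<in> Vec" "Y \<in> Vec" for X Y
      using that by (simp add: lieg_def g_cl_cl eul_cl g_zero_left g_zero_right T.vf_app_minus)
  qed (use V W in simp_all)
  then show ?thesis by (simp only: right_minus_eq)
qed

text \<open>This is \<open>L\<^bsub>[H,K]\<^esub> = [L\<^sub>H, L\<^sub>K]\<close>.\<close>
lemma lieg_bracket:
  assumes H: "H \<in> T.Vec" and K: "K \<in> T.Vec" and V: "V \<in> T.Vec" and W: "W \<in> T.Vec"
  shows "lieg (vf_bracket H K) V W =
    (vf_app H (lieg K V W) - lieg K (vf_bracket H V) W - lieg K V (vf_bracket H W)) -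
    (vf_app K (lieg H V W) - lieg H (vf_bracket K V) W - lieg H V (vf_bracket K W))"
proof -
  have b: "vf_bracket (vf_bracket H K) V = vf_bracket H (vf_bracket K V) - vf_bracket K (vf_bracket H V)"
    if "V \<in> T.Vec" for V
    using T.vf_bracket_bracket[OF H K that] by simp
  show ?thesis
    unfolding lieg_def b[OF V] b[OF W]
    using assms by (simp add: vf_app_left T.vf_app_right g_diff_left g_diff_right algebra_simps)
qed

lemma KF_bracket: "H \<in> KF \<Longrightarrow> K \<in> KF \<Longrightarrow> vf_bracket H K \<in> KF"
  by (simp add: KF_def lieg_bracket T.vf_app_zero)

text \<open>By homogeneity, \<open>L\<^bsub>[\<epsilon>,K]\<^esub> g = L\<^sub>\<epsilon> L\<^sub>K g - L\<^sub>K g\<close>.\<close>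
lemma KF_eul: "K \<in> KF \<Longrightarrow> vf_bracket eul K \<in> KF"
  by (simp add: KF_def lieg_bracket lieg_eul T.vf_app_zero) (simp add: lieg_def)

subsection \<open>Moment functions\<close>

lemma vl_commute:
  assumes "\<alpha> \<in> Om" "\<beta> \<in> Om"
  shows "vf_app (vl \<alpha>) (vf_app (vl \<beta>) F) = vf_app (vl \<beta>) (vf_app (vl \<alpha>) F)"
  using arg_cong[OF vl_vl[OF assms], of "\<lambda>V. vf_app V F"] by (simp add: vf_app_left)

lemma vl_cl_commute:
  assumes "\<alpha> \<in> Om" "Y \<in> Vec"
  shows "vf_app (vl \<alpha>) (vf_app (cl Y) F) = vf_app (cl Y) (vf_app (vl \<alpha>) F) - vf_app (vl (lie_form A Y \<alpha>)) F"
  using arg_cong[OF cl_vl[OF assms(2,1)], of "\<lambda>V. vf_app V F"] by (simp add: vf_app_left algebra_simps)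

text \<open>The functions \<open>g(\<beta>\<^sup>v, K)\<close> are called the moment functions of \<open>K\<close>. The following identities say how a
  bracket of \<open>K\<close> with one of the standard fields changes them.\<close>
lemma g_vl_bracket_vl:
  assumes \<alpha>: "\<alpha> \<in> Om" and \<beta>: "\<beta> \<in> Om" and V: "V \<in> T.Vec"
  shows "g (vl \<beta>) (vf_bracket (vl \<alpha>) V) = vf_app (vl \<alpha>) (g (vl \<beta>) V)"
  using lieg_vl[OF \<alpha> \<beta> V] g_sym[OF vl_Vec[OF \<beta>] V] g_sym[OF vl_Vec[OF \<beta>] T.Vec_bracket[OF vl_Vec[OF \<alpha>] V]]
  by (simp add: lieg_def vl_vl[OF \<alpha> \<beta>] g_zero_right[OF V])

lemma g_om_bracket_vl:
  assumes \<alpha>: "\<alpha> \<in> Om" and Y: "Y \<in> Vec" and V: "V \<in> T.Vec"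
  shows "g (om Y) (vf_bracket (vl \<alpha>) V) = vf_app (vl \<alpha>) (g (om Y) V) - g (vl (dform \<alpha> Y)) V"
proof -
  have O: "om Y \<in> T.Vec" "vl \<alpha> \<in> T.Vec" using Y \<alpha> by simp_all
  have "lieg (vl \<alpha>) (om Y) V = 0"
  proof (rule TCinf_eqI[OF lieg_Cinf[OF O(2,1) V] T.Cinf_zero])
    fix \<xi> assume \<xi>: "\<xi> \<in> TCar"
    have p: "fst \<xi> \<in> Car" by (rule TCar_fst[OF \<xi>])
    obtain \<eta> where \<eta>: "\<eta> \<in> Om" "covec \<eta> (fst \<xi>) = snd \<xi>" by (rule covec_exists[OF p TCar_snd[OF \<xi>]])
    have eq: "om Y \<xi> = vl (dform \<eta> Y) \<xi>" using om_section[OF \<eta>(1) p Y] \<eta>(2) by simp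
    have d: "dform \<eta> Y \<in> Om" using \<eta> Y by simp
    have "lieg (vl \<alpha>) (om Y) V \<xi> = lieg (vl \<alpha>) (vl (dform \<eta> Y)) V \<xi>"
      by (rule T.tensorial[where L="\<lambda>U. lieg (vl \<alpha>) U V \<xi>", OF \<xi> _ _ O(1) vl_Vec[OF d] eq])
        (simp_all add: lieg_add_left lieg_mult_left O V)
    also have "lieg (vl \<alpha>) (vl (dform \<eta> Y)) V = 0"
      using lieg_sym[OF O(2) vl_Vec[OF d] V] lieg_vl[OF \<alpha> d V] by simp
    finally show "lieg (vl \<alpha>) (om Y) V \<xi> = 0 \<xi>" .
  qed
  then show ?thesis by (simp add: lieg_def vl_om[OF \<alpha> Y] algebra_simps)
qed

lemma g_vl_bracket_cl:
  assumes X: "X \<in> Vec" and \<beta>: "\<beta> \<in> Om" and V: "V \<in> T.Vec"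
  shows "g (vl \<beta>) (vf_bracket (cl X) V) = vf_app (cl X) (g (vl \<beta>) V) - g (vl (lie_form A X \<beta>)) V"
proof -
  have "lieg (cl X) (vl \<beta>) V = 0"
    using lieg_cl[OF X \<beta> V] lieg_sym[OF cl_Vec[OF X] vl_Vec[OF \<beta>] V] by simp
  then show ?thesis by (simp add: lieg_def cl_vl[OF X \<beta>] algebra_simps)
qed

lemma g_vl_bracket_eul:
  assumes \<beta>: "\<beta> \<in> Om" and V: "V \<in> T.Vec"
  shows "g (vl \<beta>) (vf_bracket eul V) = vf_app eul (g (vl \<beta>) V)"
  using lieg_eul[OF vl_Vec[OF \<beta>] V] by (simp add: lieg_def eul_vl[OF \<beta>] g_minus_left[OF vl_Vec[OF \<beta>] V])

text \<open>The Killing equation with a vertical argument becomes a relation between moment functions, the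
  products with the fields \<open>om Y\<close>, and the action on the functions \<open>Y\<^sup>v\<close>.\<close>
lemma lieg_vv:
  assumes K: "K \<in> T.Vec" and \<alpha>: "\<alpha> \<in> Om" and \<beta>: "\<beta> \<in> Om"
  shows "lieg K (vl \<alpha>) (vl \<beta>) = vf_app (vl \<alpha>) (g (vl \<beta>) K) + vf_app (vl \<beta>) (g (vl \<alpha>) K)"
proof -
  note T = T.Vec_bracket[OF vl_Vec[OF \<alpha>] K] T.Vec_bracket[OF vl_Vec[OF \<beta>] K]
  show ?thesis
    unfolding lieg_def vf_bracket_antisym[of K] g_vl_vl[OF \<alpha> \<beta>] g_minus_left[OF T(1) vl_Vec[OF \<beta>]]
      g_minus_right[OF T(2) vl_Vec[OF \<alpha>]] g_sym[OF T(1) vl_Vec[OF \<beta>]]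
      g_vl_bracket_vl[OF \<alpha> \<beta> K] g_vl_bracket_vl[OF \<beta> \<alpha> K] T.vf_app_zero[OF K] by simp
qed

lemma lieg_cv:
  assumes K: "K \<in> T.Vec" and Y: "Y \<in> Vec" and \<beta>: "\<beta> \<in> Om"
  shows "lieg K (cl Y) (vl \<beta>) = vf_app (vl \<beta>) (vf_app K (fl Y)) + vf_app (cl Y) (g (vl \<beta>) K)
    - g (vl (lie_form A Y \<beta>)) K - vf_app (vl \<beta>) (g (om Y) K) - vf_app (vl \<beta>) (g (om Y) K)
    + g (vl (dform \<beta> Y)) K + g (vl (dform \<beta> Y)) K"
proof -
  note T = T.Vec_bracket[OF cl_Vec[OF Y] K] T.Vec_bracket[OF vl_Vec[OF \<beta>] K]
  show ?thesis
    unfolding lieg_def vf_bracket_antisym[of K] g_cl_vl[OF Y \<beta>] g_minus_left[OF T(1) vl_Vec[OF \<beta>]]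
      g_minus_right[OF T(2) cl_Vec[OF Y]] g_sym[OF T(1) vl_Vec[OF \<beta>]] g_vl_bracket_cl[OF Y \<beta> K]
      g_cl[OF Y T(2)] g_om_bracket_vl[OF \<beta> Y K] vf_app_bracket vl_fl[OF \<beta> Y] by simp
qed

end

section \<open>Killing vector fields\<close>

context affine_manifold
begin

abbreviation "va \<alpha> F \<equiv> vf_app (vl \<alpha>) F"
abbreviation "mo K \<beta> \<equiv> g (vl \<beta>) K"

lemma pp_inj: "f \<in> Cinf \<Longrightarrow> pp f = 0 \<Longrightarrow> f = 0"
  using ev_pr_pull[of 0 f] by (simp add: ev_zero)

lemma fl_inj:
  assumes V: "V \<in> Vec" and z: "fl V = 0"
  shows "V = 0"
proof (rule vf_eqI[OF V Vec_zero])
  fix f assume f: "f \<in> Cinf"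
  have "vf_app V f = ev (differential A f) (fl V)"
    using ev_fun_lift[OF Om_differential[OF f] V] differential_app[OF V, of f] by simp
  then show "vf_app V f = vf_app 0 f" by (simp add: z ev_zero vf_app_left)
qed

lemma KF_Vec: "K \<in> KF \<Longrightarrow> K \<in> T.Vec"
  and KF_zero: "K \<in> KF \<Longrightarrow> V \<in> T.Vec \<Longrightarrow> W \<in> T.Vec \<Longrightarrow> lieg K V W = 0"
  by (auto simp: KF_def)

subsection \<open>Vertical lifts of Killing forms\<close>

lemma lieg_vl_cc:
  assumes \<alpha>: "\<alpha> \<in> Om" and Y: "Y \<in> Vec" and Z: "Z \<in> Vec"
  shows "lieg (vl \<alpha>) (cl Y) (cl Z) = pp (nabla_form A D Y \<alpha> Z + nabla_form A D Z \<alpha> Y)"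
proof -
  have b: "vf_bracket (vl \<alpha>) (cl W) = - vl (lie_form A W \<alpha>)" if "W \<in> Vec" for W
    using vf_bracket_antisym[of "vl \<alpha>" "cl W"] cl_vl[OF that \<alpha>] by simp
  have "g (- vl (lie_form A Y \<alpha>)) (cl Z) = - pp (lie_form A Y \<alpha> Z)"
    using Y Z \<alpha> g_sym[of "vl (lie_form A Y \<alpha>)" "cl Z"] by (simp add: g_minus_left g_cl_vl)
  moreover have "g (cl Y) (- vl (lie_form A Z \<alpha>)) = - pp (lie_form A Z \<alpha> Y)"
    using Y Z \<alpha> by (simp add: g_minus_right g_cl_vl)
  moreover have "vf_app (vl \<alpha>) (- fl (D Y Z + D Z Y)) = - pp (\<alpha> (D Y Z + D Z Y))"
    using Y Z \<alpha> by (simp add: T.vf_app_minus)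
  ultimately have "lieg (vl \<alpha>) (cl Y) (cl Z) = pp (lie_form A Y \<alpha> Z + lie_form A Z \<alpha> Y - \<alpha> (D Y Z + D Z Y))"
    by (simp add: lieg_def b Y Z g_cl_cl pr_pull_ring)
  also have "lie_form A Y \<alpha> Z + lie_form A Z \<alpha> Y - \<alpha> (D Y Z + D Z Y) = nabla_form A D Y \<alpha> Z + nabla_form A D Z \<alpha> Y"
    using Y Z by (simp add: lie_form_app nabla_form_app bracket_D Om_lin[OF \<alpha>] fun_eq_iff)
  finally show ?thesis .
qed

text \<open>The components with a vertical argument vanish for every form, which leaves the symmetrized covariant
  derivative.\<close>
lemma vl_KF_iff:
  assumes \<alpha>: "\<alpha> \<in> Om"
  shows "vl \<alpha> \<in> KF \<longleftrightarrow> \<alpha> \<in> Kill1 A D"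
proof
  assume K: "vl \<alpha> \<in> KF"
  have "nabla_form A D Y \<alpha> Z + nabla_form A D Z \<alpha> Y = 0" if Y: "Y \<in> Vec" and Z: "Z \<in> Vec" for Y Z
  proof (rule pp_inj)
    show "nabla_form A D Y \<alpha> Z + nabla_form A D Z \<alpha> Y \<in> Cinf"
      by (rule Cinf_add[OF Om_app[OF nabla_form_Om[OF Y \<alpha>] Z] Om_app[OF nabla_form_Om[OF Z \<alpha>] Y]])
    show "pp (nabla_form A D Y \<alpha> Z + nabla_form A D Z \<alpha> Y) = 0"
      using lieg_vl_cc[OF \<alpha> Y Z] KF_zero[OF K cl_Vec[OF Y] cl_Vec[OF Z]] by simp
  qed
  then show "\<alpha> \<in> Kill1 A D" using \<alpha> by (simp add: Kill1_def)
next
  assume "\<alpha> \<in> Kill1 A D"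
  then have "\<forall>Y\<in>Vec. \<forall>Z\<in>Vec. nabla_form A D Y \<alpha> Z + nabla_form A D Z \<alpha> Y = 0"
    unfolding Kill1_def mem_Collect_eq by (rule conjunct2)
  note z = this[rule_format]
  show "vl \<alpha> \<in> KF"
  proof (rule KFI[OF vl_Vec[OF \<alpha>]])
    show "lieg (vl \<alpha>) (cl Y) (cl Z) = 0" if "Y \<in> Vec" "Z \<in> Vec" for Y Z
      unfolding lieg_vl_cc[OF \<alpha> that] z[OF that] by (rule pr_pull_zero)
  qed (use \<alpha> in \<open>simp_all add: lieg_vl\<close>)
qed

subsection \<open>Complete lifts of affine vector fields\<close>

text \<open>The Lie derivative of the connection; it is symmetric for a torsion-free connection.\<close>
definition lieD :: "'a vfield \<Rightarrow> 'a vfield \<Rightarrow> 'a vfield \<Rightarrow> 'a vfield" where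
  "lieD X Y Z = vf_bracket X (D Y Z) - D Y (vf_bracket X Z) - D (vf_bracket X Y) Z"

lemma lieD_sym:
  assumes X: "X \<in> Vec" and Y: "Y \<in> Vec" and Z: "Z \<in> Vec"
  shows "lieD X Y Z = lieD X Z Y"
proof -
  have "vf_bracket X (D Y Z - D Z Y) = vf_bracket (vf_bracket X Y) Z + vf_bracket Y (vf_bracket X Z)"
    using vf_bracket_bracket[OF X Y Z] bracket_D[OF Y Z] by simp
  moreover have "vf_bracket (vf_bracket X Y) Z = D (vf_bracket X Y) Z - D Z (vf_bracket X Y)"
    "vf_bracket Y (vf_bracket X Z) = D Y (vf_bracket X Z) - D (vf_bracket X Z) Y"
    using X Y Z by (simp_all add: bracket_D[of "vf_bracket X Y"] bracket_D[of Y])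
  ultimately show ?thesis
    using X Y Z vf_bracket_diff_right[of "D Y Z" "D Z Y" X]
    by (simp add: lieD_def algebra_simps)
qed

lemma lieg_cl_cc:
  assumes X: "X \<in> Vec" and Y: "Y \<in> Vec" and Z: "Z \<in> Vec"
  shows "lieg (cl X) (cl Y) (cl Z) = - fl (lieD X Y Z + lieD X Z Y)"
  using assms
  by (simp add: lieg_def g_cl_cl cl_cl T.vf_app_right vf_bracket_add_right lieD_def fun_lift_lin algebra_simps)

lemma lieD_Vec: "X \<in> Vec \<Longrightarrow> Y \<in> Vec \<Longrightarrow> Z \<in> Vec \<Longrightarrow> lieD X Y Z \<in> Vec"
  by (simp add: lieD_def)

lemma aff_iff: "X \<in> aff A D \<longleftrightarrow> X \<in> Vec \<and> (\<forall>Y\<in>Vec. \<forall>Z\<in>Vec. lieD X Y Z = 0)"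
  by (auto simp: aff_def lieD_def)

text \<open>What is left of the Killing equation is the symmetrization of the Lie derivative of the connection;
  by symmetry that is twice the Lie derivative itself.\<close>
lemma cl_KF_iff:
  assumes X: "X \<in> Vec"
  shows "cl X \<in> KF \<longleftrightarrow> X \<in> aff A D"
proof
  assume K: "cl X \<in> KF"
  have "lieD X Y Z = 0" if Y: "Y \<in> Vec" and Z: "Z \<in> Vec" for Y Z
  proof (rule fl_inj[OF lieD_Vec[OF X Y Z]])
    note L = lieD_Vec[OF X Y Z]
    have "- fl (lieD X Y Z + lieD X Y Z) = 0"
      using trans[OF lieg_cl_cc[OF X Y Z, symmetric] KF_zero[OF K cl_Vec[OF Y] cl_Vec[OF Z]]]
      unfolding lieD_sym[OF X Z Y] .
    then show "fl (lieD X Y Z) = 0" unfolding fun_lift_add[OF L L] by (simp add: fun_eq_iff)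
  qed
  then show "X \<in> aff A D" using X by (simp add: aff_iff)
next
  assume a: "X \<in> aff A D"
  show "cl X \<in> KF"
  proof (rule KFI[OF cl_Vec[OF X]])
    show "lieg (cl X) (cl Y) (cl Z) = 0" if "Y \<in> Vec" "Z \<in> Vec" for Y Z
      using a that by (simp add: lieg_cl_cc[OF X] aff_iff fun_lift_zero)
    show "lieg (cl X) (vl \<alpha>) (vl \<beta>) = 0" if "\<alpha> \<in> Om" "\<beta> \<in> Om" for \<alpha> \<beta>
      using that X by (simp add: lieg_cl)
  qed (use X in \<open>simp_all add: lieg_cl\<close>)
qed

subsection \<open>Horizontal lifts of bivector fields\<close>

lemma ev_mo_bl:
  assumes \<pi>: "\<pi> \<in> bivecs A" and \<beta>: "\<beta> \<in> Om" and \<eta>: "\<eta> \<in> Om"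
  shows "ev \<eta> (mo (bl \<pi>) \<beta>) = \<pi> \<eta> \<beta>"
proof -
  note V = contract_Vec[OF \<pi> \<eta>]
  have "ev \<eta> (mo (bl \<pi>) \<beta>) = ev \<eta> (g (bl \<pi>) (vl \<beta>))"
    using g_sym[OF vl_Vec[OF \<beta>] bl_Vec[OF \<pi>]] by simp
  also have "\<dots> = ev \<eta> (g (hl (contract A \<pi> \<eta>)) (vl \<beta>))"
    by (rule ev_g_left[OF \<eta> bl_Vec[OF \<pi>] hl_Vec[OF V] vl_Vec[OF \<beta>]]) (rule bl_section[OF \<pi> \<eta>])
  also have "\<dots> = \<beta> (contract A \<pi> \<eta>)"
    unfolding g_hl_vl[OF V \<beta>] by (rule ev_pr_pull[OF \<eta> Om_app[OF \<beta> V]])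
  finally show ?thesis unfolding contract_app[OF \<pi> \<eta> \<beta>] .
qed

lemma mo_bl:
  assumes \<pi>: "\<pi> \<in> bivecs A" and \<beta>: "\<beta> \<in> Om"
  shows "mo (bl \<pi>) \<beta> = - fl (contract A \<pi> \<beta>)"
proof (rule ev_eqI)
  fix \<eta> assume \<eta>: "\<eta> \<in> Om"
  show "ev \<eta> (mo (bl \<pi>) \<beta>) = ev \<eta> (- fl (contract A \<pi> \<beta>))"
    unfolding ev_mo_bl[OF \<pi> \<beta> \<eta>] ev_minus ev_fun_lift[OF \<eta> contract_Vec[OF \<pi> \<beta>]] contract_app[OF \<pi> \<beta> \<eta>]
    by (rule bv_antisym[OF \<pi> \<eta> \<beta>])
qed (use \<pi> \<beta> in simp_all)

lemma va_mo_bl: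
  assumes \<pi>: "\<pi> \<in> bivecs A" and \<alpha>: "\<alpha> \<in> Om" and \<beta>: "\<beta> \<in> Om"
  shows "va \<alpha> (mo (bl \<pi>) \<beta>) = pp (\<pi> \<alpha> \<beta>)"
  unfolding mo_bl[OF \<pi> \<beta>] T.vf_app_minus[OF vl_Vec[OF \<alpha>] fun_lift_Cinf[OF contract_Vec[OF \<pi> \<beta>]]]
    vl_fl[OF \<alpha> contract_Vec[OF \<pi> \<beta>]] contract_app[OF \<pi> \<beta> \<alpha>] pr_pull_minus[symmetric]
    bv_antisym[OF \<pi> \<alpha> \<beta>] ..

lemma g_om_bl: "\<pi> \<in> bivecs A \<Longrightarrow> Y \<in> Vec \<Longrightarrow> g (om Y) (bl \<pi>) = qf \<pi> Y"
  by (rule ev_eqI) (simp_all add: ev_g_om ev_mo_bl ev_qf)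

lemma lieg_bl_vv:
  assumes "\<pi> \<in> bivecs A" "\<alpha> \<in> Om" "\<beta> \<in> Om"
  shows "lieg (bl \<pi>) (vl \<alpha>) (vl \<beta>) = 0"
  unfolding lieg_vv[OF bl_Vec[OF assms(1)] assms(2,3)] va_mo_bl[OF assms] va_mo_bl[OF assms(1,3,2)]
    bv_antisym[OF assms] pr_pull_minus by simp

lemma ev_cl_mo_bl:
  assumes \<pi>: "\<pi> \<in> bivecs A" and Y: "Y \<in> Vec" and \<beta>: "\<beta> \<in> Om" and \<eta>: "\<eta> \<in> Om"
  shows "ev \<eta> (vf_app (cl Y) (mo (bl \<pi>) \<beta>) - mo (bl \<pi>) (lie_form A Y \<beta>)) = lie_bivec A Y \<pi> \<eta> \<beta>"
proof -
  note L = lie_form_Om[OF Y \<eta>] and L' = lie_form_Om[OF Y \<beta>]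
  show ?thesis
    unfolding ev_diff ev_cl[OF \<eta> Y g_Cinf[OF vl_Vec[OF \<beta>] bl_Vec[OF \<pi>]]] va_mo_bl[OF \<pi> L \<beta>]
      ev_mo_bl[OF \<pi> \<beta> \<eta>] ev_mo_bl[OF \<pi> L' \<eta>] ev_pr_pull[OF \<eta> bv_Cinf[OF \<pi> L \<beta>]]
      lie_bivec_app[OF \<eta> \<beta>] ..
qed

lemma lieg_bl_cv:
  assumes \<pi>: "\<pi> \<in> bivecs A" and Y: "Y \<in> Vec" and \<beta>: "\<beta> \<in> Om" and \<eta>: "\<eta> \<in> Om"
  shows "ev \<eta> (lieg (bl \<pi>) (cl Y) (vl \<beta>)) = nabla_bivec A D Y \<pi> \<eta> \<beta>"
proof -
  note d = dform_Om[OF \<eta> Y] and d' = dform_Om[OF \<beta> Y]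
  have "ev \<eta> (lieg (bl \<pi>) (cl Y) (vl \<beta>)) = lie_bivec A Y \<pi> \<eta> \<beta>
    - ev \<eta> (va \<beta> (qf \<pi> Y)) + \<pi> \<eta> (dform \<beta> Y) + \<pi> \<eta> (dform \<beta> Y)"
    unfolding lieg_cv[OF bl_Vec[OF \<pi>] Y \<beta>] g_om_bl[OF \<pi> Y] bl_fl[OF \<pi> Y] ev_cl_mo_bl[OF \<pi> Y \<beta> \<eta>, symmetric]
    by (simp only: ev_ring ev_mo_bl[OF \<pi> d' \<eta>]) (simp add: algebra_simps)
  also have "\<dots> = nabla_bivec A D Y \<pi> \<eta> \<beta>"
    unfolding ev_vl_qf[OF \<pi> Y \<eta> \<beta>] lie_bivec_nabla[OF Y \<pi> \<eta> \<beta>] bv_antisym[OF \<pi> \<beta> d] by simp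
  finally show ?thesis .
qed

text \<open>For a parallel bivector field the remaining components of the Lie derivative of the metric
  are the curvature expression.\<close>
lemma lieg_bl_cc:
  assumes \<pi>: "\<pi> \<in> bivecs A" and parallel: "\<forall>X\<in>Vec. nabla_bivec A D X \<pi> = 0"
    and Y: "Y \<in> Vec" and Z: "Z \<in> Vec" and \<eta>: "\<eta> \<in> Om"
  shows "ev \<eta> (lieg (bl \<pi>) (cl Y) (cl Z)) =
    \<eta> (curvature D Y (contract A \<pi> \<eta>) Z + curvature D Z (contract A \<pi> \<eta>) Y)"
proof -
  let ?v = "contract A \<pi> \<eta>"
  note par = parallel[rule_format]
  note v = contract_Vec[OF \<pi> \<eta>] and B = bl_Vec[OF \<pi>]
  have c: "\<pi> \<eta> \<beta> = \<beta> ?v" if "\<beta> \<in> Om" for \<beta> using contract_app[OF \<pi> \<eta> that] by simp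
  have bf: "ev \<eta> (vf_app (bl \<pi>) (fl W)) = \<eta> (D ?v W)" if "W \<in> Vec" for W
    using that \<pi> \<eta> v by (simp add: ev_qf c dform_app)
  \<comment> \<open>since \<pi> is parallel, derivatives of \<eta> are traded for derivatives of the contraction of \<pi> with \<eta>\<close>
  have E: "ev \<eta> (g (cl Z) (vf_bracket (bl \<pi>) (cl Y))) =
      \<eta> (D ?v (D Y Z)) - \<eta> (D ?v (D Z Y)) - \<eta> (D Y (D ?v Z)) + \<eta> (D (D ?v Z) Y) + \<eta> (D (D Y ?v) Z)
      - \<eta> (D (D ?v Y) Z) - \<eta> (D (D ?v Y) Z) - \<pi> (dform \<eta> Y) (dform \<eta> Z)"
    if Y: "Y \<in> Vec" and Z: "Z \<in> Vec" for Y Z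
  proof -
    let ?t = "dform \<eta> Z" and ?L = "lie_form A Y \<eta>" and ?N = "nabla_form A D Y \<eta>"
    let ?W = "vf_bracket (bl \<pi>) (cl Y)"
    note t = dform_Om[OF \<eta> Z] and L = lie_form_Om[OF Y \<eta>] and N = nabla_form_Om[OF Y \<eta>]
      and d = dform_Om[OF \<eta> Y] and Nt = nabla_form_Om[OF Y dform_Om[OF \<eta> Z]]
    have W: "?W \<in> T.Vec" using \<pi> Y by simp
    have gom: "ev \<eta> (g (om Z) ?W) = - lie_bivec A Y \<pi> \<eta> ?t"
      unfolding ev_g_om[OF \<eta> Z W]
      unfolding vf_bracket_antisym[of "bl \<pi>"]
        g_minus_right[OF T.Vec_bracket[OF cl_Vec[OF Y] B] vl_Vec[OF t]]
        g_vl_bracket_cl[OF Y t B] ev_minus ev_cl_mo_bl[OF \<pi> Y t \<eta>] ..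
    have lieb: "lie_bivec A Y \<pi> \<eta> ?t = - \<pi> (dform \<eta> Y) ?t - \<eta> (D (D ?v Y) Z)"
      using lie_bivec_nabla[OF Y \<pi> \<eta> t] par[OF Y] v Y Z by (simp add: c t dform_app)
    have "nabla_bivec A D Y \<pi> \<eta> ?t = 0" using par[OF Y] by simp
    then have "\<pi> ?N ?t = vf_app Y (\<pi> \<eta> ?t) - \<pi> \<eta> (nabla_form A D Y ?t)"
      unfolding nabla_bivec_app[OF \<eta> t] by (simp add: algebra_simps)
    also have "\<dots> = \<eta> (D (D Y ?v) Z)"
      using v Y Z by (simp add: c t Nt nabla_form_app dform_app fun_eq_iff)
    finally have Npart: "\<pi> ?N ?t = \<eta> (D (D Y ?v) Z)" .
    have "\<pi> ?L ?t = \<pi> ?N ?t + \<pi> (dform \<eta> Y) ?t"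
      unfolding lie_form_nabla[OF Y \<eta>] by (rule bv_add_left[OF \<pi> N t d])
    then have Lpart: "\<pi> ?L ?t = \<eta> (D (D Y ?v) Z) + \<pi> (dform \<eta> Y) ?t" unfolding Npart .
    have L2: "\<pi> \<eta> (dform ?L Z) = vf_app Y (\<pi> \<eta> ?t) - \<eta> (vf_bracket Y (D ?v Z))"
      using v Y Z by (simp add: c dform_Om[OF L Z] t dform_app lie_form_app fun_eq_iff)
    have flW: "ev \<eta> (vf_app ?W (fl Z)) = \<eta> (D ?v (vf_bracket Y Z)) -
        (vf_app Y (\<pi> \<eta> ?t) - (\<pi> ?L ?t + \<pi> \<eta> (dform ?L Z)))"
      using ev_cl[OF \<eta> Y qf_Cinf[OF \<pi> Z]] Y Z
      by (simp add: vf_app_bracket ev_diff bf[OF Vec_bracket[OF Y Z], unfolded bl_fl[OF \<pi> Vec_bracket[OF Y Z]]]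
          \<pi> ev_vl_qf[OF \<pi> Z \<eta> L] ev_qf[OF \<pi> Z \<eta>])
    have br: "\<eta> (D ?v (vf_bracket Y Z)) = \<eta> (D ?v (D Y Z)) - \<eta> (D ?v (D Z Y))"
      "\<eta> (vf_bracket Y (D ?v Z)) = \<eta> (D Y (D ?v Z)) - \<eta> (D (D ?v Z) Y)"
      using v Y Z by (simp_all add: bracket_D D_diff_right Om_lin[OF \<eta>])
    show ?thesis
      unfolding g_cl[OF Z W] ev_diff flW gom lieb Lpart L2 br by (simp add: algebra_simps)
  qed
  have an: "\<pi> (dform \<eta> Z) (dform \<eta> Y) = - \<pi> (dform \<eta> Y) (dform \<eta> Z)"
    by (rule bv_antisym[OF \<pi> dform_Om[OF \<eta> Z] dform_Om[OF \<eta> Y]])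
  have s: "g (vf_bracket (bl \<pi>) (cl Y)) (cl Z) = g (cl Z) (vf_bracket (bl \<pi>) (cl Y))"
    by (rule g_sym) (use \<pi> Y Z in simp_all)
  have G: "ev \<eta> (vf_app (bl \<pi>) (g (cl Y) (cl Z))) = - \<eta> (D ?v (D Y Z)) - \<eta> (D ?v (D Z Y))"
    using Y Z v bf[of "D Y Z + D Z Y"]
    by (simp add: g_cl_cl T.vf_app_minus[OF B] ev_minus D_add_right Om_lin[OF \<eta>] del: bl_fl)
  have cu: "\<eta> (curvature D Y ?v Z) = \<eta> (D Y (D ?v Z)) - \<eta> (D ?v (D Y Z)) - \<eta> (D (D Y ?v) Z) + \<eta> (D (D ?v Y) Z)"
    if "Y \<in> Vec" "Z \<in> Vec" for Y Z
    using that v by (simp add: curvature_def bracket_D D_diff_left Om_lin[OF \<eta>] algebra_simps)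
  have cV: "curvature D Y ?v Z \<in> Vec" if "Y \<in> Vec" "Z \<in> Vec" for Y Z using that v by (simp add: curvature_def)
  show ?thesis
    unfolding Om_add[OF \<eta> cV[OF Y Z] cV[OF Z Y]] cu[OF Y Z] cu[OF Z Y] lieg_def ev_diff G s E[OF Y Z] E[OF Z Y] an
    by (simp add: algebra_simps)
qed

lemma contract_add:
  assumes \<pi>: "\<pi> \<in> bivecs A" and "\<alpha> \<in> Om" "\<beta> \<in> Om"
  shows "contract A \<pi> (\<alpha> + \<beta>) = contract A \<pi> \<alpha> + contract A \<pi> \<beta>"
  by (rule vf_eqI) (use assms in \<open>simp_all add: vf_app_left contract_differential bv_add_left[OF \<pi>] fun_eq_iff\<close>)

lemma curvature_add:
  assumes "Y \<in> Vec" "Z \<in> Vec" "V \<in> Vec" "W \<in> Vec"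
  shows "curvature D Y (V + W) Z = curvature D Y V Z + curvature D Y W Z"
  using assms by (simp add: curvature_def D_add_left D_add_right vf_bracket_add_right algebra_simps)

text \<open>By polarization the symmetric tensor \<open>R\<^sup>\<pi>\<close> may be replaced by its quadratic form, which is what
  pullbacks by sections see.\<close>
lemma parallel_bivecs_iff:
  "\<pi> \<in> parallel_bivecs A D \<longleftrightarrow> \<pi> \<in> bivecs A \<and> (\<forall>X\<in>Vec. nabla_bivec A D X \<pi> = 0) \<and>
    (\<forall>Y\<in>Vec. \<forall>Z\<in>Vec. \<forall>\<eta>\<in>Om. \<eta> (curvature D Y (contract A \<pi> \<eta>) Z + curvature D Z (contract A \<pi> \<eta>) Y) = 0)"
proof -
  let ?S = "\<lambda>Y Z \<eta>. curvature D Y (contract A \<pi> \<eta>) Z + curvature D Z (contract A \<pi> \<eta>) Y"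
  have R: "R_bivec A D \<pi> Y Z \<eta> \<theta> = (\<lambda>p. (\<theta> (?S Y Z \<eta>) p + \<eta> (?S Y Z \<theta>) p) / 2)" for Y Z \<eta> \<theta>
    by (simp add: R_bivec_def symmetrization_def)
  have S: "?S Y Z \<eta> \<in> Vec" if "\<pi> \<in> bivecs A" "Y \<in> Vec" "Z \<in> Vec" "\<eta> \<in> Om" for Y Z \<eta>
    using that by (simp add: curvature_def)
  have Sadd: "?S Y Z (\<eta> + \<theta>) = ?S Y Z \<eta> + ?S Y Z \<theta>"
    if "\<pi> \<in> bivecs A" "Y \<in> Vec" "Z \<in> Vec" "\<eta> \<in> Om" "\<theta> \<in> Om" for Y Z \<eta> \<theta>
    using that by (simp add: contract_add curvature_add algebra_simps)
  have 1: "\<eta> (?S Y Z \<eta>) = 0" if "\<forall>Y\<in>Vec. \<forall>Z\<in>Vec. \<forall>\<eta>\<in>Om. \<forall>\<theta>\<in>Om. R_bivec A D \<pi> Y Z \<eta> \<theta> = 0"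
      "Y \<in> Vec" "Z \<in> Vec" "\<eta> \<in> Om" for Y Z \<eta>
  proof -
    have "R_bivec A D \<pi> Y Z \<eta> \<eta> = 0" using that by blast
    then show ?thesis unfolding R by (simp add: fun_eq_iff)
  qed
  have 2: "R_bivec A D \<pi> Y Z \<eta> \<theta> = 0"
    if \<pi>: "\<pi> \<in> bivecs A" and z: "\<forall>Y\<in>Vec. \<forall>Z\<in>Vec. \<forall>\<eta>\<in>Om. \<eta> (?S Y Z \<eta>) = 0"
      and Y: "Y \<in> Vec" and Z: "Z \<in> Vec" and \<eta>: "\<eta> \<in> Om" and \<theta>: "\<theta> \<in> Om" for Y Z \<eta> \<theta>
  proof -
    have "(\<eta> + \<theta>) (?S Y Z (\<eta> + \<theta>)) = 0" "\<eta> (?S Y Z \<eta>) = 0" "\<theta> (?S Y Z \<theta>) = 0"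
      by (rule z[rule_format, OF Y Z]; simp only: Om_plus \<eta> \<theta>)+
    then have "\<theta> (?S Y Z \<eta>) + \<eta> (?S Y Z \<theta>) = 0"
      unfolding Sadd[OF \<pi> Y Z \<eta> \<theta>] plus_fun_apply[of \<eta> \<theta>]
        Om_add[OF \<eta> S[OF \<pi> Y Z \<eta>] S[OF \<pi> Y Z \<theta>]] Om_add[OF \<theta> S[OF \<pi> Y Z \<eta>] S[OF \<pi> Y Z \<theta>]]
      by (simp only: add_0 add_0_right add.commute)
    then show ?thesis unfolding R by (simp add: fun_eq_iff)
  qed
  show ?thesis
    unfolding parallel_bivecs_def mem_Collect_eq
  proof (rule iffI)
    assume a: "\<pi> \<in> bivecs A \<and> (\<forall>X\<in>Vec. nabla_bivec A D X \<pi> = 0) \<and>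
      (\<forall>Y\<in>Vec. \<forall>Z\<in>Vec. \<forall>\<eta>\<in>Om. \<forall>\<theta>\<in>Om. R_bivec A D \<pi> Y Z \<eta> \<theta> = 0)"
    show "\<pi> \<in> bivecs A \<and> (\<forall>X\<in>Vec. nabla_bivec A D X \<pi> = 0) \<and>
      (\<forall>Y\<in>Vec. \<forall>Z\<in>Vec. \<forall>\<eta>\<in>Om. \<eta> (?S Y Z \<eta>) = 0)"
      by (intro conjI ballI conjunct1[OF a] 1[OF conjunct2[OF conjunct2[OF a]]]
        conjunct1[OF conjunct2[OF a], rule_format])
  next
    assume a: "\<pi> \<in> bivecs A \<and> (\<forall>X\<in>Vec. nabla_bivec A D X \<pi> = 0) \<and>
      (\<forall>Y\<in>Vec. \<forall>Z\<in>Vec. \<forall>\<eta>\<in>Om. \<eta> (?S Y Z \<eta>) = 0)"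
    show "\<pi> \<in> bivecs A \<and> (\<forall>X\<in>Vec. nabla_bivec A D X \<pi> = 0) \<and>
      (\<forall>Y\<in>Vec. \<forall>Z\<in>Vec. \<forall>\<eta>\<in>Om. \<forall>\<theta>\<in>Om. R_bivec A D \<pi> Y Z \<eta> \<theta> = 0)"
      by (intro conjI ballI conjunct1[OF a] 2[OF conjunct1[OF a] conjunct2[OF conjunct2[OF a]]]
        conjunct1[OF conjunct2[OF a], rule_format])
  qed
qed

text \<open>The components of \<open>L g\<close> on a complete and a vertical lift are the covariant derivative of \<open>\<pi>\<close>; once
  it vanishes, those on two complete lifts are the curvature term.\<close>
lemma bl_KF_iff:
  assumes \<pi>: "\<pi> \<in> bivecs A"
  shows "bl \<pi> \<in> KF \<longleftrightarrow> \<pi> \<in> parallel_bivecs A D"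
proof
  assume K: "bl \<pi> \<in> KF"
  have par: "\<forall>X\<in>Vec. nabla_bivec A D X \<pi> = 0"
  proof (intro ballI ext)
    fix X assume X: "X \<in> Vec"
    fix \<alpha> \<beta> p
    show "nabla_bivec A D X \<pi> \<alpha> \<beta> p = 0 \<alpha> \<beta> p"
    proof (cases "\<alpha> \<in> Om \<and> \<beta> \<in> Om")
      case True
      then have \<alpha>: "\<alpha> \<in> Om" and \<beta>: "\<beta> \<in> Om" by auto
      have "nabla_bivec A D X \<pi> \<alpha> \<beta> = ev \<alpha> (lieg (bl \<pi>) (cl X) (vl \<beta>))" by (rule lieg_bl_cv[OF \<pi> X \<beta> \<alpha>, symmetric])
      also have "\<dots> = 0" unfolding KF_zero[OF K cl_Vec[OF X] vl_Vec[OF \<beta>]] by (rule ev_zero)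
      finally show ?thesis by simp
    qed (auto simp: nabla_bivec_def)
  qed
  have "\<eta> (curvature D Y (contract A \<pi> \<eta>) Z + curvature D Z (contract A \<pi> \<eta>) Y) = 0"
    if "Y \<in> Vec" "Z \<in> Vec" "\<eta> \<in> Om" for Y Z \<eta>
  proof -
    have "ev \<eta> (lieg (bl \<pi>) (cl Y) (cl Z)) = 0"
      unfolding KF_zero[OF K cl_Vec[OF that(1)] cl_Vec[OF that(2)]] by (rule ev_zero)
    then show ?thesis unfolding lieg_bl_cc[OF \<pi> par that] .
  qed
  note cu = this
  show "\<pi> \<in> parallel_bivecs A D"
    unfolding parallel_bivecs_iff by (intro conjI \<pi> par ballI cu)
next
  assume "\<pi> \<in> parallel_bivecs A D"
  note P = this[unfolded parallel_bivecs_iff, THEN conjunct2]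
  note par = conjunct1[OF P] and cu = conjunct2[OF P, rule_format]
  show "bl \<pi> \<in> KF"
  proof (rule KFI[OF bl_Vec[OF \<pi>] lieg_bl_vv[OF \<pi>]])
    show "lieg (bl \<pi>) (cl X) (vl \<beta>) = 0" if X: "X \<in> Vec" and \<beta>: "\<beta> \<in> Om" for X \<beta>
    proof (rule ev_eqI[OF lieg_Cinf[OF bl_Vec[OF \<pi>] cl_Vec[OF X] vl_Vec[OF \<beta>]] T.Cinf_zero])
      show "ev \<eta> (lieg (bl \<pi>) (cl X) (vl \<beta>)) = ev \<eta> 0" if "\<eta> \<in> Om" for \<eta>
        unfolding lieg_bl_cv[OF \<pi> X \<beta> that] par[rule_format, OF X] ev_zero by simp
    qed
    show "lieg (bl \<pi>) (cl Y) (cl Z) = 0" if Y: "Y \<in> Vec" and Z: "Z \<in> Vec" for Y Z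
    proof (rule ev_eqI[OF lieg_Cinf[OF bl_Vec[OF \<pi>] cl_Vec[OF Y] cl_Vec[OF Z]] T.Cinf_zero])
      show "ev \<eta> (lieg (bl \<pi>) (cl Y) (cl Z)) = ev \<eta> 0" if "\<eta> \<in> Om" for \<eta>
        unfolding lieg_bl_cc[OF \<pi> par Y Z that] cu[OF Y Z that] ev_zero ..
    qed
  qed
qed

lemma eul_bl:
  assumes \<pi>: "\<pi> \<in> bivecs A"
  shows "vf_bracket eul (bl \<pi>) = bl \<pi>"
proof (rule TVec_eqI)
  fix Y assume Y: "Y \<in> Vec"
  have "vf_app eul (qf \<pi> Y) = qf \<pi> Y + qf \<pi> Y"
  proof (rule ev_eqI)
    show "ev \<eta> (vf_app eul (qf \<pi> Y)) = ev \<eta> (qf \<pi> Y + qf \<pi> Y)" if "\<eta> \<in> Om" for \<eta>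
      unfolding ev_eul[OF that] ev_vl_qf[OF \<pi> Y that that] ev_add ev_qf[OF \<pi> Y that] ..
  qed (use \<pi> Y in \<open>simp, intro T.Cinf_add qf_Cinf, simp_all\<close>)
  then show "vf_app (vf_bracket eul (bl \<pi>)) (fl Y) = vf_app (bl \<pi>) (fl Y)"
    using \<pi> Y by (simp add: vf_app_left)
qed (use \<pi> in simp_all)

end

section \<open>Gradings by a derivation\<close>

text \<open>A derivation with \<open>e\<^sup>3 = e\<close> is diagonalizable with eigenvalues \<open>-1, 0, 1\<close>: the projections are
  \<open>(e\<^sup>2 - e) / 2\<close>, \<open>1 - e\<^sup>2\<close> and \<open>(e\<^sup>2 + e) / 2\<close>. The Leibniz rule makes eigenvalues add up under the
  bracket.\<close>
lemma lie_grading_derivation: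
  fixes smul :: "real \<Rightarrow> 'v::ab_group_add \<Rightarrow> 'v"
  assumes L: "lie_algebra_on smul br L"
    and e: "\<And>x. x \<in> L \<Longrightarrow> e x \<in> L"
    and add: "\<And>x y. x \<in> L \<Longrightarrow> y \<in> L \<Longrightarrow> e (x + y) = e x + e y"
    and scale: "\<And>c x. x \<in> L \<Longrightarrow> e (smul c x) = smul c (e x)"
    and leibniz: "\<And>x y. x \<in> L \<Longrightarrow> y \<in> L \<Longrightarrow> e (br x y) = br (e x) y + br x (e y)"
    and cube: "\<And>x. x \<in> L \<Longrightarrow> e (e (e x)) = e x"
  shows "lie_grading smul br L (\<lambda>i. {x \<in> L. e x = smul (real_of_int i) x})"
    and "i \<notin> {-1, 0, 1} \<Longrightarrow> {x \<in> L. e x = smul (real_of_int i) x} = {0}"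
proof -
  let ?V = "\<lambda>i. {x \<in> L. e x = smul (real_of_int i) x}"
  interpret vector_space smul using L by (simp add: lie_algebra_on_def)
  have S: "subspace L" using L by (simp add: lie_algebra_on_def)
  have L_zero: "0 \<in> L" and L_add: "\<And>x y. x \<in> L \<Longrightarrow> y \<in> L \<Longrightarrow> x + y \<in> L"
    and L_scale: "\<And>c x. x \<in> L \<Longrightarrow> smul c x \<in> L"
    using S by (auto simp: subspace_def)
  have L_diff: "x - y \<in> L" if "x \<in> L" "y \<in> L" for x y
    using L_add[OF that(1) L_scale[OF that(2), of "-1"]] by simp
  have e_zero: "e 0 = 0" using add[OF L_zero L_zero] by simp
  have e_diff: "e (x - y) = e x - e y" if "x \<in> L" "y \<in> L" for x y
    using add[OF that(1) L_scale[OF that(2), of "-1"]] scale[OF that(2), of "-1"] by simp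
  have br_L: "br x y \<in> L" and br_scale: "br (smul c x) y = smul c (br x y)" "br x (smul c y) = smul c (br x y)"
    if "x \<in> L" "y \<in> L" for x y c
    using L that by (auto simp: lie_algebra_on_def)
  have sub: "subspace (?V i)" for i
    unfolding subspace_def
    by (auto simp: L_zero e_zero L_add add L_scale scale scale_right_distrib scale_left_commute)
  \<comment> \<open>eigenvalues inherit the cubic equation\<close>
  have eigen_zero: "x = 0" if i: "i \<notin> {-1, 0, 1}" and x: "x \<in> L" and ex: "e x = smul (real_of_int i) x" for i x
  proof -
    let ?r = "real_of_int i"
    have "smul (?r * (?r * ?r)) x = smul ?r x"
      using cube[OF x] by (simp add: ex scale x L_scale)
    then have "x = 0 \<or> ?r * (?r * ?r) = ?r" by auto
    moreover have "?r * (?r * ?r) \<noteq> ?r"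
    proof
      assume "?r * (?r * ?r) = ?r"
      then have "i * (i * i) = i" by (simp flip: of_int_mult)
      then have "(i - 1) * (i + 1) * i = 0" by (simp add: algebra_simps)
      then show False using i by auto
    qed
    ultimately show ?thesis by simp
  qed
  have uni: "\<exists>!d. (\<forall>i. d i \<in> ?V i) \<and> finite {i. d i \<noteq> 0} \<and> x = (\<Sum>i | d i \<noteq> 0. d i)" if x: "x \<in> L" for x
  proof (rule ex1I)
    let ?d = "\<lambda>i::int. if i = 1 then smul (1/2) (e (e x) + e x) else if i = 0 then x - e (e x)
      else if i = -1 then smul (1/2) (e (e x) - e x) else 0"
    note ex = e[OF x] and eex = e[OF e[OF x]]
    have V: "?d i \<in> ?V i" for i
      by (auto simp: x ex eex L_zero e_zero L_scale scale L_add add L_diff e_diff cube[OF x] algebra_simps)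
    have nz: "{i. ?d i \<noteq> 0} \<subseteq> {-1, 0, 1::int}" by auto
    have "(\<Sum>i | ?d i \<noteq> 0. ?d i) = (\<Sum>i\<in>{-1, 0, 1}. ?d i)"
      by (rule sum.mono_neutral_left) (use nz in auto)
    also have "\<dots> = smul (1/2) (e (e x)) + smul (1/2) (e (e x)) + (x - e (e x))"
      by (simp add: scale_right_distrib scale_right_diff_distrib)
    also have "\<dots> = x" by (simp flip: scale_left_distrib)
    finally show "(\<forall>i. ?d i \<in> ?V i) \<and> finite {i. ?d i \<noteq> 0} \<and> x = (\<Sum>i | ?d i \<noteq> 0. ?d i)"
      using V finite_subset[OF nz] by simp
    fix d assume d: "(\<forall>i. d i \<in> ?V i) \<and> finite {i. d i \<noteq> 0} \<and> x = (\<Sum>i | d i \<noteq> 0. d i)"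
    then have dL: "d i \<in> L" and de: "e (d i) = smul (real_of_int i) (d i)" for i by auto
    have z: "d i = 0" if "i \<notin> {-1, 0, 1}" for i using eigen_zero[OF that dL de] .
    have "x = (\<Sum>i | d i \<noteq> 0. d i)" using d by simp
    also have "\<dots> = (\<Sum>i\<in>{-1, 0, 1}. d i)"
      by (rule sum.mono_neutral_left) (use z in auto)
    finally have x1: "x = d (-1) + (d 0 + d 1)" by simp
    have x2: "e x = d 1 - d (-1)" unfolding x1 by (simp add: add dL L_add de)
    have x3: "e (e x) = d 1 + d (-1)" unfolding x2 by (simp add: e_diff dL de)
    show "d = ?d"
    proof
      fix i :: int
      consider "i = 1" | "i = 0" | "i = -1" | "i \<notin> {-1, 0, 1}" by blast
      then show "d i = ?d i"
      proof cases
        case 1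
        have "smul (1/2) (e (e x) + e x) = smul (1/2) (d 1) + smul (1/2) (d 1)"
          unfolding x3 unfolding x2 by (simp add: scale_right_distrib scale_right_diff_distrib)
        also have "\<dots> = d 1" by (simp flip: scale_left_distrib)
        finally show ?thesis using 1 by simp
      next
        case 2
        have "x - e (e x) = d 0" unfolding x3 by (subst x1) simp
        then show ?thesis using 2 by simp
      next
        case 3
        have "smul (1/2) (e (e x) - e x) = smul (1/2) (d (-1)) + smul (1/2) (d (-1))"
          unfolding x3 unfolding x2 by (simp add: scale_right_distrib scale_right_diff_distrib)
        also have "\<dots> = d (-1)" by (simp flip: scale_left_distrib)
        finally show ?thesis using 3 by simp
      qed (use z in auto)
    qed
  qed
  have grade: "br x y \<in> ?V (i + j)" if "x \<in> ?V i" "y \<in> ?V j" for x y i j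
    using that by (simp add: br_L leibniz br_scale scale_left_distrib)
  show "?V i = {0}" if "i \<notin> {-1, 0, 1}" using eigen_zero[OF that] by (auto simp: L_zero e_zero)
  show "lie_grading smul br L ?V"
    unfolding lie_grading_def
  proof (intro conjI ballI allI)
    show "?V i \<subseteq> L" for i by blast
  qed (use L sub uni grade in blast)+
qed

section \<open>The eigenspaces of the Euler field\<close>

context affine_manifold
begin

subsection \<open>The Lie algebra of Killing vector fields\<close>

lemma KF_lie_algebra: "lie_algebra_on vf_scale vf_bracket KF"
proof -
  interpret vs: vector_space "vf_scale :: real \<Rightarrow> 'a covec vfield \<Rightarrow> 'a covec vfield"
    by unfold_locales (simp_all add: vf_scale_def fun_eq_iff algebra_simps)
  have add: "H + K \<in> KF" if H: "H \<in> KF" and K: "K \<in> KF" for H K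
  proof -
    note V = KF_Vec[OF H] KF_Vec[OF K]
    have "lieg (H + K) U W = lieg H U W + lieg K U W" if "U \<in> T.Vec" "W \<in> T.Vec" for U W
      using that V by (simp add: lieg_def vf_app_left T.vf_bracket_add_left g_add_left g_add_right)
    then show ?thesis using V KF_zero[OF H] KF_zero[OF K] by (simp add: KF_def)
  qed
  have gs: "g (vf_scale c U) W = (\<lambda>\<xi>. c * g U W \<xi>)" if "U \<in> T.Vec" "W \<in> T.Vec" for c U W
  proof -
    have "g (vf_scale c U) W = T.konst c * g U W" unfolding T.vf_scale_eq[OF that(1)]
      by (rule g_mult_left) (use that in simp_all)
    then show ?thesis using T.Cinf_off[OF g_Cinf[OF that]] by (simp add: T.konst_def fun_eq_iff)
  qed
  have scale: "vf_scale c K \<in> KF" if K: "K \<in> KF" for c K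
  proof -
    note V = KF_Vec[OF K]
    have "lieg (vf_scale c K) U W = (\<lambda>\<xi>. c * lieg K U W \<xi>)" if UW: "U \<in> T.Vec" "W \<in> T.Vec" for U W
    proof -
      note b = T.Vec_bracket[OF V UW(1)] T.Vec_bracket[OF V UW(2)]
      have "g U (vf_scale c (vf_bracket K W)) = (\<lambda>\<xi>. c * g U (vf_bracket K W) \<xi>)"
        unfolding g_sym[OF UW(1) T.Vec_scale[OF b(2)]] g_sym[OF UW(1) b(2)] by (rule gs[OF b(2) UW(1)])
      then show ?thesis
        unfolding lieg_def T.vf_bracket_scale(1)[OF V UW(1)] T.vf_bracket_scale(1)[OF V UW(2)]
          gs[OF b(1) UW(2)] vf_app_scale_left
        by (simp add: fun_eq_iff algebra_simps)
    qed
    then show ?thesis using V KF_zero[OF K] by (simp add: KF_def fun_eq_iff)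
  qed
  have "vf_bracket 0 V = 0" if "V \<in> T.Vec" for V :: "'a covec vfield"
    by (rule TVec_eqI) (use that in \<open>simp_all add: vf_app_left T.vf_app_zero\<close>)
  then have zero: "0 \<in> KF" by (simp add: KF_def lieg_def vf_app_left g_zero_left g_zero_right)
  show ?thesis
    unfolding lie_algebra_on_def vs.subspace_def
  proof (intro conjI ballI allI)
    show "vector_space (vf_scale :: real \<Rightarrow> 'a covec vfield \<Rightarrow> 'a covec vfield)" ..
  qed (simp_all add: zero add scale KF_bracket KF_Vec T.vf_bracket_add_left T.vf_bracket_add_right
      T.vf_bracket_scale vf_bracket_self T.vf_jacobi)
qed

subsection \<open>Cubic equation of the Euler field\<close>

lemma vl_mo_antisym:
  assumes K: "K \<in> KF" and \<alpha>: "\<alpha> \<in> Om" and \<beta>: "\<beta> \<in> Om"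
  shows "va \<alpha> (mo K \<beta>) = - va \<beta> (mo K \<alpha>)"
  using lieg_vv[OF KF_Vec[OF K] \<alpha> \<beta>] KF_zero[OF K vl_Vec[OF \<alpha>] vl_Vec[OF \<beta>]]
  by (simp add: eq_neg_iff_add_eq_0)

lemma vl_mo_self:
  assumes K: "K \<in> KF" and \<eta>: "\<eta> \<in> Om"
  shows "va \<eta> (mo K \<eta>) = 0"
  using vl_mo_antisym[OF K \<eta> \<eta>] by (simp add: fun_eq_iff)

lemma mo_Cinf: "K \<in> KF \<Longrightarrow> \<beta> \<in> Om \<Longrightarrow> mo K \<beta> \<in> T.Cinf"
  by (rule g_Cinf[OF vl_Vec KF_Vec])

text \<open>Vertical lifts commute, so the expression is symmetric in \<open>\<alpha>\<close> and \<open>\<beta>\<close>, and by the Killing equation it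
  is antisymmetric in \<open>\<beta>\<close> and \<open>\<gamma>\<close>. Exchanging neighbours three times each returns to the start with the
  opposite sign.\<close>
lemma vl_vl_mo:
  assumes K: "K \<in> KF" and \<alpha>: "\<alpha> \<in> Om" and \<beta>: "\<beta> \<in> Om" and \<gamma>: "\<gamma> \<in> Om"
  shows "va \<alpha> (va \<beta> (mo K \<gamma>)) = 0"
proof -
  have a: "va \<alpha> (va \<beta> (mo K \<gamma>)) = - va \<alpha> (va \<gamma> (mo K \<beta>))"
    if "\<alpha> \<in> Om" "\<beta> \<in> Om" "\<gamma> \<in> Om" for \<alpha> \<beta> \<gamma>
    unfolding vl_mo_antisym[OF K that(2,3)] by (rule T.vf_app_minus) (simp_all add: that K mo_Cinf)
  have "va \<alpha> (va \<beta> (mo K \<gamma>)) = - va \<gamma> (va \<alpha> (mo K \<beta>))"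
    unfolding a[OF \<alpha> \<beta> \<gamma>] vl_commute[OF \<alpha> \<gamma>] ..
  also have "\<dots> = va \<beta> (va \<gamma> (mo K \<alpha>))"
    unfolding a[OF \<gamma> \<alpha> \<beta>] vl_commute[OF \<gamma> \<beta>] by simp
  also have "\<dots> = - va \<alpha> (va \<beta> (mo K \<gamma>))"
    unfolding a[OF \<beta> \<gamma> \<alpha>] vl_commute[OF \<beta> \<alpha>] ..
  finally show ?thesis by (simp add: fun_eq_iff)
qed

text \<open>The double bracket of \<open>\<eta>\<^sup>v\<close> with \<open>K\<close> has vanishing moment functions, so its product with the vertical
  field \<open>om Y\<close> is zero; the claim is that product written out.\<close>
lemma vl_vl_om:
  assumes K: "K \<in> KF" and \<eta>: "\<eta> \<in> Om" and Y: "Y \<in> Vec"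
  shows "va \<eta> (va \<eta> (g (om Y) K)) = va \<eta> (mo K (dform \<eta> Y)) + va \<eta> (mo K (dform \<eta> Y))"
proof -
  note KV = KF_Vec[OF K] and E = vl_Vec[OF \<eta>] and O = om_Vec[OF Y] and d = dform_Om[OF \<eta> Y]
  let ?U = "vf_bracket (vl \<eta>) K"
  have U: "?U \<in> T.Vec" by (rule T.Vec_bracket[OF E KV])
  have "g (om Y) (vf_bracket (vl \<eta>) ?U) = 0"
  proof (rule g_om_vertical[OF T.Vec_bracket[OF E U] Y])
    show "g (vl \<beta>) (vf_bracket (vl \<eta>) ?U) = 0" if "\<beta> \<in> Om" for \<beta>
      unfolding g_vl_bracket_vl[OF \<eta> that U] g_vl_bracket_vl[OF \<eta> that KV] by (rule vl_vl_mo[OF K \<eta> \<eta> that])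
  qed
  moreover have "g (om Y) (vf_bracket (vl \<eta>) ?U) =
      va \<eta> (va \<eta> (g (om Y) K)) - va \<eta> (mo K (dform \<eta> Y)) - va \<eta> (mo K (dform \<eta> Y))"
    unfolding g_om_bracket_vl[OF \<eta> Y U] g_om_bracket_vl[OF \<eta> Y KV] g_vl_bracket_vl[OF \<eta> d KV]
      T.vf_app_diff[OF E T.Vec_app[OF E g_Cinf[OF O KV]] mo_Cinf[OF K d]] ..
  ultimately show ?thesis by (simp add: algebra_simps)
qed

lemma vl_action:
  assumes K: "K \<in> KF" and \<beta>: "\<beta> \<in> Om" and Y: "Y \<in> Vec"
  shows "va \<beta> (vf_app K (fl Y)) = mo K (lie_form A Y \<beta>) - vf_app (cl Y) (mo K \<beta>)
    + (va \<beta> (g (om Y) K) + va \<beta> (g (om Y) K)) - (mo K (dform \<beta> Y) + mo K (dform \<beta> Y))"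
  using lieg_cv[OF KF_Vec[OF K] Y \<beta>] KF_zero[OF K cl_Vec[OF Y] vl_Vec[OF \<beta>]]
  by (simp add: fun_eq_iff algebra_simps)

text \<open>In the derivative of \<open>vl_action\<close> the two terms with the complete lift and the Lie derivative of \<open>\<eta>\<close>
  cancel, because the moment function of \<open>\<eta>\<close> is constant in its own direction.\<close>
lemma vl_vl_action:
  assumes K: "K \<in> KF" and \<eta>: "\<eta> \<in> Om" and Y: "Y \<in> Vec"
  shows "va \<eta> (va \<eta> (vf_app K (fl Y))) = va \<eta> (mo K (dform \<eta> Y)) + va \<eta> (mo K (dform \<eta> Y))"
proof -
  note KV = KF_Vec[OF K] and E = vl_Vec[OF \<eta>] and C = cl_Vec[OF Y] and l = lie_form_Om[OF Y \<eta>] and d = dform_Om[OF \<eta> Y]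
  have m: "mo K (lie_form A Y \<eta>) \<in> T.Cinf" "mo K (dform \<eta> Y) \<in> T.Cinf" "vf_app (cl Y) (mo K \<eta>) \<in> T.Cinf"
    "va \<eta> (g (om Y) K) \<in> T.Cinf"
    by (rule mo_Cinf[OF K l] mo_Cinf[OF K d] T.Vec_app[OF C mo_Cinf[OF K \<eta>]] T.Vec_app[OF E g_Cinf[OF om_Vec[OF Y] KV]])+
  have "va \<eta> (vf_app (cl Y) (mo K \<eta>)) = - va (lie_form A Y \<eta>) (mo K \<eta>)"
    unfolding vl_cl_commute[OF \<eta> Y] vl_mo_self[OF K \<eta>] T.vf_app_zero[OF C] by simp
  also have "\<dots> = va \<eta> (mo K (lie_form A Y \<eta>))" unfolding vl_mo_antisym[OF K \<eta> l] ..
  finally have c: "va \<eta> (vf_app (cl Y) (mo K \<eta>)) = va \<eta> (mo K (lie_form A Y \<eta>))" .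
  have "va \<eta> (F - G + (H + H) - (J + J)) = va \<eta> F - va \<eta> G + (va \<eta> H + va \<eta> H) - (va \<eta> J + va \<eta> J)"
    if "F \<in> T.Cinf" "G \<in> T.Cinf" "H \<in> T.Cinf" "J \<in> T.Cinf" for F G H J
    using that by (simp only: T.vf_app_right[OF E] T.Cinf_add T.Cinf_diff)
  from this[OF m(1,3,4,2)] show ?thesis
    unfolding vl_action[OF K \<eta> Y] c vl_vl_om[OF K \<eta> Y] by simp
qed

lemma eul_bracket_action:
  assumes "K \<in> T.Vec" "Y \<in> Vec"
  shows "vf_app (vf_bracket eul K) (fl Y) = vf_app eul (vf_app K (fl Y)) - vf_app K (fl Y)"
  using assms by (simp add: vf_app_bracket)

text \<open>On \<open>b = K Y\<^sup>v\<close> the bracket with \<open>\<epsilon>\<close> acts as \<open>\<epsilon> - 1\<close>. So the claim is \<open>(\<epsilon> - 1)\<^sup>3 b = (\<epsilon> - 1) b\<close>, that is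
  \<open>\<epsilon>(\<epsilon> - 1)(\<epsilon> - 2) b = 0\<close>, and the left hand side pulls back to third derivatives of \<open>b\<close>.\<close>
lemma eul_bracket_cube:
  assumes K: "K \<in> KF"
  shows "vf_bracket eul (vf_bracket eul (vf_bracket eul K)) = vf_bracket eul K"
proof (rule TVec_eqI)
  note KV = KF_Vec[OF K] and KV1 = KF_Vec[OF KF_eul[OF K]] and KV2 = KF_Vec[OF KF_eul[OF KF_eul[OF K]]]
  show "vf_bracket eul (vf_bracket eul (vf_bracket eul K)) \<in> T.Vec" "vf_bracket eul K \<in> T.Vec"
    by (rule KF_Vec[OF KF_eul[OF KF_eul[OF KF_eul[OF K]]]] KV1)+
  fix Y assume Y: "Y \<in> Vec"
  let ?e = "vf_app eul" and ?b = "vf_app K (fl Y)"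
  have b: "?b \<in> T.Cinf" using KV Y by simp
  note eC = T.Vec_app[OF eul_Vec]
  let ?G = "?e (?e ?b) - ?e ?b"
  have "?e ?G - ?G - ?G = 0"
  proof (rule ev_eqI)
    show "?e ?G - ?G - ?G \<in> T.Cinf" "0 \<in> T.Cinf" by (intro T.Cinf_diff eC b T.Cinf_zero)+
    fix \<eta> assume \<eta>: "\<eta> \<in> Om"
    note d = dform_Om[OF \<eta> Y] and E = vl_Vec[OF \<eta>]
    have "va \<eta> (va \<eta> (va \<eta> ?b)) = 0"
      unfolding vl_vl_action[OF K \<eta> Y]
      using T.vf_app_add[OF E T.Vec_app[OF E mo_Cinf[OF K d]] T.Vec_app[OF E mo_Cinf[OF K d]]] vl_vl_mo[OF K \<eta> \<eta> d]
      by simp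
    then show "ev \<eta> (?e ?G - ?G - ?G) = ev \<eta> 0" unfolding eul_cube[OF \<eta> b] by simp
  qed
  then have c: "?e ?G = ?G + ?G" by (simp add: algebra_simps)
  have s: "?e (F - H) = ?e F - ?e H" if "F \<in> T.Cinf" "H \<in> T.Cinf" for F H
    by (rule T.vf_app_diff[OF eul_Vec that])
  have s1: "?e (?e ?b - ?b) = ?G" by (rule s[OF eC[OF b] b])
  have s2: "?e (?G - (?e ?b - ?b)) = ?e ?G - ?G"
    unfolding s[OF T.Cinf_diff[OF eC[OF eC[OF b]] eC[OF b]] T.Cinf_diff[OF eC[OF b] b]] s1 ..
  show "vf_app (vf_bracket eul (vf_bracket eul (vf_bracket eul K))) (fl Y) = vf_app (vf_bracket eul K) (fl Y)"
    unfolding eul_bracket_action[OF KV2 Y] eul_bracket_action[OF KV1 Y] eul_bracket_action[OF KV Y] s1 s2 c by simp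
qed

subsection \<open>Identification of the eigenspaces\<close>

lemma eul_mo: "K \<in> KF \<Longrightarrow> \<beta> \<in> Om \<Longrightarrow> vf_app eul (mo K \<beta>) = mo (vf_bracket eul K) \<beta>"
  using g_vl_bracket_eul[OF _ KF_Vec] by simp

lemma eul_action: "K \<in> KF \<Longrightarrow> Y \<in> Vec \<Longrightarrow>
    vf_app eul (vf_app K (fl Y)) = vf_app K (fl Y) + vf_app (vf_bracket eul K) (fl Y)"
  using eul_bracket_action[OF KF_Vec] by simp

text \<open>The moment functions are homogeneous of degree \<open>-1\<close> and have vanishing second derivatives, so they
  are zero. Then \<open>K\<close> annihilates functions from the base, and the functions \<open>K Y\<^sup>v\<close>, of degree zero, are
  the values of a form.\<close>
lemma eigen_minus_one:
  assumes K: "K \<in> KF" and e: "vf_bracket eul K = - K"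
  shows "K \<in> vl ` Kill1 A D"
proof -
  note KV = KF_Vec[OF K]
  have m: "mo K \<beta> = 0" if \<beta>: "\<beta> \<in> Om" for \<beta>
  proof (rule ev_eqI[OF mo_Cinf[OF K \<beta>] T.Cinf_zero])
    fix \<eta> assume \<eta>: "\<eta> \<in> Om"
    note C = mo_Cinf[OF K \<beta>]
    have em: "vf_app eul (mo K \<beta>) = - mo K \<beta>"
      unfolding eul_mo[OF K \<beta>] e by (rule g_minus_right[OF KV vl_Vec[OF \<beta>]])
    have "ev \<eta> (mo K \<beta> + mo K \<beta>) = ev \<eta> (vf_app eul (vf_app eul (mo K \<beta>)) - vf_app eul (mo K \<beta>))"
      unfolding em T.vf_app_minus[OF eul_Vec C] by simp
    also have "\<dots> = 0" unfolding eul_square[OF \<eta> C] vl_vl_mo[OF K \<eta> \<eta> \<beta>] by (rule ev_zero)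
    finally show "ev \<eta> (mo K \<beta>) = ev \<eta> 0" unfolding ev_add ev_zero by (simp add: fun_eq_iff)
  qed
  define \<alpha> where "\<alpha> = (\<lambda>Y. if Y \<in> Vec then ev 0 (vf_app K (fl Y)) else 0)"
  have pp0: "vf_app K (pp f) = 0" if "f \<in> Cinf" for f
    using g_df[OF that KV] m[OF Om_differential[OF that]] by simp
  have b: "vf_app K (fl Y) = pp (ev 0 (vf_app K (fl Y)))" if Y: "Y \<in> Vec" for Y
  proof (rule eul_zero_imp_basic)
    show "vf_app K (fl Y) \<in> T.Cinf" using KV Y by simp
    show "vf_app eul (vf_app K (fl Y)) = 0" unfolding eul_action[OF K Y] e by (simp add: vf_app_left)
  qed
  have \<alpha>: "\<alpha> \<in> Om"
  proof (rule OmI)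
    show "\<alpha> X = 0" if "X \<notin> Vec" for X using that by (simp add: \<alpha>_def)
    show "\<alpha> X \<in> Cinf" if "X \<in> Vec" for X using that KV by (simp add: \<alpha>_def ev_Cinf)
    show "\<alpha> (X + Y) = \<alpha> X + \<alpha> Y" if "X \<in> Vec" "Y \<in> Vec" for X Y
      using that by (simp add: \<alpha>_def fun_lift_add T.vf_app_add[OF KV] ev_add)
    show "\<alpha> (vf_mult f X) = f * \<alpha> X" if "f \<in> Cinf" "X \<in> Vec" for f X
      using that by (simp add: \<alpha>_def fun_lift_mult T.vf_app_mult[OF KV] pp0 ev_mult ev_pr_pull)
  qed
  have "K = vl \<alpha>"
    by (rule TVec_eqI[OF KV vl_Vec[OF \<alpha>]]) (use b in \<open>simp add: \<alpha>[THEN vl_fl], simp add: \<alpha>_def\<close>)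
  then show ?thesis using vl_KF_iff[OF \<alpha>] K by simp
qed

text \<open>The moment functions have degree zero and come from the base, where they are the pairings with a
  vector field \<open>X\<close>. The functions \<open>K Y\<^sup>v\<close> have degree one, so they equal their own fibre derivative,
  which \<open>vl_action\<close> computes from the moment functions.\<close>
lemma eigen_zero:
  assumes K: "K \<in> KF" and e: "vf_bracket eul K = 0"
  shows "K \<in> cl ` aff A D"
proof -
  note KV = KF_Vec[OF K]
  have m: "mo K \<beta> = pp (ev 0 (mo K \<beta>))" if \<beta>: "\<beta> \<in> Om" for \<beta>
    by (rule eul_zero_imp_basic[OF mo_Cinf[OF K \<beta>]])
      (unfold eul_mo[OF K \<beta>] e, rule g_zero_right[OF vl_Vec[OF \<beta>]])
  define X where "X = (\<lambda>p f. if f \<in> Cinf then ev 0 (vf_app K (pp f)) p else 0)"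
  have Xf: "vf_app X f = ev 0 (vf_app K (pp f))" if "f \<in> Cinf" for f
    using that by (simp add: X_def vf_app_def)
  have X: "X \<in> Vec"
  proof (rule VecI)
    show "X p = 0" if "p \<notin> Car" for p using that by (simp add: X_def ev_def fun_eq_iff)
    show "vf_app X f \<in> Cinf" if "f \<in> Cinf" for f using that KV by (simp add: Xf ev_Cinf)
    fix p assume p: "p \<in> Car"
    show "X p \<in> Tan p"
      unfolding tangent_space_def mem_Collect_eq X_def
      by (simp add: pr_pull_add pr_pull_mult pr_pull_scale T.vf_app_right[OF KV] T.vf_app_scale[OF KV]
          ev_add ev_mult ev_scale ev_pr_pull)
  qed
  have mX: "mo K \<beta> = pp (\<beta> X)" if \<beta>: "\<beta> \<in> Om" for \<beta>
  proof -
    have "ev 0 (mo K \<beta>) p = \<beta> X p" if p: "p \<in> Car" for p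
    proof -
      let ?L = "\<lambda>\<beta>. ev 0 (mo K \<beta>) p - \<beta> X p"
      have "?L \<beta> = 0"
      proof (rule form_functional_zero[OF p _ _ _ \<beta>])
        show "?L (\<alpha> + \<gamma>) = ?L \<alpha> + ?L \<gamma>" if "\<alpha> \<in> Om" "\<gamma> \<in> Om" for \<alpha> \<gamma>
          unfolding vl_add[OF that] g_add_left[OF vl_Vec[OF that(2)] KV vl_Vec[OF that(1)]] ev_add by simp
        show "?L (form_mult h \<alpha>) = h p * ?L \<alpha>" if "h \<in> Cinf" "\<alpha> \<in> Om" for h \<alpha>
          unfolding vl_mult[OF that] g_mult_left[OF vl_Vec[OF that(2)] KV pr_pull_Cinf[OF that(1)]] ev_mult
            ev_pr_pull[OF Om_zero that(1)] form_mult_app by (simp add: algebra_simps)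
        show "?L (differential A f) = 0" if f: "f \<in> Cinf" for f
          using g_df[OF f KV] by (simp add: differential_app[OF X] Xf[OF f])
      qed
      then show ?thesis by simp
    qed
    moreover have "ev 0 (mo K \<beta>) p = \<beta> X p" if "p \<notin> Car" for p
      using that Cinf_off[OF Om_app[OF \<beta> X]] by (simp add: ev_def)
    ultimately have "ev 0 (mo K \<beta>) = \<beta> X" by blast
    then show ?thesis using m[OF \<beta>] by simp
  qed
  have "K = cl X"
  proof (rule TVec_eqI[OF KV cl_Vec[OF X]])
    fix Y assume Y: "Y \<in> Vec"
    have om: "g (om Y) K = fl (D X Y)"
    proof (rule ev_eqI[OF g_Cinf[OF om_Vec[OF Y] KV] fun_lift_Cinf[OF D_Vec[OF X Y]]])
      fix \<eta> assume \<eta>: "\<eta> \<in> Om"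
      note d = dform_Om[OF \<eta> Y]
      show "ev \<eta> (g (om Y) K) = ev \<eta> (fl (D X Y))"
        unfolding ev_g_om[OF \<eta> Y KV] mX[OF d] ev_pr_pull[OF \<eta> Om_app[OF d X]]
        unfolding ev_fun_lift[OF \<eta> D_Vec[OF X Y]] dform_app[OF X] ..
    qed
    have "vf_app K (fl Y) = fl (vf_bracket X Y)"
    proof (rule ev_eqI)
      show "vf_app K (fl Y) \<in> T.Cinf" "fl (vf_bracket X Y) \<in> T.Cinf" using KV X Y by simp_all
      fix \<eta> assume \<eta>: "\<eta> \<in> Om"
      note d = dform_Om[OF \<eta> Y] and l = lie_form_Om[OF Y \<eta>]
      have "va \<eta> (vf_app K (fl Y)) = pp (\<eta> (vf_bracket X Y))"
        unfolding vl_action[OF K \<eta> Y] mX[OF \<eta>] mX[OF d] mX[OF l] om vl_fl[OF \<eta> D_Vec[OF X Y]]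
          cl_pp[OF Y Om_app[OF \<eta> X]] lie_form_app[OF X] dform_app[OF X] pr_pull_diff
          vf_bracket_antisym[of X Y] Om_minus[OF \<eta> Vec_bracket[OF Y X]] pr_pull_minus
        by simp
      moreover have "vf_app eul (vf_app K (fl Y)) = vf_app K (fl Y)"
        unfolding eul_action[OF K Y] e by (simp add: vf_app_left)
      ultimately show "ev \<eta> (vf_app K (fl Y)) = ev \<eta> (fl (vf_bracket X Y))"
        using ev_eul[OF \<eta>, of "vf_app K (fl Y)"] ev_pr_pull[OF \<eta> Om_app[OF \<eta> Vec_bracket[OF X Y]]]
          ev_fun_lift[OF \<eta> Vec_bracket[OF X Y]] by simp
    qed
    then show "vf_app K (fl Y) = vf_app (cl X) (fl Y)" by (simp add: X Y)
  qed
  then show ?thesis using cl_KF_iff[OF X] K by simp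
qed

text \<open>The first derivatives of the moment functions are constant on the fibres and form a bivector field.
  The functions \<open>K Y\<^sup>v\<close> have degree two, so they are half of their second derivative, which
  \<open>vl_vl_action\<close> computes.\<close>
lemma eigen_one:
  assumes K: "K \<in> KF" and e: "vf_bracket eul K = K"
  shows "K \<in> bl ` parallel_bivecs A D"
proof -
  note KV = KF_Vec[OF K]
  define \<pi> where "\<pi> = (\<lambda>\<alpha> \<beta>. if \<alpha> \<in> Om \<and> \<beta> \<in> Om then ev 0 (va \<alpha> (mo K \<beta>)) else 0)"
  have C: "va \<alpha> (mo K \<beta>) \<in> T.Cinf" if "\<alpha> \<in> Om" "\<beta> \<in> Om" for \<alpha> \<beta>
    by (rule T.Vec_app[OF vl_Vec[OF that(1)] mo_Cinf[OF K that(2)]])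
  have \<pi>_app: "\<pi> \<alpha> \<beta> = ev 0 (va \<alpha> (mo K \<beta>))" if "\<alpha> \<in> Om" "\<beta> \<in> Om" for \<alpha> \<beta>
    using that by (simp add: \<pi>_def)
  have m: "va \<alpha> (mo K \<beta>) = pp (\<pi> \<alpha> \<beta>)" if "\<alpha> \<in> Om" "\<beta> \<in> Om" for \<alpha> \<beta>
    unfolding \<pi>_app[OF that] by (rule vertical_zero_imp_basic[OF C[OF that]]) (rule vl_vl_mo[OF K _ that])
  have \<pi>: "\<pi> \<in> bivecs A"
  proof (rule bivecsI)
    show "\<pi> \<alpha> \<beta> = 0" if "\<alpha> \<notin> Om \<or> \<beta> \<notin> Om" for \<alpha> \<beta> using that by (auto simp: \<pi>_def)
    show "\<pi> \<alpha> \<beta> \<in> Cinf" if "\<alpha> \<in> Om" "\<beta> \<in> Om" for \<alpha> \<beta>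
      unfolding \<pi>_app[OF that] by (rule ev_Cinf[OF Om_zero C[OF that]])
    show "\<pi> \<alpha> \<beta> = - \<pi> \<beta> \<alpha>" if "\<alpha> \<in> Om" "\<beta> \<in> Om" for \<alpha> \<beta>
      unfolding \<pi>_app[OF that] \<pi>_app[OF that(2,1)] vl_mo_antisym[OF K that] by (rule ev_minus)
    show "\<pi> (\<alpha> + \<beta>) \<gamma> = \<pi> \<alpha> \<gamma> + \<pi> \<beta> \<gamma>" if "\<alpha> \<in> Om" "\<beta> \<in> Om" "\<gamma> \<in> Om" for \<alpha> \<beta> \<gamma>
      unfolding \<pi>_app[OF that(1,3)] \<pi>_app[OF that(2,3)] \<pi>_app[OF Om_plus[OF that(1,2)] that(3)]
        vl_add[OF that(1,2)] vf_app_add_left by (rule ev_add)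
    show "\<pi> (form_mult f \<alpha>) \<beta> = f * \<pi> \<alpha> \<beta>" if "f \<in> Cinf" "\<alpha> \<in> Om" "\<beta> \<in> Om" for f \<alpha> \<beta>
      unfolding \<pi>_app[OF that(2,3)] \<pi>_app[OF Om_form_mult[OF that(1,2)] that(3)]
        vl_mult[OF that(1,2)] vf_app_mult_left ev_mult ev_pr_pull[OF Om_zero that(1)] ..
  qed
  have "K = bl \<pi>"
  proof (rule TVec_eqI[OF KV bl_Vec[OF \<pi>]])
    fix Y assume Y: "Y \<in> Vec"
    have b: "vf_app K (fl Y) \<in> T.Cinf" using KV Y by simp
    have eb: "vf_app eul (vf_app K (fl Y)) = vf_app K (fl Y) + vf_app K (fl Y)"
      unfolding eul_action[OF K Y] e ..
    have "vf_app K (fl Y) = qf \<pi> Y"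
    proof (rule ev_eqI[OF b qf_Cinf[OF \<pi> Y]])
      fix \<eta> assume \<eta>: "\<eta> \<in> Om"
      note d = dform_Om[OF \<eta> Y]
      have "ev \<eta> (vf_app K (fl Y) + vf_app K (fl Y)) =
          ev \<eta> (vf_app eul (vf_app eul (vf_app K (fl Y))) - vf_app eul (vf_app K (fl Y)))"
        unfolding eb T.vf_app_add[OF eul_Vec b b] by (simp add: eb)
      also have "\<dots> = \<pi> \<eta> (dform \<eta> Y) + \<pi> \<eta> (dform \<eta> Y)"
        unfolding eul_square[OF \<eta> b] vl_vl_action[OF K \<eta> Y] m[OF \<eta> d] ev_add
          ev_pr_pull[OF \<eta> bv_Cinf[OF \<pi> \<eta> d]] ..
      finally show "ev \<eta> (vf_app K (fl Y)) = ev \<eta> (qf \<pi> Y)"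
        unfolding ev_qf[OF \<pi> Y \<eta>] ev_add by (simp add: fun_eq_iff)
    qed
    then show "vf_app K (fl Y) = vf_app (bl \<pi>) (fl Y)" unfolding bl_fl[OF \<pi> Y] .
  qed
  then show ?thesis using bl_KF_iff[OF \<pi>] K by simp
qed

theorem eigenspaces:
  "vl ` Kill1 A D = {K \<in> KF. vf_bracket eul K = - K}"
  "cl ` aff A D = {K \<in> KF. vf_bracket eul K = 0}"
  "bl ` parallel_bivecs A D = {K \<in> KF. vf_bracket eul K = K}"
proof -
  have "vl \<alpha> \<in> KF \<and> vf_bracket eul (vl \<alpha>) = - vl \<alpha>" if "\<alpha> \<in> Kill1 A D" for \<alpha>
    using that vl_KF_iff eul_vl by (auto simp: Kill1_def)
  then show "vl ` Kill1 A D = {K \<in> KF. vf_bracket eul K = - K}" using eigen_minus_one by blast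
  have "cl X \<in> KF \<and> vf_bracket eul (cl X) = 0" if "X \<in> aff A D" for X
    using that cl_KF_iff eul_cl by (auto simp: aff_def)
  then show "cl ` aff A D = {K \<in> KF. vf_bracket eul K = 0}" using eigen_zero by blast
  have "bl \<pi> \<in> KF \<and> vf_bracket eul (bl \<pi>) = bl \<pi>" if "\<pi> \<in> parallel_bivecs A D" for \<pi>
    using that bl_KF_iff eul_bl by (auto simp: parallel_bivecs_def)
  then show "bl ` parallel_bivecs A D = {K \<in> KF. vf_bracket eul K = K}" using eigen_one by blast
qed

definition grade :: "int \<Rightarrow> 'a covec vfield set" where
  "grade i = (if i = -1 then vl ` Kill1 A D else if i = 0 then cl ` aff A D
    else if i = 1 then bl ` parallel_bivecs A D else {0})"

theorem killing_grading: "lie_grading vf_scale vf_bracket KF grade"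
proof -
  let ?e = "vf_bracket eul" and ?E = "\<lambda>i. {K \<in> KF. vf_bracket eul K = vf_scale (real_of_int i) K}"
  have add: "?e (H + K) = ?e H + ?e K" if "H \<in> KF" "K \<in> KF" for H K
    by (rule T.vf_bracket_add_right[OF KF_Vec[OF that(1)] KF_Vec[OF that(2)] eul_Vec])
  have scale: "?e (vf_scale c K) = vf_scale c (?e K)" if "K \<in> KF" for K c
    by (rule T.vf_bracket_scale(2)[OF eul_Vec KF_Vec[OF that]])
  have leibniz: "?e (vf_bracket H K) = vf_bracket (?e H) K + vf_bracket H (?e K)" if "H \<in> KF" "K \<in> KF" for H K
    by (rule T.vf_bracket_bracket[OF eul_Vec KF_Vec[OF that(1)] KF_Vec[OF that(2)]])
  note derivation = KF_lie_algebra KF_eul add scale leibniz eul_bracket_cube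
  have "lie_grading vf_scale vf_bracket KF ?E"
    by (rule lie_grading_derivation(1)) (fact derivation)+
  moreover have z: "?E i = {0}" if i: "i \<notin> {-1, 0, 1}" for i
    by (rule lie_grading_derivation(2)) (fact derivation i)+
  moreover have "grade = ?E"
  proof
    fix i :: int
    consider "i = -1" | "i = 0" | "i = 1" | "i \<notin> {-1, 0, 1}" by blast
    then show "grade i = ?E i"
    proof cases
      case 4
      then show ?thesis unfolding z[OF 4] by (simp add: grade_def)
    qed (simp_all add: grade_def eigenspaces vf_scale_def fun_eq_iff)
  qed
  ultimately show ?thesis by simp
qed

subsection \<open>The brackets\<close>

text \<open>The Killing equation turns \<open>\<alpha> \<circ> \<nabla>Y - d(\<alpha>(Y))\<close> into \<open>\<nabla>\<^sub>Y\<alpha>\<close>, and since \<open>\<pi>\<close> is parallel, the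
  contraction of \<open>\<nabla>\<^sub>Y\<alpha>\<close> with \<open>\<pi>\<close> is \<open>\<nabla>\<^sub>Y(\<pi>(\<alpha>))\<close>.\<close>
lemma vl_bl:
  assumes \<alpha>: "\<alpha> \<in> Kill1 A D" and \<pi>: "\<pi> \<in> parallel_bivecs A D"
  shows "vf_bracket (vl \<alpha>) (bl \<pi>) = cl (contract A \<pi> \<alpha>)"
proof -
  have \<alpha>O: "\<alpha> \<in> Om" using \<alpha> by (simp add: Kill1_def)
  have \<pi>B: "\<pi> \<in> bivecs A" using \<pi> by (simp add: parallel_bivecs_def)
  let ?V = "contract A \<pi> \<alpha>"
  note V = contract_Vec[OF \<pi>B \<alpha>O]
  show ?thesis
  proof (rule TVec_eqI[OF T.Vec_bracket[OF vl_Vec[OF \<alpha>O] bl_Vec[OF \<pi>B]] cl_Vec[OF V]])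
    fix Y assume Y: "Y \<in> Vec"
    note aY = Om_app[OF \<alpha>O Y] and q = qf_Cinf[OF \<pi>B Y]
    note daY = Om_differential[OF aY] and dY = dform_Om[OF \<alpha>O Y] and nY = nabla_form_Om[OF Y \<alpha>O]
    have nab: "dform \<alpha> Y = nabla_form A D Y \<alpha> + differential A (\<alpha> Y)"
    proof (rule form_eqI[OF dY Om_plus[OF nY daY]])
      fix Z assume Z: "Z \<in> Vec"
      have "nabla_form A D Y \<alpha> Z + nabla_form A D Z \<alpha> Y = 0" using \<alpha> Y Z unfolding Kill1_def by blast
      then show "dform \<alpha> Y Z = (nabla_form A D Y \<alpha> + differential A (\<alpha> Y)) Z"
        by (simp add: dform_app[OF Z] differential_app[OF Z] nabla_form_app[OF Y, of Z] fun_eq_iff algebra_simps)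
    qed
    have "va \<alpha> (qf \<pi> Y) - vf_app (bl \<pi>) (pp (\<alpha> Y)) = fl (vf_bracket ?V Y)"
    proof (rule ev_eqI)
      show "va \<alpha> (qf \<pi> Y) - vf_app (bl \<pi>) (pp (\<alpha> Y)) \<in> T.Cinf" "fl (vf_bracket ?V Y) \<in> T.Cinf"
        by (intro T.Cinf_diff T.Vec_app vl_Vec \<alpha>O q bl_Vec \<pi>B pr_pull_Cinf aY fun_lift_Cinf Vec_bracket V Y)+
      fix \<eta> assume \<eta>: "\<eta> \<in> Om"
      note n\<eta> = nabla_form_Om[OF Y \<eta>]
      have "nabla_bivec A D Y \<pi> = 0" using \<pi> Y by (simp add: parallel_bivecs_def)
      then have par: "vf_app Y (\<pi> \<alpha> \<eta>) = \<pi> (nabla_form A D Y \<alpha>) \<eta> + \<pi> \<alpha> (nabla_form A D Y \<eta>)"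
        using nabla_bivec_app[OF \<alpha>O \<eta>, of Y \<pi>] by (simp add: fun_eq_iff algebra_simps)
      have "\<eta> (D Y ?V) = \<pi> (nabla_form A D Y \<alpha>) \<eta>"
        using nabla_form_app[OF V, of Y \<eta>] unfolding contract_app[OF \<pi>B \<alpha>O \<eta>] contract_app[OF \<pi>B \<alpha>O n\<eta>] par
        by (simp add: algebra_simps)
      then have rhs: "ev \<eta> (fl (vf_bracket ?V Y)) = \<pi> \<alpha> (dform \<eta> Y) + \<pi> \<eta> (nabla_form A D Y \<alpha>)"
        unfolding ev_fun_lift[OF \<eta> Vec_bracket[OF V Y]]
        unfolding bracket_D[OF V Y] Om_diff[OF \<eta> D_Vec[OF V Y] D_Vec[OF Y V]]
          dform_app[OF V, of \<eta> Y, symmetric] contract_app[OF \<pi>B \<alpha>O dform_Om[OF \<eta> Y]] bv_antisym[OF \<pi>B \<eta> nY]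
        by simp
      have "ev \<eta> (va \<alpha> (qf \<pi> Y) - vf_app (bl \<pi>) (pp (\<alpha> Y))) =
          \<pi> \<alpha> (dform \<eta> Y) + \<pi> \<eta> (dform \<alpha> Y) - \<pi> \<eta> (differential A (\<alpha> Y))"
        unfolding ev_diff ev_vl_qf[OF \<pi>B Y \<eta> \<alpha>O] bl_pp[OF \<pi>B aY] ev_minus ev_fun_lift[OF \<eta> contract_Vec[OF \<pi>B daY]]
          contract_app[OF \<pi>B daY \<eta>] bv_antisym[OF \<pi>B daY \<eta>] by simp
      then show "ev \<eta> (va \<alpha> (qf \<pi> Y) - vf_app (bl \<pi>) (pp (\<alpha> Y))) = ev \<eta> (fl (vf_bracket ?V Y))"
        unfolding rhs nab bv_add_right[OF \<pi>B \<eta> nY daY] by simp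
    qed
    then show "vf_app (vf_bracket (vl \<alpha>) (bl \<pi>)) (fl Y) = vf_app (cl ?V) (fl Y)"
      unfolding vf_app_bracket bl_fl[OF \<pi>B Y] vl_fl[OF \<alpha>O Y] cl_fl[OF V Y] .
  qed
qed

text \<open>The invariance of the connection under \<open>X\<close>, in dual form.\<close>
lemma lie_form_dform:
  assumes X: "X \<in> aff A D" and Y: "Y \<in> Vec" and \<eta>: "\<eta> \<in> Om"
  shows "lie_form A X (dform \<eta> Y) = dform (lie_form A X \<eta>) Y + dform \<eta> (vf_bracket X Y)"
proof -
  have XV: "X \<in> Vec" using X by (simp add: aff_def)
  note XY = Vec_bracket[OF XV Y] and l = lie_form_Om[OF XV \<eta>]
  show ?thesis
  proof (rule form_eqI[OF lie_form_Om[OF XV dform_Om[OF \<eta> Y]] Om_plus[OF dform_Om[OF l Y] dform_Om[OF \<eta> XY]]])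
    fix Z assume Z: "Z \<in> Vec"
    note XZ = Vec_bracket[OF XV Z] and ZY = D_Vec[OF Z Y]
    have "vf_bracket X (D Z Y) - D Z (vf_bracket X Y) = D (vf_bracket X Z) Y"
      using X Z Y unfolding aff_def by blast
    then have "vf_bracket X (D Z Y) = D (vf_bracket X Z) Y + D Z (vf_bracket X Y)"
      by (simp add: algebra_simps)
    then have "\<eta> (vf_bracket X (D Z Y)) = \<eta> (D (vf_bracket X Z) Y) + \<eta> (D Z (vf_bracket X Y))"
      by (simp add: Om_add[OF \<eta> D_Vec[OF XZ Y] D_Vec[OF Z XY]])
    then show "lie_form A X (dform \<eta> Y) Z = (dform (lie_form A X \<eta>) Y + dform \<eta> (vf_bracket X Y)) Z"
      by (simp add: lie_form_app[OF Z] lie_form_app[OF ZY] dform_app[OF Z] dform_app[OF XZ] fun_eq_iff)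
  qed
qed

lemma cl_bl:
  assumes X: "X \<in> aff A D" and \<pi>: "\<pi> \<in> bivecs A"
  shows "vf_bracket (cl X) (bl \<pi>) = bl (lie_bivec A X \<pi>)"
proof -
  have XV: "X \<in> Vec" using X by (simp add: aff_def)
  note L = lie_bivec_bivecs[OF XV \<pi>]
  show ?thesis
  proof (rule TVec_eqI[OF T.Vec_bracket[OF cl_Vec[OF XV] bl_Vec[OF \<pi>]] bl_Vec[OF L]])
    fix Y assume Y: "Y \<in> Vec"
    note XY = Vec_bracket[OF XV Y] and q = qf_Cinf[OF \<pi> Y]
    have "vf_app (cl X) (qf \<pi> Y) - qf \<pi> (vf_bracket X Y) = qf (lie_bivec A X \<pi>) Y"
    proof (rule ev_eqI)
      show "vf_app (cl X) (qf \<pi> Y) - qf \<pi> (vf_bracket X Y) \<in> T.Cinf" "qf (lie_bivec A X \<pi>) Y \<in> T.Cinf"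
        by (intro T.Cinf_diff T.Vec_app cl_Vec XV q qf_Cinf \<pi> XY L Y)+
      fix \<eta> assume \<eta>: "\<eta> \<in> Om"
      note l = lie_form_Om[OF XV \<eta>] and d = dform_Om[OF \<eta> Y]
      show "ev \<eta> (vf_app (cl X) (qf \<pi> Y) - qf \<pi> (vf_bracket X Y)) = ev \<eta> (qf (lie_bivec A X \<pi>) Y)"
        unfolding ev_diff ev_cl[OF \<eta> XV q] ev_vl_qf[OF \<pi> Y \<eta> l] ev_qf[OF \<pi> Y \<eta>] ev_qf[OF \<pi> XY \<eta>]
          ev_qf[OF L Y \<eta>] lie_bivec_app[OF \<eta> d] lie_form_dform[OF X Y \<eta>]
          bv_add_right[OF \<pi> \<eta> dform_Om[OF l Y] dform_Om[OF \<eta> XY]]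
        by (simp add: algebra_simps)
    qed
    then show "vf_app (vf_bracket (cl X) (bl \<pi>)) (fl Y) = vf_app (bl (lie_bivec A X \<pi>)) (fl Y)"
      unfolding vf_app_bracket bl_fl[OF \<pi> Y] bl_fl[OF L Y] cl_fl[OF XV Y] bl_fl[OF \<pi> XY] .
  qed
qed

text \<open>The bracket has degree two.\<close>
lemma bl_bl:
  assumes "\<pi> \<in> parallel_bivecs A D" "\<rho> \<in> parallel_bivecs A D"
  shows "vf_bracket (bl \<pi>) (bl \<rho>) = 0"
proof -
  have "bl \<pi> \<in> grade 1" "bl \<rho> \<in> grade 1" using assms by (auto simp: grade_def)
  then have "vf_bracket (bl \<pi>) (bl \<rho>) \<in> grade (1 + 1)" using killing_grading unfolding lie_grading_def by blast
  then show ?thesis by (simp add: grade_def)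
qed

end

section \<open>The grading of the Killing algebra\<close>

theorem theorem5p16:
  fixes A :: "('a, 'e::euclidean_space) chart set"
    and D :: "'a vfield \<Rightarrow> 'a vfield \<Rightarrow> 'a vfield"
  assumes "smooth_manifold A" and "connection A D" and "torsion_free A D"
  shows "lie_grading vf_scale vf_bracket
           (killing_fields (cotangent_bundle A) (pw_metric A D))
           (\<lambda>i. if i = -1 then vert_lift A ` Kill1 A D
                else if i = 0 then complete_lift A ` aff A D
                else if i = 1 then bivec_lift A D ` parallel_bivecs A D
                else {0}) \<and>
         (\<forall>\<alpha>\<in>Kill1 A D. \<forall>\<beta>\<in>Kill1 A D. \<forall>X\<in>aff A D. \<forall>Y\<in>aff A D.
          \<forall>\<pi>\<in>parallel_bivecs A D. \<forall>\<rho>\<in>parallel_bivecs A D.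
            vf_bracket (vert_lift A \<alpha>) (vert_lift A \<beta>) = 0 \<and>
            vf_bracket (complete_lift A X) (vert_lift A \<alpha>) = vert_lift A (lie_form A X \<alpha>) \<and>
            vf_bracket (vert_lift A \<alpha>) (bivec_lift A D \<pi>) = complete_lift A (contract A \<pi> \<alpha>) \<and>
            vf_bracket (complete_lift A X) (complete_lift A Y) = complete_lift A (vf_bracket X Y) \<and>
            vf_bracket (complete_lift A X) (bivec_lift A D \<pi>) = bivec_lift A D (lie_bivec A X \<pi>) \<and>
            vf_bracket (bivec_lift A D \<pi>) (bivec_lift A D \<rho>) = 0)"
proof -
  interpret affine_manifold A D
    using assms by unfold_locales (auto simp: smooth_manifold_def)
  have O: "\<alpha> \<in> Om" if "\<alpha> \<in> Kill1 A D" for \<alpha> using that by (simp add: Kill1_def)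
  have V: "X \<in> Vec" if "X \<in> aff A D" for X using that by (simp add: aff_def)
  have B: "\<pi> \<in> bivecs A" if "\<pi> \<in> parallel_bivecs A D" for \<pi> using that by (simp add: parallel_bivecs_def)
  have "grade = (\<lambda>i. if i = -1 then vl ` Kill1 A D else if i = 0 then cl ` aff A D
      else if i = 1 then bl ` parallel_bivecs A D else {0})"
    by (rule ext) (rule grade_def)
  with killing_grading show ?thesis
    unfolding killing_fields_eq
    by (intro conjI ballI vl_vl cl_vl cl_cl vl_bl cl_bl bl_bl O V B) simp_all
qed

end
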